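(* Let $1<p<\infty$ and let $\{T_\varepsilon\}_{\varepsilon\in[0,\delta)}$ be a family of maps of $[0,1]$ satisfying assumptions (A1)–(A9) listed in the context. Then there exists $\delta_2>0$ such that for all $\varepsilon\in[0,\delta_2)$, the transfer operator $P_{T_\varepsilon}$ admits a unique invariant density $h_\varepsilon\in W^{2,p}$. Moreover, $P_{T_\varepsilon}$ exhibits a uniform spectral gap on both $W^{1,p}$ and $W^{2,p}$, with constants independent of $\varepsilon\in[0,\delta_2)$. Specifically, there exists $C>0$ such that $$\left\|(\mathrm{Id}-P_{T_\varepsilon})^{-1}\right\|_{W_0^{1,p}\to W^{1,p}}\le C\quad\text{for all }\varepsilon\in[0,\delta_2).$$
   Context: Fix $\delta>0$, $1<p<\infty$, $c\in(0,1)$ and $\beta\in\left(-1,\frac{1-2p}{2p}\right)$. All function spaces $L^r$, $W^{i,p}$ ($i=1,2$) are over the unit interval with Lebesgue measure $\mu$; $W^{i,p}$ are the usual Sobolev spaces, and $W_0^{1,p}=\{u\in W^{1,p}:\int_0^1u\,dx=0\}$ (mean-zero functions, not functions vanishing at the boundary). Primes denote derivatives in $x$. For each $\varepsilon\in[0,\delta)$, $T_\varepsilon:[0,1]\to[0,1]$ is a map non-singular with respect to $\mu$. Its transfer operator $P_{T_\varepsilon}$ is defined by $$\int_0^1P_{T_\varepsilon}f\cdot g\,d\mu=\int_0^1f\cdot(g\circ T_\varepsilon)\,d\mu\quad\text{for all } f\in L^1,\ g\in L^\infty,$$ and is considered acting on $L^p$ and on Sobolev spaces. An invariant density is a probability density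 $h$ with $P_{T_\varepsilon}h=h$. $(\mathrm{Id}-P_{T_\varepsilon})^{-1}$ is the inverse of $\mathrm{Id}-P_{T_\varepsilon}$ on $W_0^{1,p}$. Uniform spectral gap on $W^{i,p}$: for each $\varepsilon$, $1$ is a simple eigenvalue of $P_{T_\varepsilon}$ on $W^{i,p}$ and the rest of the spectrum lies in a disc of radius strictly less than $1$, uniformly in $\varepsilon$; that is, there are $K>0$ and $r\in(0,1)$ independent of $\varepsilon$ with $\|P_{T_\varepsilon}^nf\|_{W^{i,p}}\le Kr^n\|f\|_{W^{i,p}}$ for all $n\in\mathbb{N}$ and all $f\in W^{i,p}$ with $\int_0^1f\,dx=0$. Assumptions: (A1) $T_{0,\varepsilon}:=T_\varepsilon|_{[0,c)}$ and $T_{1,\varepsilon}:=T_\varepsilon|_{(c,1]}$ are one-to-one. (A2) $T_\varepsilon(0)=0$, $T_\varepsilon(1)=0$, $\lim_{x\to c^\pm}T_\varepsilon(x)=a_\varepsilon\in[0,1]$. (A3) $T_\varepsilon|_{[0,1]\setminus\{c\}}\in C^3$. (A4) There is $\theta>1$ such that $|T_\varepsilon'(x)|\ge\theta$ for all $\varepsilon\in[0,\delta)$ and all $x\in[0,1]\setminus\{c\}$. (A5) $T_0$ is topologically mixing on $[0,a_0]$. (A6) $\lim_{x\to c^-}T_\varepsilon'(x)=+\infty$, $\lim_{x\to c^+}T_\varepsilon'(x)=-\infty$, and $\lim_{x\to c^\pm}\frac{|T_\varepsilon'(x)|}{|x-c|^\beta}=C_{\varepsilon,1}$ for all $\varepsilon\in[0,\delta)$.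 (A7) $\lim_{x\to c^\pm}\frac{|T_\varepsilon''(x)|}{|x-c|^{\beta-1}}=C_{\varepsilon,2}$ and $\lim_{x\to c^\pm}\frac{|T_\varepsilon'''(x)|}{|x-c|^{\beta-2}}=C_{\varepsilon,3}$ for all $\varepsilon\in[0,\delta)$. (In (A6) and (A7) the $C_{\varepsilon,j}$ are finite constants.) (A8) $\displaystyle\sup_{\varepsilon\in[0,\delta),\,i\in\{0,1,2\},\,x\in[0,1]\setminus\{c\}}\frac{|T_\varepsilon^{(i+1)}(x)|}{|x-c|^{\beta-i}}<\infty$ and $\displaystyle\inf_{\varepsilon\in[0,\delta),\,x\in[0,1]\setminus\{c\}}\frac{|T_\varepsilon'(x)|}{|x-c|^\beta}>0$. (A9) $\displaystyle\sup_{\|f\|_{W^{1,p}}\le1}\|(P_{T_0}-P_{T_\varepsilon})f\|_{L^{2p}}\to0$ as $\varepsilon\to0$; moreover, for every $f\in W^{2,p}$ there exists $\partial_\varepsilon P_{T_\varepsilon}f|_{\varepsilon=0}\in W^{1,p}$ such that $$\left\|P_{T_\varepsilon}f-P_{T_0}f-\varepsilon\left(\partial_\varepsilon P_{T_\varepsilon}f|_{\varepsilon=0}\right)\right\|_{W^{1,p}}=o(\varepsilon).$$ *)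

theory Defs
  imports "HOL-Analysis.Analysis" "HOL-Library.Landau_Symbols"
begin

(* Elements of the function spaces are represented by total functions on the reals; only their
   class modulo equality almost everywhere on the unit interval matters.  The codomain is left
   polymorphic so that the same definitions give the real spaces and their complexifications. *)

abbreviation \<mu> :: "real measure" where
  "\<mu> \<equiv> lebesgue_on {0..1}"

definition ae_eq :: "(real \<Rightarrow> 'a) \<Rightarrow> (real \<Rightarrow> 'a) \<Rightarrow> bool" where
  "ae_eq f g \<longleftrightarrow> (AE x in \<mu>. f x = g x)"


subsection \<open>Lebesgue and Sobolev spaces on the unit interval\<close>

definition Lp_space :: "real \<Rightarrow> (real \<Rightarrow> 'a::{real_normed_field, banach, second_countable_topology}) set" where
  "Lp_space p = {f \<in> borel_measurable \<mu>. integrable \<mu> (\<lambda>x. norm (f x) powr p)}"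

definition Lp_norm :: "real \<Rightarrow> (real \<Rightarrow> 'a::{real_normed_field, banach, second_countable_topology}) \<Rightarrow> real" where
  "Lp_norm p f = (\<integral>x. norm (f x) powr p \<partial>\<mu>) powr (1 / p)"

definition Linf_space :: "(real \<Rightarrow> 'a::{real_normed_field, banach, second_countable_topology}) set" where
  "Linf_space = {f \<in> borel_measurable \<mu>. \<exists>M. AE x in \<mu>. norm (f x) \<le> M}"

definition test_fun :: "(real \<Rightarrow> real) \<Rightarrow> bool" where
  "test_fun \<phi> \<longleftrightarrow>
     (\<forall>n x. (deriv ^^ n) \<phi> differentiable (at x)) \<and>
     (\<exists>a b. 0 < a \<and> b < 1 \<and> (\<forall>x. x \<notin> {a..b} \<longrightarrow> \<phi> x = 0))"

definition weak_deriv ::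
  "(real \<Rightarrow> 'a::{real_normed_field, banach, second_countable_topology}) \<Rightarrow> (real \<Rightarrow> 'a) \<Rightarrow> bool" where
  "weak_deriv f g \<longleftrightarrow> integrable \<mu> f \<and> integrable \<mu> g \<and>
     (\<forall>\<phi>. test_fun \<phi> \<longrightarrow> (\<integral>x. deriv \<phi> x *\<^sub>R f x \<partial>\<mu>) = - (\<integral>x. \<phi> x *\<^sub>R g x \<partial>\<mu>))"

definition wderiv ::
  "(real \<Rightarrow> 'a::{real_normed_field, banach, second_countable_topology}) \<Rightarrow> (real \<Rightarrow> 'a)" where
  "wderiv f = (SOME g. weak_deriv f g)"

primrec sobolev ::
  "nat \<Rightarrow> real \<Rightarrow> (real \<Rightarrow> 'a::{real_normed_field, banach, second_countable_topology}) set" where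
  "sobolev 0 p = Lp_space p"
| "sobolev (Suc k) p = {f \<in> Lp_space p. \<exists>g \<in> sobolev k p. weak_deriv f g}"

definition sobolev_norm ::
  "nat \<Rightarrow> real \<Rightarrow> (real \<Rightarrow> 'a::{real_normed_field, banach, second_countable_topology}) \<Rightarrow> real" where
  "sobolev_norm k p f = (\<Sum>j\<le>k. Lp_norm p ((wderiv ^^ j) f))"

definition sobolev_mean_zero ::
  "nat \<Rightarrow> real \<Rightarrow> (real \<Rightarrow> 'a::{real_normed_field, banach, second_countable_topology}) set" where
  "sobolev_mean_zero k p = {f \<in> sobolev k p. (\<integral>x. f x \<partial>\<mu>) = 0}"


subsection \<open>Linear operators modulo null sets\<close>

(* The value is infinite as soon as the image of the unit ball of X is not contained in Y. *)
definition op_norm ::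
  "(real \<Rightarrow> 'a) set \<Rightarrow> ((real \<Rightarrow> 'a) \<Rightarrow> real) \<Rightarrow> (real \<Rightarrow> 'b) set \<Rightarrow> ((real \<Rightarrow> 'b) \<Rightarrow> real) \<Rightarrow>
   ((real \<Rightarrow> 'a) \<Rightarrow> (real \<Rightarrow> 'b)) \<Rightarrow> ereal" where
  "op_norm X NX Y NY A =
     (SUP f \<in> {f \<in> X. NX f \<le> 1}. if A f \<in> Y then ereal (NY (A f)) else \<infinity>)"

definition ae_bij :: "(real \<Rightarrow> 'a) set \<Rightarrow> ((real \<Rightarrow> 'a) \<Rightarrow> (real \<Rightarrow> 'a)) \<Rightarrow> bool" where
  "ae_bij X A \<longleftrightarrow>
     (\<forall>f\<in>X. A f \<in> X) \<and>
     (\<forall>f\<in>X. \<forall>g\<in>X. ae_eq (A f) (A g) \<longrightarrow> ae_eq f g) \<and>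
     (\<forall>g\<in>X. \<exists>f\<in>X. ae_eq (A f) g)"

definition ae_inv :: "(real \<Rightarrow> 'a) set \<Rightarrow> ((real \<Rightarrow> 'a) \<Rightarrow> (real \<Rightarrow> 'a)) \<Rightarrow> (real \<Rightarrow> 'a) \<Rightarrow> (real \<Rightarrow> 'a)" where
  "ae_inv X A g = (SOME f. f \<in> X \<and> ae_eq (A f) g)"

definition shifted :: "'a::field \<Rightarrow> ((real \<Rightarrow> 'a) \<Rightarrow> (real \<Rightarrow> 'a)) \<Rightarrow> (real \<Rightarrow> 'a) \<Rightarrow> (real \<Rightarrow> 'a)" where
  "shifted z A f = (\<lambda>x. z * f x - A f x)"

definition spectrum_on ::
  "(real \<Rightarrow> complex) set \<Rightarrow> ((real \<Rightarrow> complex) \<Rightarrow> real) \<Rightarrow> ((real \<Rightarrow> complex) \<Rightarrow> (real \<Rightarrow> complex)) \<Rightarrow> complex set" where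
  "spectrum_on X N A =
     {z. \<not> (ae_bij X (shifted z A) \<and> op_norm X N X N (ae_inv X (shifted z A)) < \<infinity>)}"

(* Simplicity is algebraic: the whole generalized eigenspace is spanned by one eigenfunction. *)
definition simple_eigenvalue ::
  "(real \<Rightarrow> 'a::field) set \<Rightarrow> ((real \<Rightarrow> 'a) \<Rightarrow> (real \<Rightarrow> 'a)) \<Rightarrow> 'a \<Rightarrow> bool" where
  "simple_eigenvalue X A z \<longleftrightarrow>
     (\<exists>f\<in>X. \<not> ae_eq f (\<lambda>x. 0) \<and> ae_eq (A f) (\<lambda>x. z * f x) \<and>
        (\<forall>g\<in>X. \<forall>k. ae_eq ((shifted z A ^^ k) g) (\<lambda>x. 0) \<longrightarrow> (\<exists>a. ae_eq g (\<lambda>x. a * f x))))"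


subsection \<open>Transfer operators\<close>

definition nonsingular :: "(real \<Rightarrow> real) \<Rightarrow> bool" where
  "nonsingular T \<longleftrightarrow> T \<in> measurable \<mu> \<mu> \<and>
     (\<forall>A \<in> null_sets \<mu>. T -` A \<inter> {0..1} \<in> null_sets \<mu>)"

(* For nonsingular T and integrable f the function chosen below exists and is unique
   up to null sets. *)
definition transfer ::
  "(real \<Rightarrow> real) \<Rightarrow> (real \<Rightarrow> 'a::{real_normed_field, banach, second_countable_topology}) \<Rightarrow> (real \<Rightarrow> 'a)" where
  "transfer T f = (SOME h. integrable \<mu> h \<and>
     (\<forall>g \<in> Linf_space. (\<integral>x. h x * g x \<partial>\<mu>) = (\<integral>x. f x * g (T x) \<partial>\<mu>)))"

definition invariant_density :: "(real \<Rightarrow> real) \<Rightarrow> (real \<Rightarrow> real) \<Rightarrow> bool" where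
  "invariant_density T h \<longleftrightarrow>
     integrable \<mu> h \<and> (AE x in \<mu>. 0 \<le> h x) \<and> (\<integral>x. h x \<partial>\<mu>) = 1 \<and> ae_eq (transfer T h) h"

(* The spectrum is that of the operator on complex-valued functions; the norm estimates are
   for real-valued functions. *)
definition uniform_spectral_gap :: "nat \<Rightarrow> real \<Rightarrow> real set \<Rightarrow> (real \<Rightarrow> real \<Rightarrow> real) \<Rightarrow> bool" where
  "uniform_spectral_gap i p E T \<longleftrightarrow>
     (\<forall>\<epsilon>\<in>E. op_norm (sobolev i p :: (real \<Rightarrow> real) set) (sobolev_norm i p)
                    (sobolev i p :: (real \<Rightarrow> real) set) (sobolev_norm i p) (transfer (T \<epsilon>)) < \<infinity>) \<and>
     (\<forall>\<epsilon>\<in>E. simple_eigenvalue (sobolev i p) (transfer (T \<epsilon>)) (1::complex)) \<and>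
     (\<exists>K>0. \<exists>r. 0 < r \<and> r < 1 \<and>
        (\<forall>\<epsilon>\<in>E. spectrum_on (sobolev i p) (sobolev_norm i p) (transfer (T \<epsilon>)) - {1} \<subseteq> cball 0 r) \<and>
        (\<forall>\<epsilon>\<in>E. \<forall>n. \<forall>f \<in> (sobolev_mean_zero i p :: (real \<Rightarrow> real) set).
           (transfer (T \<epsilon>) ^^ n) f \<in> sobolev i p \<and>
           sobolev_norm i p ((transfer (T \<epsilon>) ^^ n) f) \<le> K * r ^ n * sobolev_norm i p f))"


subsection \<open>Regularity and mixing of maps\<close>

(* Derivatives are relative to S, hence one-sided at boundary points belonging to S. *)
definition deriv_on :: "real set \<Rightarrow> nat \<Rightarrow> (real \<Rightarrow> real) \<Rightarrow> (real \<Rightarrow> real)" where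
  "deriv_on S k f = ((\<lambda>g x. vector_derivative g (at x within S)) ^^ k) f"

definition Ck_on :: "nat \<Rightarrow> real set \<Rightarrow> (real \<Rightarrow> real) \<Rightarrow> bool" where
  "Ck_on k S f \<longleftrightarrow>
     (\<forall>j<k. \<forall>x\<in>S. deriv_on S j f differentiable (at x within S)) \<and>
     continuous_on S (deriv_on S k f)"

definition topologically_mixing_on :: "real set \<Rightarrow> (real \<Rightarrow> real) \<Rightarrow> bool" where
  "topologically_mixing_on S f \<longleftrightarrow>
     (\<forall>U V. openin (top_of_set S) U \<and> U \<noteq> {} \<and> openin (top_of_set S) V \<and> V \<noteq> {} \<longrightarrow>
        (\<exists>N. \<forall>n\<ge>N. (f ^^ n) ` U \<inter> V \<noteq> {}))"

end

theory Submission
  imports Defs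
begin

text \<open>
  Let \<open>G = 1 / T'\<close>, which vanishes at the turning point because \<open>T'\<close> blows up there like \<open>\<bar>x - c\<bar>\<^sup>\<beta>\<close>.
  Integrating by parts against test functions of the form \<open>\<phi> \<circ> T\<close> produces no boundary term at \<open>c\<close>, so that
  \<open>(P f)' = P ((G f)')\<close> and \<open>(P f)'' = P (G\<^sup>2 f'' + 3 G G' f' + (G G')' f)\<close>, with \<open>\<bar>G\<bar> \<le> 1 / \<theta> < 1\<close>.
  A Lasota--Yorke inequality on \<open>W\<^sup>1\<^sup>,\<^sup>1\<close>, uniform in \<open>\<epsilon>\<close>, bounds the densities \<open>P\<^sup>n 1\<close>; these bounds turn
  \<open>P\<^sup>n\<close> into uniformly bounded operators on \<open>L\<^sup>p\<close>, which gives Lasota--Yorke inequalities on \<open>W\<^sup>1\<^sup>,\<^sup>p\<close> and \<open>W\<^sup>2\<^sup>,\<^sup>p\<close>.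

  Topological mixing forces \<open>a\<^sub>0 = 1\<close>, so the unperturbed map has two full branches and expands every interval to
  the whole of \<open>[0, 1]\<close>. A mean-zero function with controlled derivative has positive and
  negative mass on intervals of definite length; a fixed iterate of the unperturbed \<open>P\<close> makes
  these cancel and contracts the \<open>L\<^sup>1\<close> norm. The closeness of the operators carries the contraction over to small
  \<open>\<epsilon>\<close>, and the Lasota--Yorke inequalities lift it to exponential decay on mean-zero functions in both Sobolev
  spaces. The invariant density, the simplicity of the eigenvalue \<open>1\<close>, the location of the spectrum and the bound on
  the resolvent then follow from Neumann series on the mean-zero subspace.
\<close>

section \<open>Lebesgue spaces on the unit interval\<close>

text \<open>For \<epsilon> > 0 the branches need not be full, so no covering property of the
  perturbed maps is at hand. The contraction is therefore proved for the unperturbed map alone, in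
  the weak norm of L^1, where closeness of the operators controls a fixed number of iterates; all
  other estimates use constants common to the family. The derivative of G is bounded by |x -
  c|^(-1-\<beta>) and that of G G' by |x - c|^(-2-2\<beta>). The upper bound on \<beta> is exactly
  the condition for the second power to lie in L^p; it forces \<beta> < -1/2, which makes G G'
  continuous at c. An application of P in L^p costs a constant factor M. Paid at every step it would
  destroy the contraction 1 / \<theta>, so the recurrences for the derivatives of P^n f are unrolled
  pointwise and M is paid once. Positivity arguments are real whereas the spectrum is complex:
  everything is proved over the reals, and the complex operator is then handled through real and
  imaginary parts. Uniqueness of the density is claimed among all integrable densities and so also
  needs convergence of P^n in L^1 beyond the Sobolev space.\<close>

lemma emeasure_mu_UNIV [simp]: "emeasure \<mu> {0..1} = 1"
  by (simp add: emeasure_restrict_space)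

lemma measure_mu_UNIV [simp]: "measure \<mu> {0..1} = 1"
  by (simp add: measure_def)

interpretation mu: finite_measure \<mu>
  by standard simp

lemma integrable_mu_bounded:
  fixes f :: "real \<Rightarrow> 'a::{banach, second_countable_topology}"
  assumes "f \<in> borel_measurable \<mu>" "AE x in \<mu>. norm (f x) \<le> B"
  shows "integrable \<mu> f"
  using mu.integrable_const_bound assms by blast

lemma integral_mu_bounded:
  assumes "integrable \<mu> f" "AE x in \<mu>. f x \<le> (B::real)"
  shows "(\<integral>x. f x \<partial>\<mu>) \<le> B"
  using integral_mono_AE[OF assms(1) _ assms(2)] by simp

lemma ae_eq_refl [simp]: "ae_eq f f"
  by (simp add: ae_eq_def)

lemma ae_eq_sym: "ae_eq f g \<Longrightarrow> ae_eq g f"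
  by (auto simp: ae_eq_def)

lemma ae_eq_trans [trans]: "ae_eq f g \<Longrightarrow> ae_eq g h \<Longrightarrow> ae_eq f h"
  unfolding ae_eq_def by (rule eventually_elim2) auto

text \<open>\<open>\<mu>\<close> is complete, being a restriction of Lebesgue measure, so a change
  on a null set preserves measurability. This is what makes all the spaces invariant under a.e.
  equality.\<close>

lemma borel_measurable_mu_ae:
  fixes f :: "real \<Rightarrow> 'a::{real_normed_field, banach, second_countable_topology}"
  assumes "f \<in> borel_measurable \<mu>" "ae_eq f g"
  shows "g \<in> borel_measurable \<mu>"
proof -
  interpret complete_measure \<mu>
  proof (rule complete_measure.intro)
    fix A B :: "real set" assume "B \<subseteq> A" "A \<in> null_sets \<mu>"
    then have "A \<in> null_sets lebesgue" "B \<subseteq> {0..1}"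
      by (auto simp: null_sets_restrict_space)
    then have "B \<in> sets lebesgue"
      using null_sets_completion_subset[OF \<open>B \<subseteq> A\<close>] by blast
    then show "B \<in> sets \<mu>"
      using \<open>B \<subseteq> {0..1}\<close> by (simp add: sets_restrict_space_iff)
  qed
  obtain N where N: "N \<in> null_sets \<mu>" "{x \<in> space \<mu>. f x \<noteq> g x} \<subseteq> N"
    using assms(2) unfolding ae_eq_def by (auto elim!: AE_E simp: null_sets_def)
  show ?thesis
  proof (rule borel_measurableI)
    fix S :: "'a set" assume "open S"
    then have A: "f -` S \<inter> space \<mu> \<in> sets \<mu>" by (rule measurable_sets[OF assms(1) borel_open])
    have B: "g -` S \<inter> space \<mu> \<inter> N \<in> sets \<mu>"
      using complete[OF _ N(1)] by (metis inf_le2 null_setsD2)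
    have "g -` S \<inter> space \<mu> = (f -` S \<inter> space \<mu> - N) \<union> (g -` S \<inter> space \<mu> \<inter> N)"
      using N(2) by auto
    then show "g -` S \<inter> space \<mu> \<in> sets \<mu>"
      using sets.Un[OF sets.Diff[OF A null_setsD2[OF N(1)]] B] by simp
  qed
qed

lemma integrable_ae_eq:
  fixes f :: "real \<Rightarrow> 'a::{real_normed_field, banach, second_countable_topology}"
  assumes "integrable \<mu> f" "ae_eq f g"
  shows "integrable \<mu> g"
  using assms borel_measurable_mu_ae[OF _ assms(2)] integrable_cong_AE[of f \<mu> g]
  by (auto simp: ae_eq_def)

lemma Lp_norm_nonneg [simp]: "0 \<le> Lp_norm p f"
  by (simp add: Lp_norm_def)

lemma Lp_norm_powr: "0 < p \<Longrightarrow> Lp_norm p f powr p = (\<integral>x. norm (f x) powr p \<partial>\<mu>)"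
  by (simp add: Lp_norm_def powr_powr)

lemma Lp_norm_leI:
  assumes "0 < p" "0 \<le> B" "(\<integral>x. norm (f x) powr p \<partial>\<mu>) \<le> B powr p"
  shows "Lp_norm p f \<le> B"
proof -
  have "Lp_norm p f \<le> (B powr p) powr (1/p)"
    unfolding Lp_norm_def using assms by (intro powr_mono2) auto
  then show ?thesis using assms by (simp add: powr_powr)
qed

text \<open>The equation holds for arbitrary functions: if the integrand is not measurable for one
  representative, it is not measurable for the other, and both Bochner integrals take their default
  value 0.\<close>

lemma Lp_norm_cong:
  assumes "ae_eq f g" shows "Lp_norm p f = Lp_norm p (g :: real \<Rightarrow> 'a::{real_normed_field, banach, second_countable_topology})"
proof -
  have "(\<integral>x. norm (f x) powr p \<partial>\<mu>) = (\<integral>x. norm (g x) powr p \<partial>\<mu>)"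
  proof (cases "f \<in> borel_measurable \<mu>")
    case True
    then have "g \<in> borel_measurable \<mu>" using assms by (rule borel_measurable_mu_ae)
    with True show ?thesis using assms unfolding ae_eq_def
      by (intro integral_cong_AE) auto
  next
    case False
    have *: "ae_eq (\<lambda>x. norm (f x) powr p) (\<lambda>x. norm (g x) powr p)"
      using assms unfolding ae_eq_def by eventually_elim simp
    show ?thesis
    proof (cases "(\<lambda>x. norm (f x) powr p) \<in> borel_measurable \<mu>")
      case True
      then have "(\<lambda>x. norm (g x) powr p) \<in> borel_measurable \<mu>" using * by (rule borel_measurable_mu_ae)
      with True show ?thesis using * unfolding ae_eq_def by (intro integral_cong_AE) auto
    next
      case False
      moreover have "(\<lambda>x. norm (g x) powr p) \<notin> borel_measurable \<mu>"
        using False borel_measurable_mu_ae[OF _ ae_eq_sym[OF *]] by blast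
      ultimately show ?thesis
        by (metis not_integrable_integral_eq borel_measurable_integrable)
    qed
  qed
  then show ?thesis by (simp add: Lp_norm_def)
qed

lemma Lp_space_cong: "f \<in> Lp_space p \<Longrightarrow> ae_eq f g \<Longrightarrow> g \<in> Lp_space p"
proof -
  assume f: "f \<in> Lp_space p" and e: "ae_eq f g"
  have g: "g \<in> borel_measurable \<mu>" using f e borel_measurable_mu_ae by (auto simp: Lp_space_def)
  have "integrable \<mu> (\<lambda>x. norm (f x) powr p)" using f by (simp add: Lp_space_def)
  moreover have "ae_eq (\<lambda>x. norm (f x) powr p) (\<lambda>x. norm (g x) powr p)"
    using e unfolding ae_eq_def by eventually_elim simp
  ultimately show ?thesis using g integrable_ae_eq by (auto simp: Lp_space_def)
qed

lemma Lp_space_measurable: "f \<in> Lp_space p \<Longrightarrow> f \<in> borel_measurable \<mu>"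
  by (simp add: Lp_space_def)

lemma Lp_mono:
  fixes f :: "real \<Rightarrow> 'a::{real_normed_field, banach, second_countable_topology}"
    and g :: "real \<Rightarrow> 'b::{real_normed_field, banach, second_countable_topology}"
  assumes "0 < p" "f \<in> borel_measurable \<mu>" "g \<in> Lp_space p" "AE x in \<mu>. norm (f x) \<le> norm (g x)"
  shows "f \<in> Lp_space p" "Lp_norm p f \<le> Lp_norm p g"
proof -
  have g: "integrable \<mu> (\<lambda>x. norm (g x) powr p)" using assms by (simp add: Lp_space_def)
  have le: "AE x in \<mu>. norm (f x) powr p \<le> norm (g x) powr p"
    using assms(4) by eventually_elim (use assms(1) in \<open>auto intro: powr_mono2\<close>)
  have f: "integrable \<mu> (\<lambda>x. norm (f x) powr p)"
    by (rule Bochner_Integration.integrable_bound[OF g]) (use assms le in auto)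
  then show "f \<in> Lp_space p" using assms by (simp add: Lp_space_def)
  show "Lp_norm p f \<le> Lp_norm p g" unfolding Lp_norm_def
    using assms by (intro powr_mono2 integral_mono_AE f g le) auto
qed

lemma Lp_bounded:
  fixes f :: "real \<Rightarrow> 'a::{real_normed_field, banach, second_countable_topology}"
  assumes "0 < p" "0 \<le> B" "f \<in> borel_measurable \<mu>" "AE x in \<mu>. norm (f x) \<le> B"
  shows "f \<in> Lp_space p" "Lp_norm p f \<le> B"
proof -
  have c: "(\<lambda>x. B) \<in> Lp_space p" by (simp add: Lp_space_def)
  have n: "Lp_norm p (\<lambda>x. B) = B" using assms by (simp add: Lp_norm_def powr_powr)
  show "f \<in> Lp_space p" "Lp_norm p f \<le> B"
    using Lp_mono[OF assms(1,3) c] assms(2,4) n by auto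
qed

lemma Lp_zero [simp]: "0 < p \<Longrightarrow> (\<lambda>x. 0) \<in> Lp_space p" "0 < p \<Longrightarrow> Lp_norm p (\<lambda>x. 0) = 0"
  by (simp_all add: Lp_space_def Lp_norm_def)

lemma Lp_scale:
  fixes f :: "real \<Rightarrow> 'a::{real_normed_field, banach, second_countable_topology}"
  assumes "0 < p"
  shows "f \<in> Lp_space p \<Longrightarrow> (\<lambda>x. a * f x) \<in> Lp_space p"
    and "Lp_norm p (\<lambda>x. a * f x) = norm a * Lp_norm p f"
  using assms by (auto simp: Lp_space_def Lp_norm_def norm_mult powr_mult powr_powr)

lemma Lp_norm_minus: "Lp_norm p (\<lambda>x. - f x) = Lp_norm p f"
  by (simp add: Lp_norm_def)

text \<open>Convexity of t^p with weights A / (A + B) and B / (A + B). With A and B upper bounds for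
  the two norms, integration gives Minkowski's inequality without a detour through Hoelder. A
  vanishing argument is treated apart, by \<open>shrink\<close>.\<close>

lemma powr_convex_two:
  assumes "1 \<le> p" "0 \<le> a" "0 \<le> b" "0 < A" "0 < B"
  shows "((a + b) / (A + B)) powr p \<le> A / (A + B) * (a / A) powr p + B / (A + B) * (b / B) powr (p::real)"
proof -
  have shrink: "(y / (C + D)) powr p \<le> C / (C + D) * (y / C) powr p" if "0 \<le> y" "0 < C" "0 < D" for y C D
  proof -
    have "(y / (C + D)) powr p = (C / (C + D)) powr p * (y / C) powr p"
      using that by (simp flip: powr_mult)
    also have "\<dots> \<le> C / (C + D) * (y / C) powr p"
      using that assms(1) powr_le_one_le[of "C / (C + D)" p] by (intro mult_right_mono) auto
    finally show ?thesis .
  qed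
  show ?thesis
  proof (cases "a = 0 \<or> b = 0")
    case True
    then show ?thesis
      using shrink[of b B A] shrink[of a A B] assms by (auto simp: add.commute)
  next
    case False
    have AB: "1 - B/(A+B) = A/(A+B)" using assms by (simp add: field_simps)
    have "((1 - B/(A+B)) *\<^sub>R (a/A) + (B/(A+B)) *\<^sub>R (b/B)) powr p
       \<le> (1 - B / (A + B)) * (a / A) powr p + B / (A + B) * (b / B) powr p"
      using assms False by (intro convex_onD[OF powr_convex]) (auto simp: field_simps)
    moreover have "(A/(A+B)) *\<^sub>R (a/A) + (B/(A+B)) *\<^sub>R (b/B) = (a + b) / (A + B)"
      using assms by (simp add: add_divide_distrib)
    ultimately show ?thesis by (simp add: AB)
  qed
qed

lemma Lp_zero_AE:
  assumes "0 < p" "f \<in> Lp_space p" "Lp_norm p f = 0"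
  shows "AE x in \<mu>. f x = 0"
proof -
  have "(\<integral>x. norm (f x) powr p \<partial>\<mu>) = 0" using assms Lp_norm_powr[of p f] by simp
  then have "AE x in \<mu>. norm (f x) powr p = 0"
    using assms integral_nonneg_eq_0_iff_AE[of \<mu> "\<lambda>x. norm (f x) powr p"] by (auto simp: Lp_space_def)
  then show ?thesis by eventually_elim simp
qed

lemma Lp_add:
  fixes f g :: "real \<Rightarrow> 'a::{real_normed_field, banach, second_countable_topology}"
  assumes p: "1 \<le> p" and f: "f \<in> Lp_space p" and g: "g \<in> Lp_space p"
  shows "(\<lambda>x. f x + g x) \<in> Lp_space p"
    and "Lp_norm p (\<lambda>x. f x + g x) \<le> Lp_norm p f + Lp_norm p g"
proof -
  \<comment> \<open>Positive upper bounds \<open>A\<close> and \<open>B\<close> replace the norms,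
    which may vanish and could then not be divided by; the norms are approached at the end with an
    error e.\<close>
  have key: "(\<lambda>x. f x + g x) \<in> Lp_space p \<and> Lp_norm p (\<lambda>x. f x + g x) \<le> A + B"
    if AB: "0 < A" "0 < B" "Lp_norm p f \<le> A" "Lp_norm p g \<le> B" for A B
  proof -
    let ?F = "\<lambda>x. (A + B) powr p * (A / (A + B) * (norm (f x) powr p / A powr p) + B / (A + B) * (norm (g x) powr p / B powr p))"
    have fi: "integrable \<mu> (\<lambda>x. norm (f x) powr p)" and gi: "integrable \<mu> (\<lambda>x. norm (g x) powr p)"
      and fm [measurable]: "f \<in> borel_measurable \<mu>" "g \<in> borel_measurable \<mu>"
      using f g by (auto simp: Lp_space_def)
    have Fi: "integrable \<mu> ?F"
      by (intro Bochner_Integration.integrable_add integrable_mult_right integrable_divide fi gi)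
    have pw: "norm (f x + g x) powr p \<le> ?F x" for x
    proof -
      have "norm (f x + g x) powr p \<le> (norm (f x) + norm (g x)) powr p"
        using p by (intro powr_mono2 norm_triangle_ineq) auto
      also have "\<dots> = (A + B) powr p * ((norm (f x) + norm (g x)) / (A + B)) powr p"
        using AB by (simp add: powr_divide)
      also have "\<dots> \<le> ?F x"
        using powr_convex_two[OF p, of "norm (f x)" "norm (g x)" A B] AB
        by (intro mult_left_mono) (auto simp: powr_divide)
      finally show ?thesis .
    qed
    have i: "integrable \<mu> (\<lambda>x. norm (f x + g x) powr p)"
      by (rule Bochner_Integration.integrable_bound[OF Fi])
        (use pw in \<open>auto intro!: AE_I2 intro: order_trans[OF _ abs_ge_self]\<close>)
    have "(\<integral>x. norm (f x + g x) powr p \<partial>\<mu>) \<le> (\<integral>x. ?F x \<partial>\<mu>)"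
      by (intro integral_mono i Fi pw)
    also have "\<dots> = (A + B) powr p * (A / (A + B) * (Lp_norm p f powr p / A powr p)
        + B / (A + B) * (Lp_norm p g powr p / B powr p))"
      using p by (subst Lp_norm_powr Lp_norm_powr, simp)+
        (simp add: fi gi)
    also have "\<dots> \<le> (A + B) powr p * (A / (A + B) * 1 + B / (A + B) * 1)"
      using AB p by (intro mult_left_mono add_mono) (auto simp: field_simps intro: powr_mono2)
    also have "\<dots> = (A + B) powr p" using AB by (simp flip: add_divide_distrib)
    finally have "Lp_norm p (\<lambda>x. f x + g x) \<le> A + B"
      using AB p by (intro Lp_norm_leI) auto
    with i show ?thesis by (simp add: Lp_space_def)
  qed
  show "(\<lambda>x. f x + g x) \<in> Lp_space p"
    using key[of "Lp_norm p f + 1" "Lp_norm p g + 1"] by (auto simp: add_nonneg_pos)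
  show "Lp_norm p (\<lambda>x. f x + g x) \<le> Lp_norm p f + Lp_norm p g"
  proof (rule field_le_epsilon)
    fix e :: real assume "0 < e"
    then show "Lp_norm p (\<lambda>x. f x + g x) \<le> Lp_norm p f + Lp_norm p g + e"
      using key[of "Lp_norm p f + e/2" "Lp_norm p g + e/2"] by (auto simp: add_nonneg_pos)
  qed
qed

lemma Lp_diff:
  fixes f g :: "real \<Rightarrow> 'a::{real_normed_field, banach, second_countable_topology}"
  assumes p: "1 \<le> p" and f: "f \<in> Lp_space p" and g: "g \<in> Lp_space p"
  shows "(\<lambda>x. f x - g x) \<in> Lp_space p"
    and "Lp_norm p (\<lambda>x. f x - g x) \<le> Lp_norm p f + Lp_norm p g"
  using Lp_add[OF p f, of "\<lambda>x. - g x"] Lp_scale(1)[of p g "-1"] p g by (auto simp: Lp_norm_minus)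

lemma Lp_sum:
  fixes f :: "nat \<Rightarrow> real \<Rightarrow> 'a::{real_normed_field, banach, second_countable_topology}"
  assumes p: "1 \<le> p" and f: "\<And>i. f i \<in> Lp_space p"
  shows "(\<lambda>x. \<Sum>i\<in>{m..<n}. f i x) \<in> Lp_space p"
    and "Lp_norm p (\<lambda>x. \<Sum>i\<in>{m..<n}. f i x) \<le> (\<Sum>i\<in>{m..<n}. Lp_norm p (f i))"
proof -
  have "(\<lambda>x. \<Sum>i\<in>{m..<n}. f i x) \<in> Lp_space p \<and>
      Lp_norm p (\<lambda>x. \<Sum>i\<in>{m..<n}. f i x) \<le> (\<Sum>i\<in>{m..<n}. Lp_norm p (f i))"
  proof (induction n)
    case 0 then show ?case using p by simp
  next
    case (Suc n)
    show ?case
    proof (cases "m \<le> n")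
      case True
      then show ?thesis using Suc Lp_add[OF p, of "\<lambda>x. \<Sum>i\<in>{m..<n}. f i x" "f n"] f[of n] by auto
    next
      case False
      then show ?thesis using p by simp
    qed
  qed
  then show "(\<lambda>x. \<Sum>i\<in>{m..<n}. f i x) \<in> Lp_space p"
    "Lp_norm p (\<lambda>x. \<Sum>i\<in>{m..<n}. f i x) \<le> (\<Sum>i\<in>{m..<n}. Lp_norm p (f i))" by auto
qed

lemma Lp_integrable:
  fixes f :: "real \<Rightarrow> 'a::{real_normed_field, banach, second_countable_topology}"
  assumes p: "1 \<le> p" and f: "f \<in> Lp_space p"
  shows "integrable \<mu> f" and "(\<integral>x. norm (f x) \<partial>\<mu>) \<le> Lp_norm p f"
proof -
  \<comment> \<open>Young's inequality for t / A and 1, multiplied by A. As \<open>\<mu>\<close> has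
    mass 1, the right side integrates to at most A once A dominates the norm; this gives the
    inclusion of L^p in L^1 with constant 1.\<close>
  have pw: "t \<le> A * (t powr p / A powr p / p + (1 - 1/p))" if "0 \<le> t" "0 < A" for t A :: real
  proof -
    have "t / A \<le> (t / A) powr p / p + (1 - 1/p)"
    proof (cases "p = 1 \<or> t = 0")
      case True then show ?thesis using that p by auto
    next
      case False
      have *: "1 / (p / (p - 1)) = 1 - 1/p" using False p by (simp add: field_simps)
      have "t / A * 1 \<le> (t / A) powr p / p + 1 powr (p / (p - 1)) / (p / (p - 1))"
        using False p that by (intro Youngs_inequality) (auto simp: field_simps)
      then show ?thesis using * by simp
    qed
    then have "A * (t / A) \<le> A * ((t / A) powr p / p + (1 - 1/p))"
      using that by (intro mult_left_mono) auto
    then show ?thesis using that by (simp add: powr_divide)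
  qed
  have fi: "integrable \<mu> (\<lambda>x. norm (f x) powr p)"
    and fm [measurable]: "f \<in> borel_measurable \<mu>" using f by (auto simp: Lp_space_def)
  have Fi: "integrable \<mu> (\<lambda>x. A * (norm (f x) powr p / A powr p / p + (1 - 1/p)))" for A
    by (intro Bochner_Integration.integrable_add integrable_mult_right integrable_divide fi) simp
  show i: "integrable \<mu> f"
    by (rule Bochner_Integration.integrable_bound[OF Fi[of 1]])
      (use pw[of _ 1] in \<open>auto intro!: AE_I2 intro: order_trans[OF _ abs_ge_self]\<close>)
  have *: "(\<integral>x. norm (f x) \<partial>\<mu>) \<le> A" if A: "0 < A" "Lp_norm p f \<le> A" for A
  proof -
    have "(\<integral>x. norm (f x) \<partial>\<mu>) \<le> (\<integral>x. A * (norm (f x) powr p / A powr p / p + (1 - 1/p)) \<partial>\<mu>)"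
      using A by (intro integral_mono integrable_norm i Fi pw) auto
    also have "\<dots> = A * (Lp_norm p f powr p / A powr p / p + (1 - 1/p))"
      using p by (subst Lp_norm_powr, simp) (simp add: fi)
    also have "\<dots> \<le> A * (1 / p + (1 - 1/p))"
      using A p by (intro mult_left_mono add_mono divide_right_mono) (auto simp: field_simps intro: powr_mono2)
    finally show ?thesis by simp
  qed
  show "(\<integral>x. norm (f x) \<partial>\<mu>) \<le> Lp_norm p f"
  proof (rule field_le_epsilon)
    fix e :: real assume "0 < e"
    then show "(\<integral>x. norm (f x) \<partial>\<mu>) \<le> Lp_norm p f + e"
      using * by (simp add: add_nonneg_pos)
  qed
qed

lemma Lp_Fatou:
  fixes f :: "real \<Rightarrow> 'a::{real_normed_field, banach, second_countable_topology}"
  assumes p: "0 < p" and g: "\<And>n. g n \<in> Lp_space p" and b: "\<And>n. Lp_norm p (g n) \<le> L"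
    and lim: "AE x in \<mu>. (\<lambda>n. g n x) \<longlonglongrightarrow> f x" and f [measurable]: "f \<in> borel_measurable \<mu>"
  shows "f \<in> Lp_space p" and "Lp_norm p f \<le> L"
proof -
  have L: "0 \<le> L" using b[of 0] Lp_norm_nonneg[of p "g 0"] by linarith
  have gm [measurable]: "g n \<in> borel_measurable \<mu>" for n using g by (auto simp: Lp_space_def)
  have "(\<integral>\<^sup>+x. ennreal (norm (f x) powr p) \<partial>\<mu>) = (\<integral>\<^sup>+x. liminf (\<lambda>n. ennreal (norm (g n x) powr p)) \<partial>\<mu>)"
  proof (rule nn_integral_cong_AE, use lim in eventually_elim)
    case (elim x)
    have "(\<lambda>n. ennreal (norm (g n x) powr p)) \<longlonglongrightarrow> ennreal (norm (f x) powr p)"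
      using elim p by (intro tendsto_ennrealI tendsto_powr' tendsto_norm tendsto_const) auto
    then show ?case by (metis lim_imp_Liminf trivial_limit_sequentially)
  qed
  also have "\<dots> \<le> liminf (\<lambda>n. \<integral>\<^sup>+x. ennreal (norm (g n x) powr p) \<partial>\<mu>)"
    by (rule nn_integral_liminf) simp
  also have "\<dots> \<le> ennreal (L powr p)"
  proof (rule Liminf_le, simp, rule always_eventually, rule allI)
    fix n
    have "(\<integral>\<^sup>+x. ennreal (norm (g n x) powr p) \<partial>\<mu>) = ennreal (Lp_norm p (g n) powr p)"
      using p g[of n] by (subst nn_integral_eq_integral) (auto simp: Lp_norm_powr Lp_space_def)
    also have "\<dots> \<le> ennreal (L powr p)"
      using b[of n] p by (intro ennreal_leI powr_mono2) auto
    finally show "(\<integral>\<^sup>+x. ennreal (norm (g n x) powr p) \<partial>\<mu>) \<le> ennreal (L powr p)" .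
  qed
  finally have nn: "(\<integral>\<^sup>+x. ennreal (norm (f x) powr p) \<partial>\<mu>) \<le> ennreal (L powr p)" .
  have i: "integrable \<mu> (\<lambda>x. norm (f x) powr p)"
    using nn by (intro integrableI_bounded) (auto simp: le_less_trans[OF _ ennreal_less_top])
  then show "f \<in> Lp_space p" by (simp add: Lp_space_def)
  have "ennreal (\<integral>x. norm (f x) powr p \<partial>\<mu>) \<le> ennreal (L powr p)"
    using nn i by (subst (asm) nn_integral_eq_integral) auto
  then show "Lp_norm p f \<le> L" using p L by (intro Lp_norm_leI) auto
qed

text \<open>Riesz-Fischer for absolutely convergent series: summable norms make the series of
  absolute values integrable, hence convergent a.e., and Fatou applied to the partial sums of the
  tail gives the quantitative bound. The Neumann series needs this form.\<close>

lemma Lp_complete: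
  fixes f :: "nat \<Rightarrow> real \<Rightarrow> 'a::{real_normed_field, banach, second_countable_topology}"
  assumes p: "1 \<le> p" and f: "\<And>i. f i \<in> Lp_space p" and s: "summable (\<lambda>i. Lp_norm p (f i))"
  obtains F where "F \<in> Lp_space p"
    "\<And>n. Lp_norm p (\<lambda>x. F x - (\<Sum>i<n. f i x)) \<le> (\<Sum>i. Lp_norm p (f (i + n)))"
proof -
  have fm [measurable]: "f n \<in> borel_measurable \<mu>" for n using f by (auto simp: Lp_space_def)
  have fi: "integrable \<mu> (f n)" for n using Lp_integrable(1)[OF p f] .
  have "(\<integral>\<^sup>+x. (\<Sum>i. ennreal (norm (f i x))) \<partial>\<mu>) = (\<Sum>i. \<integral>\<^sup>+x. ennreal (norm (f i x)) \<partial>\<mu>)"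
    by (rule nn_integral_suminf) simp
  also have "\<dots> \<le> (\<Sum>i. ennreal (Lp_norm p (f i)))"
    by (intro suminf_le summableI)
      (use Lp_integrable(2)[OF p f] fi in \<open>auto simp: nn_integral_eq_integral intro!: ennreal_leI\<close>)
  also have "\<dots> = ennreal (\<Sum>i. Lp_norm p (f i))"
    by (rule suminf_ennreal2) (auto simp: s)
  finally have "(\<integral>\<^sup>+x. (\<Sum>i. ennreal (norm (f i x))) \<partial>\<mu>) \<noteq> \<infinity>"
    by (auto simp: top_unique)
  then have "AE x in \<mu>. (\<Sum>i. ennreal (norm (f i x))) \<noteq> \<infinity>"
    by (intro nn_integral_PInf_AE) auto
  then have sm: "AE x in \<mu>. summable (\<lambda>i. f i x)"
    by eventually_elim (rule summable_norm_cancel, rule summable_suminf_not_top, auto)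
  define F where "F x = (\<Sum>i. f i x)" for x
  have Fm [measurable]: "F \<in> borel_measurable \<mu>"
    unfolding F_def by measurable
  have main: "(\<lambda>x. F x - (\<Sum>i<n. f i x)) \<in> Lp_space p \<and>
      Lp_norm p (\<lambda>x. F x - (\<Sum>i<n. f i x)) \<le> (\<Sum>i. Lp_norm p (f (i + n)))" for n
  proof -
    have g: "(\<lambda>x. \<Sum>i\<in>{0..<m}. f (i + n) x) \<in> Lp_space p" for m
      using Lp_sum(1)[OF p, of "\<lambda>i. f (i + n)"] f by auto
    have b: "Lp_norm p (\<lambda>x. \<Sum>i\<in>{0..<m}. f (i + n) x) \<le> (\<Sum>i. Lp_norm p (f (i + n)))" for m
      using Lp_sum(2)[OF p, of "\<lambda>i. f (i + n)" 0 m] f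
        sum_le_suminf[of "\<lambda>i. Lp_norm p (f (i + n))" "{0..<m}"] s summable_ignore_initial_segment[OF s, of n]
      by (auto intro: order_trans)
    have l: "AE x in \<mu>. (\<lambda>m. \<Sum>i\<in>{0..<m}. f (i + n) x) \<longlonglongrightarrow> F x - (\<Sum>i<n. f i x)"
      using sm
    proof eventually_elim
      case (elim x)
      then have "(\<lambda>i. f (i + n) x) sums (F x - (\<Sum>i<n. f i x))"
        unfolding F_def by (subst sums_iff_shift) (simp add: summable_sums)
      then show ?case by (simp add: sums_def atLeast0LessThan)
    qed
    show ?thesis using Lp_Fatou[OF _ g b l] p by auto
  qed
  have "F \<in> Lp_space p" using main[of 0] by simp
  then show ?thesis using that main by blast
qed

section \<open>Smooth bump functions\<close>

text \<open>The powers x^(-k) in front of exp(-1/x) make the family closed under differentiation up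
  to linear combinations, with indices k + 2 and k + 1. One derivative formula thus covers all
  orders, also at the flat point 0.\<close>

definition exp_bump :: "nat \<Rightarrow> real \<Rightarrow> real" where
  "exp_bump k x = (if 0 < x then (1 / x) ^ k * exp (- (1 / x)) else 0)"

lemma exp_bump_has_derivative:
  "(exp_bump k has_real_derivative (exp_bump (k + 2) x - real k * exp_bump (k + 1) x)) (at x)"
proof -
  consider "0 < x" | "x < 0" | "x = 0" by linarith
  then show ?thesis
  proof cases
    case 1
    have "((\<lambda>x. (1 / x) ^ k * exp (- (1 / x))) has_real_derivative
        exp_bump (k + 2) x - real k * exp_bump (k + 1) x) (at x)"
    proof (rule DERIV_cong)
      show "((\<lambda>x. (1 / x) ^ k * exp (- (1 / x))) has_real_derivative
        real k * (1 / x) ^ (k - 1) * (- ((1 / x) ^ 2)) * exp (- (1 / x)) + (1 / x) ^ k * (exp (- (1 / x)) * (1 / x) ^ 2)) (at x)"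
      proof -
        have d: "((\<lambda>x. 1 / x) has_real_derivative - ((1 / x) ^ 2)) (at x)"
          using 1 by (auto intro!: derivative_eq_intros simp: field_simps power2_eq_square)
        show ?thesis
          by (rule DERIV_cong[OF DERIV_mult[OF DERIV_power[OF d] DERIV_chain2[OF DERIV_exp DERIV_minus[OF d]]]])
            (simp add: algebra_simps)
      qed
      show "real k * (1 / x) ^ (k - 1) * (- ((1 / x) ^ 2)) * exp (- (1 / x)) + (1 / x) ^ k * (exp (- (1 / x)) * (1 / x) ^ 2)
        = exp_bump (k + 2) x - real k * exp_bump (k + 1) x"
        using 1 by (cases k) (simp_all add: exp_bump_def power_add power2_eq_square algebra_simps add_divide_distrib)
    qed
    moreover have "eventually (\<lambda>y. (1 / y) ^ k * exp (- (1 / y)) = exp_bump k y) (nhds x)"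
      using eventually_nhds_in_open[of "{0<..}" x] 1
      by (auto simp: exp_bump_def elim!: eventually_mono)
    ultimately show ?thesis by (subst (asm) DERIV_cong_ev[OF refl _ refl]) auto
  next
    case 2
    have "((\<lambda>x. 0) has_real_derivative exp_bump (k + 2) x - real k * exp_bump (k + 1) x) (at x)"
      using 2 by (simp add: exp_bump_def)
    moreover have "eventually (\<lambda>y. 0 = exp_bump k y) (nhds x)"
      using eventually_nhds_in_open[of "{..<0}" x] 2
      by (auto simp: exp_bump_def elim!: eventually_mono)
    ultimately show ?thesis by (subst (asm) DERIV_cong_ev[OF refl _ refl]) auto
  next
    case 3
    have "((\<lambda>h. exp_bump k h / h) \<longlongrightarrow> 0) (at 0)"
    proof (rule filterlim_split_at)
      show "((\<lambda>h. exp_bump k h / h) \<longlongrightarrow> 0) (at_left 0)"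
        by (rule tendsto_eventually) (auto simp: exp_bump_def eventually_at_filter)
      have "((\<lambda>h::real. (inverse h) ^ Suc k / exp (inverse h)) \<longlongrightarrow> 0) (at_right 0)"
        using filterlim_compose[OF tendsto_power_div_exp_0[of "Suc k"] filterlim_inverse_at_top_right] .
      then show "((\<lambda>h. exp_bump k h / h) \<longlongrightarrow> 0) (at_right 0)"
        by (rule Lim_transform_eventually)
          (auto simp: exp_bump_def eventually_at_filter exp_minus field_simps)
    qed
    then show ?thesis using 3 by (simp add: DERIV_def exp_bump_def)
  qed
qed

text \<open>An algebra of functions closed under \<open>deriv\<close>. Membership alone yields
  infinite differentiability by induction, with no formula for higher derivatives of
  products.\<close>

inductive smooth_class :: "(real \<Rightarrow> real) \<Rightarrow> bool" where
  base: "smooth_class (\<lambda>x. exp_bump k (\<alpha> * x + \<gamma>))"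
| const: "smooth_class (\<lambda>x. r)"
| add: "smooth_class f \<Longrightarrow> smooth_class g \<Longrightarrow> smooth_class (\<lambda>x. f x + g x)"
| mult: "smooth_class f \<Longrightarrow> smooth_class g \<Longrightarrow> smooth_class (\<lambda>x. f x * g x)"

lemma smooth_class_deriv:
  "smooth_class f \<Longrightarrow> \<exists>f'. smooth_class f' \<and> (\<forall>x. (f has_real_derivative f' x) (at x))"
proof (induction rule: smooth_class.induct)
  case (base k \<alpha> \<gamma>)
  let ?f' = "\<lambda>x. \<alpha> * (exp_bump (k + 2) (\<alpha> * x + \<gamma>) + (- real k) * exp_bump (k + 1) (\<alpha> * x + \<gamma>))"
  have "smooth_class ?f'" by (intro smooth_class.intros)
  moreover have "((\<lambda>x. exp_bump k (\<alpha> * x + \<gamma>)) has_real_derivative ?f' x) (at x)" for x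
    by (rule DERIV_cong, rule DERIV_chain2[OF exp_bump_has_derivative])
      (auto intro!: derivative_eq_intros)
  ultimately show ?case by blast
next
  case (const r)
  have "smooth_class (\<lambda>x. 0)" by (rule smooth_class.const)
  then show ?case by (intro exI[of _ "\<lambda>x. 0"]) auto
next
  case (add f g)
  then obtain f' g' where "smooth_class f'" "\<And>x. (f has_real_derivative f' x) (at x)"
    "smooth_class g'" "\<And>x. (g has_real_derivative g' x) (at x)" by blast
  then show ?case
    by (intro exI[of _ "\<lambda>x. f' x + g' x"]) (auto intro: smooth_class.add DERIV_add)
next
  case (mult f g)
  then obtain f' g' where fg: "smooth_class f'" "\<And>x. (f has_real_derivative f' x) (at x)"
    "smooth_class g'" "\<And>x. (g has_real_derivative g' x) (at x)" by blast
  then have "smooth_class (\<lambda>x. f' x * g x + g' x * f x)"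
    using mult by (intro smooth_class.intros) auto
  with fg show ?case
    by (intro exI[of _ "\<lambda>x. f' x * g x + g' x * f x"]) (auto intro: DERIV_mult)
qed

lemma smooth_class_funpow_deriv: "smooth_class f \<Longrightarrow> smooth_class ((deriv ^^ n) f)"
proof (induction n)
  case (Suc n)
  then obtain f' where "smooth_class f'" "\<And>x. ((deriv ^^ n) f has_real_derivative f' x) (at x)"
    using smooth_class_deriv by blast
  moreover from this have "deriv ((deriv ^^ n) f) = f'" by (auto intro: DERIV_imp_deriv)
  ultimately show ?case by simp
qed simp

lemma smooth_class_differentiable: "smooth_class f \<Longrightarrow> (deriv ^^ n) f differentiable (at x)"
  using smooth_class_deriv[OF smooth_class_funpow_deriv] real_differentiable_def by blast

text \<open>The arguments equal (n+1)^2 (x - u - 1/(n+1)) and (n+1)^2 (v - x - 1/(n+1)). The shift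
  by 1/(n+1) keeps the support inside the open interval (u, v), and the growing slope drives the
  values there to 1.\<close>

definition bump :: "real \<Rightarrow> real \<Rightarrow> nat \<Rightarrow> real \<Rightarrow> real" where
  "bump u v n x = exp_bump 0 ((real n + 1)\<^sup>2 * (x - u) - (real n + 1)) *
     exp_bump 0 ((real n + 1)\<^sup>2 * (v - x) - (real n + 1))"

lemma smooth_class_bump: "smooth_class (bump u v n)"
proof -
  have "smooth_class (\<lambda>x. exp_bump 0 ((real n + 1)\<^sup>2 * x + (- ((real n + 1)\<^sup>2 * u) - (real n + 1))) *
     exp_bump 0 (- (real n + 1)\<^sup>2 * x + ((real n + 1)\<^sup>2 * v - (real n + 1))))"
    by (intro smooth_class.intros)
  moreover have "(\<lambda>x. exp_bump 0 ((real n + 1)\<^sup>2 * x + (- ((real n + 1)\<^sup>2 * u) - (real n + 1))) *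
     exp_bump 0 (- (real n + 1)\<^sup>2 * x + ((real n + 1)\<^sup>2 * v - (real n + 1)))) = bump u v n"
    by (rule ext, unfold bump_def, rule arg_cong2[where f = "\<lambda>a b. exp_bump 0 a * exp_bump 0 b"])
      (simp_all add: algebra_simps)
  ultimately show ?thesis by simp
qed

lemma bump_bounds: "0 \<le> bump u v n x" "bump u v n x \<le> 1"
proof -
  have "0 \<le> exp_bump 0 y" "exp_bump 0 y \<le> 1" for y by (auto simp: exp_bump_def)
  then show "0 \<le> bump u v n x" "bump u v n x \<le> 1"
    unfolding bump_def by (auto intro: mult_le_one)
qed

lemma bump_eq_0: "x < u + 1 / (real n + 1) \<or> v - 1 / (real n + 1) < x \<Longrightarrow> bump u v n x = 0"
proof -
  have a: "(real n + 1)\<^sup>2 * y - (real n + 1) = (real n + 1)\<^sup>2 * (y - 1 / (real n + 1))" for y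
    by (simp add: field_simps power2_eq_square)
  assume "x < u + 1 / (real n + 1) \<or> v - 1 / (real n + 1) < x"
  then show ?thesis
    unfolding bump_def exp_bump_def a by (auto simp: zero_less_mult_iff)
qed

lemma bump_tendsto: "(\<lambda>n. bump u v n x) \<longlonglongrightarrow> indicator {u<..<v} x"
proof (cases "u < x \<and> x < v")
  case True
  have lim: "(\<lambda>n. exp_bump 0 ((real n + 1)\<^sup>2 * y - (real n + 1))) \<longlonglongrightarrow> 1" if y: "0 < y" for y
  proof -
    have top: "filterlim (\<lambda>n. (real n + 1) * ((real n + 1) * y - 1)) at_top sequentially"
    proof (rule filterlim_at_top_mult_at_top)
      have r: "filterlim (\<lambda>n. real n + 1) at_top sequentially"
        using filterlim_tendsto_add_at_top[OF tendsto_const filterlim_real_sequentially, of 1]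
        by (simp add: add.commute)
      then show "filterlim (\<lambda>n. real n + 1) at_top sequentially" .
      show "filterlim (\<lambda>n. (real n + 1) * y - 1) at_top sequentially"
        using filterlim_tendsto_add_at_top[OF tendsto_const[of "-1"] filterlim_tendsto_pos_mult_at_top[OF tendsto_const y r]]
        by (simp add: mult.commute)
    qed
    have "(\<lambda>n. exp (- (inverse ((real n + 1) * ((real n + 1) * y - 1))))) \<longlonglongrightarrow> exp (- 0)"
      by (intro tendsto_exp tendsto_minus filterlim_compose[OF tendsto_inverse_0_at_top[OF filterlim_ident] top])
    moreover have "eventually (\<lambda>n. exp (- (inverse ((real n + 1) * ((real n + 1) * y - 1)))) =
        exp_bump 0 ((real n + 1)\<^sup>2 * y - (real n + 1))) sequentially"
      using filterlim_at_top_dense[THEN iffD1, OF top, rule_format, of 0]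
    proof eventually_elim
      case (elim n)
      have "(real n + 1)\<^sup>2 * y - (real n + 1) = (real n + 1) * ((real n + 1) * y - 1)"
        by (simp add: power2_eq_square algebra_simps)
      then show ?case using elim by (simp add: exp_bump_def inverse_eq_divide)
    qed
    ultimately show ?thesis by (auto intro: Lim_transform_eventually)
  qed
  show ?thesis
    using tendsto_mult[OF lim[of "x - u"] lim[of "v - x"]] True by (simp add: bump_def)
next
  case False
  have "bump u v n x = 0" for n
  proof (rule bump_eq_0)
    have "0 < 1 / (real n + 1)" by simp
    with False show "x < u + 1 / (real n + 1) \<or> v - 1 / (real n + 1) < x" by linarith
  qed
  then show ?thesis using False by (auto simp: indicator_def)
qed

lemma test_fun_bump: "0 \<le> u \<Longrightarrow> v \<le> 1 \<Longrightarrow> test_fun (bump u v n)"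
  unfolding test_fun_def
proof (intro conjI allI)
  fix m x show "(deriv ^^ m) (bump u v n) differentiable (at x)"
    by (intro smooth_class_differentiable smooth_class_bump)
next
  assume uv: "0 \<le> u" "v \<le> 1"
  have "0 < 1 / (real n + 1)" by simp
  then have "0 < u + 1 / (real n + 1)" "v - 1 / (real n + 1) < 1" using uv by linarith+
  moreover have "\<forall>x. x \<notin> {u + 1 / (real n + 1)..v - 1 / (real n + 1)} \<longrightarrow> bump u v n x = 0"
    using bump_eq_0 by (auto simp: not_le)
  ultimately show "\<exists>a b. 0 < a \<and> b < 1 \<and> (\<forall>x. x \<notin> {a..b} \<longrightarrow> bump u v n x = 0)" by blast
qed

lemma test_fun_differentiable: "test_fun \<phi> \<Longrightarrow> (\<phi> has_real_derivative deriv \<phi> x) (at x)"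
  unfolding test_fun_def by (metis DERIV_deriv_iff_real_differentiable funpow_0)

lemma test_fun_continuous: "test_fun \<phi> \<Longrightarrow> continuous_on A \<phi>"
  by (intro continuous_at_imp_continuous_on ballI DERIV_isCont[OF test_fun_differentiable])

lemma test_fun_deriv: "test_fun \<phi> \<Longrightarrow> test_fun (deriv \<phi>)"
proof -
  assume t: "test_fun \<phi>"
  then obtain a b where ab: "0 < a" "b < 1" "\<And>x. x \<notin> {a..b} \<Longrightarrow> \<phi> x = 0"
    by (auto simp: test_fun_def)
  have "deriv \<phi> x = 0" if "x \<notin> {a..b}" for x
  proof -
    have "eventually (\<lambda>y. \<phi> y = 0) (nhds x)"
    proof -
      have "eventually (\<lambda>y. y \<in> - {a..b}) (nhds x)"
        using that by (intro eventually_nhds_in_open) auto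
      then show ?thesis by (rule eventually_mono) (use ab(3) in auto)
    qed
    then have "(\<phi> has_real_derivative 0) (at x)"
      by (subst DERIV_cong_ev[OF refl _ refl, of _ "\<lambda>_. 0"]) auto
    then show ?thesis by (rule DERIV_imp_deriv)
  qed
  moreover have "(deriv ^^ n) (deriv \<phi>) differentiable (at x)" for n x
  proof -
    have "(deriv ^^ Suc n) \<phi> differentiable (at x)" using t unfolding test_fun_def by blast
    then show ?thesis by (simp only: funpow_Suc_right comp_apply)
  qed
  ultimately show ?thesis using ab by (auto simp: test_fun_def)
qed

lemma test_fun_0: "test_fun \<phi> \<Longrightarrow> x \<le> 0 \<or> 1 \<le> x \<Longrightarrow> \<phi> x = 0"
  unfolding test_fun_def by (auto simp: not_le)

lemma continuous_imp_borel_mu: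
  fixes f :: "real \<Rightarrow> 'a::{banach, second_countable_topology}"
  assumes "continuous_on {0..1} f"
  shows "f \<in> borel_measurable \<mu>"
  using assms by (intro continuous_imp_measurable_on_sets_lebesgue) auto

lemma continuous_imp_integrable_mu:
  fixes f :: "real \<Rightarrow> 'a::euclidean_space"
  assumes "continuous_on {0..1} f"
  shows "integrable \<mu> f"
  by (rule continuous_imp_integrable_real) (rule assms)

text \<open>The exceptional set \<open>K\<close> accommodates the turning point, where the
  integrands derived from the map have no derivative; continuity of \<open>\<psi>\<close> across
  \<open>K\<close> bridges it.\<close>

lemma FTC_mu:
  fixes \<psi> \<psi>' :: "real \<Rightarrow> real"
  assumes "continuous_on {0..1} \<psi>" "finite K" "\<And>x. x \<in> {0<..<1} - K \<Longrightarrow> (\<psi> has_real_derivative \<psi>' x) (at x)"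
    and i: "integrable \<mu> \<psi>'" and uv: "0 \<le> u" "u \<le> v" "v \<le> 1"
  shows "(\<integral>t. indicator {u..v} t * \<psi>' t \<partial>\<mu>) = \<psi> v - \<psi> u"
proof -
  have "(\<psi>' has_integral \<psi> v - \<psi> u) {u..v}"
  proof (rule fundamental_theorem_of_calculus_interior_strong)
    show "finite K" "u \<le> v" by fact+
    show "continuous_on {u..v} \<psi>" by (rule continuous_on_subset[OF assms(1)]) (use uv in auto)
    fix x assume "x \<in> {u<..<v} - K"
    then show "(\<psi> has_vector_derivative \<psi>' x) (at x)"
      using assms(3)[of x] uv by (simp add: has_real_derivative_iff_has_vector_derivative)
  qed
  moreover have sub: "{u..v} \<subseteq> {0..1}" using uv by auto
  have s: "set_integrable lebesgue {0..1} \<psi>'"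
    using i by (simp add: integrable_restrict_space set_integrable_def)
  have "set_integrable lebesgue {u..v} \<psi>'"
    by (rule set_integrable_subset[OF s _ sub]) simp
  then have "(\<psi>' has_integral (LINT x:{u..v}|lebesgue. \<psi>' x)) {u..v}"
    by (rule has_integral_set_lebesgue)
  ultimately have "(LINT x:{u..v}|lebesgue. \<psi>' x) = \<psi> v - \<psi> u" by (metis has_integral_unique)
  moreover have "(\<integral>t. indicator {u..v} t * \<psi>' t \<partial>\<mu>) = (LINT x:{u..v}|lebesgue. \<psi>' x)"
    using sub by (subst integral_restrict_space)
      (auto simp: set_lebesgue_integral_def indicator_def intro!: Bochner_Integration.integral_cong)
  ultimately show ?thesis by simp
qed

section \<open>Weak derivatives\<close>

text \<open>Dynkin's theorem for the intersection-stable class of open intervals gives the Borel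
  sets. The last case, invariance under null modifications, passes to Lebesgue sets and also absorbs
  the endpoints of [0, 1].\<close>

lemma mu_sets_induct [consumes 1, case_names interval compl union null]:
  assumes A: "A \<in> sets \<mu>"
    and interval: "\<And>u v. 0 \<le> u \<Longrightarrow> u \<le> v \<Longrightarrow> v \<le> 1 \<Longrightarrow> Q {u<..<v}"
    and compl: "\<And>A. A \<in> sets \<mu> \<Longrightarrow> Q A \<Longrightarrow> Q ({0..1} - A)"
    and union: "\<And>A :: nat \<Rightarrow> real set. (\<And>i. A i \<in> sets \<mu>) \<Longrightarrow> disjoint_family A \<Longrightarrow> (\<And>i. Q (A i)) \<Longrightarrow> Q (\<Union>i. A i)"
    and null: "\<And>A B. A \<in> sets \<mu> \<Longrightarrow> B \<in> sets \<mu> \<Longrightarrow> Q A \<Longrightarrow> (AE x in \<mu>. x \<in> A \<longleftrightarrow> x \<in> B) \<Longrightarrow> Q B"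
  shows "Q A"
proof -
  have inmu: "B \<inter> {0..1} \<in> sets \<mu>" if "B \<in> sets borel" for B
    using that by (auto simp: sets_restrict_space_iff)
  have borel: "borel = sigma UNIV (range (\<lambda>(a, b). {a<..<b::real}))"
    using borel_eq_box[where 'a = real] by (simp add: box_real)
  have stable: "Int_stable (range (\<lambda>(a, b). {a<..<b::real}))"
    by (auto simp: Int_stable_def image_iff)
  have sub: "range (\<lambda>(a, b). {a<..<b::real}) \<subseteq> Pow UNIV" by simp
  have bor: "Q (B \<inter> {0..1})" if B: "B \<in> sets borel" for B
  proof -
    have "B \<in> sigma_sets UNIV (range (\<lambda>(a, b). {a<..<b::real}))"
      using B by (subst (asm) borel) (simp add: sets_measure_of)
    with stable sub show ?thesis
    proof (induction rule: sigma_sets_induct_disjoint)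
      case (basic A)
      then obtain a b where ab: "A = {a<..<b}" by auto
      show ?case
      proof (cases "max a 0 \<le> min b 1")
        case True
        have "Q {max a 0<..<min b 1}" using True by (intro interval) auto
        moreover have "AE x in \<mu>. x \<in> {max a 0<..<min b 1} \<longleftrightarrow> x \<in> A \<inter> {0..1}"
        proof -
          have "AE x in \<mu>. x \<noteq> 0 \<and> x \<noteq> 1"
            by (rule AE_I'[of "{0, 1}"])
              (auto simp: null_sets_restrict_space intro!: null_sets_completionI finite_imp_null_set_lborel)
          then show ?thesis by (rule AE_mp) (auto intro!: AE_I2 simp: ab)
        qed
        moreover have "{max a 0<..<min b 1} \<in> sets \<mu>" by (subst sets_restrict_space_iff) auto
        ultimately show ?thesis
          using null[of "{max a 0<..<min b 1}" "A \<inter> {0..1}"] inmu[of A] ab by auto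
      next
        case False
        then have "A \<inter> {0..1} = {}" using ab by auto
        then show ?thesis using interval[of 0 0] by simp
      qed
    next
      case empty
      then show ?case using interval[of 0 0] by simp
    next
      case (compl A)
      have A: "A \<in> sets borel"
        using compl(1) by (subst borel) (simp add: sets_measure_of)
      have "Q ({0..1} - A \<inter> {0..1})" using compl(2) inmu[OF A] by (intro assms(3))
      moreover have "{0..1} - A \<inter> {0..1} = (UNIV - A) \<inter> {0..1}" by auto
      ultimately show ?case by simp
    next
      case (union A)
      have A: "A i \<in> sets borel" for i
        using union(2) by (subst borel) (auto simp: sets_measure_of)
      have "Q (\<Union>i. A i \<inter> {0..1})"
        using union inmu[OF A] by (intro assms(4)) (auto simp: disjoint_family_on_def)
      moreover have "(\<Union>i. A i \<inter> {0..1}) = (\<Union>i. A i) \<inter> {0..1}" by blast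
      ultimately show ?case by simp
    qed
  qed
  have "A \<in> sets lebesgue" using A by (auto simp: sets_restrict_space_iff)
  then obtain S N N' where S: "A = S \<union> N" "N \<subseteq> N'" "N' \<in> null_sets lborel" "S \<in> sets lborel"
    by (rule sets_completionE)
  show ?thesis
  proof (rule null[OF _ A bor[of S]])
    show "S \<in> sets borel" using S(4) by simp
    then show "S \<inter> {0..1} \<in> sets \<mu>" by (rule inmu)
    have "N' \<in> null_sets lebesgue" using S(3) by (rule null_sets_completionI)
    then have "N' \<inter> {0..1} \<in> null_sets \<mu>"
      by (auto simp: null_sets_restrict_space intro: null_set_Int2)
    moreover have "{x \<in> space \<mu>. \<not> (x \<in> S \<inter> {0..1} \<longleftrightarrow> x \<in> A)} \<subseteq> N' \<inter> {0..1}"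
      using S A sets.sets_into_space[OF A] by auto
    ultimately show "AE x in \<mu>. x \<in> S \<inter> {0..1} \<longleftrightarrow> x \<in> A" by (rule AE_I')
  qed
qed

lemma integrable_mu_scaleR_bounded:
  fixes v :: "real \<Rightarrow> 'a::{banach, second_countable_topology}"
  assumes "integrable \<mu> v" "\<xi> \<in> borel_measurable \<mu>" "AE x in \<mu>. \<bar>\<xi> x\<bar> \<le> B"
  shows "integrable \<mu> (\<lambda>x. (\<xi> x :: real) *\<^sub>R v x)"
proof (rule Bochner_Integration.integrable_bound)
  show "integrable \<mu> (\<lambda>x. B * norm (v x))" using assms by auto
  show "AE x in \<mu>. norm (\<xi> x *\<^sub>R v x) \<le> norm (B * norm (v x))"
    using assms(3)
    by eventually_elim (auto simp: abs_mult intro!: mult_right_mono)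
qed (use assms in auto)

lemma bump_borel [measurable]: "bump u v n \<in> borel_measurable borel"
proof -
  have "continuous_on UNIV (bump u v n)"
    using smooth_class_deriv[OF smooth_class_bump[of u v n]]
    by (metis DERIV_isCont continuous_at_imp_continuous_on)
  then show ?thesis by (rule borel_measurable_continuous_onI)
qed

lemma test_fun_borel: "test_fun \<phi> \<Longrightarrow> \<phi> \<in> borel_measurable \<mu>"
  by (intro continuous_imp_borel_mu test_fun_continuous)

lemma bump_mu [measurable]: "bump u v n \<in> borel_measurable \<mu>"
  using bump_borel by (simp add: measurable_completion measurable_restrict_space1)

lemma bump_integral_tendsto:
  fixes f :: "real \<Rightarrow> 'a::{banach, second_countable_topology}"
  assumes "integrable \<mu> f"
  shows "(\<lambda>n. \<integral>x. bump u v n x *\<^sub>R f x \<partial>\<mu>) \<longlonglongrightarrow> (\<integral>x. indicator {u<..<v} x *\<^sub>R f x \<partial>\<mu>)"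
proof (rule integral_dominated_convergence[where w = "\<lambda>x. norm (f x)"])
  show "AE x in \<mu>. (\<lambda>n. bump u v n x *\<^sub>R f x) \<longlonglongrightarrow> indicator {u<..<v} x *\<^sub>R f x"
    by (intro AE_I2 tendsto_scaleR tendsto_const bump_tendsto)
  show "AE x in \<mu>. norm (bump u v n x *\<^sub>R f x) \<le> norm (f x)" for n
    using bump_bounds[of u v n] by (auto intro!: AE_I2 mult_left_le_one_le)
  have [measurable]: "{u<..<v} \<inter> {0..1} \<in> sets \<mu>" by (auto simp: sets_restrict_space_iff)
  have "(indicator {u<..<v} :: real \<Rightarrow> real) \<in> borel_measurable \<mu>"
    by (subst borel_measurable_indicator_iff) simp
  then show "(\<lambda>x. indicator {u<..<v} x *\<^sub>R f x) \<in> borel_measurable \<mu>" using assms by auto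
qed (use assms in auto)

text \<open>The fundamental lemma of the calculus of variations, tested on bumps only. Restricting
  the test class matters in the du Bois-Reymond argument, where the identity is known only for
  members of \<open>smooth_class\<close>.\<close>

lemma bump_integral_zero_imp_set_integral_zero:
  fixes v :: "real \<Rightarrow> 'a::{banach, second_countable_topology}"
  assumes v: "integrable \<mu> v"
    and z: "\<And>a b n. 0 \<le> a \<Longrightarrow> b \<le> 1 \<Longrightarrow> (\<integral>x. bump a b n x *\<^sub>R v x \<partial>\<mu>) = 0"
    and A: "A \<in> sets \<mu>"
  shows "set_lebesgue_integral \<mu> A v = 0"
  using A
proof (induction rule: mu_sets_induct)
  case (interval a b)
  have "(\<lambda>n. \<integral>x. bump a b n x *\<^sub>R v x \<partial>\<mu>) \<longlonglongrightarrow> (\<integral>x. indicator {a<..<b} x *\<^sub>R v x \<partial>\<mu>)"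
    by (rule bump_integral_tendsto[OF v])
  moreover have "(\<integral>x. bump a b n x *\<^sub>R v x \<partial>\<mu>) = 0" for n
    using interval by (intro z) auto
  ultimately show ?case by (simp add: set_lebesgue_integral_def LIMSEQ_const_iff)
next
  case (compl A)
  have "(\<lambda>n. \<integral>x. bump 0 1 n x *\<^sub>R v x \<partial>\<mu>) \<longlonglongrightarrow> (\<integral>x. indicator {0<..<1} x *\<^sub>R v x \<partial>\<mu>)"
    by (rule bump_integral_tendsto[OF v])
  moreover have "(\<integral>x. bump 0 1 n x *\<^sub>R v x \<partial>\<mu>) = 0" for n
    by (intro z) auto
  moreover have "(\<integral>x. indicator {0<..<1} x *\<^sub>R v x \<partial>\<mu>) = (\<integral>x. v x \<partial>\<mu>)"
  proof (rule integral_cong_AE)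
    have "AE x in \<mu>. x \<noteq> 0 \<and> x \<noteq> 1"
      by (rule AE_I'[of "{0, 1}"])
        (auto simp: null_sets_restrict_space intro!: null_sets_completionI finite_imp_null_set_lborel)
    then show "AE x in \<mu>. indicator {0<..<1} x *\<^sub>R v x = v x"
      by (rule AE_mp) (auto intro!: AE_I2 simp: indicator_def)
    have "(indicator {0<..<1} :: real \<Rightarrow> real) \<in> borel_measurable \<mu>"
      by (subst borel_measurable_indicator_iff) (auto simp: sets_restrict_space_iff)
    then show "(\<lambda>x. indicator {0<..<1} x *\<^sub>R v x) \<in> borel_measurable \<mu>" using v by auto
  qed (use v in auto)
  ultimately have "(\<integral>x. v x \<partial>\<mu>) = 0" by (simp add: LIMSEQ_const_iff)
  moreover have "(\<integral>x. v x \<partial>\<mu>) = (\<integral>x. indicator A x *\<^sub>R v x + indicator ({0..1} - A) x *\<^sub>R v x \<partial>\<mu>)"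
    by (intro Bochner_Integration.integral_cong) (auto simp: indicator_def)
  moreover have "\<dots> = (\<integral>x. indicator A x *\<^sub>R v x \<partial>\<mu>) + (\<integral>x. indicator ({0..1} - A) x *\<^sub>R v x \<partial>\<mu>)"
    using compl v sets.compl_sets[OF compl(1)]
    by (intro Bochner_Integration.integral_add integrable_mult_indicator) auto
  ultimately show ?case using compl(2) by (simp add: set_lebesgue_integral_def)
next
  case (union A)
  have "(\<Union>i. A i) \<in> sets \<mu>" using union(1) by blast
  then have "set_integrable \<mu> (\<Union>i. A i) v"
    unfolding set_integrable_def using v by (intro integrable_mult_indicator)
  then have "set_lebesgue_integral \<mu> (\<Union>i. A i) v = (\<Sum>i. set_lebesgue_integral \<mu> (A i) v)"
    using union by (intro lebesgue_integral_countable_add) (auto simp: disjoint_family_on_def)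
  then show ?case using union by simp
next
  case (null A B)
  have "set_lebesgue_integral \<mu> B v = set_lebesgue_integral \<mu> A v"
    unfolding set_lebesgue_integral_def
  proof (rule integral_cong_AE)
    show "AE x in \<mu>. indicator B x *\<^sub>R v x = indicator A x *\<^sub>R v x"
      using \<open>AE x in \<mu>. x \<in> A \<longleftrightarrow> x \<in> B\<close> by (rule AE_mp) (auto intro!: AE_I2 simp: indicator_def)
  qed (use null v in auto)
  then show ?case using \<open>set_lebesgue_integral \<mu> A v = 0\<close> by simp
qed

lemma test_fun_integral_zero_imp_AE_zero:
  fixes v :: "real \<Rightarrow> 'a::{banach, second_countable_topology}"
  assumes v: "integrable \<mu> v" and z: "\<And>\<xi>. test_fun \<xi> \<Longrightarrow> (\<integral>x. \<xi> x *\<^sub>R v x \<partial>\<mu>) = 0"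
  shows "AE x in \<mu>. v x = 0"
  by (rule mu.density_zero[OF v] bump_integral_zero_imp_set_integral_zero[OF v] z test_fun_bump)+

section \<open>Primitives of integrable functions, integration by parts and the du Bois-Reymond
  lemma\<close>

definition prim :: "(real \<Rightarrow> 'a::{real_normed_field, banach, second_countable_topology}) \<Rightarrow> real \<Rightarrow> 'a" where
  "prim g x = (\<integral>t. indicator {0..x} t *\<^sub>R g t \<partial>\<mu>)"

lemma indicator_Icc_mu [measurable]: "(indicator {u..v::real} :: real \<Rightarrow> real) \<in> borel_measurable \<mu>"
  by (subst borel_measurable_indicator_iff) (auto simp: sets_restrict_space_iff)

text \<open>Exchange of the order of integration over the triangle 0 <= t <= x <= 1. It is the
  source of integration by parts for merely integrable g.\<close>

lemma prim_Fubini: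
  fixes g :: "real \<Rightarrow> 'a::{real_normed_field, banach, second_countable_topology}"
  assumes u: "integrable \<mu> u" and g: "integrable \<mu> g"
  shows "integrable \<mu> (\<lambda>x. (u x :: real) *\<^sub>R prim g x)"
    and "(\<integral>x. u x *\<^sub>R prim g x \<partial>\<mu>) = (\<integral>t. (\<integral>x. indicator {t..1} x * u x \<partial>\<mu>) *\<^sub>R g t \<partial>\<mu>)"
proof -
  interpret pair_sigma_finite \<mu> \<mu> by standard
  have um [measurable]: "u \<in> borel_measurable \<mu>" and gm [measurable]: "g \<in> borel_measurable \<mu>"
    using u g by auto
  let ?f = "\<lambda>x t. (indicator {t. 0 \<le> t \<and> t \<le> x} t * u x) *\<^sub>R g t"
  have id [measurable]: "(\<lambda>x. x) \<in> borel_measurable \<mu>"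
    by (rule measurable_restrict_space1) (simp add: measurable_completion)
  have fm [measurable]: "(\<lambda>(x, t). ?f x t) \<in> borel_measurable (\<mu> \<Otimes>\<^sub>M \<mu>)"
  proof -
    have [measurable]: "fst \<in> borel_measurable (\<mu> \<Otimes>\<^sub>M \<mu>)" "snd \<in> borel_measurable (\<mu> \<Otimes>\<^sub>M \<mu>)"
      using measurable_comp[OF measurable_fst id] measurable_comp[OF measurable_snd id] by (auto simp: comp_def)
    have "(\<lambda>z. (indicator {z \<in> space (\<mu> \<Otimes>\<^sub>M \<mu>). 0 \<le> snd z \<and> snd z \<le> fst z} z * u (fst z)) *\<^sub>R g (snd z)) \<in> borel_measurable (\<mu> \<Otimes>\<^sub>M \<mu>)"
      by measurable
    then show ?thesis
      by (rule measurable_cong[THEN iffD1, rotated]) (auto simp: indicator_def space_pair_measure)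
  qed
  have int: "integrable (\<mu> \<Otimes>\<^sub>M \<mu>) (\<lambda>(x, t). ?f x t)"
  proof (rule Fubini_integrable[OF fm])
    have le: "(\<integral>t. norm (?f x t) \<partial>\<mu>) \<le> \<bar>u x\<bar> * (\<integral>t. norm (g t) \<partial>\<mu>)" for x
    proof -
      have "(\<integral>t. norm (?f x t) \<partial>\<mu>) \<le> (\<integral>t. \<bar>u x\<bar> * norm (g t) \<partial>\<mu>)"
        using g by (intro integral_mono') (auto simp: indicator_def)
      then show ?thesis by simp
    qed
    show "integrable \<mu> (\<lambda>x. \<integral>t. norm (case (x, t) of (x, t) \<Rightarrow> ?f x t) \<partial>\<mu>)"
    proof (rule Bochner_Integration.integrable_bound)
      show "integrable \<mu> (\<lambda>x. \<bar>u x\<bar> * (\<integral>t. norm (g t) \<partial>\<mu>))" using u by auto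
      show "(\<lambda>x. \<integral>t. norm (case (x, t) of (x, t) \<Rightarrow> ?f x t) \<partial>\<mu>) \<in> borel_measurable \<mu>"
        using fm by (intro mu.borel_measurable_lebesgue_integral) (auto simp: split_def)
    qed (use le in \<open>auto intro!: AE_I2 intro: order_trans[OF _ abs_ge_self]\<close>)
    show "AE x in \<mu>. integrable \<mu> (\<lambda>t. case (x, t) of (x, t) \<Rightarrow> ?f x t)"
    proof (rule AE_I2)
      fix x
      have "integrable \<mu> (\<lambda>t. indicator {0..x} t *\<^sub>R (u x *\<^sub>R g t))"
        using integrable_scaleR_right[OF g, of "u x"]
        by (rule integrable_mu_scaleR_bounded[where B = 1]) (auto simp: indicator_def)
      then show "integrable \<mu> (\<lambda>t. case (x, t) of (x, t) \<Rightarrow> ?f x t)"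
        by (rule Bochner_Integration.integrable_cong[THEN iffD1, rotated 2]) (auto simp: indicator_def)
    qed
  qed
  have eq1: "(\<integral>t. ?f x t \<partial>\<mu>) = u x *\<^sub>R prim g x" for x
  proof -
    have "(\<integral>t. ?f x t \<partial>\<mu>) = (\<integral>t. u x *\<^sub>R (indicator {0..x} t *\<^sub>R g t) \<partial>\<mu>)"
      by (intro Bochner_Integration.integral_cong) (auto simp: indicator_def)
    also have "\<dots> = u x *\<^sub>R (\<integral>t. indicator {0..x} t *\<^sub>R g t \<partial>\<mu>)"
      by (rule Bochner_Integration.integral_scaleR_right)
    finally show ?thesis by (simp add: prim_def)
  qed
  have eq2: "(\<integral>x. ?f x t \<partial>\<mu>) = (\<integral>x. indicator {t..1} x * u x \<partial>\<mu>) *\<^sub>R g t" if "t \<in> space \<mu>" for t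
  proof (cases "g t = 0")
    case False
    have "integrable \<mu> (\<lambda>x. indicator {t..1} x *\<^sub>R u x)"
      using u by (intro integrable_mu_scaleR_bounded[where B = 1]) (auto simp: indicator_def)
    then have "(\<integral>x. (indicator {t..1} x * u x) *\<^sub>R g t \<partial>\<mu>) = (\<integral>x. indicator {t..1} x * u x \<partial>\<mu>) *\<^sub>R g t"
      by (intro integral_scaleR_left) auto
    moreover have "(\<integral>x. ?f x t \<partial>\<mu>) = (\<integral>x. (indicator {t..1} x * u x) *\<^sub>R g t \<partial>\<mu>)"
      using that by (intro Bochner_Integration.integral_cong) (auto simp: indicator_def)
    ultimately show ?thesis by simp
  qed simp
  show "integrable \<mu> (\<lambda>x. u x *\<^sub>R prim g x)"
    using integrable_fst'[OF int] by (simp add: eq1)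
  have "(\<integral>x. u x *\<^sub>R prim g x \<partial>\<mu>) = (\<integral>x. \<integral>t. ?f x t \<partial>\<mu> \<partial>\<mu>)" by (simp add: eq1)
  also have "\<dots> = (\<integral>t. \<integral>x. ?f x t \<partial>\<mu> \<partial>\<mu>)" using Fubini_integral[OF int] by simp
  also have "\<dots> = (\<integral>t. (\<integral>x. indicator {t..1} x * u x \<partial>\<mu>) *\<^sub>R g t \<partial>\<mu>)"
    by (intro Bochner_Integration.integral_cong refl eq2)
  finally show "(\<integral>x. u x *\<^sub>R prim g x \<partial>\<mu>) = (\<integral>t. (\<integral>x. indicator {t..1} x * u x \<partial>\<mu>) *\<^sub>R g t \<partial>\<mu>)" .
qed

lemma prim_integrable:
  fixes g :: "real \<Rightarrow> 'a::{real_normed_field, banach, second_countable_topology}"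
  assumes "integrable \<mu> g" shows "integrable \<mu> (prim g)"
  using prim_Fubini(1)[of "\<lambda>x. 1", OF _ assms] by simp

lemma prim_parts:
  fixes g :: "real \<Rightarrow> 'a::{real_normed_field, banach, second_countable_topology}"
  assumes g: "integrable \<mu> g"
    and \<psi>: "continuous_on {0..1} \<psi>" "finite K" "\<And>x. x \<in> {0<..<1} - K \<Longrightarrow> (\<psi> has_real_derivative \<psi>' x) (at x)"
      "integrable \<mu> \<psi>'" "\<psi> 0 = 0" "\<psi> 1 = 0"
  shows "(\<integral>x. \<psi>' x *\<^sub>R (C + prim g x) \<partial>\<mu>) = - (\<integral>x. \<psi> x *\<^sub>R g x \<partial>\<mu>)"
proof -
  have "(\<integral>x. \<psi>' x *\<^sub>R (C + prim g x) \<partial>\<mu>) = (\<integral>x. \<psi>' x *\<^sub>R C \<partial>\<mu>) + (\<integral>x. \<psi>' x *\<^sub>R prim g x \<partial>\<mu>)"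
    unfolding scaleR_add_right
    using \<psi>(4) by (intro Bochner_Integration.integral_add prim_Fubini(1) g) auto
  also have "(\<integral>x. \<psi>' x *\<^sub>R C \<partial>\<mu>) = (\<integral>x. \<psi>' x \<partial>\<mu>) *\<^sub>R C"
    using \<psi>(4) by (intro integral_scaleR_left) auto
  also have "(\<integral>x. \<psi>' x \<partial>\<mu>) = (\<integral>x. indicator {0..1} x * \<psi>' x \<partial>\<mu>)"
    by (intro Bochner_Integration.integral_cong) auto
  also have "\<dots> = 0" using FTC_mu[OF \<psi>(1-4), of 0 1] \<psi>(5,6) by simp
  also have "(\<integral>x. \<psi>' x *\<^sub>R prim g x \<partial>\<mu>) = (\<integral>t. (\<integral>x. indicator {t..1} x * \<psi>' x \<partial>\<mu>) *\<^sub>R g t \<partial>\<mu>)"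
    by (rule prim_Fubini(2)[OF \<psi>(4) g])
  also have "\<dots> = (\<integral>t. - (\<psi> t *\<^sub>R g t) \<partial>\<mu>)"
  proof (intro Bochner_Integration.integral_cong refl)
    fix t assume "t \<in> space \<mu>"
    then have "(\<integral>x. indicator {t..1} x * \<psi>' x \<partial>\<mu>) = - \<psi> t"
      using FTC_mu[OF \<psi>(1-4), of t 1] \<psi>(6) by simp
    then show "(\<integral>x. indicator {t..1} x * \<psi>' x \<partial>\<mu>) *\<^sub>R g t = - (\<psi> t *\<^sub>R g t)" by simp
  qed
  finally show ?thesis by simp
qed

lemma weak_derivD:
  assumes "weak_deriv f g"
  shows "integrable \<mu> f" "integrable \<mu> g"
    "test_fun \<phi> \<Longrightarrow> (\<integral>x. deriv \<phi> x *\<^sub>R f x \<partial>\<mu>) = - (\<integral>x. \<phi> x *\<^sub>R g x \<partial>\<mu>)"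
  using assms by (auto simp: weak_deriv_def)

lemma test_fun_bounded: "test_fun \<phi> \<Longrightarrow> \<exists>B. \<forall>x. \<bar>\<phi> x\<bar> \<le> B"
proof -
  assume t: "test_fun \<phi>"
  have "compact (\<phi> ` {0..1})" by (intro compact_continuous_image test_fun_continuous t compact_Icc)
  then obtain B where B: "\<And>x. x \<in> {0..1} \<Longrightarrow> \<bar>\<phi> x\<bar> \<le> B"
    by (metis bounded_iff compact_imp_bounded image_eqI real_norm_def)
  have "\<bar>\<phi> x\<bar> \<le> max B 0" for x
    using B[of x] test_fun_0[OF t, of x] by (cases "x \<in> {0..1}") auto
  then show ?thesis by blast
qed

lemma test_fun_scaleR_integrable:
  fixes v :: "real \<Rightarrow> 'a::{banach, second_countable_topology}"
  assumes "test_fun \<phi>" "integrable \<mu> v"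
  shows "integrable \<mu> (\<lambda>x. \<phi> x *\<^sub>R v x)"
  using test_fun_bounded[OF assms(1)] integrable_mu_scaleR_bounded[OF assms(2) test_fun_borel[OF assms(1)]]
  by auto

lemma weak_deriv_ae_cong:
  fixes f f' g g' :: "real \<Rightarrow> 'a::{real_normed_field, banach, second_countable_topology}"
  assumes "weak_deriv f g" "ae_eq f f'" "ae_eq g g'"
  shows "weak_deriv f' g'"
  unfolding weak_deriv_def
proof (intro conjI allI impI)
  show f': "integrable \<mu> f'" and g': "integrable \<mu> g'"
    using assms integrable_ae_eq weak_derivD(1,2) by blast+
  fix \<phi> assume t: "test_fun \<phi>"
  have "(\<integral>x. deriv \<phi> x *\<^sub>R f' x \<partial>\<mu>) = (\<integral>x. deriv \<phi> x *\<^sub>R f x \<partial>\<mu>)"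
    using assms(2) unfolding ae_eq_def
    by (intro integral_cong_AE borel_measurable_integrable[OF test_fun_scaleR_integrable] test_fun_deriv t
        f' weak_derivD(1)[OF assms(1)]) (auto elim: eventually_mono)
  also have "\<dots> = - (\<integral>x. \<phi> x *\<^sub>R g x \<partial>\<mu>)" by (rule weak_derivD(3)[OF assms(1) t])
  also have "(\<integral>x. \<phi> x *\<^sub>R g x \<partial>\<mu>) = (\<integral>x. \<phi> x *\<^sub>R g' x \<partial>\<mu>)"
    using assms(3) unfolding ae_eq_def
    by (intro integral_cong_AE borel_measurable_integrable[OF test_fun_scaleR_integrable] t
        g' weak_derivD(2)[OF assms(1)]) (auto elim: eventually_mono)
  finally show "(\<integral>x. deriv \<phi> x *\<^sub>R f' x \<partial>\<mu>) = - (\<integral>x. \<phi> x *\<^sub>R g' x \<partial>\<mu>)" .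
qed

lemma weak_deriv_unique:
  fixes f g :: "real \<Rightarrow> 'a::{real_normed_field, banach, second_countable_topology}"
  assumes "weak_deriv f g" "weak_deriv f h"
  shows "ae_eq g h"
proof -
  have "AE x in \<mu>. g x - h x = 0"
  proof (rule test_fun_integral_zero_imp_AE_zero)
    show "integrable \<mu> (\<lambda>x. g x - h x)" using assms weak_derivD(2) by blast
    fix \<phi> assume t: "test_fun \<phi>"
    have "(\<integral>x. \<phi> x *\<^sub>R (g x - h x) \<partial>\<mu>) = (\<integral>x. \<phi> x *\<^sub>R g x \<partial>\<mu>) - (\<integral>x. \<phi> x *\<^sub>R h x \<partial>\<mu>)"
      unfolding scaleR_diff_right using assms t
      by (intro Bochner_Integration.integral_diff test_fun_scaleR_integrable) (auto dest: weak_derivD)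
    then show "(\<integral>x. \<phi> x *\<^sub>R (g x - h x) \<partial>\<mu>) = 0"
      using weak_derivD(3)[OF assms(1) t] weak_derivD(3)[OF assms(2) t] by simp
  qed
  then show ?thesis by (simp add: ae_eq_def)
qed

lemma test_fun_add_scaled:
  assumes "smooth_class f" "test_fun f" "smooth_class g" "test_fun g"
  shows "smooth_class (\<lambda>x. f x + k * g x)" "test_fun (\<lambda>x. f x + k * g x)"
proof -
  show s: "smooth_class (\<lambda>x. f x + k * g x)"
    using assms by (intro smooth_class.intros) auto
  from assms obtain a b a' b' where
    "0 < a" "b < 1" "\<And>x. x \<notin> {a..b} \<Longrightarrow> f x = 0" "0 < a'" "b' < 1" "\<And>x. x \<notin> {a'..b'} \<Longrightarrow> g x = 0"
    by (auto simp: test_fun_def)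
  moreover from this have "f x = 0 \<and> g x = 0" if "x \<notin> {min a a'..max b b'}" for x
    using that by (simp add: not_le) blast
  ultimately have "0 < min a a'" "max b b' < 1" "\<And>x. x \<notin> {min a a'..max b b'} \<Longrightarrow> f x + k * g x = 0"
    by auto
  then show "test_fun (\<lambda>x. f x + k * g x)"
    unfolding test_fun_def using smooth_class_differentiable[OF s] by blast
qed

text \<open>The vanishing integral is what makes the primitive return to 0 to the right of the
  support, so that it is again a test function.\<close>

lemma test_fun_primitive:
  assumes \<theta>: "smooth_class \<theta>" "test_fun \<theta>" "(\<integral>x. \<theta> x \<partial>\<mu>) = 0"
  obtains \<phi> where "test_fun \<phi>" "deriv \<phi> = \<theta>"
proof -
  obtain a b where ab: "0 < a" "b < 1" "\<And>x. x \<notin> {a..b} \<Longrightarrow> \<theta> x = 0"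
    using \<theta>(2) by (auto simp: test_fun_def)
  have c: "continuous_on A \<theta>" for A by (rule test_fun_continuous[OF \<theta>(2)])
  have i: "\<theta> integrable_on {u..v}" for u v by (rule integrable_continuous_real[OF c])
  \<comment> \<open>The base point -1 lies to the left of the support; for x < -1 the integral is
    over an empty interval, so \<phi> vanishes everywhere below a.\<close>
  define \<phi> where "\<phi> x = integral {-1..x} \<theta>" for x
  have neg: "\<phi> x = 0" if "x < a" for x
  proof -
    have "integral {-1..x} \<theta> = integral {-1..x} (\<lambda>x. 0)"
      using that ab(3) by (intro Henstock_Kurzweil_Integration.integral_cong) auto
    then show ?thesis by (simp add: \<phi>_def)
  qed
  have "integral {0..1} \<theta> = (\<integral>x. \<theta> x \<partial>\<mu>)"
    using lebesgue_integral_eq_integral[OF continuous_imp_integrable_mu[OF c]] by simp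
  with \<theta>(3) have z: "integral {0..1} \<theta> = 0" by simp
  have pos: "\<phi> x = 0" if "b < x" for x
  proof (cases "x < a")
    case False
    have t0: "integral S \<theta> = 0" if "\<And>x. x \<in> S \<Longrightarrow> x < a \<or> b < x" for S
    proof -
      have "integral S \<theta> = integral S (\<lambda>x. 0)"
        using that ab(3) by (intro Henstock_Kurzweil_Integration.integral_cong) fastforce
      then show ?thesis by simp
    qed
    have m: "\<phi> (max x 1) = \<phi> x"
    proof -
      have "\<phi> x + integral {x..max x 1} \<theta> = \<phi> (max x 1)"
        unfolding \<phi>_def using False ab i by (intro Henstock_Kurzweil_Integration.integral_combine) auto
      then show ?thesis using t0[of "{x..max x 1}"] that by auto
    qed
    have "integral {-1..0} \<theta> + integral {0..max x 1} \<theta> = \<phi> (max x 1)"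
      unfolding \<phi>_def using False ab i by (intro Henstock_Kurzweil_Integration.integral_combine) auto
    moreover have "integral {0..1} \<theta> + integral {1..max x 1} \<theta> = integral {0..max x 1} \<theta>"
      using i by (intro Henstock_Kurzweil_Integration.integral_combine) auto
    ultimately show ?thesis
      using m z t0[of "{-1..0}"] t0[of "{1..max x 1}"] ab by auto
  qed (rule neg)
  have d: "(\<phi> has_real_derivative \<theta> x) (at x)" for x
  proof (cases "x < a")
    case True
    have "eventually (\<lambda>y. y \<in> {..<a}) (nhds x)"
      using True by (intro eventually_nhds_in_open) auto
    then have e: "eventually (\<lambda>y. \<phi> y = 0) (nhds x)" by (rule eventually_mono) (use neg in auto)
    have "\<theta> x = 0" using True ab by auto
    then show ?thesis by (subst DERIV_cong_ev[OF refl e refl]) simp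
  next
    case False
    have "(\<phi> has_vector_derivative \<theta> x) (at x within {-1..x+1})"
      unfolding \<phi>_def using False ab by (intro integral_has_vector_derivative c) auto
    then show ?thesis
      using False ab at_within_Icc_at[of "-1" x "x+1"]
      by (simp add: has_real_derivative_iff_has_vector_derivative)
  qed
  then have dd: "deriv \<phi> = \<theta>" by (auto intro: DERIV_imp_deriv)
  have "(deriv ^^ n) \<phi> differentiable (at x)" for n x
  proof (cases n)
    case 0 then show ?thesis using d real_differentiable_def by auto
  next
    case (Suc m)
    have "(deriv ^^ n) \<phi> = (deriv ^^ m) \<theta>"
      unfolding Suc funpow_Suc_right comp_apply dd ..
    then show ?thesis using smooth_class_differentiable[OF \<theta>(1)] by simp
  qed
  moreover have "\<phi> x = 0" if "x \<notin> {a..b}" for x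
    using that neg pos by (auto simp: not_le)
  ultimately have "test_fun \<phi>" using ab by (auto simp: test_fun_def)
  then show ?thesis using dd that by blast
qed

text \<open>The function u = f - \<open>prim g\<close> annihilates derivatives of test functions.
  Subtracting from a test function the right multiple of one fixed bump makes it mean-zero, hence a
  derivative; so u acts on test functions like the constant C.\<close>

lemma du_Bois_Reymond:
  fixes f g :: "real \<Rightarrow> 'a::{real_normed_field, banach, second_countable_topology}"
  assumes "weak_deriv f g"
  obtains C where "ae_eq f (\<lambda>x. C + prim g x)"
proof -
  have gi: "integrable \<mu> g" and fi: "integrable \<mu> f" using assms by (auto dest: weak_derivD)
  define u where "u x = f x - prim g x" for x
  have ui: "integrable \<mu> u" unfolding u_def using fi prim_integrable[OF gi] by auto
  have u0: "(\<integral>x. deriv \<phi> x *\<^sub>R u x \<partial>\<mu>) = 0" if t: "test_fun \<phi>" for \<phi>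
  proof -
    have t': "test_fun (deriv \<phi>)" by (rule test_fun_deriv[OF t])
    have "(\<integral>x. deriv \<phi> x *\<^sub>R u x \<partial>\<mu>) = (\<integral>x. deriv \<phi> x *\<^sub>R f x \<partial>\<mu>) - (\<integral>x. deriv \<phi> x *\<^sub>R prim g x \<partial>\<mu>)"
      unfolding u_def scaleR_diff_right
      by (intro Bochner_Integration.integral_diff test_fun_scaleR_integrable t' fi prim_integrable gi)
    also have "(\<integral>x. deriv \<phi> x *\<^sub>R prim g x \<partial>\<mu>) = - (\<integral>x. \<phi> x *\<^sub>R g x \<partial>\<mu>)"
      using prim_parts[OF gi test_fun_continuous[OF t], of "{}" "deriv \<phi>" 0] test_fun_differentiable[OF t]
        continuous_imp_integrable_mu[OF test_fun_continuous[OF t']] test_fun_0[OF t] by simp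
    finally show ?thesis using weak_derivD(3)[OF assms t] by simp
  qed
  \<comment> \<open>Index 4 makes the bump positive on (1/5, 4/5), which contains [1/4, 3/4]; hence
    its integral cannot vanish.\<close>
  let ?\<omega> = "bump 0 1 4"
  have \<omega>s: "smooth_class ?\<omega>" and \<omega>t: "test_fun ?\<omega>" by (auto intro: smooth_class_bump test_fun_bump)
  define K where "K = (\<integral>x. ?\<omega> x \<partial>\<mu>)"
  have "K \<noteq> 0"
  proof
    assume "K = 0"
    moreover have "integrable \<mu> ?\<omega>" by (intro continuous_imp_integrable_mu test_fun_continuous \<omega>t)
    ultimately have "AE x in \<mu>. ?\<omega> x = 0"
      unfolding K_def by (subst (asm) integral_nonneg_eq_0_iff_AE) (auto simp: bump_bounds)
    then have "AE x in \<mu>. x \<notin> {1/4..3/4}"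
      by eventually_elim (auto simp: bump_def exp_bump_def split: if_splits)
    then have "emeasure \<mu> {1/4..3/4} = 0"
      by (subst (asm) AE_iff_measurable[where N = "{1/4..3/4}"]) (auto simp: sets_restrict_space_iff)
    moreover have "emeasure \<mu> {1/4..3/4::real} = ennreal (1/2)"
      by (subst emeasure_restrict_space) auto
    ultimately show False by simp
  qed
  define C where "C = (1 / K) *\<^sub>R (\<integral>x. ?\<omega> x *\<^sub>R u x \<partial>\<mu>)"
  have key: "(\<integral>x. \<xi> x *\<^sub>R u x \<partial>\<mu>) = (\<integral>x. \<xi> x \<partial>\<mu>) *\<^sub>R C" if s: "smooth_class \<xi>" and t: "test_fun \<xi>" for \<xi>
  proof -
    define k where "k = - (\<integral>x. \<xi> x \<partial>\<mu>) / K"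
    have ii: "integrable \<mu> \<xi>" "integrable \<mu> ?\<omega>"
      using t \<omega>t by (auto intro: continuous_imp_integrable_mu test_fun_continuous)
    have "(\<integral>x. \<xi> x + k * ?\<omega> x \<partial>\<mu>) = 0"
      using ii \<open>K \<noteq> 0\<close> by (simp add: k_def K_def)
    then obtain \<phi> where "test_fun \<phi>" "deriv \<phi> = (\<lambda>x. \<xi> x + k * ?\<omega> x)"
      using test_fun_primitive[OF test_fun_add_scaled[OF s t \<omega>s \<omega>t]] by blast
    then have "(\<integral>x. (\<xi> x + k * ?\<omega> x) *\<^sub>R u x \<partial>\<mu>) = 0" using u0[of \<phi>] by simp
    moreover have "(\<integral>x. (\<xi> x + k * ?\<omega> x) *\<^sub>R u x \<partial>\<mu>) = (\<integral>x. \<xi> x *\<^sub>R u x \<partial>\<mu>) + k *\<^sub>R (\<integral>x. ?\<omega> x *\<^sub>R u x \<partial>\<mu>)"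
      using test_fun_scaleR_integrable[OF t ui] test_fun_scaleR_integrable[OF \<omega>t ui]
      by (simp add: scaleR_add_left flip: scaleR_scaleR)
    ultimately show ?thesis by (simp add: k_def C_def)
  qed
  have ind: "(indicator {a<..<b} :: real \<Rightarrow> real) \<in> borel_measurable \<mu>" for a b
    by (subst borel_measurable_indicator_iff) (auto simp: sets_restrict_space_iff)
  have uC: "AE x in \<mu>. u x - C = 0"
  proof (rule mu.density_zero)
    show ii: "integrable \<mu> (\<lambda>x. u x - C)" using ui by auto
    fix A assume "A \<in> sets \<mu>"
    have "(\<integral>x. bump a b n x *\<^sub>R (u x - C) \<partial>\<mu>) = 0" if "0 \<le> a" "b \<le> 1" for a b n
    proof -
      have t: "test_fun (bump a b n)" using that by (rule test_fun_bump)
      have "(\<integral>x. bump a b n x *\<^sub>R (u x - C) \<partial>\<mu>) = (\<integral>x. bump a b n x *\<^sub>R u x \<partial>\<mu>) - (\<integral>x. bump a b n x *\<^sub>R C \<partial>\<mu>)"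
        unfolding scaleR_diff_right
        by (intro Bochner_Integration.integral_diff test_fun_scaleR_integrable t ui) auto
      also have "(\<integral>x. bump a b n x *\<^sub>R C \<partial>\<mu>) = (\<integral>x. bump a b n x \<partial>\<mu>) *\<^sub>R C"
        using t by (intro integral_scaleR_left continuous_imp_integrable_mu test_fun_continuous)
      finally show ?thesis using key[OF smooth_class_bump t] by simp
    qed
    then show "set_lebesgue_integral \<mu> A (\<lambda>x. u x - C) = 0"
      using \<open>A \<in> sets \<mu>\<close> bump_integral_zero_imp_set_integral_zero[OF ii] by blast
  qed
  then have "ae_eq f (\<lambda>x. C + prim g x)"
    unfolding ae_eq_def u_def by eventually_elim (simp add: algebra_simps)
  then show ?thesis by (rule that)
qed

text \<open>Enlarges the class of multipliers in the definition of the weak derivative: continuity,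
  a derivative off a finite set and vanishing at the ends suffice, because f is a.e. an explicit
  primitive.\<close>

lemma weak_deriv_parts:
  fixes f g :: "real \<Rightarrow> 'a::{real_normed_field, banach, second_countable_topology}"
  assumes w: "weak_deriv f g"
    and \<psi>: "continuous_on {0..1} \<psi>" "finite K" "\<And>x. x \<in> {0<..<1} - K \<Longrightarrow> (\<psi> has_real_derivative \<psi>' x) (at x)"
      "integrable \<mu> \<psi>'" "\<psi> 0 = 0" "\<psi> 1 = 0"
  shows "(\<integral>x. \<psi>' x *\<^sub>R f x \<partial>\<mu>) = - (\<integral>x. \<psi> x *\<^sub>R g x \<partial>\<mu>)"
proof -
  have g: "integrable \<mu> g" and f: "integrable \<mu> f" using w by (auto dest: weak_derivD)
  obtain C where C: "ae_eq f (\<lambda>x. C + prim g x)" by (rule du_Bois_Reymond[OF w])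
  have "(\<integral>x. \<psi>' x *\<^sub>R f x \<partial>\<mu>) = (\<integral>x. \<psi>' x *\<^sub>R (C + prim g x) \<partial>\<mu>)"
  proof (rule integral_cong_AE)
    show "AE x in \<mu>. \<psi>' x *\<^sub>R f x = \<psi>' x *\<^sub>R (C + prim g x)"
      using C unfolding ae_eq_def by eventually_elim simp
    show "(\<lambda>x. \<psi>' x *\<^sub>R (C + prim g x)) \<in> borel_measurable \<mu>"
      using prim_integrable[OF g] \<psi>(4) by auto
  qed (use f \<psi>(4) in auto)
  then show ?thesis using prim_parts[OF g \<psi>] by simp
qed

lemma integrable_mu_Icc:
  fixes g :: "real \<Rightarrow> 'a::{banach, second_countable_topology}"
  assumes "integrable \<mu> g"
  shows "integrable \<mu> (\<lambda>t. indicator {u..v} t *\<^sub>R g t)"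
  by (rule integrable_mu_scaleR_bounded[OF assms indicator_Icc_mu, where B = 1]) (simp add: indicator_def)

lemma prim_diff_le:
  fixes g :: "real \<Rightarrow> 'a::{real_normed_field, banach, second_countable_topology}"
  assumes g: "integrable \<mu> g" and "u \<le> x" "x \<le> y" "y \<le> v" "0 \<le> u"
  shows "norm (prim g y - prim g x) \<le> prim (\<lambda>t. norm (g t)) v - prim (\<lambda>t. norm (g t)) u"
proof -
  note i = integrable_mu_Icc[OF g] and i' = integrable_mu_Icc[OF integrable_norm[OF g]]
  have "prim g y - prim g x = (\<integral>t. indicator {0..y} t *\<^sub>R g t - indicator {0..x} t *\<^sub>R g t \<partial>\<mu>)"
    unfolding prim_def by (intro Bochner_Integration.integral_diff[symmetric] i)
  also have "norm \<dots> \<le> (\<integral>t. norm (indicator {0..y} t *\<^sub>R g t - indicator {0..x} t *\<^sub>R g t) \<partial>\<mu>)"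
    by (rule integral_norm_bound)
  also have "\<dots> \<le> (\<integral>t. indicator {0..v} t *\<^sub>R norm (g t) - indicator {0..u} t *\<^sub>R norm (g t) \<partial>\<mu>)"
    using assms by (intro integral_mono integrable_norm Bochner_Integration.integrable_diff i i')
      (auto simp: indicator_def)
  also have "\<dots> = prim (\<lambda>t. norm (g t)) v - prim (\<lambda>t. norm (g t)) u"
    unfolding prim_def by (intro Bochner_Integration.integral_diff i')
  finally show ?thesis .
qed

lemma prim_1: "prim g 1 = (\<integral>t. g t \<partial>\<mu>)"
  unfolding prim_def by (intro Bochner_Integration.integral_cong) auto

lemma prim_norm_nonneg: "0 \<le> prim (\<lambda>t. norm (g t)) x"
  unfolding prim_def by (rule Bochner_Integration.integral_nonneg) simp

lemma prim_sup_diff_le: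
  fixes g :: "real \<Rightarrow> 'a::{real_normed_field, banach, second_countable_topology}"
  assumes g: "integrable \<mu> g" and "x \<in> {0..1}" "y \<in> {0..1}"
  shows "norm (prim g y - prim g x) \<le> (\<integral>t. norm (g t) \<partial>\<mu>)"
proof -
  have *: "norm (prim g y - prim g x) \<le> (\<integral>t. norm (g t) \<partial>\<mu>)" if "x \<in> {0..1}" "y \<in> {0..1}" "x \<le> y" for x y
    using prim_diff_le[OF g, of 0 x y 1] prim_norm_nonneg[of g 0] that by (simp add: prim_1)
  show ?thesis using *[of x y] *[of y x] assms by (cases "x \<le> y") (auto simp: norm_minus_commute)
qed

text \<open>The one-dimensional Sobolev embedding with constant 1: |f(x)| <= |f(y)| +
  \<integral>|g|, averaged over y in a space of mass 1.\<close>

lemma weak_deriv_sup_bound: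
  fixes f g :: "real \<Rightarrow> 'a::{real_normed_field, banach, second_countable_topology}"
  assumes w: "weak_deriv f g"
  shows "AE x in \<mu>. norm (f x) \<le> (\<integral>x. norm (f x) \<partial>\<mu>) + (\<integral>x. norm (g x) \<partial>\<mu>)"
proof -
  have g: "integrable \<mu> g" and f: "integrable \<mu> f" using w by (auto dest: weak_derivD)
  obtain C where C: "ae_eq f (\<lambda>x. C + prim g x)" by (rule du_Bois_Reymond[OF w])
  let ?N = "\<integral>x. norm (g x) \<partial>\<mu>"
  from C have "AE x in \<mu>. x \<in> space \<mu> \<and> f x = C + prim g x" by (auto simp: ae_eq_def)
  then show ?thesis
  proof eventually_elim
    case (elim x)
    have "AE y in \<mu>. y \<in> space \<mu> \<and> f y = C + prim g y" using C by (auto simp: ae_eq_def)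
    then have "AE y in \<mu>. norm (f x) - ?N \<le> norm (f y)"
    proof eventually_elim
      case (elim y)
      have "norm (f x - f y) \<le> ?N"
        using prim_sup_diff_le[OF g, of y x] elim \<open>x \<in> space \<mu> \<and> f x = C + prim g x\<close> by simp
      then show ?case using norm_triangle_ineq2[of "f x" "f y"] by linarith
    qed
    then have "(\<integral>y. norm (f x) - ?N \<partial>\<mu>) \<le> (\<integral>y. norm (f y) \<partial>\<mu>)"
      using f by (intro integral_mono_AE) auto
    then show ?case by simp
  qed
qed

lemma weak_deriv_wderiv:
  fixes f g :: "real \<Rightarrow> 'a::{real_normed_field, banach, second_countable_topology}"
  assumes "weak_deriv f g"
  shows "weak_deriv f (wderiv f)" "ae_eq g (wderiv f)"
proof -
  show "weak_deriv f (wderiv f)" unfolding wderiv_def by (rule someI[of "weak_deriv f", OF assms])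
  then show "ae_eq g (wderiv f)" using assms weak_deriv_unique by blast
qed

lemma weak_deriv_add:
  fixes f g :: "real \<Rightarrow> 'a::{real_normed_field, banach, second_countable_topology}"
  assumes "weak_deriv f g" "weak_deriv f' g'"
  shows "weak_deriv (\<lambda>x. f x + f' x) (\<lambda>x. g x + g' x)"
  unfolding weak_deriv_def
proof (intro conjI allI impI)
  note i = weak_derivD(1,2)[OF assms(1)] weak_derivD(1,2)[OF assms(2)]
  then show "integrable \<mu> (\<lambda>x. f x + f' x)" "integrable \<mu> (\<lambda>x. g x + g' x)" by auto
  fix \<phi> assume t: "test_fun \<phi>"
  show "(\<integral>x. deriv \<phi> x *\<^sub>R (f x + f' x) \<partial>\<mu>) = - (\<integral>x. \<phi> x *\<^sub>R (g x + g' x) \<partial>\<mu>)"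
    using test_fun_scaleR_integrable[OF t i(2)] test_fun_scaleR_integrable[OF t i(4)]
      test_fun_scaleR_integrable[OF test_fun_deriv[OF t] i(1)] test_fun_scaleR_integrable[OF test_fun_deriv[OF t] i(3)]
    by (simp add: scaleR_add_right weak_derivD(3)[OF assms(1) t] weak_derivD(3)[OF assms(2) t])
qed

lemma weak_deriv_scale:
  fixes f g :: "real \<Rightarrow> 'a::{real_normed_field, banach, second_countable_topology}"
  assumes "weak_deriv f g"
  shows "weak_deriv (\<lambda>x. k * f x) (\<lambda>x. k * g x)"
  using assms by (auto simp: weak_deriv_def simp flip: mult_scaleR_right)

lemma weak_deriv_const: "weak_deriv (\<lambda>x. k :: 'a::{real_normed_field, banach, second_countable_topology}) (\<lambda>x. 0)"
  unfolding weak_deriv_def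
proof (intro conjI allI impI)
  fix \<phi> assume t: "test_fun \<phi>"
  have "(\<integral>x. deriv \<phi> x *\<^sub>R (k + prim (\<lambda>x. 0) x) \<partial>\<mu>) = - (\<integral>x. \<phi> x *\<^sub>R 0 \<partial>\<mu>)"
    using prim_parts[of "\<lambda>x. 0" \<phi> "{}" "deriv \<phi>" k, OF _ test_fun_continuous[OF t]] test_fun_differentiable[OF t]
      continuous_imp_integrable_mu[OF test_fun_continuous[OF test_fun_deriv[OF t]]] test_fun_0[OF t] by simp
  then show "(\<integral>x. deriv \<phi> x *\<^sub>R k \<partial>\<mu>) = - (\<integral>x. \<phi> x *\<^sub>R 0 \<partial>\<mu>)"
    by (simp add: prim_def)
qed auto

lemma L1_limit_test_fun:
  fixes F :: "real \<Rightarrow> 'a::{real_normed_field, banach, second_countable_topology}"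
  assumes "\<And>n. integrable \<mu> (f n)" "integrable \<mu> F" "(\<lambda>n. \<integral>x. norm (F x - f n x) \<partial>\<mu>) \<longlonglongrightarrow> 0" "test_fun \<phi>"
  shows "(\<lambda>n. \<integral>x. \<phi> x *\<^sub>R f n x \<partial>\<mu>) \<longlonglongrightarrow> (\<integral>x. \<phi> x *\<^sub>R F x \<partial>\<mu>)"
proof -
  obtain B where B: "\<And>x. \<bar>\<phi> x\<bar> \<le> B" using test_fun_bounded[OF assms(4)] by blast
  show ?thesis
  proof (rule LIM_zero_cancel, rule Lim_null_comparison)
    show "(\<lambda>n. B * (\<integral>x. norm (F x - f n x) \<partial>\<mu>)) \<longlonglongrightarrow> 0"
      using tendsto_mult_right[OF assms(3), of B] by (simp add: mult.commute)
    show "\<forall>\<^sub>F n in sequentially. norm ((\<integral>x. \<phi> x *\<^sub>R f n x \<partial>\<mu>) - (\<integral>x. \<phi> x *\<^sub>R F x \<partial>\<mu>))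
        \<le> B * (\<integral>x. norm (F x - f n x) \<partial>\<mu>)"
    proof (intro always_eventually allI)
      fix n
      have i: "integrable \<mu> (\<lambda>x. \<phi> x *\<^sub>R (f n x - F x))"
        using assms by (intro test_fun_scaleR_integrable) auto
      have "(\<integral>x. \<phi> x *\<^sub>R f n x \<partial>\<mu>) - (\<integral>x. \<phi> x *\<^sub>R F x \<partial>\<mu>) = (\<integral>x. \<phi> x *\<^sub>R (f n x - F x) \<partial>\<mu>)"
        unfolding scaleR_diff_right using assms
        by (intro Bochner_Integration.integral_diff[symmetric] test_fun_scaleR_integrable)
      also have "norm \<dots> \<le> (\<integral>x. norm (\<phi> x *\<^sub>R (f n x - F x)) \<partial>\<mu>)" by (rule integral_norm_bound)
      also have "\<dots> \<le> (\<integral>x. B * norm (F x - f n x) \<partial>\<mu>)"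
      proof (rule integral_mono)
        show "integrable \<mu> (\<lambda>x. norm (\<phi> x *\<^sub>R (f n x - F x)))" by (rule integrable_norm[OF i])
        show "norm (\<phi> x *\<^sub>R (f n x - F x)) \<le> B * norm (F x - f n x)" for x
          using B[of x] by (simp add: norm_minus_commute mult_right_mono)
      qed (use assms in auto)
      finally show "norm ((\<integral>x. \<phi> x *\<^sub>R f n x \<partial>\<mu>) - (\<integral>x. \<phi> x *\<^sub>R F x \<partial>\<mu>)) \<le> B * (\<integral>x. norm (F x - f n x) \<partial>\<mu>)"
        by simp
    qed
  qed
qed

lemma weak_deriv_limit:
  fixes F G :: "real \<Rightarrow> 'a::{real_normed_field, banach, second_countable_topology}"
  assumes w: "\<And>n. weak_deriv (f n) (g n)" and F: "integrable \<mu> F" and G: "integrable \<mu> G"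
    and lf: "(\<lambda>n. \<integral>x. norm (F x - f n x) \<partial>\<mu>) \<longlonglongrightarrow> 0" and lg: "(\<lambda>n. \<integral>x. norm (G x - g n x) \<partial>\<mu>) \<longlonglongrightarrow> 0"
  shows "weak_deriv F G"
  unfolding weak_deriv_def
proof (intro conjI allI impI F G)
  fix \<phi> assume t: "test_fun \<phi>"
  have "(\<lambda>n. \<integral>x. deriv \<phi> x *\<^sub>R f n x \<partial>\<mu>) \<longlonglongrightarrow> (\<integral>x. deriv \<phi> x *\<^sub>R F x \<partial>\<mu>)"
    using w by (intro L1_limit_test_fun F lf test_fun_deriv t) (auto dest: weak_derivD)
  moreover have "(\<lambda>n. - (\<integral>x. \<phi> x *\<^sub>R g n x \<partial>\<mu>)) \<longlonglongrightarrow> - (\<integral>x. \<phi> x *\<^sub>R G x \<partial>\<mu>)"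
    using w by (intro tendsto_minus L1_limit_test_fun G lg t) (auto dest: weak_derivD)
  ultimately show "(\<integral>x. deriv \<phi> x *\<^sub>R F x \<partial>\<mu>) = - (\<integral>x. \<phi> x *\<^sub>R G x \<partial>\<mu>)"
    using weak_derivD(3)[OF w t] LIMSEQ_unique by auto
qed

section \<open>Sobolev spaces\<close>

lemma sobolev_Lp: "f \<in> sobolev k p \<Longrightarrow> f \<in> Lp_space p"
  by (cases k) auto

lemma sobolev_cong:
  assumes "f \<in> sobolev k p" "ae_eq f g"
  shows "g \<in> sobolev k p"
  using assms by (cases k) (auto intro: Lp_space_cong weak_deriv_ae_cong[OF _ _ ae_eq_refl])

lemma sobolev_SucI: "f \<in> Lp_space p \<Longrightarrow> weak_deriv f g \<Longrightarrow> g \<in> sobolev k p \<Longrightarrow> f \<in> sobolev (Suc k) p"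
  by auto

lemma sobolev_SucD:
  assumes "f \<in> sobolev (Suc k) p"
  shows "f \<in> Lp_space p" "weak_deriv f (wderiv f)" "wderiv f \<in> sobolev k p"
proof -
  obtain g where g: "g \<in> sobolev k p" "weak_deriv f g" using assms by auto
  then show "weak_deriv f (wderiv f)" "wderiv f \<in> sobolev k p"
    using weak_deriv_wderiv[OF g(2)] sobolev_cong by blast+
qed (use assms in auto)

text \<open>An actual equality of functions: a.e. equal functions have the same set of weak
  derivatives, from which \<open>SOME\<close> picks the same element.\<close>

lemma wderiv_cong:
  assumes "ae_eq f (g :: real \<Rightarrow> 'a::{real_normed_field, banach, second_countable_topology})"
  shows "wderiv f = wderiv g"
proof -
  have "weak_deriv f = weak_deriv g"
    using weak_deriv_ae_cong[OF _ assms ae_eq_refl] weak_deriv_ae_cong[OF _ ae_eq_sym[OF assms] ae_eq_refl] by blast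
  then show ?thesis by (simp add: wderiv_def)
qed

lemma sobolev_norm_0 [simp]: "sobolev_norm 0 p f = Lp_norm p f"
  by (simp add: sobolev_norm_def)

lemma sobolev_norm_Suc: "sobolev_norm (Suc k) p f = Lp_norm p f + sobolev_norm k p (wderiv f)"
proof -
  have "sobolev_norm (Suc k) p f = Lp_norm p f + (\<Sum>j\<le>k. Lp_norm p ((wderiv ^^ Suc j) f))"
    unfolding sobolev_norm_def by (subst sum.atMost_Suc_shift) simp
  then show ?thesis by (simp only: sobolev_norm_def funpow_Suc_right comp_apply)
qed

lemma sobolev_norm_cong:
  "ae_eq f g \<Longrightarrow> sobolev_norm k p f = sobolev_norm k p (g :: real \<Rightarrow> 'a::{real_normed_field, banach, second_countable_topology})"
  by (cases k) (auto simp: sobolev_norm_Suc wderiv_cong intro: Lp_norm_cong)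

lemma sobolev_norm_weak:
  fixes f :: "real \<Rightarrow> 'a::{real_normed_field, banach, second_countable_topology}"
  assumes "weak_deriv f g"
  shows "sobolev_norm (Suc k) p f = Lp_norm p f + sobolev_norm k p g"
  using sobolev_norm_cong[OF weak_deriv_wderiv(2)[OF assms]] by (simp add: sobolev_norm_Suc)

lemma sobolev_norm_nonneg [simp]: "0 \<le> sobolev_norm k p f"
  by (simp add: sobolev_norm_def sum_nonneg)

lemma Lp_le_sobolev_norm: "Lp_norm p f \<le> sobolev_norm k p f"
  by (cases k) (auto simp: sobolev_norm_Suc)

lemma sobolev_zero_AE: "0 < p \<Longrightarrow> f \<in> sobolev k p \<Longrightarrow> sobolev_norm k p f = 0 \<Longrightarrow> ae_eq f (\<lambda>x. 0)"
  using Lp_zero_AE[OF _ sobolev_Lp, of p f k] Lp_le_sobolev_norm[of p f k] Lp_norm_nonneg[of p f]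
  by (simp add: ae_eq_def)

lemma sobolev_integrable:
  assumes "1 \<le> p" "f \<in> sobolev k p"
  shows "integrable \<mu> f" "(\<integral>x. norm (f x) \<partial>\<mu>) \<le> sobolev_norm k p f"
  using Lp_integrable[OF assms(1) sobolev_Lp[OF assms(2)]] Lp_le_sobolev_norm[of p f k] by auto

lemma sobolev_add:
  fixes f g :: "real \<Rightarrow> 'a::{real_normed_field, banach, second_countable_topology}"
  assumes p: "1 \<le> p" and "f \<in> sobolev k p" "g \<in> sobolev k p"
  shows "(\<lambda>x. f x + g x) \<in> sobolev k p"
    "sobolev_norm k p (\<lambda>x. f x + g x) \<le> sobolev_norm k p f + sobolev_norm k p g"
  using assms(2,3)
proof (induction k arbitrary: f g)
  case 0
  { case 1 then show ?case using Lp_add[OF p] by simp }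
  { case 2 then show ?case using Lp_add[OF p] by simp }
next
  case (Suc k)
  { case 1
    have w: "weak_deriv (\<lambda>x. f x + g x) (\<lambda>x. wderiv f x + wderiv g x)"
      using sobolev_SucD[OF 1(1)] sobolev_SucD[OF 1(2)] by (intro weak_deriv_add) auto
    then show ?case
      using sobolev_SucD[OF 1(1)] sobolev_SucD[OF 1(2)] Suc(1) Lp_add[OF p] by (intro sobolev_SucI[OF _ w]) auto }
  { case 2
    have w: "weak_deriv (\<lambda>x. f x + g x) (\<lambda>x. wderiv f x + wderiv g x)"
      using sobolev_SucD[OF 2(1)] sobolev_SucD[OF 2(2)] by (intro weak_deriv_add) auto
    show ?case unfolding sobolev_norm_weak[OF w] sobolev_norm_Suc
      using sobolev_SucD[OF 2(1)] sobolev_SucD[OF 2(2)] Suc(2)[of "wderiv f" "wderiv g"] Lp_add(2)[OF p, of f g] by auto }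
qed

lemma sobolev_scale:
  fixes f :: "real \<Rightarrow> 'a::{real_normed_field, banach, second_countable_topology}"
  assumes p: "0 < p" and "f \<in> sobolev k p"
  shows "(\<lambda>x. a * f x) \<in> sobolev k p"
    "sobolev_norm k p (\<lambda>x. a * f x) = norm a * sobolev_norm k p f"
  using assms(2)
proof (induction k arbitrary: f)
  case 0
  { case 1 then show ?case using Lp_scale[OF p] by simp }
  { case 2 then show ?case using Lp_scale[OF p] by simp }
next
  case (Suc k)
  { case 1
    have w: "weak_deriv (\<lambda>x. a * f x) (\<lambda>x. a * wderiv f x)"
      using sobolev_SucD[OF 1] by (intro weak_deriv_scale) auto
    then show ?case
      using sobolev_SucD[OF 1] Suc(1) Lp_scale[OF p] by (intro sobolev_SucI[OF _ w]) auto }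
  { case 2
    have w: "weak_deriv (\<lambda>x. a * f x) (\<lambda>x. a * wderiv f x)"
      using sobolev_SucD[OF 2] by (intro weak_deriv_scale) auto
    show ?case unfolding sobolev_norm_weak[OF w] sobolev_norm_Suc
      using sobolev_SucD[OF 2] Suc(2)[of "wderiv f"] Lp_scale(2)[OF p, of a f] by (auto simp: algebra_simps) }
qed

lemma sobolev_const:
  assumes p: "0 < p"
  shows "(\<lambda>x. a :: 'a::{real_normed_field, banach, second_countable_topology}) \<in> sobolev k p"
proof (induction k arbitrary: a)
  case 0 show ?case using Lp_bounded(1)[of p "norm a" "\<lambda>x. a"] p by auto
next
  case (Suc k)
  show ?case
    using Lp_bounded(1)[of p "norm a" "\<lambda>x. a"] p Suc weak_deriv_const by (intro sobolev_SucI) auto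
qed

lemma sobolev_diff:
  fixes f g :: "real \<Rightarrow> 'a::{real_normed_field, banach, second_countable_topology}"
  assumes p: "1 \<le> p" and "f \<in> sobolev k p" "g \<in> sobolev k p"
  shows "(\<lambda>x. f x - g x) \<in> sobolev k p"
    "sobolev_norm k p (\<lambda>x. f x - g x) \<le> sobolev_norm k p f + sobolev_norm k p g"
  using sobolev_add[OF p assms(2), of "\<lambda>x. (-1) * g x"] sobolev_scale[of p g k "-1"] assms by auto

lemma sobolev_sum:
  fixes f :: "nat \<Rightarrow> real \<Rightarrow> 'a::{real_normed_field, banach, second_countable_topology}"
  assumes p: "1 \<le> p" and "\<And>i. f i \<in> sobolev k p"
  shows "(\<lambda>x. \<Sum>i<n. f i x) \<in> sobolev k p"
  using assms by (induction n) (auto intro: sobolev_const sobolev_add)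

text \<open>The derivatives converge by the induction hypothesis to some G, and the weak derivative
  is a closed operator under L^1 convergence, so G is the derivative of the L^p limit F.\<close>

lemma sobolev_complete:
  fixes f :: "nat \<Rightarrow> real \<Rightarrow> 'a::{real_normed_field, banach, second_countable_topology}"
  assumes p: "1 \<le> p" and f: "\<And>i. f i \<in> sobolev k p" and s: "summable (\<lambda>i. sobolev_norm k p (f i))"
  shows "\<exists>F \<in> sobolev k p. \<forall>n. sobolev_norm k p (\<lambda>x. F x - (\<Sum>i<n. f i x)) \<le> (\<Sum>i. sobolev_norm k p (f (i + n)))"
  using f s
proof (induction k arbitrary: f)
  case 0
  then obtain F where "F \<in> Lp_space p"
    "\<And>n. Lp_norm p (\<lambda>x. F x - (\<Sum>i<n. f i x)) \<le> (\<Sum>i. Lp_norm p (f (i + n)))"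
    using Lp_complete[OF p, of f] by auto
  then show ?case by auto
next
  case (Suc k)
  note fD = sobolev_SucD[OF Suc(2)]
  have s1: "summable (\<lambda>i. Lp_norm p (f i))"
    by (rule summable_comparison_test'[OF Suc(3), of 0]) (auto intro: Lp_le_sobolev_norm)
  have s2: "summable (\<lambda>i. sobolev_norm k p (wderiv (f i)))"
    by (rule summable_comparison_test'[OF Suc(3), of 0]) (auto simp: sobolev_norm_Suc)
  obtain F where F: "F \<in> Lp_space p"
    "\<And>n. Lp_norm p (\<lambda>x. F x - (\<Sum>i<n. f i x)) \<le> (\<Sum>i. Lp_norm p (f (i + n)))"
    using Lp_complete[OF p fD(1) s1] by blast
  obtain G where G: "G \<in> sobolev k p"
    "\<And>n. sobolev_norm k p (\<lambda>x. G x - (\<Sum>i<n. wderiv (f i) x)) \<le> (\<Sum>i. sobolev_norm k p (wderiv (f (i + n))))"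
    using Suc(1)[OF fD(3) s2] by blast
  have wn: "weak_deriv (\<lambda>x. \<Sum>i<n. f i x) (\<lambda>x. \<Sum>i<n. wderiv (f i) x)" for n
    using fD(2) by (induction n) (auto intro: weak_deriv_const weak_deriv_add)
  have Si: "(\<lambda>x. \<Sum>i<n. f i x) \<in> Lp_space p" for n
    using Lp_sum(1)[OF p fD(1), where m = 0] by (simp add: atLeast0LessThan)
  have w: "weak_deriv F G"
  proof (rule weak_deriv_limit[OF wn])
    show "integrable \<mu> F" by (rule Lp_integrable(1)[OF p F(1)])
    show "integrable \<mu> G" by (rule sobolev_integrable(1)[OF p G(1)])
    show "(\<lambda>n. \<integral>x. norm (F x - (\<Sum>i<n. f i x)) \<partial>\<mu>) \<longlonglongrightarrow> 0"
    proof (rule tendsto_sandwich[OF _ _ tendsto_const])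
      show "\<forall>\<^sub>F n in sequentially. (\<integral>x. norm (F x - (\<Sum>i<n. f i x)) \<partial>\<mu>) \<le> (\<Sum>i. Lp_norm p (f (i + n)))"
        using order_trans[OF Lp_integrable(2)[OF p Lp_diff(1)[OF p F(1) Si]] F(2)] by auto
    qed (auto intro: suminf_exist_split2 s1)
    show "(\<lambda>n. \<integral>x. norm (G x - (\<Sum>i<n. wderiv (f i) x)) \<partial>\<mu>) \<longlonglongrightarrow> 0"
    proof (rule tendsto_sandwich[OF _ _ tendsto_const])
      show "\<forall>\<^sub>F n in sequentially. (\<integral>x. norm (G x - (\<Sum>i<n. wderiv (f i) x)) \<partial>\<mu>) \<le> (\<Sum>i. sobolev_norm k p (wderiv (f (i + n))))"
        using order_trans[OF sobolev_integrable(2)[OF p sobolev_diff(1)[OF p G(1) sobolev_sum[OF p fD(3)]]] G(2)] by auto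
    qed (auto intro: suminf_exist_split2[OF s2])
  qed
  show ?case
  proof (intro bexI[of _ F] allI)
    show "F \<in> sobolev (Suc k) p" using F(1) w G(1) by (rule sobolev_SucI)
    fix n
    have "weak_deriv (\<lambda>x. F x + (-1) * (\<Sum>i<n. f i x)) (\<lambda>x. G x + (-1) * (\<Sum>i<n. wderiv (f i) x))"
      by (intro weak_deriv_add w weak_deriv_scale wn)
    then have w': "weak_deriv (\<lambda>x. F x - (\<Sum>i<n. f i x)) (\<lambda>x. G x - (\<Sum>i<n. wderiv (f i) x))" by simp
    have "sobolev_norm (Suc k) p (\<lambda>x. F x - (\<Sum>i<n. f i x))
      \<le> (\<Sum>i. Lp_norm p (f (i + n))) + (\<Sum>i. sobolev_norm k p (wderiv (f (i + n))))"
      unfolding sobolev_norm_weak[OF w'] using F(2) G(2) by (intro add_mono)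
    also have "\<dots> = (\<Sum>i. sobolev_norm (Suc k) p (f (i + n)))"
      unfolding sobolev_norm_Suc
      by (intro suminf_add summable_ignore_initial_segment s1 s2)
    finally show "sobolev_norm (Suc k) p (\<lambda>x. F x - (\<Sum>i<n. f i x)) \<le> (\<Sum>i. sobolev_norm (Suc k) p (f (i + n)))" .
  qed
qed

text \<open>Density of the bumps in L^1, phrased as an induction rule. It extends a convergence
  statement from functions in the Sobolev space to all integrable functions.\<close>

lemma L1_dense_induct [consumes 1, case_names bump scale add lim ae]:
  fixes f :: "real \<Rightarrow> real"
  assumes f: "integrable \<mu> f"
    and bump: "\<And>a b n. 0 \<le> a \<Longrightarrow> b \<le> 1 \<Longrightarrow> Q (bump a b n)"
    and scale: "\<And>f k. integrable \<mu> f \<Longrightarrow> Q f \<Longrightarrow> Q (\<lambda>x. k * f x)"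
    and add: "\<And>f g. integrable \<mu> f \<Longrightarrow> integrable \<mu> g \<Longrightarrow> Q f \<Longrightarrow> Q g \<Longrightarrow> Q (\<lambda>x. f x + g x)"
    and lim: "\<And>F f. integrable \<mu> F \<Longrightarrow> (\<And>n::nat. integrable \<mu> (f n)) \<Longrightarrow> (\<And>n. Q (f n)) \<Longrightarrow>
        (\<lambda>n. \<integral>x. \<bar>F x - f n x\<bar> \<partial>\<mu>) \<longlonglongrightarrow> 0 \<Longrightarrow> Q F"
  shows "Q f"
proof -
  have ind_i: "integrable \<mu> (indicator A :: real \<Rightarrow> real)" if "A \<in> sets \<mu>" for A
    using that by (intro integrable_mu_bounded[where B = 1]) (auto simp: indicator_def)
  have limdct: "Q F" if F: "F \<in> borel_measurable \<mu>" and fm: "\<And>n. f n \<in> borel_measurable \<mu>" and Qf: "\<And>n. Q (f n)"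
    and l: "AE x in \<mu>. (\<lambda>n. f n x) \<longlonglongrightarrow> F x" and w: "integrable \<mu> w" and b: "\<And>n. AE x in \<mu>. \<bar>f n x\<bar> \<le> w x"
    for F and f :: "nat \<Rightarrow> real \<Rightarrow> real" and w :: "real \<Rightarrow> real"
  proof (rule lim[of F f])
    show fi: "integrable \<mu> (f n)" for n
      by (rule Bochner_Integration.integrable_bound[OF w fm]) (use b[of n] in \<open>eventually_elim, auto\<close>)
    show Fi: "integrable \<mu> F"
      by (rule integrable_dominated_convergence[where s = f and w = w]) (use F fm w l b in auto)
    have "(\<lambda>n. \<integral>x. norm (f n x - F x) \<partial>\<mu>) \<longlonglongrightarrow> (\<integral>x. 0 \<partial>\<mu>)"
    proof (rule integral_dominated_convergence[where w = "\<lambda>x. w x + \<bar>F x\<bar>"])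
      show "AE x in \<mu>. (\<lambda>n. norm (f n x - F x)) \<longlonglongrightarrow> 0"
        using l by eventually_elim (intro tendsto_norm_zero LIM_zero)
      show "AE x in \<mu>. norm (norm (f n x - F x)) \<le> w x + \<bar>F x\<bar>" for n
        using b[of n] by eventually_elim auto
    qed (use w Fi F fm in auto)
    then show "(\<lambda>n. \<integral>x. \<bar>F x - f n x\<bar> \<partial>\<mu>) \<longlonglongrightarrow> 0" by (simp add: abs_minus_commute)
  qed (use Qf in auto)
  have opm: "(indicator {a<..<b} :: real \<Rightarrow> real) \<in> borel_measurable \<mu>" for a b
    by (subst borel_measurable_indicator_iff) (auto simp: sets_restrict_space_iff)
  have one: "Q (\<lambda>x. 1)"
  proof (rule limdct[of _ "bump 0 1" "\<lambda>x. 1"])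
    have "AE x in \<mu>. x \<noteq> 0 \<and> x \<noteq> 1"
      by (rule AE_I'[of "{0, 1}"])
        (auto simp: null_sets_restrict_space intro!: null_sets_completionI finite_imp_null_set_lborel)
    then have "AE x in \<mu>. x \<in> {0<..<1}" by (rule AE_mp) (auto intro!: AE_I2)
    then show "AE x in \<mu>. (\<lambda>n. bump 0 1 n x) \<longlonglongrightarrow> 1"
    proof eventually_elim
      case (elim x) then show ?case using bump_tendsto[of 0 1 x] by simp
    qed
  qed (use bump bump_bounds in auto)
  have zero: "Q (\<lambda>x. 0)" using scale[OF _ one, of 0] by simp
  have ind: "Q (indicator A)" if "A \<in> sets \<mu>" for A
    using that
  proof (induction rule: mu_sets_induct)
    case (interval a b)
    show ?case
      by (rule limdct[of _ "bump a b" "\<lambda>x. 1"]) (use interval bump bump_bounds bump_tendsto opm in auto)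
  next
    case (compl A)
    have "Q (\<lambda>x. 1 + (-1) * indicator A x)" by (intro add scale one compl ind_i) (auto intro!: ind_i compl)
    then show ?case
    proof (rule limdct[of "indicator ({0..1} - A)" "\<lambda>n x. 1 + (-1) * indicator A x" "\<lambda>x. 1", rotated 2])
      have "{0..1} - A \<in> sets \<mu>" using sets.compl_sets[OF compl(1)] by simp
      then show "(indicator ({0..1} - A) :: real \<Rightarrow> real) \<in> borel_measurable \<mu>"
        by (rule borel_measurable_indicator)
      show "(\<lambda>x. 1 + (-1) * indicator A x :: real) \<in> borel_measurable \<mu>" using compl(1) by simp
    qed (auto simp: indicator_def)
  next
    case (union A)
    have fin: "Q (\<lambda>x. \<Sum>i<n. indicator (A i) x) \<and> integrable \<mu> (\<lambda>x. \<Sum>i<n. indicator (A i) x :: real)" for n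
      by (induction n) (use zero union ind_i in \<open>auto intro!: add\<close>)
    show ?case
    proof (rule limdct[of _ "\<lambda>n x. \<Sum>i<n. indicator (A i) x" "\<lambda>x. 1"])
      show "AE x in \<mu>. (\<lambda>n. \<Sum>i<n. indicator (A i) x) \<longlonglongrightarrow> (indicator (\<Union>i. A i) x :: real)"
        using indicator_sums[of A] union(2) by (auto simp: sums_def disjoint_family_on_def intro!: AE_I2)
      show "AE x in \<mu>. \<bar>\<Sum>i<n. indicator (A i) x\<bar> \<le> (1::real)" for n
      proof (rule AE_I2)
        fix x
        have "(\<Sum>i<n. indicator (A i) x :: real) = indicator (\<Union>i<n. A i) x"
          using union(2) by (intro indicator_UN_disjoint[symmetric]) (auto simp: disjoint_family_on_def)
        then show "\<bar>\<Sum>i<n. indicator (A i) x\<bar> \<le> (1::real)" by (simp add: indicator_def)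
      qed
    qed (use fin union in auto)
  next
    case (null A B)
    show ?case
    proof (rule limdct[of _ "\<lambda>n. indicator A" "\<lambda>x. 1"])
      show "AE x in \<mu>. (\<lambda>n. indicator A x) \<longlonglongrightarrow> (indicator B x :: real)"
        using \<open>AE x in \<mu>. x \<in> A \<longleftrightarrow> x \<in> B\<close> by eventually_elim (simp add: indicator_def)
    qed (use null in \<open>auto intro: indicator_abs_le_1\<close>)
  qed
  show ?thesis using f
  proof (induction rule: integrable_induct)
    case (base A c)
    then have "Q (\<lambda>x. c * indicator A x)" by (intro scale ind ind_i)
    then show ?case by (simp add: mult.commute)
  next
    case (add f g)
    then show ?case by (intro assms(4))
  next
    case (lim f s)
    show ?case
      by (rule limdct[of _ s "\<lambda>x. 2 * \<bar>f x\<bar>"]) (use lim in auto)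
  qed
qed

section \<open>Transfer operators\<close>

lemma nonsingular_AE:
  assumes "nonsingular T" "AE x in \<mu>. Q x"
  shows "AE x in \<mu>. Q (T x)"
proof -
  obtain N where N: "{x \<in> space \<mu>. \<not> Q x} \<subseteq> N" "N \<in> null_sets \<mu>"
    using assms(2) by (auto simp: eventually_ae_filter)
  have T: "T \<in> measurable \<mu> \<mu>" using assms(1) by (simp add: nonsingular_def)
  show ?thesis
  proof (rule AE_I')
    show "T -` N \<inter> {0..1} \<in> null_sets \<mu>" using assms(1) N(2) by (auto simp: nonsingular_def)
    show "{x \<in> space \<mu>. \<not> Q (T x)} \<subseteq> T -` N \<inter> {0..1}"
    proof
      fix x assume x: "x \<in> {x \<in> space \<mu>. \<not> Q (T x)}"
      then have "T x \<in> space \<mu>" using measurable_space[OF T] by blast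
      with x N(1) show "x \<in> T -` N \<inter> {0..1}" by auto
    qed
  qed
qed

lemma Linf_comp:
  assumes "nonsingular T" "g \<in> Linf_space"
  shows "(\<lambda>x. g (T x)) \<in> Linf_space"
proof -
  obtain M where g: "g \<in> borel_measurable \<mu>" "AE x in \<mu>. norm (g x) \<le> M" using assms(2) by (auto simp: Linf_space_def)
  have T: "T \<in> measurable \<mu> \<mu>" using assms(1) by (simp add: nonsingular_def)
  have "(\<lambda>x. g (T x)) \<in> borel_measurable \<mu>" using measurable_compose[OF T g(1)] .
  moreover have "AE x in \<mu>. norm (g (T x)) \<le> M" by (rule nonsingular_AE[OF assms(1) g(2)])
  ultimately show ?thesis by (auto simp: Linf_space_def)
qed

lemma Linf_mult_integrable:
  assumes "integrable \<mu> f" "g \<in> Linf_space"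
  shows "integrable \<mu> (\<lambda>x. f x * g x)"
proof -
  obtain M where g: "g \<in> borel_measurable \<mu>" "AE x in \<mu>. norm (g x) \<le> M" using assms(2) by (auto simp: Linf_space_def)
  show ?thesis
  proof (rule Bochner_Integration.integrable_bound)
    show "integrable \<mu> (\<lambda>x. M * norm (f x))" using assms by auto
    show "AE x in \<mu>. norm (f x * g x) \<le> norm (M * norm (f x))"
      using g(2)
    proof eventually_elim
      case (elim x)
      then have "norm (f x) * norm (g x) \<le> norm (f x) * M" by (intro mult_left_mono) auto
      then show ?case using elim by (simp add: norm_mult abs_mult mult.commute) (smt (verit) norm_ge_zero abs_of_nonneg)
    qed
  qed (use assms g in auto)
qed

definition is_transfer ::
  "(real \<Rightarrow> real) \<Rightarrow> (real \<Rightarrow> 'a::{real_normed_field, banach, second_countable_topology}) \<Rightarrow> (real \<Rightarrow> 'a) \<Rightarrow> bool" where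
  "is_transfer T f h \<longleftrightarrow> integrable \<mu> h \<and>
     (\<forall>g \<in> Linf_space. (\<integral>x. h x * g x \<partial>\<mu>) = (\<integral>x. f x * g (T x) \<partial>\<mu>))"

lemma transfer_alt: "transfer T f = (SOME h. is_transfer T f h)"
  by (simp add: transfer_def is_transfer_def)

text \<open>The sign of h - h' is an admissible bounded test function and turns the duality relation
  into the L^1 norm of the difference.\<close>

lemma is_transfer_unique_real:
  fixes f :: "real \<Rightarrow> real"
  assumes "is_transfer T f h" "is_transfer T f h'"
  shows "ae_eq h h'"
proof -
  have i: "integrable \<mu> h" "integrable \<mu> h'" using assms by (auto simp: is_transfer_def)
  define g where "g x = sgn (h x - h' x)" for x
  have g: "g \<in> Linf_space"
    unfolding Linf_space_def g_def using i by (auto intro!: exI[of _ 1] AE_I2 simp: sgn_real_def)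
  have "(\<integral>x. h x * g x - h' x * g x \<partial>\<mu>) = 0"
    using assms g i by (subst Bochner_Integration.integral_diff) (auto simp: is_transfer_def intro: Linf_mult_integrable)
  moreover have "h x * g x - h' x * g x = \<bar>h x - h' x\<bar>" for x
    by (auto simp: g_def sgn_real_def)
  ultimately have "(\<integral>x. \<bar>h x - h' x\<bar> \<partial>\<mu>) = 0" by simp
  then have "AE x in \<mu>. \<bar>h x - h' x\<bar> = 0"
    using i by (subst (asm) integral_nonneg_eq_0_iff_AE) auto
  then show ?thesis by (simp add: ae_eq_def)
qed

text \<open>The image under T of the measure with density f is absolutely continuous by
  nonsingularity; its Radon-Nikodym density is the transfer of f. The construction also keeps the
  nonnegativity on which monotonicity of the operator rests.\<close>

lemma is_transfer_ex_nonneg: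
  fixes f :: "real \<Rightarrow> real"
  assumes T: "nonsingular T" and f: "integrable \<mu> f" and nn: "\<And>x. 0 \<le> f x"
  shows "\<exists>h. is_transfer T f h \<and> (\<forall>x. 0 \<le> h x)"
proof -
  have Tm [measurable]: "T \<in> measurable \<mu> \<mu>" using T by (simp add: nonsingular_def)
  have fm [measurable]: "f \<in> borel_measurable \<mu>" using f by auto
  define \<nu> where "\<nu> = distr (density \<mu> (\<lambda>x. ennreal (f x))) \<mu> T"
  have s: "sets \<nu> = sets \<mu>" by (simp add: \<nu>_def)
  have T': "T \<in> measurable (density \<mu> (\<lambda>x. ennreal (f x))) \<mu>" by simp
  have ac: "absolutely_continuous \<mu> \<nu>"
  proof (unfold absolutely_continuous_def, rule subsetI)
    fix A assume A: "A \<in> null_sets \<mu>"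
    have N: "T -` A \<inter> {0..1} \<in> null_sets \<mu>" using A T by (auto simp: nonsingular_def)
    have "emeasure \<nu> A = emeasure (density \<mu> (\<lambda>x. ennreal (f x))) (T -` A \<inter> {0..1})"
      unfolding \<nu>_def using A by (subst emeasure_distr[OF T']) auto
    also have "\<dots> = 0"
      using N by (subst emeasure_density) (auto simp: nn_integral_null_set)
    finally show "A \<in> null_sets \<nu>" using A s by (auto simp: null_sets_def)
  qed
  obtain h where h: "h \<in> borel_measurable \<mu>" "density \<mu> h = \<nu>"
    using mu.Radon_Nikodym[OF ac s] by blast
  have nnint: "(\<integral>\<^sup>+x. h x * g x \<partial>\<mu>) = (\<integral>\<^sup>+x. ennreal (f x) * g (T x) \<partial>\<mu>)" if g: "g \<in> borel_measurable \<mu>" for g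
  proof -
    have "(\<integral>\<^sup>+x. h x * g x \<partial>\<mu>) = (\<integral>\<^sup>+x. g x \<partial>\<nu>)"
      using h g by (subst h(2)[symmetric], subst nn_integral_density) auto
    also have "\<dots> = (\<integral>\<^sup>+x. g (T x) \<partial>density \<mu> (\<lambda>x. ennreal (f x)))"
      unfolding \<nu>_def using g by (subst nn_integral_distr[OF T']) auto
    also have "\<dots> = (\<integral>\<^sup>+x. ennreal (f x) * g (T x) \<partial>\<mu>)"
      using g measurable_compose[OF Tm g] by (subst nn_integral_density) auto
    finally show ?thesis .
  qed
  have "(\<integral>\<^sup>+x. h x \<partial>\<mu>) = (\<integral>\<^sup>+x. ennreal (f x) \<partial>\<mu>)" using nnint[of "\<lambda>x. 1"] by simp
  also have "\<dots> < \<infinity>" using f nn by (simp add: nn_integral_eq_integral)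
  finally have fin: "(\<integral>\<^sup>+x. h x \<partial>\<mu>) < \<infinity>" .
  then have hfin: "AE x in \<mu>. h x \<noteq> \<infinity>" using h(1) by (intro nn_integral_PInf_AE) auto
  \<comment> \<open>The Radon-Nikodym density takes values in the extended reals but is finite a.e.,
    its total mass being that of f; \<open>k\<close> is a finite representative.\<close>
  define k where "k x = enn2real (h x)" for x
  have km [measurable]: "k \<in> borel_measurable \<mu>" unfolding k_def using h(1) by measurable
  have hk: "AE x in \<mu>. h x = ennreal (k x)"
    using hfin by eventually_elim (simp add: k_def less_top)
  have knn: "0 \<le> k x" for x by (simp add: k_def)
  have kn: "(\<integral>\<^sup>+x. ennreal (k x) * g x \<partial>\<mu>) = (\<integral>\<^sup>+x. ennreal (f x) * g (T x) \<partial>\<mu>)" if g: "g \<in> borel_measurable \<mu>" for g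
    unfolding nnint[OF g, symmetric]
    by (rule nn_integral_cong_AE) (use hk in \<open>eventually_elim, simp\<close>)
  have ki: "integrable \<mu> k"
  proof (rule integrableI_nonneg)
    show "(\<integral>\<^sup>+x. ennreal (k x) \<partial>\<mu>) < \<infinity>"
      using kn[of "\<lambda>x. 1"] f nn by (simp add: nn_integral_eq_integral)
  qed (auto simp: knn)
  have pos: "(\<integral>x. k x * g x \<partial>\<mu>) = (\<integral>x. f x * g (T x) \<partial>\<mu>)"
    if g: "g \<in> borel_measurable \<mu>" "\<And>x. 0 \<le> g x" for g :: "real \<Rightarrow> real"
  proof -
    have [measurable]: "g \<in> borel_measurable \<mu>" "(\<lambda>x. g (T x)) \<in> borel_measurable \<mu>"
      using g(1) measurable_compose[OF Tm g(1)] by auto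
    show ?thesis
      using kn[of "\<lambda>x. ennreal (g x)"] g knn nn
      by (subst (1 2) integral_eq_nn_integral) (auto simp: ennreal_mult)
  qed
  have "(\<integral>x. k x * g x \<partial>\<mu>) = (\<integral>x. f x * g (T x) \<partial>\<mu>)" if g: "g \<in> Linf_space" for g :: "real \<Rightarrow> real"
  proof -
    let ?p = "\<lambda>x. max (g x) 0" and ?n = "\<lambda>x. max (- g x) 0"
    have gm: "g \<in> borel_measurable \<mu>" using g by (simp add: Linf_space_def)
    obtain M where M: "AE x in \<mu>. norm (g x) \<le> M" using g by (auto simp: Linf_space_def)
    have "AE x in \<mu>. norm (?p x) \<le> M" "AE x in \<mu>. norm (?n x) \<le> M"
      using M by (eventually_elim, auto)+
    then have L: "?p \<in> Linf_space" "?n \<in> Linf_space"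
      unfolding Linf_space_def using gm by auto
    have "(\<integral>x. k x * g x \<partial>\<mu>) = (\<integral>x. k x * ?p x - k x * ?n x \<partial>\<mu>)"
      by (intro Bochner_Integration.integral_cong) (auto simp: max_def)
    also have "\<dots> = (\<integral>x. k x * ?p x \<partial>\<mu>) - (\<integral>x. k x * ?n x \<partial>\<mu>)"
      by (intro Bochner_Integration.integral_diff Linf_mult_integrable ki L)
    also have "\<dots> = (\<integral>x. f x * ?p (T x) \<partial>\<mu>) - (\<integral>x. f x * ?n (T x) \<partial>\<mu>)"
      using gm by (subst (1 2) pos) auto
    also have "\<dots> = (\<integral>x. f x * ?p (T x) - f x * ?n (T x) \<partial>\<mu>)"
      by (intro Bochner_Integration.integral_diff[symmetric] Linf_mult_integrable f Linf_comp[OF T L(1)] Linf_comp[OF T L(2)])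
    also have "\<dots> = (\<integral>x. f x * g (T x) \<partial>\<mu>)"
      by (intro Bochner_Integration.integral_cong) (auto simp: max_def)
    finally show ?thesis .
  qed
  then show ?thesis using ki knn by (auto simp: is_transfer_def)
qed

lemma is_transfer_add:
  assumes "nonsingular T" "integrable \<mu> f" "integrable \<mu> f'" "is_transfer T f h" "is_transfer T f' h'"
  shows "is_transfer T (\<lambda>x. f x + f' x) (\<lambda>x. h x + h' x)"
  unfolding is_transfer_def
proof (intro conjI ballI)
  show "integrable \<mu> (\<lambda>x. h x + h' x)" using assms by (auto simp: is_transfer_def)
  fix g :: "real \<Rightarrow> 'a" assume g: "g \<in> Linf_space"
  show "(\<integral>x. (h x + h' x) * g x \<partial>\<mu>) = (\<integral>x. (f x + f' x) * g (T x) \<partial>\<mu>)"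
    using assms Linf_mult_integrable[OF _ g] Linf_mult_integrable[OF _ Linf_comp[OF assms(1) g]] g
    by (simp add: distrib_right is_transfer_def)
qed

lemma is_transfer_scale:
  assumes "is_transfer T f h"
  shows "is_transfer T (\<lambda>x. k * f x) (\<lambda>x. k * h x)"
  using assms by (auto simp: is_transfer_def mult.assoc)

lemma is_transfer_ae:
  assumes "nonsingular T" "is_transfer T f h" "integrable \<mu> f" "ae_eq f f'" "ae_eq h h'"
  shows "is_transfer T f' h'"
  unfolding is_transfer_def
proof (intro conjI ballI)
  have h: "integrable \<mu> h" using assms by (auto simp: is_transfer_def)
  show h': "integrable \<mu> h'" by (rule integrable_ae_eq[OF h assms(5)])
  have f': "integrable \<mu> f'" by (rule integrable_ae_eq[OF assms(3,4)])
  fix g :: "real \<Rightarrow> 'a" assume g: "g \<in> Linf_space"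
  have "(\<integral>x. h' x * g x \<partial>\<mu>) = (\<integral>x. h x * g x \<partial>\<mu>)"
    using assms(5) unfolding ae_eq_def
    by (intro integral_cong_AE borel_measurable_integrable Linf_mult_integrable h h' g) (auto elim: eventually_mono)
  also have "\<dots> = (\<integral>x. f x * g (T x) \<partial>\<mu>)" using assms g by (simp add: is_transfer_def)
  also have "\<dots> = (\<integral>x. f' x * g (T x) \<partial>\<mu>)"
    using assms(4) unfolding ae_eq_def
    by (intro integral_cong_AE borel_measurable_integrable Linf_mult_integrable f' assms(3) Linf_comp[OF assms(1) g])
      (auto elim: eventually_mono)
  finally show "(\<integral>x. h' x * g x \<partial>\<mu>) = (\<integral>x. f' x * g (T x) \<partial>\<mu>)" .
qed

lemma is_transfer_ex_real:
  fixes f :: "real \<Rightarrow> real"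
  assumes T: "nonsingular T" and f: "integrable \<mu> f"
  shows "\<exists>h. is_transfer T f h"
proof -
  have i: "integrable \<mu> (\<lambda>x. max (f x) 0)" "integrable \<mu> (\<lambda>x. max (- f x) 0)" using f by auto
  obtain h1 h2 where "is_transfer T (\<lambda>x. max (f x) 0) h1" "is_transfer T (\<lambda>x. max (- f x) 0) h2"
    using is_transfer_ex_nonneg[OF T i(1)] is_transfer_ex_nonneg[OF T i(2)] by auto
  then have "is_transfer T (\<lambda>x. max (f x) 0 + (-1) * max (- f x) 0) (\<lambda>x. h1 x + (-1) * h2 x)"
    using i by (intro is_transfer_add T is_transfer_scale) auto
  moreover have "(\<lambda>x. max (f x) 0 + (-1) * max (- f x) 0) = f" by (auto simp: max_def)
  ultimately show ?thesis by auto
qed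

lemma transfer_is_transfer_real:
  fixes f :: "real \<Rightarrow> real"
  assumes "nonsingular T" "integrable \<mu> f"
  shows "is_transfer T f (transfer T f)"
  unfolding transfer_alt using is_transfer_ex_real[OF assms] by (rule someI_ex)

context
  fixes T :: "real \<Rightarrow> real"
  assumes T: "nonsingular T"
begin

lemma transfer_integrable: "integrable \<mu> f \<Longrightarrow> integrable \<mu> (transfer T f :: real \<Rightarrow> real)"
  using transfer_is_transfer_real[OF T] by (auto simp: is_transfer_def)

lemma transfer_duality:
  fixes f g :: "real \<Rightarrow> real"
  shows "integrable \<mu> f \<Longrightarrow> g \<in> Linf_space \<Longrightarrow> (\<integral>x. transfer T f x * g x \<partial>\<mu>) = (\<integral>x. f x * g (T x) \<partial>\<mu>)"
  using transfer_is_transfer_real[OF T] by (auto simp: is_transfer_def)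

lemma transfer_integral:
  fixes f :: "real \<Rightarrow> real"
  shows "integrable \<mu> f \<Longrightarrow> (\<integral>x. transfer T f x \<partial>\<mu>) = (\<integral>x. f x \<partial>\<mu>)"
  using transfer_duality[of f "\<lambda>x. 1"] by (simp add: Linf_space_def) blast

lemma transfer_cong:
  fixes f :: "real \<Rightarrow> real"
  assumes "integrable \<mu> f" "ae_eq f f'"
  shows "ae_eq (transfer T f) (transfer T f')"
  using is_transfer_unique_real[OF is_transfer_ae[OF T transfer_is_transfer_real[OF T assms(1)] assms(1,2) ae_eq_refl]
    transfer_is_transfer_real[OF T integrable_ae_eq[OF assms]]] .

lemma transfer_add:
  fixes f :: "real \<Rightarrow> real"
  assumes "integrable \<mu> f" "integrable \<mu> f'"
  shows "ae_eq (transfer T (\<lambda>x. f x + f' x)) (\<lambda>x. transfer T f x + transfer T f' x)"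
  using assms by (intro is_transfer_unique_real[OF transfer_is_transfer_real[OF T]]
    is_transfer_add T transfer_is_transfer_real[OF T]) auto

lemma transfer_scale:
  fixes f :: "real \<Rightarrow> real"
  assumes "integrable \<mu> f"
  shows "ae_eq (transfer T (\<lambda>x. k * f x)) (\<lambda>x. k * transfer T f x)"
  using assms by (intro is_transfer_unique_real[OF transfer_is_transfer_real[OF T]]
    is_transfer_scale transfer_is_transfer_real[OF T]) auto

lemma transfer_diff:
  fixes f :: "real \<Rightarrow> real"
  assumes "integrable \<mu> f" "integrable \<mu> f'"
  shows "ae_eq (transfer T (\<lambda>x. f x - f' x)) (\<lambda>x. transfer T f x - transfer T f' x)"
proof -
  have "ae_eq (transfer T (\<lambda>x. f x + (-1) * f' x)) (\<lambda>x. transfer T f x + transfer T (\<lambda>x. (-1) * f' x) x)"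
    using assms by (intro transfer_add) auto
  moreover have "ae_eq (transfer T (\<lambda>x. (-1) * f' x)) (\<lambda>x. (-1) * transfer T f' x)" by (rule transfer_scale[OF assms(2)])
  ultimately have "AE x in \<mu>. transfer T (\<lambda>x. f x + (-1) * f' x) x = transfer T f x + (-1) * transfer T f' x"
    unfolding ae_eq_def by eventually_elim simp
  then show ?thesis by (simp add: ae_eq_def)
qed

lemma transfer_nonneg:
  fixes f :: "real \<Rightarrow> real"
  assumes f: "integrable \<mu> f" and nn: "AE x in \<mu>. 0 \<le> f x"
  shows "AE x in \<mu>. 0 \<le> transfer T f x"
proof -
  have i: "integrable \<mu> (\<lambda>x. \<bar>f x\<bar>)" using f by auto
  obtain h where h: "is_transfer T (\<lambda>x. \<bar>f x\<bar>) h" "\<And>x. 0 \<le> h x" using is_transfer_ex_nonneg[OF T i] by auto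
  have "ae_eq (\<lambda>x. \<bar>f x\<bar>) f" using nn by (auto simp: ae_eq_def elim: eventually_mono)
  then have "is_transfer T f h" by (rule is_transfer_ae[OF T h(1) i _ ae_eq_refl])
  then have "ae_eq h (transfer T f)" by (rule is_transfer_unique_real[OF _ transfer_is_transfer_real[OF T f]])
  then show ?thesis unfolding ae_eq_def by eventually_elim (use h(2) in \<open>metis\<close>)
qed

lemma transfer_mono:
  fixes f g :: "real \<Rightarrow> real"
  assumes "integrable \<mu> f" "integrable \<mu> g" "AE x in \<mu>. f x \<le> g x"
  shows "AE x in \<mu>. transfer T f x \<le> transfer T g x"
proof -
  have "AE x in \<mu>. 0 \<le> transfer T (\<lambda>x. g x - f x) x"
    using assms by (intro transfer_nonneg) (auto elim: eventually_mono)
  then show ?thesis using transfer_diff[OF assms(2,1)] unfolding ae_eq_def by eventually_elim simp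
qed

lemma transfer_abs:
  fixes f g :: "real \<Rightarrow> real"
  assumes f: "integrable \<mu> f" and g: "integrable \<mu> g" and le: "AE x in \<mu>. \<bar>f x\<bar> \<le> g x"
  shows "AE x in \<mu>. \<bar>transfer T f x\<bar> \<le> transfer T g x"
proof -
  have 1: "AE x in \<mu>. transfer T f x \<le> transfer T g x"
    using le by (intro transfer_mono f g) (auto elim: eventually_mono)
  have 2: "AE x in \<mu>. transfer T (\<lambda>x. (-1) * f x) x \<le> transfer T g x"
    using le f by (intro transfer_mono g) (auto elim: eventually_mono)
  show ?thesis using 1 2 transfer_scale[OF f, of "-1"] unfolding ae_eq_def by eventually_elim auto
qed

lemma transfer_L1:
  fixes f :: "real \<Rightarrow> real"
  assumes f: "integrable \<mu> f"
  shows "(\<integral>x. \<bar>transfer T f x\<bar> \<partial>\<mu>) \<le> (\<integral>x. \<bar>f x\<bar> \<partial>\<mu>)"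
proof -
  have "(\<integral>x. \<bar>transfer T f x\<bar> \<partial>\<mu>) \<le> (\<integral>x. transfer T (\<lambda>x. \<bar>f x\<bar>) x \<partial>\<mu>)"
    using f by (intro integral_mono_AE transfer_abs transfer_integrable integrable_abs) auto
  then show ?thesis using transfer_integral[of "\<lambda>x. \<bar>f x\<bar>"] f by simp
qed

section \<open>Iterates of the map and of the transfer operator\<close>

lemma nonsingular_funpow: "nonsingular (T ^^ n)"
proof (induction n)
  case 0
  have "A \<inter> {0..1} \<in> null_sets \<mu>" if "A \<in> null_sets \<mu>" for A :: "real set"
    using that by (intro null_set_Int2) (auto simp: sets_restrict_space_iff)
  then show ?case by (simp add: nonsingular_def id_def)
next
  case (Suc n)
  have Tm: "T \<in> measurable \<mu> \<mu>" using T by (simp add: nonsingular_def)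
  have m: "T ^^ n \<circ> T \<in> measurable \<mu> \<mu>" using Suc Tm by (intro measurable_comp[OF Tm]) (simp add: nonsingular_def)
  have "(T ^^ n \<circ> T) -` A \<inter> {0..1} \<in> null_sets \<mu>" if "A \<in> null_sets \<mu>" for A
  proof -
    have "T -` ((T ^^ n) -` A \<inter> {0..1}) \<inter> {0..1} \<in> null_sets \<mu>"
      using that Suc T unfolding nonsingular_def by blast
    moreover have "T -` ((T ^^ n) -` A \<inter> {0..1}) \<inter> {0..1} = (T ^^ n \<circ> T) -` A \<inter> {0..1}"
      using measurable_space[OF Tm] by auto
    ultimately show ?thesis by simp
  qed
  with m show ?case unfolding funpow_Suc_right nonsingular_def by blast
qed

lemma funpow_transfer_integrable: "integrable \<mu> f \<Longrightarrow> integrable \<mu> ((transfer T ^^ n) f :: real \<Rightarrow> real)"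
  by (induction n) (auto intro: transfer_integrable)

lemma funpow_transfer_integral:
  "integrable \<mu> f \<Longrightarrow> (\<integral>x. (transfer T ^^ n) f x \<partial>\<mu>) = (\<integral>x. (f x :: real) \<partial>\<mu>)"
  by (induction n) (auto simp: transfer_integral funpow_transfer_integrable)

lemma funpow_transfer_duality:
  fixes f g :: "real \<Rightarrow> real"
  assumes f: "integrable \<mu> f" and "g \<in> Linf_space"
  shows "(\<integral>x. (transfer T ^^ n) f x * g x \<partial>\<mu>) = (\<integral>x. f x * g ((T ^^ n) x) \<partial>\<mu>)"
  using assms(2)
proof (induction n arbitrary: g)
  case (Suc n)
  have "(\<integral>x. (transfer T ^^ Suc n) f x * g x \<partial>\<mu>) = (\<integral>x. (transfer T ^^ n) f x * g (T x) \<partial>\<mu>)"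
    using Suc(2) by (simp add: transfer_duality funpow_transfer_integrable f)
  also have "\<dots> = (\<integral>x. f x * g ((T ^^ Suc n) x) \<partial>\<mu>)"
    using Suc(1)[OF Linf_comp[OF T Suc(2)]] by simp
  finally show ?case .
qed simp

lemma funpow_transfer_add:
  fixes f :: "real \<Rightarrow> real"
  assumes "integrable \<mu> f" "integrable \<mu> f'"
  shows "ae_eq ((transfer T ^^ n) (\<lambda>x. f x + f' x)) (\<lambda>x. (transfer T ^^ n) f x + (transfer T ^^ n) f' x)"
proof (induction n)
  case (Suc n)
  have "ae_eq ((transfer T ^^ Suc n) (\<lambda>x. f x + f' x)) (transfer T (\<lambda>x. (transfer T ^^ n) f x + (transfer T ^^ n) f' x))"
    using transfer_cong[OF _ Suc] assms by (simp add: funpow_transfer_integrable)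
  also have "ae_eq (transfer T (\<lambda>x. (transfer T ^^ n) f x + (transfer T ^^ n) f' x))
    (\<lambda>x. (transfer T ^^ Suc n) f x + (transfer T ^^ Suc n) f' x)"
    using transfer_add[OF funpow_transfer_integrable[OF assms(1)] funpow_transfer_integrable[OF assms(2)]] by simp
  finally show ?case .
qed simp

lemma funpow_transfer_scale:
  fixes f :: "real \<Rightarrow> real"
  assumes "integrable \<mu> f"
  shows "ae_eq ((transfer T ^^ n) (\<lambda>x. k * f x)) (\<lambda>x. k * (transfer T ^^ n) f x)"
proof (induction n)
  case (Suc n)
  have "ae_eq ((transfer T ^^ Suc n) (\<lambda>x. k * f x)) (transfer T (\<lambda>x. k * (transfer T ^^ n) f x))"
    using transfer_cong[OF _ Suc] assms by (simp add: funpow_transfer_integrable)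
  also have "ae_eq (transfer T (\<lambda>x. k * (transfer T ^^ n) f x)) (\<lambda>x. k * (transfer T ^^ Suc n) f x)"
    using transfer_scale[OF funpow_transfer_integrable[OF assms(1)]] by simp
  finally show ?case .
qed simp

lemma funpow_transfer_diff:
  fixes f :: "real \<Rightarrow> real"
  assumes "integrable \<mu> f" "integrable \<mu> f'"
  shows "ae_eq ((transfer T ^^ n) (\<lambda>x. f x - f' x)) (\<lambda>x. (transfer T ^^ n) f x - (transfer T ^^ n) f' x)"
proof (induction n)
  case (Suc n)
  have "ae_eq ((transfer T ^^ Suc n) (\<lambda>x. f x - f' x)) (transfer T (\<lambda>x. (transfer T ^^ n) f x - (transfer T ^^ n) f' x))"
    using transfer_cong[OF _ Suc] assms by (simp add: funpow_transfer_integrable)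
  also have "ae_eq (transfer T (\<lambda>x. (transfer T ^^ n) f x - (transfer T ^^ n) f' x))
    (\<lambda>x. (transfer T ^^ Suc n) f x - (transfer T ^^ Suc n) f' x)"
    using transfer_diff[OF funpow_transfer_integrable[OF assms(1)] funpow_transfer_integrable[OF assms(2)]] by simp
  finally show ?case .
qed simp

lemma funpow_transfer_abs:
  fixes f g :: "real \<Rightarrow> real"
  assumes "integrable \<mu> f" "integrable \<mu> g" "AE x in \<mu>. \<bar>f x\<bar> \<le> g x"
  shows "AE x in \<mu>. \<bar>(transfer T ^^ n) f x\<bar> \<le> (transfer T ^^ n) g x"
proof (induction n)
  case (Suc n)
  then show ?case using transfer_abs[OF funpow_transfer_integrable funpow_transfer_integrable Suc] assms by simp
qed (use assms in simp)

lemma funpow_transfer_L1: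
  fixes f :: "real \<Rightarrow> real"
  assumes f: "integrable \<mu> f"
  shows "(\<integral>x. \<bar>(transfer T ^^ n) f x\<bar> \<partial>\<mu>) \<le> (\<integral>x. \<bar>f x\<bar> \<partial>\<mu>)"
proof (induction n)
  case (Suc n)
  then show ?case using transfer_L1[OF funpow_transfer_integrable[OF f, of n]] by simp
qed simp

end

section \<open>Unimodal maps with a singular turning point\<close>

lemma AE_mu_neq: "AE x in \<mu>. x \<noteq> c"
  by (rule AE_I'[of "{c} \<inter> {0..1}"])
    (auto simp: null_sets_restrict_space intro!: null_sets_completionI finite_imp_null_set_lborel)

lemma borel_measurable_mu_continuous_off:
  fixes f :: "real \<Rightarrow> real"
  assumes "continuous_on ({0..1} - {c}) f"
  shows "f \<in> borel_measurable \<mu>"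
proof -
  have "(\<lambda>x. indicator ({0..1} - {c}) x *\<^sub>R f x) \<in> borel_measurable borel"
    by (intro borel_measurable_continuous_on_indicator assms) auto
  then have "(\<lambda>x. indicator ({0..1} - {c}) x *\<^sub>R f x) \<in> borel_measurable \<mu>"
    by (simp add: measurable_completion measurable_restrict_space1)
  moreover have "ae_eq (\<lambda>x. indicator ({0..1} - {c}) x *\<^sub>R f x) f"
    using AE_mu_neq[of c] AE_space[of \<mu>] unfolding ae_eq_def by eventually_elim simp
  ultimately show ?thesis by (rule borel_measurable_mu_ae)
qed

lemma integrable_mu_abs_powr:
  assumes "-1 < e"
  shows "integrable \<mu> (\<lambda>x. \<bar>x - c\<bar> powr e)"
proof -
  define F where "F x = sgn (x - c) * (\<bar>x - c\<bar> powr (e + 1) / (e + 1))" for x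
  have der0: "(F has_real_derivative \<bar>x - c\<bar> powr e) (at x)" if "x \<noteq> c" for x
  proof -
    have "((\<lambda>x. (x - c) powr (e + 1) / (e + 1)) has_real_derivative (x - c) powr e) (at x)" if "c < x"
    proof -
      have "((\<lambda>x. (x - c) powr (e + 1) / (e + 1)) has_real_derivative ((e + 1) * (x - c) powr (e + 1 - 1) * 1) / (e + 1)) (at x)"
        using that by (intro DERIV_cdivide DERIV_chain2[OF has_real_derivative_powr]) (auto intro!: derivative_eq_intros)
      then show ?thesis using assms by simp
    qed
    moreover have "((\<lambda>x. - ((c - x) powr (e + 1) / (e + 1))) has_real_derivative (c - x) powr e) (at x)" if "x < c"
    proof -
      have "((\<lambda>x. - ((c - x) powr (e + 1) / (e + 1))) has_real_derivative - (((e + 1) * (c - x) powr (e + 1 - 1) * (- 1)) / (e + 1))) (at x)"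
        using that by (intro DERIV_minus DERIV_cdivide DERIV_chain2[OF has_real_derivative_powr]) (auto intro!: derivative_eq_intros)
      then show ?thesis using assms by simp
    qed
    moreover have "\<forall>\<^sub>F y in nhds x. F y = (y - c) powr (e + 1) / (e + 1)" if "c < x"
    proof -
      have "\<forall>\<^sub>F y in nhds x. y \<in> {c<..}" using that by (intro eventually_nhds_in_open) auto
      then show ?thesis by eventually_elim (simp add: F_def)
    qed
    moreover have "\<forall>\<^sub>F y in nhds x. F y = - ((c - y) powr (e + 1) / (e + 1))" if "x < c"
    proof -
      have "\<forall>\<^sub>F y in nhds x. y \<in> {..<c}" using that by (intro eventually_nhds_in_open) auto
      then show ?thesis by eventually_elim (simp add: F_def)
    qed
    ultimately show "(F has_real_derivative \<bar>x - c\<bar> powr e) (at x)"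
      using that by (cases "x < c") (auto simp: DERIV_cong_ev[OF refl _ refl])
  qed
  then have der: "(F has_vector_derivative \<bar>x - c\<bar> powr e) (at x)" if "x \<noteq> c" for x
    using that by (simp add: has_real_derivative_iff_has_vector_derivative)
  have cont: "continuous_on {0..1} F"
  proof -
    have "isCont F x" for x
    proof (cases "x = c")
      case True
      have "(F \<longlongrightarrow> 0) (at c)"
      proof (rule Lim_null_comparison)
        show "\<forall>\<^sub>F x in at c. norm (F x) \<le> \<bar>x - c\<bar> powr (e + 1) / (e + 1)"
          using assms by (intro always_eventually) (auto simp: F_def sgn_real_def abs_mult)
        have "((\<lambda>x. \<bar>x - c\<bar> powr (e + 1) / (e + 1)) \<longlongrightarrow> \<bar>c - c\<bar> powr (e + 1) / (e + 1)) (at c)"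
          using assms by (intro tendsto_intros) auto
        then show "((\<lambda>x. \<bar>x - c\<bar> powr (e + 1) / (e + 1)) \<longlongrightarrow> 0) (at c)" using assms by simp
      qed
      then show ?thesis using True by (simp add: isCont_def F_def)
    next
      case False
      then show ?thesis by (rule DERIV_isCont[OF der0])
    qed
    then show ?thesis by (simp add: continuous_at_imp_continuous_on)
  qed
  have "((\<lambda>x. \<bar>x - c\<bar> powr e) has_integral F 1 - F 0) {0..1}"
    by (rule fundamental_theorem_of_calculus_interior_strong[of "{c}"]) (auto intro!: cont der)
  then have "(\<lambda>x. \<bar>x - c\<bar> powr e) absolutely_integrable_on {0..1}"
    by (intro nonnegative_absolutely_integrable_1) auto
  then show ?thesis by (simp add: integrable_restrict_space set_integrable_def)
qed

text \<open>Splits an unbounded weight into a part bounded by B and an excess of small integral.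
  This produces the small coefficient that the Lasota-Yorke inequality can absorb.\<close>

lemma integrable_tail:
  fixes w :: "real \<Rightarrow> real"
  assumes w: "integrable \<mu> w" and \<eta>: "0 < \<eta>"
  obtains B where "0 \<le> B" "(\<integral>x. max (w x - B) 0 \<partial>\<mu>) \<le> \<eta>"
proof -
  have "(\<lambda>n. \<integral>x. max (w x - real n) 0 \<partial>\<mu>) \<longlonglongrightarrow> (\<integral>x. 0 \<partial>\<mu>)"
  proof (rule integral_dominated_convergence[where w = "\<lambda>x. \<bar>w x\<bar>"])
    show "AE x in \<mu>. (\<lambda>n. max (w x - real n) 0) \<longlonglongrightarrow> 0"
    proof (rule AE_I2)
      fix x
      obtain N where N: "w x \<le> real N" using real_arch_simple by blast
      have "\<forall>\<^sub>F n in sequentially. max (w x - real n) 0 = 0"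
        using eventually_ge_at_top[of N] by eventually_elim (use N in auto)
      then show "(\<lambda>n. max (w x - real n) 0) \<longlonglongrightarrow> 0" by (rule tendsto_eventually)
    qed
  qed (use w in auto)
  then have "\<forall>\<^sub>F n in sequentially. (\<integral>x. max (w x - real n) 0 \<partial>\<mu>) < \<eta>"
    using \<eta> by (auto simp: order_tendsto_iff)
  then obtain n where "(\<integral>x. max (w x - real n) 0 \<partial>\<mu>) < \<eta>" by (auto simp: eventually_sequentially)
  then show ?thesis using that[of "real n"] by auto
qed

text \<open>The bounded part of the weight is paid for with the L^1 norm of f, the excess with its
  sup norm. The Sobolev embedding later turns \<eta> S into a small multiple of the norm of f' plus
  a weak term.\<close>

lemma integral_mult_tail:
  fixes w f :: "real \<Rightarrow> real"
  assumes w: "integrable \<mu> w" and f: "integrable \<mu> f" and S: "AE x in \<mu>. \<bar>f x\<bar> \<le> S" "0 \<le> S"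
    and B: "0 \<le> B" "(\<integral>x. max (w x - B) 0 \<partial>\<mu>) \<le> \<eta>" and nn: "\<And>x. 0 \<le> w x"
  shows "integrable \<mu> (\<lambda>x. w x * \<bar>f x\<bar>)" "(\<integral>x. w x * \<bar>f x\<bar> \<partial>\<mu>) \<le> B * (\<integral>x. \<bar>f x\<bar> \<partial>\<mu>) + S * \<eta>"
proof -
  show i: "integrable \<mu> (\<lambda>x. w x * \<bar>f x\<bar>)"
  proof (rule Bochner_Integration.integrable_bound)
    show "integrable \<mu> (\<lambda>x. w x * S)" using w by auto
    show "AE x in \<mu>. norm (w x * \<bar>f x\<bar>) \<le> norm (w x * S)"
      using S(1) by eventually_elim (use nn S(2) in \<open>auto simp: abs_mult intro!: mult_left_mono\<close>)
  qed (use w f in auto)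
  have "(\<integral>x. w x * \<bar>f x\<bar> \<partial>\<mu>) \<le> (\<integral>x. B * \<bar>f x\<bar> + S * max (w x - B) 0 \<partial>\<mu>)"
  proof (rule integral_mono_AE[OF i])
    show "AE x in \<mu>. w x * \<bar>f x\<bar> \<le> B * \<bar>f x\<bar> + S * max (w x - B) 0"
      using S(1)
    proof eventually_elim
      case (elim x)
      have "w x * \<bar>f x\<bar> \<le> (B + max (w x - B) 0) * \<bar>f x\<bar>" by (intro mult_right_mono) auto
      also have "\<dots> \<le> B * \<bar>f x\<bar> + S * max (w x - B) 0"
        using mult_left_mono[OF elim, of "max (w x - B) 0"] by (simp add: algebra_simps)
      finally show ?case .
    qed
  qed (use w f in auto)
  also have "\<dots> = B * (\<integral>x. \<bar>f x\<bar> \<partial>\<mu>) + S * (\<integral>x. max (w x - B) 0 \<partial>\<mu>)"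
    using w f by simp
  finally show "(\<integral>x. w x * \<bar>f x\<bar> \<partial>\<mu>) \<le> B * (\<integral>x. \<bar>f x\<bar> \<partial>\<mu>) + S * \<eta>"
    using mult_left_mono[OF B(2) S(2)] by linarith
qed

text \<open>The derivative Q' is only integrable and may blow up at c; the product Q' f is still
  integrable because the weakly differentiable f is essentially bounded.\<close>

lemma weak_deriv_mult:
  fixes f g Q Q' :: "real \<Rightarrow> real"
  assumes w: "weak_deriv f g" and Q: "continuous_on {0..1} Q"
    "\<And>x. x \<in> {0<..<1} - {c} \<Longrightarrow> (Q has_real_derivative Q' x) (at x)" and Q': "integrable \<mu> Q'"
  shows "weak_deriv (\<lambda>x. Q x * f x) (\<lambda>x. Q' x * f x + Q x * g x)"
  unfolding weak_deriv_def
proof (intro conjI allI impI)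
  have fi: "integrable \<mu> f" and gi: "integrable \<mu> g" using w by (auto dest: weak_derivD)
  have Qm: "Q \<in> borel_measurable \<mu>" by (rule continuous_imp_borel_mu[OF Q(1)])
  obtain B where B: "\<And>x. x \<in> {0..1} \<Longrightarrow> \<bar>Q x\<bar> \<le> B"
    using compact_imp_bounded[OF compact_continuous_image[OF Q(1) compact_Icc]]
    by (metis bounded_iff image_eqI real_norm_def)
  have BQ: "AE x in \<mu>. \<bar>Q x\<bar> \<le> B" using B by auto
  show Qf: "integrable \<mu> (\<lambda>x. Q x * f x)"
    using integrable_mu_scaleR_bounded[OF fi Qm BQ] by simp
  have Qg: "integrable \<mu> (\<lambda>x. Q x * g x)"
    using integrable_mu_scaleR_bounded[OF gi Qm BQ] by simp
  obtain S where "AE x in \<mu>. \<bar>f x\<bar> \<le> S" using weak_deriv_sup_bound[OF w] by auto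
  then have Q'f: "integrable \<mu> (\<lambda>x. Q' x * f x)"
    using integrable_mu_scaleR_bounded[OF Q' borel_measurable_integrable[OF fi]] by (auto simp: mult.commute)
  show "integrable \<mu> (\<lambda>x. Q' x * f x + Q x * g x)" using Q'f Qg by auto
  fix \<phi> assume t: "test_fun \<phi>"
  note t' = test_fun_deriv[OF t]
  have "(\<integral>x. (deriv \<phi> x * Q x + Q' x * \<phi> x) *\<^sub>R f x \<partial>\<mu>) = - (\<integral>x. (\<phi> x * Q x) *\<^sub>R g x \<partial>\<mu>)"
  proof (rule weak_deriv_parts[OF w, where K = "{c}"])
    show "continuous_on {0..1} (\<lambda>x. \<phi> x * Q x)"
      by (intro continuous_intros test_fun_continuous t Q)
    show "((\<lambda>x. \<phi> x * Q x) has_real_derivative deriv \<phi> x * Q x + Q' x * \<phi> x) (at x)" if "x \<in> {0<..<1} - {c}" for x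
      by (rule DERIV_mult[OF test_fun_differentiable[OF t] Q(2)[OF that]])
    have "integrable \<mu> (\<lambda>x. deriv \<phi> x * Q x)"
      by (intro continuous_imp_integrable_mu continuous_intros test_fun_continuous t' Q)
    moreover have "integrable \<mu> (\<lambda>x. Q' x * \<phi> x)"
      using test_fun_scaleR_integrable[OF t Q'] by (simp add: mult.commute)
    ultimately show "integrable \<mu> (\<lambda>x. deriv \<phi> x * Q x + Q' x * \<phi> x)" by auto
  qed (auto simp: test_fun_0[OF t])
  moreover have "(\<integral>x. (deriv \<phi> x * Q x + Q' x * \<phi> x) *\<^sub>R f x \<partial>\<mu>)
      = (\<integral>x. deriv \<phi> x *\<^sub>R (Q x * f x) \<partial>\<mu>) + (\<integral>x. \<phi> x *\<^sub>R (Q' x * f x) \<partial>\<mu>)"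
    unfolding Bochner_Integration.integral_add[OF test_fun_scaleR_integrable[OF t' Qf] test_fun_scaleR_integrable[OF t Q'f], symmetric]
    by (intro Bochner_Integration.integral_cong) (auto simp: algebra_simps)
  moreover have "(\<integral>x. \<phi> x *\<^sub>R (Q' x * f x + Q x * g x) \<partial>\<mu>)
      = (\<integral>x. \<phi> x *\<^sub>R (Q' x * f x) \<partial>\<mu>) + (\<integral>x. (\<phi> x * Q x) *\<^sub>R g x \<partial>\<mu>)"
  proof -
    have "integrable \<mu> (\<lambda>x. (\<phi> x * Q x) *\<^sub>R g x)"
      using test_fun_scaleR_integrable[OF t Qg] by (simp add: mult.assoc)
    from Bochner_Integration.integral_add[OF test_fun_scaleR_integrable[OF t Q'f] this, symmetric]
    show ?thesis by (simp add: algebra_simps)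
  qed
  ultimately show "(\<integral>x. deriv \<phi> x *\<^sub>R (Q x * f x) \<partial>\<mu>) = - (\<integral>x. \<phi> x *\<^sub>R (Q' x * f x + Q x * g x) \<partial>\<mu>)"
    by simp
qed

section \<open>The class of maps with common constants, and the weight at the turning point\<close>

locale singular_params =
  fixes c \<beta> \<theta> \<kappa> L p :: real
  assumes c01: "0 < c" "c < 1" and p1: "1 < p" and \<beta>1: "-1 < \<beta>" and \<beta>p: "\<beta> < (1 - 2 * p) / (2 * p)"
    and \<theta>1: "1 < \<theta>" and \<kappa>0: "0 < \<kappa>" and L0: "0 \<le> L"
begin

text \<open>The first inequality makes the exponent -1 - 2 \<beta> of G G' positive; the second is
  p-integrability of the squared weight |x - c|^(-2-2\<beta>).\<close>

lemma beta_half: "\<beta> < -1/2" and beta_exp: "-1 < 2 * p * (-1 - \<beta>)"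
proof -
  have *: "\<beta> * (2 * p) < 1 - 2 * p" using \<beta>p p1 by (simp add: pos_less_divide_eq)
  then show "-1 < 2 * p * (-1 - \<beta>)" by (simp add: algebra_simps)
  have "(1 - 2 * p) / (2 * p) < -1/2" using p1 by (simp add: field_simps)
  then show "\<beta> < -1/2" using \<beta>p by linarith
qed

text \<open>Uniformity in \<epsilon> is expressed by quantification over this class: a constant
  found inside the locale depends on the locale parameters only and therefore serves every map of
  the family. The value of T at c is left open.\<close>

definition adm :: "(real \<Rightarrow> real) \<Rightarrow> (real \<Rightarrow> real) \<Rightarrow> (real \<Rightarrow> real) \<Rightarrow> (real \<Rightarrow> real) \<Rightarrow> bool" where
  "adm T T1 T2 T3 \<longleftrightarrow> nonsingular T \<and> T 0 = 0 \<and> T 1 = 0 \<and> (\<exists>a. a \<in> {0..1} \<and> (T \<longlongrightarrow> a) (at c)) \<and>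
     (\<forall>x\<in>{0..1} - {c}. T x \<in> {0..1} \<and>
        (T has_real_derivative T1 x) (at x within {0..1} - {c}) \<and>
        (T1 has_real_derivative T2 x) (at x within {0..1} - {c}) \<and>
        (T2 has_real_derivative T3 x) (at x within {0..1} - {c}) \<and>
        \<theta> \<le> \<bar>T1 x\<bar> \<and> \<kappa> * \<bar>x - c\<bar> powr \<beta> \<le> \<bar>T1 x\<bar> \<and> \<bar>T1 x\<bar> \<le> L * \<bar>x - c\<bar> powr \<beta> \<and>
        \<bar>T2 x\<bar> \<le> L * \<bar>x - c\<bar> powr (\<beta> - 1) \<and> \<bar>T3 x\<bar> \<le> L * \<bar>x - c\<bar> powr (\<beta> - 2)) \<and>
     continuous_on ({0..1} - {c}) T3"

text \<open>The order of the bound for G' = -T'' / T'^2 near c: the exponent is (\<beta> - 1) - 2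
  \<beta>.\<close>

definition wgt :: "real \<Rightarrow> real" where "wgt x = \<bar>x - c\<bar> powr (-1 - \<beta>)"

definition K0 :: real where "K0 = L / \<kappa>^2 + 3 * (L / \<kappa>^3) + L / \<kappa>^3 + 3 * (L / \<kappa>^2)^2"

lemma wgt_nonneg [simp]: "0 \<le> wgt x" by (simp add: wgt_def)

lemma K0_nonneg: "0 \<le> K0" using L0 \<kappa>0 by (simp add: K0_def)

lemma wgt_integrable: "integrable \<mu> wgt"
  unfolding wgt_def using beta_half beta_exp p1 \<beta>1 by (intro integrable_mu_abs_powr) auto

lemma wgt_sq_Lp: "(\<lambda>x. (wgt x)\<^sup>2) \<in> Lp_space p"
proof -
  have "((wgt x)\<^sup>2) powr p = \<bar>x - c\<bar> powr (2 * p * (-1 - \<beta>))" for x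
    by (simp add: wgt_def power2_eq_square powr_powr algebra_simps flip: powr_add)
  moreover have "integrable \<mu> (\<lambda>x. \<bar>x - c\<bar> powr (2 * p * (-1 - \<beta>)))"
    by (rule integrable_mu_abs_powr[OF beta_exp])
  moreover have "(\<lambda>x. (wgt x)\<^sup>2) \<in> borel_measurable \<mu>" using wgt_integrable by auto
  ultimately show ?thesis by (simp add: Lp_space_def)
qed

lemma wgt_Lp: "wgt \<in> Lp_space p"
proof -
  have "(\<lambda>x. 1 + (wgt x)\<^sup>2) \<in> Lp_space p"
    using p1 by (intro Lp_add(1) wgt_sq_Lp Lp_bounded(1)[where B = 1]) auto
  moreover have "wgt x \<le> 1 + (wgt x)\<^sup>2" for x
  proof -
    have "0 \<le> (wgt x - 1)\<^sup>2" by simp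
    also have "(wgt x - 1)\<^sup>2 = (wgt x)\<^sup>2 - 2 * wgt x + 1" by (simp add: power2_eq_square algebra_simps)
    finally show ?thesis using wgt_nonneg[of x] by linarith
  qed
  then have "AE x in \<mu>. norm (wgt x) \<le> norm (1 + (wgt x)\<^sup>2)" by simp
  ultimately show ?thesis
    using p1 borel_measurable_integrable[OF wgt_integrable] by (intro Lp_mono(1)[of p wgt "\<lambda>x. 1 + (wgt x)\<^sup>2"]) simp_all
qed

end

lemma continuous_on_patch:
  fixes f :: "real \<Rightarrow> real"
  assumes f: "continuous_on ({0..1} - {c}) f" and "f c = 0" and e: "0 < e"
    and b: "\<And>x. x \<in> {0..1} - {c} \<Longrightarrow> \<bar>f x\<bar> \<le> M * \<bar>x - c\<bar> powr e"
  shows "continuous_on {0..1} f"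
  unfolding continuous_on_eq_continuous_within
proof
  fix x :: real assume x: "x \<in> {0..1}"
  show "continuous (at x within {0..1}) f"
  proof (cases "x = c")
    case True
    have "(f \<longlongrightarrow> 0) (at c within {0..1})"
    proof (rule Lim_null_comparison)
      show "\<forall>\<^sub>F x in at c within {0..1}. norm (f x) \<le> M * \<bar>x - c\<bar> powr e"
        using b by (auto simp: eventually_at_filter intro!: always_eventually)
      have "((\<lambda>x. M * \<bar>x - c\<bar> powr e) \<longlongrightarrow> M * \<bar>c - c\<bar> powr e) (at c within {0..1})"
        using e by (intro tendsto_intros) auto
      then show "((\<lambda>x. M * \<bar>x - c\<bar> powr e) \<longlongrightarrow> 0) (at c within {0..1})" using e by simp
    qed
    then show ?thesis using True assms(2) by (simp add: continuous_within)
  next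
    case False
    have "continuous (at x within {0..1} - {c}) f"
      using f x False by (auto simp: continuous_on_eq_continuous_within)
    moreover have "at x within {0..1} - {c} = at x within {0..1}"
      using False at_within_nhd[of x "- {c}" "{0..1} - {c}" "{0..1}"] by (auto simp: Diff_eq)
    ultimately show ?thesis by (simp add: continuous_within)
  qed
qed

context singular_params
begin

context
  fixes T T1 T2 T3 :: "real \<Rightarrow> real"
  assumes A: "adm T T1 T2 T3"
begin

lemma adm_nonsingular: "nonsingular T"
  using A by (simp add: adm_def)

lemma adm_derivs:
  assumes "x \<in> {0..1} - {c}"
  shows "(T has_real_derivative T1 x) (at x within {0..1} - {c})"
    "(T1 has_real_derivative T2 x) (at x within {0..1} - {c})"
    "(T2 has_real_derivative T3 x) (at x within {0..1} - {c})"
  using A assms by (auto simp: adm_def)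

lemma adm_bounds:
  assumes "x \<in> {0..1} - {c}"
  shows "\<theta> \<le> \<bar>T1 x\<bar>" "\<kappa> * \<bar>x - c\<bar> powr \<beta> \<le> \<bar>T1 x\<bar>" "\<bar>T1 x\<bar> \<le> L * \<bar>x - c\<bar> powr \<beta>"
    "\<bar>T2 x\<bar> \<le> L * \<bar>x - c\<bar> powr (\<beta> - 1)" "\<bar>T3 x\<bar> \<le> L * \<bar>x - c\<bar> powr (\<beta> - 2)"
  using A assms by (auto simp: adm_def)

lemma adm_nz: "x \<in> {0..1} - {c} \<Longrightarrow> T1 x \<noteq> 0"
  using adm_bounds(1)[of x] \<theta>1 by auto

lemma adm_at_interior:
  assumes "x \<in> {0<..<1} - {c}"
  shows "at x within {0..1} - {c} = at x"
proof (rule at_within_open_subset)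
  show "open ({0<..<1} - {c})" by auto
qed (use assms in auto)

lemma adm_derivs_int:
  assumes "x \<in> {0<..<1} - {c}"
  shows "(T has_real_derivative T1 x) (at x)" "(T1 has_real_derivative T2 x) (at x)" "(T2 has_real_derivative T3 x) (at x)"
  using adm_derivs[of x] assms adm_at_interior[OF assms] by auto

lemma adm_cont: "continuous_on ({0..1} - {c}) T" "continuous_on ({0..1} - {c}) T1"
    "continuous_on ({0..1} - {c}) T2" "continuous_on ({0..1} - {c}) T3"
proof -
  show "continuous_on ({0..1} - {c}) T" "continuous_on ({0..1} - {c}) T1" "continuous_on ({0..1} - {c}) T2"
    using DERIV_continuous_on[OF adm_derivs(1)] DERIV_continuous_on[OF adm_derivs(2)]
      DERIV_continuous_on[OF adm_derivs(3)] by auto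
  show "continuous_on ({0..1} - {c}) T3" using A by (simp add: adm_def)
qed

text \<open>Here \<open>G1\<close> is G', \<open>GG\<close> is G G' and \<open>H2\<close> is (G
  G')'. The product is written as -T'' / T'^3 with value 0 at c because it extends continuously
  there, although \<open>G1\<close> itself may be unbounded.\<close>

definition G where "G x = (if x = c then 0 else 1 / T1 x)"
definition G1 where "G1 x = - T2 x / (T1 x)^2"
definition GG where "GG x = (if x = c then 0 else - T2 x / (T1 x)^3)"
definition H2 where "H2 x = - T3 x / (T1 x)^3 + 3 * (T2 x)^2 / (T1 x)^4"

lemma inv_bound:
  assumes x: "x \<in> {0..1} - {c}"
  shows "1 / \<bar>T1 x\<bar> ^ n \<le> (1 / \<kappa> ^ n) * \<bar>x - c\<bar> powr (- (real n * \<beta>))"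
proof -
  have d: "0 < \<bar>x - c\<bar>" using x by auto
  then have pos: "0 < \<kappa> * \<bar>x - c\<bar> powr \<beta>" using \<kappa>0 by simp
  have "1 / \<bar>T1 x\<bar> ^ n \<le> 1 / (\<kappa> * \<bar>x - c\<bar> powr \<beta>) ^ n"
  proof -
    have "0 < (\<kappa> * \<bar>x - c\<bar> powr \<beta>) ^ n" using pos by (rule zero_less_power)
    moreover have "(\<kappa> * \<bar>x - c\<bar> powr \<beta>) ^ n \<le> \<bar>T1 x\<bar> ^ n"
      using pos adm_bounds(2)[OF x] by (intro power_mono) auto
    ultimately show ?thesis by (intro divide_left_mono mult_pos_pos) linarith+
  qed
  also have "(\<kappa> * \<bar>x - c\<bar> powr \<beta>) ^ n = \<kappa> ^ n * \<bar>x - c\<bar> powr (real n * \<beta>)"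
    using d by (simp add: power_mult_distrib powr_realpow powr_powr mult.commute flip: powr_realpow)
  also have "1 / \<dots> = (1 / \<kappa> ^ n) * \<bar>x - c\<bar> powr (- (real n * \<beta>))"
    by (simp add: powr_minus_divide)
  finally show ?thesis .
qed

lemma G_bound: "x \<in> {0..1} \<Longrightarrow> \<bar>G x\<bar> \<le> 1 / \<theta>"
  using adm_bounds(1)[of x] \<theta>1 by (cases "x = c") (auto simp: G_def intro!: divide_left_mono mult_pos_pos)

lemma quot_bound:
  assumes x: "x \<in> {0..1} - {c}" and a: "\<bar>a\<bar> \<le> l * \<bar>x - c\<bar> powr s"
  shows "\<bar>a / (T1 x) ^ n\<bar> \<le> (l / \<kappa> ^ n) * \<bar>x - c\<bar> powr (s - real n * \<beta>)"
proof -
  have "\<bar>a / (T1 x) ^ n\<bar> = \<bar>a\<bar> * (1 / \<bar>T1 x\<bar> ^ n)" by (simp add: abs_divide power_abs)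
  also have "\<dots> \<le> (l * \<bar>x - c\<bar> powr s) * ((1 / \<kappa> ^ n) * \<bar>x - c\<bar> powr (- (real n * \<beta>)))"
    using a by (intro mult_mono inv_bound x order_trans[OF abs_ge_zero a]) auto
  also have "\<dots> = (l / \<kappa> ^ n) * (\<bar>x - c\<bar> powr s * \<bar>x - c\<bar> powr (- (real n * \<beta>)))" by simp
  also have "\<dots> = (l / \<kappa> ^ n) * \<bar>x - c\<bar> powr (s - real n * \<beta>)" by (simp flip: powr_add)
  finally show ?thesis .
qed

lemma K0_ge: "L / \<kappa>^2 \<le> K0" "L / \<kappa>^3 \<le> K0" "L / \<kappa>^3 + 3 * (L / \<kappa>^2)^2 \<le> K0"
proof -
  have "0 \<le> L / \<kappa>^2" "0 \<le> L / \<kappa>^3" "0 \<le> (L / \<kappa>^2)^2" using L0 \<kappa>0 by auto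
  then show "L / \<kappa>^2 \<le> K0" "L / \<kappa>^3 \<le> K0" "L / \<kappa>^3 + 3 * (L / \<kappa>^2)^2 \<le> K0"
    unfolding K0_def by linarith+
qed

lemma G1_bound: assumes "x \<in> {0..1} - {c}" shows "\<bar>G1 x\<bar> \<le> K0 * wgt x"
proof -
  have "\<bar>G1 x\<bar> \<le> (L / \<kappa>^2) * \<bar>x - c\<bar> powr ((\<beta> - 1) - real 2 * \<beta>)"
    unfolding G1_def by (rule quot_bound[OF assms]) (use adm_bounds(4)[OF assms] in simp)
  also have "(\<beta> - 1) - real 2 * \<beta> = -1 - \<beta>" by simp
  also have "(L / \<kappa>^2) * \<bar>x - c\<bar> powr (-1 - \<beta>) \<le> K0 * \<bar>x - c\<bar> powr (-1 - \<beta>)"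
    using K0_ge by (intro mult_right_mono) auto
  finally show ?thesis by (simp add: wgt_def)
qed

lemma GG_bound': assumes "x \<in> {0..1} - {c}" shows "\<bar>GG x\<bar> \<le> K0 * \<bar>x - c\<bar> powr (-1 - 2 * \<beta>)"
proof -
  have "\<bar>GG x\<bar> \<le> (L / \<kappa>^3) * \<bar>x - c\<bar> powr ((\<beta> - 1) - real 3 * \<beta>)"
    unfolding GG_def using assms quot_bound[OF assms, of "- T2 x" L "\<beta> - 1" 3] adm_bounds(4)[OF assms] by auto
  also have "(\<beta> - 1) - real 3 * \<beta> = -1 - 2 * \<beta>" by simp
  also have "(L / \<kappa>^3) * \<bar>x - c\<bar> powr (-1 - 2 * \<beta>) \<le> K0 * \<bar>x - c\<bar> powr (-1 - 2 * \<beta>)"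
    using K0_ge by (intro mult_right_mono) auto
  finally show ?thesis .
qed

lemma GG_bound: assumes "x \<in> {0..1}" shows "\<bar>GG x\<bar> \<le> K0"
proof (cases "x = c")
  case False
  have "\<bar>x - c\<bar> powr (-1 - 2 * \<beta>) \<le> 1"
    using assms c01 beta_half by (intro powr_le1) auto
  then have "K0 * \<bar>x - c\<bar> powr (-1 - 2 * \<beta>) \<le> K0 * 1" by (intro mult_left_mono K0_nonneg)
  then show ?thesis using GG_bound'[of x] assms False by auto
qed (simp add: GG_def K0_nonneg)

text \<open>Both terms have the same order at c: T''' / T'^3 has exponent (\<beta> - 2) - 3 \<beta>,
  and the other term is the square of T'' / T'^2, hence of order \<open>wgt\<close> squared.\<close>

lemma H2_bound: assumes "x \<in> {0..1} - {c}" shows "\<bar>H2 x\<bar> \<le> K0 * (wgt x)^2"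
proof -
  have d: "0 < \<bar>x - c\<bar>" using assms by auto
  have w: "(wgt x)^2 = \<bar>x - c\<bar> powr (-2 - 2 * \<beta>)"
    by (simp add: wgt_def power2_eq_square flip: powr_add)
  have 1: "\<bar>- T3 x / (T1 x)^3\<bar> \<le> (L / \<kappa>^3) * \<bar>x - c\<bar> powr ((\<beta> - 2) - real 3 * \<beta>)"
    by (rule quot_bound[OF assms]) (use adm_bounds(5)[OF assms] in simp)
  have "\<bar>- T2 x / (T1 x)^2\<bar> \<le> (L / \<kappa>^2) * wgt x"
  proof -
    have "(\<beta> - 1) - real 2 * \<beta> = -1 - \<beta>" by simp
    with quot_bound[OF assms, of "- T2 x" L "\<beta> - 1" 2] adm_bounds(4)[OF assms] show ?thesis
      by (simp only: wgt_def abs_minus_cancel)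
  qed
  then have "\<bar>- T2 x / (T1 x)^2\<bar>^2 \<le> ((L / \<kappa>^2) * wgt x)^2" by (intro power_mono) auto
  moreover have "(T2 x)^2 / (T1 x)^4 = \<bar>- T2 x / (T1 x)^2\<bar>^2"
    by (simp add: power_divide flip: power_mult)
  ultimately have 2: "(T2 x)^2 / (T1 x)^4 \<le> (L / \<kappa>^2)^2 * (wgt x)^2" by (simp only: power_mult_distrib)
  have "\<bar>H2 x\<bar> \<le> \<bar>- T3 x / (T1 x)^3\<bar> + 3 * ((T2 x)^2 / (T1 x)^4)"
    unfolding H2_def by (rule order_trans[OF abs_triangle_ineq]) (simp add: abs_mult)
  also have "\<dots> \<le> (L / \<kappa>^3) * (wgt x)^2 + 3 * ((L / \<kappa>^2)^2 * (wgt x)^2)"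
  proof (intro add_mono mult_left_mono 2)
    have "(\<beta> - 2) - real 3 * \<beta> = -2 - 2 * \<beta>" by simp
    with 1 show "\<bar>- T3 x / (T1 x)^3\<bar> \<le> (L / \<kappa>^3) * (wgt x)^2" by (simp only: w)
  qed simp
  also have "\<dots> = (L / \<kappa>^3 + 3 * (L / \<kappa>^2)^2) * (wgt x)^2" by (simp add: algebra_simps)
  also have "\<dots> \<le> K0 * (wgt x)^2" using K0_ge by (intro mult_right_mono) auto
  finally show ?thesis .
qed

lemma G_cont: "continuous_on {0..1} G"
proof (rule continuous_on_patch[where e = "- \<beta>" and M = "1 / \<kappa>"])
  have "continuous_on ({0..1} - {c}) (\<lambda>x. 1 / T1 x)" using adm_nz by (intro continuous_intros adm_cont) auto
  then show "continuous_on ({0..1} - {c}) G" by (rule continuous_on_cong[THEN iffD1, rotated 2]) (auto simp: G_def)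
  show "\<bar>G x\<bar> \<le> 1 / \<kappa> * \<bar>x - c\<bar> powr - \<beta>" if "x \<in> {0..1} - {c}" for x
    using inv_bound[OF that, of 1] that by (simp add: G_def)
qed (use beta_half in \<open>auto simp: G_def\<close>)

lemma GG_cont: "continuous_on {0..1} GG"
proof (rule continuous_on_patch[where e = "-1 - 2 * \<beta>" and M = K0])
  have "continuous_on ({0..1} - {c}) (\<lambda>x. - T2 x / (T1 x)^3)" using adm_nz by (intro continuous_intros adm_cont) auto
  then show "continuous_on ({0..1} - {c}) GG" by (rule continuous_on_cong[THEN iffD1, rotated 2]) (auto simp: GG_def)
qed (use beta_half GG_bound' in \<open>auto simp: GG_def\<close>)

lemma G_deriv: assumes x: "x \<in> {0<..<1} - {c}" shows "(G has_real_derivative G1 x) (at x)"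
proof -
  have "T1 x \<noteq> 0" using adm_nz[of x] x by auto
  then have "((\<lambda>x. 1 / T1 x) has_real_derivative G1 x) (at x)"
    by (auto intro!: derivative_eq_intros adm_derivs_int[OF x] simp: G1_def power2_eq_square)
  moreover have "\<forall>\<^sub>F y in nhds x. y \<in> - {c}" using x by (intro eventually_nhds_in_open) auto
  then have "\<forall>\<^sub>F y in nhds x. 1 / T1 y = G y" by eventually_elim (simp add: G_def)
  ultimately show ?thesis by (subst (asm) DERIV_cong_ev[OF refl _ refl]) auto
qed

lemma GG_deriv: assumes x: "x \<in> {0<..<1} - {c}" shows "(GG has_real_derivative H2 x) (at x)"
proof -
  have nz: "T1 x \<noteq> 0" using adm_nz[of x] x by auto
  have "((\<lambda>x. - T2 x / (T1 x)^3) has_real_derivative (- T3 x * (T1 x)^3 - (- T2 x) * (real 3 * (T2 x * (T1 x)^(3 - Suc 0)))) / ((T1 x)^3 * (T1 x)^3)) (at x)"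
    using nz by (intro DERIV_divide DERIV_minus DERIV_power adm_derivs_int[OF x]) auto
  moreover have "(- T3 x * (T1 x)^3 - (- T2 x) * (real 3 * (T2 x * (T1 x)^(3 - Suc 0)))) / ((T1 x)^3 * (T1 x)^3) = H2 x"
    using nz by (simp add: H2_def field_simps power2_eq_square power3_eq_cube power4_eq_xxxx)
  ultimately have "((\<lambda>x. - T2 x / (T1 x)^3) has_real_derivative H2 x) (at x)" by simp
  moreover have "\<forall>\<^sub>F y in nhds x. y \<in> - {c}" using x by (intro eventually_nhds_in_open) auto
  then have "\<forall>\<^sub>F y in nhds x. - T2 y / (T1 y)^3 = GG y" by eventually_elim (simp add: GG_def)
  ultimately show ?thesis by (subst (asm) DERIV_cong_ev[OF refl _ refl]) auto
qed

lemma GG_eq: "x \<noteq> c \<Longrightarrow> GG x = G x * G1 x"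
  by (simp add: GG_def G_def G1_def power2_eq_square power3_eq_cube)

lemma AE_mu_S: "AE x in \<mu>. x \<in> {0..1} - {c}"
  using AE_mu_neq[of c] AE_space[of \<mu>] by eventually_elim simp

lemma G1_measurable [measurable]: "G1 \<in> borel_measurable \<mu>"
  unfolding G1_def using adm_nz by (intro borel_measurable_mu_continuous_off[where c = c] continuous_intros adm_cont) auto

lemma H2_measurable [measurable]: "H2 \<in> borel_measurable \<mu>"
  unfolding H2_def using adm_nz by (intro borel_measurable_mu_continuous_off[where c = c] continuous_intros adm_cont) auto

lemma G_measurable [measurable]: "G \<in> borel_measurable \<mu>" and GG_measurable [measurable]: "GG \<in> borel_measurable \<mu>"
  by (intro continuous_imp_borel_mu G_cont GG_cont)+

lemma G1_integrable: "integrable \<mu> G1"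
proof (rule Bochner_Integration.integrable_bound[OF _ G1_measurable])
  show "integrable \<mu> (\<lambda>x. K0 * wgt x)" using wgt_integrable by simp
  show "AE x in \<mu>. norm (G1 x) \<le> norm (K0 * wgt x)"
    using AE_mu_S by eventually_elim (use G1_bound K0_nonneg in \<open>simp add: abs_mult\<close>)
qed

lemma H2_integrable: "integrable \<mu> H2"
proof (rule Bochner_Integration.integrable_bound[OF _ H2_measurable])
  show "integrable \<mu> (\<lambda>x. K0 * (wgt x)^2)"
    using Lp_integrable(1)[OF _ wgt_sq_Lp] p1 by simp
  show "AE x in \<mu>. norm (H2 x) \<le> norm (K0 * (wgt x)^2)"
    using AE_mu_S by eventually_elim (use H2_bound K0_nonneg in \<open>simp add: abs_mult\<close>)
qed

text \<open>By duality the integral of \<phi>' against P f is that of (\<phi>' o T) f, which is that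
  of (\<phi> o T)' times G f. The composition \<phi> o T vanishes at 0 and at 1, since T sends both
  to 0. Differentiability is asked of G f rather than of f, so that the lemma applies again to the
  first derivative, where only the product with G is controlled.\<close>

lemma transfer_weak_deriv:
  fixes f v :: "real \<Rightarrow> real"
  assumes f: "integrable \<mu> f" and w: "weak_deriv (\<lambda>x. G x * f x) v"
  shows "weak_deriv (transfer T f) (transfer T v)"
  unfolding weak_deriv_def
proof (intro conjI allI impI)
  note ns = adm_nonsingular
  have v: "integrable \<mu> v" using w by (rule weak_derivD)
  show "integrable \<mu> (transfer T f)" "integrable \<mu> (transfer T v)" by (intro transfer_integrable ns f v)+
  fix \<phi> assume t: "test_fun \<phi>"
  note t' = test_fun_deriv[OF t]
  have Linf: "\<phi> \<in> Linf_space" if "test_fun \<phi>" for \<phi>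
    using test_fun_bounded[OF that] test_fun_borel[OF that] by (auto simp: Linf_space_def)
  obtain a where a: "a \<in> {0..1}" "(T \<longlongrightarrow> a) (at c)" using A by (auto simp: adm_def)
  \<comment> \<open>The continuous version of the map: T has a common two-sided limit at c but an
    arbitrary value there. It agrees with T a.e., so the integrals do not change.\<close>
  define S where "S x = (if x = c then a else T x)" for x
  have S_eq: "S x = T x" if "x \<noteq> c" for x using that by (simp add: S_def)
  have Scont: "continuous_on {0..1} S"
    unfolding continuous_on_eq_continuous_within
  proof
    fix x :: real assume x: "x \<in> {0..1}"
    show "continuous (at x within {0..1}) S"
    proof (cases "x = c")
      case True
      have "(S \<longlongrightarrow> a) (at c)"
        using a(2) by (rule Lim_transform_eventually) (auto simp: S_def eventually_at_filter)
      then show ?thesis using True by (auto simp: continuous_within S_def intro: tendsto_within_subset)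
    next
      case False
      have "continuous (at x within {0..1} - {c}) T"
        using adm_cont(1) x False by (auto simp: continuous_on_eq_continuous_within)
      moreover have "at x within {0..1} - {c} = at x within {0..1}"
        using False at_within_nhd[of x "- {c}" "{0..1} - {c}" "{0..1}"] by (auto simp: Diff_eq)
      ultimately have "(T \<longlongrightarrow> T x) (at x within {0..1})" by (simp add: continuous_within)
      moreover have "\<forall>\<^sub>F y in at x within {0..1}. T y = S y"
      proof -
        have "\<forall>\<^sub>F y in nhds x. y \<in> - {c}" using False by (intro eventually_nhds_in_open) auto
        then show ?thesis unfolding eventually_at_filter by eventually_elim (simp add: S_def)
      qed
      ultimately have "(S \<longlongrightarrow> T x) (at x within {0..1})" by (rule Lim_transform_eventually)
      then show ?thesis using S_eq[OF False] by (simp add: continuous_within)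
    qed
  qed
  have Sder: "(S has_real_derivative T1 x) (at x)" if x: "x \<in> {0<..<1} - {c}" for x
  proof -
    have "\<forall>\<^sub>F y in nhds x. y \<in> - {c}" using x by (intro eventually_nhds_in_open) auto
    then have "\<forall>\<^sub>F y in nhds x. T y = S y" by eventually_elim (simp add: S_def)
    then show ?thesis using adm_derivs_int(1)[OF x] by (subst (asm) DERIV_cong_ev[OF refl _ refl]) auto
  qed
  have T1m: "T1 \<in> borel_measurable \<mu>" by (rule borel_measurable_mu_continuous_off[OF adm_cont(2)])
  have T1i: "integrable \<mu> T1"
  proof (rule Bochner_Integration.integrable_bound[OF _ T1m])
    show "integrable \<mu> (\<lambda>x. L * \<bar>x - c\<bar> powr \<beta>)" using integrable_mu_abs_powr[OF \<beta>1, of c] by simp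
    show "AE x in \<mu>. norm (T1 x) \<le> norm (L * \<bar>x - c\<bar> powr \<beta>)"
      using AE_mu_S by eventually_elim (use adm_bounds(3) L0 in \<open>simp add: abs_mult\<close>)
  qed
  obtain B where B: "\<And>x. \<bar>deriv \<phi> x\<bar> \<le> B" using test_fun_bounded[OF t'] by blast
  have parts: "(\<integral>x. (deriv \<phi> (S x) * T1 x) *\<^sub>R (G x * f x) \<partial>\<mu>) = - (\<integral>x. \<phi> (S x) *\<^sub>R v x \<partial>\<mu>)"
  proof (rule weak_deriv_parts[OF w, where K = "{c}"])
    show "continuous_on {0..1} (\<lambda>x. \<phi> (S x))"
      using continuous_on_compose2[OF test_fun_continuous[OF t, of UNIV] Scont] by simp
    show "((\<lambda>x. \<phi> (S x)) has_real_derivative deriv \<phi> (S x) * T1 x) (at x)" if "x \<in> {0<..<1} - {c}" for x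
      by (rule DERIV_chain2[OF test_fun_differentiable[OF t] Sder[OF that]])
    have "continuous_on {0..1} (\<lambda>x. deriv \<phi> (S x))"
      using continuous_on_compose2[OF test_fun_continuous[OF t', of UNIV] Scont] by simp
    then have "integrable \<mu> (\<lambda>x. deriv \<phi> (S x) *\<^sub>R T1 x)"
      using B by (intro integrable_mu_scaleR_bounded[OF T1i, where B = B] continuous_imp_borel_mu) auto
    then show "integrable \<mu> (\<lambda>x. deriv \<phi> (S x) * T1 x)" by simp
    show "\<phi> (S 0) = 0" "\<phi> (S 1) = 0"
      using A c01 test_fun_0[OF t, of 0] by (auto simp: S_def adm_def)
  qed simp
  have Gf: "integrable \<mu> (\<lambda>x. G x * f x)" using w by (rule weak_derivD)
  have "(\<integral>x. deriv \<phi> x *\<^sub>R transfer T f x \<partial>\<mu>) = (\<integral>x. f x * deriv \<phi> (T x) \<partial>\<mu>)"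
    using transfer_duality[OF ns f Linf[OF t']] by (simp add: mult.commute)
  also have "\<dots> = (\<integral>x. (deriv \<phi> (S x) * T1 x) *\<^sub>R (G x * f x) \<partial>\<mu>)"
  proof (rule integral_cong_AE)
    show "AE x in \<mu>. f x * deriv \<phi> (T x) = (deriv \<phi> (S x) * T1 x) *\<^sub>R (G x * f x)"
      using AE_mu_S by eventually_elim (use adm_nz in \<open>simp add: S_eq G_def\<close>)
    show "(\<lambda>x. f x * deriv \<phi> (T x)) \<in> borel_measurable \<mu>"
      by (rule borel_measurable_integrable[OF Linf_mult_integrable[OF f Linf_comp[OF ns Linf[OF t']]]])
    have "(\<lambda>x. deriv \<phi> (S x)) \<in> borel_measurable \<mu>"
      using continuous_on_compose2[OF test_fun_continuous[OF t', of UNIV] Scont] by (intro continuous_imp_borel_mu) simp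
    then show "(\<lambda>x. (deriv \<phi> (S x) * T1 x) *\<^sub>R (G x * f x)) \<in> borel_measurable \<mu>"
      using T1m Gf by simp
  qed
  also have "\<dots> = - (\<integral>x. \<phi> (S x) *\<^sub>R v x \<partial>\<mu>)" by (rule parts)
  also have "(\<integral>x. \<phi> (S x) *\<^sub>R v x \<partial>\<mu>) = (\<integral>x. v x * \<phi> (T x) \<partial>\<mu>)"
  proof (rule integral_cong_AE)
    show "AE x in \<mu>. \<phi> (S x) *\<^sub>R v x = v x * \<phi> (T x)"
      using AE_mu_neq[of c] by eventually_elim (simp add: S_eq)
    show "(\<lambda>x. v x * \<phi> (T x)) \<in> borel_measurable \<mu>"
      by (rule borel_measurable_integrable[OF Linf_mult_integrable[OF v Linf_comp[OF ns Linf[OF t]]]])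
    have "(\<lambda>x. \<phi> (S x)) \<in> borel_measurable \<mu>"
      using continuous_on_compose2[OF test_fun_continuous[OF t, of UNIV] Scont] by (intro continuous_imp_borel_mu) simp
    then show "(\<lambda>x. \<phi> (S x) *\<^sub>R v x) \<in> borel_measurable \<mu>" using v by simp
  qed
  also have "\<dots> = (\<integral>x. \<phi> x *\<^sub>R transfer T v x \<partial>\<mu>)"
    using transfer_duality[OF ns v Linf[OF t]] by (simp add: mult.commute)
  finally show "(\<integral>x. deriv \<phi> x *\<^sub>R transfer T f x \<partial>\<mu>) = - (\<integral>x. \<phi> x *\<^sub>R transfer T v x \<partial>\<mu>)" .
qed

lemma weak_deriv_G:
  "weak_deriv f f' \<Longrightarrow> weak_deriv (\<lambda>x. G x * f x) (\<lambda>x. G1 x * f x + G x * f' x)"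
  by (rule weak_deriv_mult[OF _ G_cont G_deriv G1_integrable])

lemma transfer_deriv1:
  "weak_deriv f f' \<Longrightarrow> weak_deriv (transfer T f) (transfer T (\<lambda>x. G1 x * f x + G x * f' x))"
  by (intro transfer_weak_deriv weak_deriv_G) (rule weak_derivD)

text \<open>G times the first derivative is (G G') f + G^2 f'. The coefficient 3 of G G' f' collects
  one term from differentiating the first summand and two from differentiating G^2 in the
  second.\<close>

lemma transfer_deriv2:
  assumes f: "weak_deriv f f'" and f': "weak_deriv f' f''"
  shows "weak_deriv (transfer T (\<lambda>x. G1 x * f x + G x * f' x))
    (transfer T (\<lambda>x. H2 x * f x + 3 * (GG x * f' x) + (G x)^2 * f'' x))"
proof (rule transfer_weak_deriv)
  show "integrable \<mu> (\<lambda>x. G1 x * f x + G x * f' x)" using weak_deriv_G[OF f] by (rule weak_derivD)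
  have 1: "weak_deriv (\<lambda>x. GG x * f x) (\<lambda>x. H2 x * f x + GG x * f' x)"
    by (rule weak_deriv_mult[OF f GG_cont GG_deriv H2_integrable])
  have GGi: "integrable \<mu> (\<lambda>x. 2 * GG x)" by (intro continuous_imp_integrable_mu continuous_intros GG_cont)
  have 2: "weak_deriv (\<lambda>x. (G x)^2 * f' x) (\<lambda>x. (2 * GG x) * f' x + (G x)^2 * f'' x)"
  proof (rule weak_deriv_mult[OF f', where c = c])
    show "continuous_on {0..1} (\<lambda>x. (G x)^2)" by (intro continuous_intros G_cont)
    show "((\<lambda>x. (G x)^2) has_real_derivative 2 * GG x) (at x)" if "x \<in> {0<..<1} - {c}" for x
      using that by (auto intro!: derivative_eq_intros G_deriv simp: GG_eq)
  qed (rule GGi)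
  show "weak_deriv (\<lambda>x. G x * (G1 x * f x + G x * f' x)) (\<lambda>x. H2 x * f x + 3 * (GG x * f' x) + (G x)^2 * f'' x)"
  proof (rule weak_deriv_ae_cong[OF weak_deriv_add[OF 1 2]])
    show "ae_eq (\<lambda>x. GG x * f x + (G x)^2 * f' x) (\<lambda>x. G x * (G1 x * f x + G x * f' x))"
      unfolding ae_eq_def using AE_mu_neq[of c] by eventually_elim (simp add: GG_eq algebra_simps power2_eq_square)
    show "ae_eq (\<lambda>x. H2 x * f x + GG x * f' x + (2 * GG x * f' x + (G x)^2 * f'' x)) (\<lambda>x. H2 x * f x + 3 * (GG x * f' x) + (G x)^2 * f'' x)"
      by (simp add: ae_eq_def algebra_simps)
  qed
qed

end

end

section \<open>Uniform Lasota--Yorke inequalities\<close>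

lemma Linf_bounded:
  fixes g :: "real \<Rightarrow> real"
  assumes "g \<in> borel_measurable \<mu>" "\<And>x. \<bar>g x\<bar> \<le> B"
  shows "g \<in> Linf_space"
  using assms by (auto simp: Linf_space_def)

text \<open>Duality and Young's inequality replace interpolation: the bound on P^n 1 gives
  \<integral> g o T^n = \<integral> g P^n 1 <= M \<integral> g for nonnegative g, and g is taken to
  be the extremal function of Hoelder's inequality for v = P^n u.\<close>

lemma funpow_transfer_Lp:
  fixes u :: "real \<Rightarrow> real"
  assumes T: "nonsingular T" and p: "1 < p" and M1: "1 \<le> M"
    and M: "AE x in \<mu>. (transfer T ^^ n) (\<lambda>x. 1) x \<le> M" and u: "u \<in> Lp_space p"
  shows "(transfer T ^^ n) u \<in> Lp_space p" "Lp_norm p ((transfer T ^^ n) u) \<le> M * Lp_norm p u"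
proof -
  define v where "v = (transfer T ^^ n) u"
  define q where "q = p / (p - 1)"
  have q: "1 < q" "1 / p + 1 / q = 1" "(p - 1) * q = p" using p by (auto simp: q_def field_simps)
  have ui: "integrable \<mu> u" using Lp_integrable(1)[OF _ u] p by simp
  have up: "integrable \<mu> (\<lambda>x. \<bar>u x\<bar> powr p)" using u by (simp add: Lp_space_def)
  have vi: "integrable \<mu> v" unfolding v_def by (rule funpow_transfer_integrable[OF T ui])
  then have vm [measurable]: "v \<in> borel_measurable \<mu>" by auto
  \<comment> \<open>Truncation: v is so far known only to be integrable, and absorbing its p-th
    moment into the left side requires that moment to be finite. Fatou removes the truncation at the
    end.\<close>
  define \<nu> where "\<nu> k x = min \<bar>v x\<bar> (real k)" for k x
  have \<nu>b: "0 \<le> \<nu> k x" "\<nu> k x \<le> real k" for k x by (auto simp: \<nu>_def)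
  have \<nu>m [measurable]: "\<nu> k \<in> borel_measurable \<mu>" for k unfolding \<nu>_def by measurable
  have kb: "\<nu> k \<in> Lp_space p" for k
    using p \<nu>b by (intro Lp_bounded(1)[where B = "real k"]) auto
  have "Lp_norm p (\<nu> k) \<le> M * Lp_norm p u" for k
  proof -
    \<comment> \<open>The test function dual to the truncated v: its q-th power is
      \<open>\<nu> k x powr p\<close>, and v times it dominates the same quantity.\<close>
    define g where "g x = sgn (v x) * \<nu> k x powr (p - 1)" for x
    have gm [measurable]: "g \<in> borel_measurable \<mu>" unfolding g_def by measurable
    have gb: "\<bar>g x\<bar> \<le> real k powr (p - 1)" for x
      using \<nu>b[of k x] p by (auto simp: g_def abs_mult sgn_real_def intro: powr_mono2)
    have gL: "g \<in> Linf_space" by (rule Linf_bounded[OF gm gb])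
    have gq: "\<bar>g x\<bar> powr q = \<nu> k x powr p" for x
    proof (cases "v x = 0")
      case True then show ?thesis using p by (simp add: g_def \<nu>_def)
    next
      case False
      then have "\<bar>g x\<bar> = \<nu> k x powr (p - 1)" by (simp add: g_def abs_mult sgn_real_def)
      then show ?thesis using q by (simp add: powr_powr)
    qed
    define I where "I = (\<integral>x. \<nu> k x powr p \<partial>\<mu>)"
    have \<nu>p: "integrable \<mu> (\<lambda>x. \<nu> k x powr p)" using kb[of k] \<nu>b by (simp add: Lp_space_def)
    have Ti: "nonsingular (T ^^ n)" by (rule nonsingular_funpow[OF T])
    have pL: "(\<lambda>x. \<nu> k x powr p) \<in> Linf_space"
      using \<nu>b p by (intro Linf_bounded[where B = "real k powr p"]) (auto intro: powr_mono2)
    have comp: "integrable \<mu> (\<lambda>x. \<nu> k ((T ^^ n) x) powr p)"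
      using Linf_mult_integrable[OF _ Linf_comp[OF Ti pL], of "\<lambda>x. 1"] by simp
    have cb: "(\<integral>x. \<nu> k ((T ^^ n) x) powr p \<partial>\<mu>) \<le> M * I"
    proof -
      have "(\<integral>x. \<nu> k ((T ^^ n) x) powr p \<partial>\<mu>) = (\<integral>x. (transfer T ^^ n) (\<lambda>x. 1) x * \<nu> k x powr p \<partial>\<mu>)"
        using funpow_transfer_duality[OF T _ pL, of "\<lambda>x. 1" n] by simp
      also have "\<dots> \<le> (\<integral>x. M * \<nu> k x powr p \<partial>\<mu>)"
      proof (rule integral_mono_AE)
        show "integrable \<mu> (\<lambda>x. (transfer T ^^ n) (\<lambda>x. 1) x * \<nu> k x powr p)"
          by (intro Linf_mult_integrable pL funpow_transfer_integrable[OF T]) simp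
        show "AE x in \<mu>. (transfer T ^^ n) (\<lambda>x. 1) x * \<nu> k x powr p \<le> M * \<nu> k x powr p"
          using M by eventually_elim (auto intro: mult_right_mono)
      qed (use \<nu>p in auto)
      finally show ?thesis by (simp add: I_def)
    qed
    define l where "l = M powr (1 / q)"
    have l: "0 < l" "l powr q = M" using M1 q by (auto simp: l_def powr_powr)
    \<comment> \<open>Young's inequality with \<open>l\<close> chosen so that the second term is absorbed into the left-hand side\<close>
    have young: "u x * g y \<le> l powr p / p * \<bar>u x\<bar> powr p + (1 / (M * q)) * \<nu> k y powr p" for x y
    proof -
      have "u x * g y \<le> (l * \<bar>u x\<bar>) * (\<bar>g y\<bar> / l)"
        using l abs_ge_self[of "u x * g y"] by (simp add: abs_mult)
      also have "\<dots> \<le> (l * \<bar>u x\<bar>) powr p / p + (\<bar>g y\<bar> / l) powr q / q"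
        using p q l by (intro Youngs_inequality) auto
      also have "\<dots> = l powr p / p * \<bar>u x\<bar> powr p + (1 / (M * q)) * \<nu> k y powr p"
        using l by (simp add: powr_mult powr_divide gq)
      finally show ?thesis .
    qed
    have "I \<le> (\<integral>x. v x * g x \<partial>\<mu>)"
      unfolding I_def
    proof (rule integral_mono[OF \<nu>p Linf_mult_integrable[OF vi gL]])
      fix x
      have "\<nu> k x powr p \<le> \<bar>v x\<bar> * \<nu> k x powr (p - 1)"
      proof (cases "\<nu> k x = 0")
        case False
        then have "0 < \<nu> k x" using \<nu>b[of k x] by simp
        then have "\<nu> k x powr p = \<nu> k x * \<nu> k x powr (p - 1)" by (simp add: powr_mult_base)
        also have "\<dots> \<le> \<bar>v x\<bar> * \<nu> k x powr (p - 1)" by (intro mult_right_mono) (auto simp: \<nu>_def)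
        finally show ?thesis .
      qed (use p in simp)
      also have "\<dots> = v x * g x" by (auto simp: g_def sgn_real_def)
      finally show "\<nu> k x powr p \<le> v x * g x" .
    qed
    also have "\<dots> = (\<integral>x. u x * g ((T ^^ n) x) \<partial>\<mu>)"
      unfolding v_def by (rule funpow_transfer_duality[OF T ui gL])
    also have "\<dots> \<le> (\<integral>x. l powr p / p * \<bar>u x\<bar> powr p + (1 / (M * q)) * \<nu> k ((T ^^ n) x) powr p \<partial>\<mu>)"
      using up comp by (intro integral_mono Linf_mult_integrable ui Linf_comp[OF Ti gL] young) auto
    also have "\<dots> = l powr p / p * (\<integral>x. \<bar>u x\<bar> powr p \<partial>\<mu>) + (1 / (M * q)) * (\<integral>x. \<nu> k ((T ^^ n) x) powr p \<partial>\<mu>)"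
      using up comp by simp
    also have "\<dots> \<le> l powr p / p * (\<integral>x. \<bar>u x\<bar> powr p \<partial>\<mu>) + (1 / (M * q)) * (M * I)"
      using M1 q by (intro add_left_mono mult_left_mono cb) auto
    finally have "I \<le> l powr p / p * (\<integral>x. \<bar>u x\<bar> powr p \<partial>\<mu>) + I / q" using M1 by simp
    then have "I * (1 - 1 / q) \<le> l powr p / p * (\<integral>x. \<bar>u x\<bar> powr p \<partial>\<mu>)" by (simp add: algebra_simps)
    moreover have "1 - 1 / q = 1 / p" using q by simp
    ultimately have "I \<le> l powr p * (\<integral>x. \<bar>u x\<bar> powr p \<partial>\<mu>)" using p by (simp add: field_simps)
    also have "(\<integral>x. \<bar>u x\<bar> powr p \<partial>\<mu>) = Lp_norm p u powr p" using p by (simp add: Lp_norm_powr)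
    also have "l powr p \<le> M powr p"
    proof (rule powr_mono2)
      show "l \<le> M" using M1 q powr_mono[of "1/q" 1 M] by (simp add: l_def)
    qed (use p l in auto)
    finally have "I \<le> (M * Lp_norm p u) powr p" using M1 by (simp add: powr_mult mult_right_mono)
    then show ?thesis using p M1 \<nu>b by (intro Lp_norm_leI) (auto simp: I_def)
  qed
  note b = this
  have lim: "AE x in \<mu>. (\<lambda>k. \<nu> k x) \<longlonglongrightarrow> \<bar>v x\<bar>"
  proof (rule AE_I2)
    fix x
    obtain N where N: "\<bar>v x\<bar> \<le> real N" using real_arch_simple by blast
    have "\<forall>\<^sub>F k in sequentially. \<nu> k x = \<bar>v x\<bar>"
      using eventually_ge_at_top[of N] by eventually_elim (use N in \<open>auto simp: \<nu>_def\<close>)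
    then show "(\<lambda>k. \<nu> k x) \<longlonglongrightarrow> \<bar>v x\<bar>" by (rule tendsto_eventually)
  qed
  have F: "(\<lambda>x. \<bar>v x\<bar>) \<in> Lp_space p" "Lp_norm p (\<lambda>x. \<bar>v x\<bar>) \<le> M * Lp_norm p u"
    using Lp_Fatou[OF _ kb b lim] p by auto
  show "(transfer T ^^ n) u \<in> Lp_space p" "Lp_norm p ((transfer T ^^ n) u) \<le> M * Lp_norm p u"
    using Lp_mono[OF _ vm F(1)] F(2) p by (auto simp: v_def)
qed

lemma Lp_abs: "u \<in> Lp_space p \<Longrightarrow> (\<lambda>x. \<bar>u x\<bar> :: real) \<in> Lp_space p" "Lp_norm p (\<lambda>x. \<bar>u x\<bar>) = Lp_norm p u"
  by (auto simp: Lp_space_def Lp_norm_def)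

text \<open>Estimating P in L^p at each step would produce the factor M \<rho>, which need not be
  below 1. The induction instead bounds P^m |D n| for all m simultaneously, so that the operators
  accumulate into one power, estimated once by M, while \<rho> contracts at every step.\<close>

lemma transfer_recurrence_Lp:
  fixes D R :: "nat \<Rightarrow> real \<Rightarrow> real" and y :: "nat \<Rightarrow> real"
  assumes T: "nonsingular T" and p: "1 < p" and M1: "1 \<le> M"
    and M: "\<And>n. AE x in \<mu>. (transfer T ^^ n) (\<lambda>x. 1) x \<le> M"
    and D: "\<And>n. D n \<in> Lp_space p" and R: "\<And>n. R n \<in> Lp_space p" and \<rho>: "0 \<le> \<rho>"
    and rec: "\<And>n. AE x in \<mu>. \<bar>D (Suc n) x\<bar> \<le> transfer T (\<lambda>x. \<rho> * \<bar>D n x\<bar> + \<bar>R n x\<bar>) x"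
    and y: "Lp_norm p (D 0) \<le> y 0" "\<And>n. \<rho> * y n + Lp_norm p (R n) \<le> y (Suc n)"
  shows "Lp_norm p (D n) \<le> M * y n"
proof -
  note P = funpow_transfer_Lp[OF T p M1 M]
  have p1: "1 \<le> p" using p by simp
  have Di: "integrable \<mu> (\<lambda>x. \<bar>D n x\<bar>)" and Ri: "integrable \<mu> (\<lambda>x. \<bar>R n x\<bar>)" for n
    using Lp_integrable(1)[OF p1 D] Lp_integrable(1)[OF p1 R] by auto
  have "\<forall>m. Lp_norm p ((transfer T ^^ m) (\<lambda>x. \<bar>D n x\<bar>)) \<le> M * y n"
  proof (induction n)
    case 0
    show ?case
    proof
      fix m
      have "Lp_norm p ((transfer T ^^ m) (\<lambda>x. \<bar>D 0 x\<bar>)) \<le> M * Lp_norm p (D 0)"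
        using P(2)[OF Lp_abs(1)[OF D]] by (simp add: Lp_abs)
      also have "\<dots> \<le> M * y 0" using y M1 by (intro mult_left_mono) auto
      finally show "Lp_norm p ((transfer T ^^ m) (\<lambda>x. \<bar>D 0 x\<bar>)) \<le> M * y 0" .
    qed
  next
    case (Suc n)
    show ?case
    proof
      fix m
      let ?A = "(transfer T ^^ Suc m) (\<lambda>x. \<bar>D n x\<bar>)" and ?B = "(transfer T ^^ Suc m) (\<lambda>x. \<bar>R n x\<bar>)"
      let ?f = "\<lambda>x. \<rho> * \<bar>D n x\<bar> + \<bar>R n x\<bar>"
      have fi: "integrable \<mu> ?f" using Di Ri by auto
      have "AE x in \<mu>. \<bar>(transfer T ^^ m) (\<lambda>x. \<bar>D (Suc n) x\<bar>) x\<bar> \<le> (transfer T ^^ m) (transfer T ?f) x"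
        using rec[of n] by (intro funpow_transfer_abs T Di transfer_integrable fi) auto
      moreover have "(transfer T ^^ m) (transfer T ?f) = (transfer T ^^ Suc m) ?f"
        by (simp only: funpow_Suc_right comp_apply)
      ultimately have a: "AE x in \<mu>. \<bar>(transfer T ^^ m) (\<lambda>x. \<bar>D (Suc n) x\<bar>) x\<bar> \<le> (transfer T ^^ Suc m) ?f x"
        by (simp only:)
      have b: "AE x in \<mu>. (transfer T ^^ Suc m) ?f x = (transfer T ^^ Suc m) (\<lambda>x. \<rho> * \<bar>D n x\<bar>) x + ?B x"
        using funpow_transfer_add[OF T, of "\<lambda>x. \<rho> * \<bar>D n x\<bar>" "\<lambda>x. \<bar>R n x\<bar>" "Suc m"] Di Ri by (simp only: ae_eq_def) simp
      have d: "AE x in \<mu>. (transfer T ^^ Suc m) (\<lambda>x. \<rho> * \<bar>D n x\<bar>) x = \<rho> * ?A x"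
        using funpow_transfer_scale[OF T Di] by (simp only: ae_eq_def)
      from a b d have ae: "AE x in \<mu>. \<bar>(transfer T ^^ m) (\<lambda>x. \<bar>D (Suc n) x\<bar>) x\<bar> \<le> \<rho> * ?A x + ?B x"
        by eventually_elim linarith
      have A: "?A \<in> Lp_space p" and B: "?B \<in> Lp_space p" using P(1) Lp_abs(1) D R by blast+
      have lA: "(\<lambda>x. \<rho> * ?A x) \<in> Lp_space p" using Lp_scale(1)[OF _ A] p by simp
      have "Lp_norm p ((transfer T ^^ m) (\<lambda>x. \<bar>D (Suc n) x\<bar>)) \<le> Lp_norm p (\<lambda>x. \<rho> * ?A x + ?B x)"
      proof (rule Lp_mono(2)[OF _ _ Lp_add(1)[OF p1 lA B]])
        show "(transfer T ^^ m) (\<lambda>x. \<bar>D (Suc n) x\<bar>) \<in> borel_measurable \<mu>"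
          using funpow_transfer_integrable[OF T Di] by auto
        show "AE x in \<mu>. norm ((transfer T ^^ m) (\<lambda>x. \<bar>D (Suc n) x\<bar>) x) \<le> norm (\<rho> * ?A x + ?B x)"
          using ae by (rule eventually_mono) (unfold real_norm_def, erule order_trans, rule abs_ge_self)
      qed (use p in simp)
      also have "\<dots> \<le> \<rho> * Lp_norm p ?A + Lp_norm p ?B"
        using Lp_add(2)[OF p1 lA B] Lp_scale(2)[of p \<rho> ?A] p \<rho> by simp
      also have "\<dots> \<le> \<rho> * (M * y n) + M * Lp_norm p (R n)"
      proof (intro add_mono mult_left_mono \<rho>)
        show "Lp_norm p ?A \<le> M * y n" using Suc by blast
        show "Lp_norm p ?B \<le> M * Lp_norm p (R n)"
          using P(2)[OF Lp_abs(1)[OF R[of n]], of "Suc m"] by (simp only: Lp_abs(2))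
      qed
      also have "\<dots> = M * (\<rho> * y n + Lp_norm p (R n))" by (simp add: algebra_simps)
      also have "\<dots> \<le> M * y (Suc n)" using y M1 by (intro mult_left_mono) auto
      finally show "Lp_norm p ((transfer T ^^ m) (\<lambda>x. \<bar>D (Suc n) x\<bar>)) \<le> M * y (Suc n)" .
    qed
  qed
  then have "Lp_norm p ((transfer T ^^ 0) (\<lambda>x. \<bar>D n x\<bar>)) \<le> M * y n" by blast
  then show ?thesis by (simp add: Lp_abs)
qed

context singular_params
begin

section \<open>The inequality in W^{1,1} and the uniform bound on the iterates of 1\<close>

definition admT :: "(real \<Rightarrow> real) \<Rightarrow> bool" where
  "admT T \<longleftrightarrow> (\<exists>T1 T2 T3. adm T T1 T2 T3)"

lemma admT_nonsingular: "admT T \<Longrightarrow> nonsingular T"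
  using adm_nonsingular by (auto simp: admT_def)

text \<open>The midpoint between 1 / \<theta> and 1: half of the gap absorbs the small term from the
  unbounded weight, and the other half keeps the rate below 1.\<close>

definition lam where "lam = (1 + 1 / \<theta>) / 2"

lemma lam: "0 < lam" "lam < 1" "1 / \<theta> < lam"
  using \<theta>1 by (auto simp: lam_def field_simps)

text \<open>The coefficient G' is merely integrable and cannot be estimated by its sup. Its tail, of
  integral at most \<eta>, multiplies the sup of f, hence at most the sum of the norms of f and f';
  this raises the rate from 1 / \<theta> to \<open>lam\<close>.\<close>

lemma Lasota_Yorke_W11:
  "\<exists>C\<ge>0. \<forall>T f f'. admT T \<longrightarrow> weak_deriv f f' \<longrightarrow>
     (\<exists>g. weak_deriv (transfer T f) g \<and> (\<integral>x. \<bar>g x\<bar> \<partial>\<mu>) \<le> lam * (\<integral>x. \<bar>f' x\<bar> \<partial>\<mu>) + C * (\<integral>x. \<bar>f x\<bar> \<partial>\<mu>))"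
proof -
  define \<eta> where "\<eta> = (1 - 1 / \<theta>) / 2"
  have \<eta>: "0 < \<eta>" "1 / \<theta> + \<eta> = lam" using \<theta>1 by (auto simp: \<eta>_def lam_def field_simps)
  have wi: "integrable \<mu> (\<lambda>x. K0 * wgt x)" using wgt_integrable by simp
  obtain B where B: "0 \<le> B" "(\<integral>x. max (K0 * wgt x - B) 0 \<partial>\<mu>) \<le> \<eta>" by (rule integrable_tail[OF wi \<eta>(1)])
  show ?thesis
  proof (intro exI[of _ "B + \<eta>"] conjI allI impI)
    show "0 \<le> B + \<eta>" using B \<eta> by simp
    fix T and f f' :: "real \<Rightarrow> real" assume T: "admT T" and w: "weak_deriv f f'"
    from T obtain T1 T2 T3 where A: "adm T T1 T2 T3" by (auto simp: admT_def)
    let ?v = "\<lambda>x. G1 T1 T2 x * f x + G T1 x * f' x"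
    have fi: "integrable \<mu> f" and fi': "integrable \<mu> f'" using w by (auto dest: weak_derivD)
    have vi: "integrable \<mu> ?v" using weak_deriv_G[OF A w] by (rule weak_derivD)
    let ?S = "(\<integral>x. \<bar>f x\<bar> \<partial>\<mu>) + (\<integral>x. \<bar>f' x\<bar> \<partial>\<mu>)"
    have S: "AE x in \<mu>. \<bar>f x\<bar> \<le> ?S" using weak_deriv_sup_bound[OF w] by simp
    have S0: "0 \<le> ?S" by (intro add_nonneg_nonneg integral_nonneg) auto
    have nn: "\<And>x. 0 \<le> K0 * wgt x" by (simp add: K0_nonneg)
    note tail = integral_mult_tail[OF wi fi S S0 B nn]
    have "(\<integral>x. \<bar>transfer T ?v x\<bar> \<partial>\<mu>) \<le> (\<integral>x. \<bar>?v x\<bar> \<partial>\<mu>)"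
      by (rule transfer_L1[OF adm_nonsingular[OF A] vi])
    also have "\<dots> \<le> (\<integral>x. (K0 * wgt x) * \<bar>f x\<bar> + (1 / \<theta>) * \<bar>f' x\<bar> \<partial>\<mu>)"
    proof (rule integral_mono_AE)
      show "AE x in \<mu>. \<bar>?v x\<bar> \<le> (K0 * wgt x) * \<bar>f x\<bar> + (1 / \<theta>) * \<bar>f' x\<bar>"
        using AE_mu_S[OF A]
      proof eventually_elim
        case (elim x)
        have "\<bar>?v x\<bar> \<le> \<bar>G1 T1 T2 x\<bar> * \<bar>f x\<bar> + \<bar>G T1 x\<bar> * \<bar>f' x\<bar>"
          by (rule order_trans[OF abs_triangle_ineq]) (simp add: abs_mult)
        also have "\<dots> \<le> (K0 * wgt x) * \<bar>f x\<bar> + (1 / \<theta>) * \<bar>f' x\<bar>"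
          using elim G1_bound[OF A elim] G_bound[OF A, of x] by (intro add_mono mult_right_mono) auto
        finally show ?case .
      qed
    qed (use vi tail fi' in auto)
    also have "\<dots> = (\<integral>x. (K0 * wgt x) * \<bar>f x\<bar> \<partial>\<mu>) + (1 / \<theta>) * (\<integral>x. \<bar>f' x\<bar> \<partial>\<mu>)"
      using tail(1) fi' by simp
    also have "\<dots> \<le> (B * (\<integral>x. \<bar>f x\<bar> \<partial>\<mu>) + ?S * \<eta>) + (1 / \<theta>) * (\<integral>x. \<bar>f' x\<bar> \<partial>\<mu>)"
      using tail(2) by simp
    also have "\<dots> = (1 / \<theta> + \<eta>) * (\<integral>x. \<bar>f' x\<bar> \<partial>\<mu>) + (B + \<eta>) * (\<integral>x. \<bar>f x\<bar> \<partial>\<mu>)"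
      by (simp add: algebra_simps)
    finally have "(\<integral>x. \<bar>transfer T ?v x\<bar> \<partial>\<mu>) \<le> lam * (\<integral>x. \<bar>f' x\<bar> \<partial>\<mu>) + (B + \<eta>) * (\<integral>x. \<bar>f x\<bar> \<partial>\<mu>)"
      by (simp only: \<eta>)
    then show "\<exists>g. weak_deriv (transfer T f) g \<and> (\<integral>x. \<bar>g x\<bar> \<partial>\<mu>) \<le> lam * (\<integral>x. \<bar>f' x\<bar> \<partial>\<mu>) + (B + \<eta>) * (\<integral>x. \<bar>f x\<bar> \<partial>\<mu>)"
      using transfer_deriv1[OF A w] by blast
  qed
qed

lemma Lasota_Yorke_W11_iterate:
  "\<exists>C\<ge>0. \<forall>T f f' n. admT T \<longrightarrow> weak_deriv f f' \<longrightarrow>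
     (\<exists>g. weak_deriv ((transfer T ^^ n) f) g \<and> (\<integral>x. \<bar>g x\<bar> \<partial>\<mu>) \<le> lam ^ n * (\<integral>x. \<bar>f' x\<bar> \<partial>\<mu>) + C * (\<integral>x. \<bar>f x\<bar> \<partial>\<mu>))"
proof -
  obtain C where C: "0 \<le> C" "\<And>T f f'. admT T \<Longrightarrow> weak_deriv f f' \<Longrightarrow>
     (\<exists>g. weak_deriv (transfer T f) g \<and> (\<integral>x. \<bar>g x\<bar> \<partial>\<mu>) \<le> lam * (\<integral>x. \<bar>f' x\<bar> \<partial>\<mu>) + C * (\<integral>x. \<bar>f x\<bar> \<partial>\<mu>))"
    using Lasota_Yorke_W11 by blast
  \<comment> \<open>The fixed point of the recursion C' = lam C' + C, so the weak term reproduces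
    itself under iteration.\<close>
  define C' where "C' = C / (1 - lam)"
  have C': "lam * C' + C = C'" "0 \<le> C'" using lam C(1) by (auto simp: C'_def field_simps)
  have "\<exists>g. weak_deriv ((transfer T ^^ n) f) g \<and> (\<integral>x. \<bar>g x\<bar> \<partial>\<mu>) \<le> lam ^ n * (\<integral>x. \<bar>f' x\<bar> \<partial>\<mu>) + C' * (\<integral>x. \<bar>f x\<bar> \<partial>\<mu>)"
    if T: "admT T" and w: "weak_deriv f f'" for T f f' n
  proof (induction n)
    case 0
    have "0 \<le> C' * (\<integral>x. \<bar>f x\<bar> \<partial>\<mu>)" using C' by (intro mult_nonneg_nonneg integral_nonneg) auto
    with w show ?case by auto
  next
    case (Suc n)
    then obtain g where g: "weak_deriv ((transfer T ^^ n) f) g"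
      "(\<integral>x. \<bar>g x\<bar> \<partial>\<mu>) \<le> lam ^ n * (\<integral>x. \<bar>f' x\<bar> \<partial>\<mu>) + C' * (\<integral>x. \<bar>f x\<bar> \<partial>\<mu>)" by blast
    obtain k where k: "weak_deriv (transfer T ((transfer T ^^ n) f)) k"
      "(\<integral>x. \<bar>k x\<bar> \<partial>\<mu>) \<le> lam * (\<integral>x. \<bar>g x\<bar> \<partial>\<mu>) + C * (\<integral>x. \<bar>(transfer T ^^ n) f x\<bar> \<partial>\<mu>)"
      using C(2)[OF T g(1)] by blast
    note k(2)
    also have "lam * (\<integral>x. \<bar>g x\<bar> \<partial>\<mu>) + C * (\<integral>x. \<bar>(transfer T ^^ n) f x\<bar> \<partial>\<mu>)
      \<le> lam * (lam ^ n * (\<integral>x. \<bar>f' x\<bar> \<partial>\<mu>) + C' * (\<integral>x. \<bar>f x\<bar> \<partial>\<mu>)) + C * (\<integral>x. \<bar>f x\<bar> \<partial>\<mu>)"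
      using g(2) C(1) lam funpow_transfer_L1[OF admT_nonsingular[OF T] weak_derivD(1)[OF w], of n]
      by (intro add_mono mult_left_mono) auto
    also have "\<dots> = lam ^ Suc n * (\<integral>x. \<bar>f' x\<bar> \<partial>\<mu>) + (lam * C' + C) * (\<integral>x. \<bar>f x\<bar> \<partial>\<mu>)"
      by (simp add: algebra_simps)
    finally show ?case using k(1) C'(1) by auto
  qed
  then show ?thesis using C'(2) by blast
qed

text \<open>The derivative of the constant 1 is 0, so only the weak term C survives in the iterated
  inequality; the sup bound adds the L^1 norm of P^n 1, which is at most 1.\<close>

lemma funpow_transfer_one_bound:
  "\<exists>M\<ge>1. \<forall>T n. admT T \<longrightarrow> (AE x in \<mu>. (transfer T ^^ n) (\<lambda>x. 1::real) x \<le> M)"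
proof -
  obtain C where C: "0 \<le> C" "\<And>T f f' n. admT T \<Longrightarrow> weak_deriv f f' \<Longrightarrow>
     (\<exists>g. weak_deriv ((transfer T ^^ n) f) g \<and> (\<integral>x. \<bar>g x\<bar> \<partial>\<mu>) \<le> lam ^ n * (\<integral>x. \<bar>f' x\<bar> \<partial>\<mu>) + C * (\<integral>x. \<bar>f x\<bar> \<partial>\<mu>))"
    using Lasota_Yorke_W11_iterate by blast
  have "AE x in \<mu>. (transfer T ^^ n) (\<lambda>x. 1::real) x \<le> 1 + C" if T: "admT T" for T n
  proof -
    let ?f = "(transfer T ^^ n) (\<lambda>x. 1::real)"
    obtain g where g: "weak_deriv ?f g" "(\<integral>x. \<bar>g x\<bar> \<partial>\<mu>) \<le> C"
      using C(2)[OF T weak_deriv_const[of 1], of n] by auto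
    have 1: "(\<integral>x. \<bar>?f x\<bar> \<partial>\<mu>) \<le> 1"
      using funpow_transfer_L1[OF admT_nonsingular[OF T], of "\<lambda>x. 1" n] by simp
    from weak_deriv_sup_bound[OF g(1)] show ?thesis by eventually_elim (use g(2) 1 in auto)
  qed
  then show ?thesis using C(1) by (intro exI[of _ "1 + C"]) auto
qed

text \<open>A bound common to all admissible maps and all n, fixed once so that later constants can
  be formed from it.\<close>

definition MM where
  "MM = (SOME M. 1 \<le> M \<and> (\<forall>T n. admT T \<longrightarrow> (AE x in \<mu>. (transfer T ^^ n) (\<lambda>x. 1::real) x \<le> M)))"

lemma MM: "1 \<le> MM" "admT T \<Longrightarrow> AE x in \<mu>. (transfer T ^^ n) (\<lambda>x. 1::real) x \<le> MM"
  using someI_ex[OF funpow_transfer_one_bound] unfolding MM_def by blast+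

lemma funpow_transfer_sup:
  fixes f :: "real \<Rightarrow> real"
  assumes T: "admT T" and f: "f \<in> borel_measurable \<mu>" and S: "AE x in \<mu>. \<bar>f x\<bar> \<le> S"
  shows "AE x in \<mu>. \<bar>(transfer T ^^ n) f x\<bar> \<le> MM * S"
proof -
  note ns = admT_nonsingular[OF T]
  have fi: "integrable \<mu> f" using S by (intro integrable_mu_bounded[OF f]) auto
  have "AE x in \<mu>. 0 \<le> S" using S by eventually_elim linarith
  then have "(\<integral>x. 0 \<partial>\<mu>) \<le> (\<integral>x. S \<partial>\<mu>)" by (intro integral_mono_AE) auto
  then have S0: "0 \<le> S" by simp
  have "AE x in \<mu>. \<bar>(transfer T ^^ n) f x\<bar> \<le> (transfer T ^^ n) (\<lambda>x. S * 1) x"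
    by (rule funpow_transfer_abs[OF ns fi _]) (use S in auto)
  moreover have "ae_eq ((transfer T ^^ n) (\<lambda>x. S * 1)) (\<lambda>x. S * (transfer T ^^ n) (\<lambda>x. 1) x)"
    by (rule funpow_transfer_scale[OF ns]) simp
  ultimately show ?thesis
    using MM(2)[OF T, of n] unfolding ae_eq_def
  proof eventually_elim
    case (elim x)
    have "S * (transfer T ^^ n) (\<lambda>x. 1) x \<le> S * MM" using elim S0 by (intro mult_left_mono)
    with elim show ?case by (simp add: mult.commute)
  qed
qed

text \<open>Explicit representatives of the derivatives of P^n f. An arbitrary choice
  \<open>wderiv\<close> would satisfy the recursion only after a further a.e. identification; here
  the recurrence estimate applies to it directly.\<close>

primrec Dn :: "(real \<Rightarrow> real) \<Rightarrow> (real \<Rightarrow> real) \<Rightarrow> (real \<Rightarrow> real) \<Rightarrow> (real \<Rightarrow> real) \<Rightarrow> (real \<Rightarrow> real) \<Rightarrow> nat \<Rightarrow> real \<Rightarrow> real" where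
  "Dn T T1 T2 f f' 0 = f'"
| "Dn T T1 T2 f f' (Suc n) = transfer T (\<lambda>x. G1 T1 T2 x * (transfer T ^^ n) f x + G T1 x * Dn T T1 T2 f f' n x)"

primrec En :: "(real \<Rightarrow> real) \<Rightarrow> (real \<Rightarrow> real) \<Rightarrow> (real \<Rightarrow> real) \<Rightarrow> (real \<Rightarrow> real) \<Rightarrow> (real \<Rightarrow> real) \<Rightarrow> (real \<Rightarrow> real) \<Rightarrow> (real \<Rightarrow> real) \<Rightarrow> nat \<Rightarrow> real \<Rightarrow> real" where
  "En T T1 T2 T3 f f' f'' 0 = f''"
| "En T T1 T2 T3 f f' f'' (Suc n) = transfer T (\<lambda>x. H2 T1 T2 T3 x * (transfer T ^^ n) f x
      + 3 * (GG T1 T2 x * Dn T T1 T2 f f' n x) + (G T1 x)^2 * En T T1 T2 T3 f f' f'' n x)"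

end

section \<open>The inequalities in W^{1,p} and W^{2,p}\<close>

context singular_params
begin

lemma funpow_transfer_Lp':
  fixes u :: "real \<Rightarrow> real"
  assumes T: "admT T" and u: "u \<in> Lp_space p"
  shows "(transfer T ^^ n) u \<in> Lp_space p" "Lp_norm p ((transfer T ^^ n) u) \<le> MM * Lp_norm p u"
  using funpow_transfer_Lp[OF admT_nonsingular[OF T] p1 MM(1) MM(2)[OF T] u] by auto

lemma transfer_Lp:
  fixes u :: "real \<Rightarrow> real"
  assumes T: "admT T" and u: "u \<in> Lp_space p"
  shows "transfer T u \<in> Lp_space p"
  using funpow_transfer_Lp'(1)[OF assms, of 1] by simp

text \<open>The coefficient may be unbounded at c and belongs only to L^p, so the other factor has
  to be controlled in sup norm. This is why sup bounds on P^n f are carried along.\<close>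

lemma weighted_Lp:
  fixes q h w :: "real \<Rightarrow> real"
  assumes A: "adm T T1 T2 T3" and q: "q \<in> borel_measurable \<mu>" "\<And>x. x \<in> {0..1} - {c} \<Longrightarrow> \<bar>q x\<bar> \<le> K0 * w x"
    and w: "w \<in> Lp_space p" "\<And>x. 0 \<le> w x"
    and h: "h \<in> borel_measurable \<mu>" "AE x in \<mu>. \<bar>h x\<bar> \<le> S" and S: "0 \<le> S"
  shows "(\<lambda>x. q x * h x) \<in> Lp_space p" "Lp_norm p (\<lambda>x. q x * h x) \<le> K0 * Lp_norm p w * S"
proof -
  have p0: "0 < p" using p1 by simp
  have b: "(\<lambda>x. (K0 * S) * w x) \<in> Lp_space p" by (rule Lp_scale(1)[OF p0 w(1)])
  have m: "(\<lambda>x. q x * h x) \<in> borel_measurable \<mu>" using q h by auto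
  have le: "AE x in \<mu>. norm (q x * h x) \<le> norm ((K0 * S) * w x)"
    using AE_mu_S[OF A] h(2)
  proof eventually_elim
    case (elim x)
    have "\<bar>q x\<bar> * \<bar>h x\<bar> \<le> (K0 * w x) * S"
      using elim q(2) K0_nonneg w(2)[of x] by (intro mult_mono) auto
    then show ?case using K0_nonneg w(2)[of x] S by (simp add: abs_mult mult_ac)
  qed
  show "(\<lambda>x. q x * h x) \<in> Lp_space p" by (rule Lp_mono(1)[OF p0 m b le])
  have "Lp_norm p (\<lambda>x. q x * h x) \<le> Lp_norm p (\<lambda>x. (K0 * S) * w x)" by (rule Lp_mono(2)[OF p0 m b le])
  also have "\<dots> = K0 * Lp_norm p w * S" using K0_nonneg S by (simp add: Lp_scale(2)[OF p0])
  finally show "Lp_norm p (\<lambda>x. q x * h x) \<le> K0 * Lp_norm p w * S" .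
qed

lemma bounded_mult_Lp:
  fixes q h :: "real \<Rightarrow> real"
  assumes q: "q \<in> borel_measurable \<mu>" "\<And>x. x \<in> {0..1} \<Longrightarrow> \<bar>q x\<bar> \<le> B" and B: "0 \<le> B" and h: "h \<in> Lp_space p"
  shows "(\<lambda>x. q x * h x) \<in> Lp_space p" "Lp_norm p (\<lambda>x. q x * h x) \<le> B * Lp_norm p h"
proof -
  have p0: "0 < p" using p1 by simp
  have b: "(\<lambda>x. B * h x) \<in> Lp_space p" by (rule Lp_scale(1)[OF p0 h])
  have m: "(\<lambda>x. q x * h x) \<in> borel_measurable \<mu>" using q Lp_space_measurable[OF h] by auto
  have le: "AE x in \<mu>. norm (q x * h x) \<le> norm (B * h x)"
    using AE_space[of \<mu>] by eventually_elim (use q(2) B in \<open>auto simp: abs_mult intro!: mult_right_mono\<close>)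
  show "(\<lambda>x. q x * h x) \<in> Lp_space p" by (rule Lp_mono(1)[OF p0 m b le])
  show "Lp_norm p (\<lambda>x. q x * h x) \<le> B * Lp_norm p h"
    using Lp_mono(2)[OF p0 m b le] B by (simp add: Lp_scale(2)[OF p0])
qed

lemma Dn_weak: "adm T T1 T2 T3 \<Longrightarrow> weak_deriv f f' \<Longrightarrow> weak_deriv ((transfer T ^^ n) f) (Dn T T1 T2 f f' n)"
  by (induction n) (auto intro: transfer_deriv1)

lemma En_weak:
  assumes A: "adm T T1 T2 T3" and "weak_deriv f f'" "weak_deriv f' f''"
  shows "weak_deriv (Dn T T1 T2 f f' n) (En T T1 T2 T3 f f' f'' n)"
  by (induction n) (auto intro: transfer_deriv2[OF A Dn_weak[OF A]] assms)

lemma Dn_Lp: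
  assumes A: "adm T T1 T2 T3" and w: "weak_deriv f f'" and f': "f' \<in> Lp_space p"
    and S: "AE x in \<mu>. \<bar>f x\<bar> \<le> S" "0 \<le> S"
  shows "(\<lambda>x. G1 T1 T2 x * (transfer T ^^ n) f x) \<in> Lp_space p"
    "Lp_norm p (\<lambda>x. G1 T1 T2 x * (transfer T ^^ n) f x) \<le> K0 * Lp_norm p wgt * (MM * S)"
    "Dn T T1 T2 f f' n \<in> Lp_space p"
proof -
  have T: "admT T" using A by (auto simp: admT_def)
  have fi: "integrable \<mu> f" using w by (rule weak_derivD)
  have MS: "0 \<le> MM * S" using S MM(1) by simp
  have R: "(\<lambda>x. G1 T1 T2 x * (transfer T ^^ n) f x) \<in> Lp_space p"
    "Lp_norm p (\<lambda>x. G1 T1 T2 x * (transfer T ^^ n) f x) \<le> K0 * Lp_norm p wgt * (MM * S)" for n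
    using weighted_Lp[OF A G1_measurable[OF A] G1_bound[OF A] wgt_Lp wgt_nonneg
        borel_measurable_integrable[OF funpow_transfer_integrable[OF admT_nonsingular[OF T] fi]]
        funpow_transfer_sup[OF T borel_measurable_integrable[OF fi] S(1)] MS] by auto
  show "(\<lambda>x. G1 T1 T2 x * (transfer T ^^ n) f x) \<in> Lp_space p"
    "Lp_norm p (\<lambda>x. G1 T1 T2 x * (transfer T ^^ n) f x) \<le> K0 * Lp_norm p wgt * (MM * S)" by (rule R)+
  show "Dn T T1 T2 f f' n \<in> Lp_space p"
  proof (induction n)
    case (Suc n)
    have "(\<lambda>x. G T1 x * Dn T T1 T2 f f' n x) \<in> Lp_space p"
      using \<theta>1 by (intro bounded_mult_Lp(1)[OF G_measurable[OF A] G_bound[OF A] _ Suc]) auto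
    then show ?case using p1 by (simp, intro transfer_Lp[OF T] Lp_add(1) R(1)) auto
  qed (simp add: f')
qed

lemma sobolev_1_iff: "f \<in> sobolev (Suc 0) p \<longleftrightarrow> f \<in> Lp_space p \<and> (\<exists>g \<in> Lp_space p. weak_deriv f g)"
  by simp

text \<open>The weak term is a sup bound S for f rather than an L^p norm: the inhomogeneity G' P^n f
  has L^p norm at most K0 times the norm of the weight times MM S. Keeping S separate from the
  Sobolev norm lets a function small in sup norm profit from the inequality.\<close>

lemma W1p_Lasota_Yorke:
  "\<exists>K>0. \<forall>T n f S. admT T \<longrightarrow> f \<in> sobolev (Suc 0) p \<longrightarrow> (AE x in \<mu>. \<bar>f x\<bar> \<le> S) \<longrightarrow>
     (transfer T ^^ n) f \<in> sobolev (Suc 0) p \<and>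
     sobolev_norm (Suc 0) p ((transfer T ^^ n) f) \<le> K * ((1 / \<theta>) ^ n * sobolev_norm (Suc 0) p f + (S :: real))"
proof -
  define b where "b = K0 * Lp_norm p wgt * MM"
  have b0: "0 \<le> b" using K0_nonneg MM(1) by (simp add: b_def)
  define K where "K = MM * (1 + b / (1 - 1 / \<theta>))"
  have t: "0 < 1 / \<theta>" "1 / \<theta> < 1" using \<theta>1 by auto
  have K: "0 < K" "MM \<le> K"
  proof -
    have 0: "0 \<le> b / (1 - 1 / \<theta>)" using b0 t by simp
    then show "MM \<le> K" using MM(1) mult_left_mono[of 1 "1 + b / (1 - 1 / \<theta>)" MM] by (simp add: K_def)
    then show "0 < K" using MM(1) by linarith
  qed
  show ?thesis
  proof (intro exI[of _ K] conjI allI impI K)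
    fix T n and f :: "real \<Rightarrow> real" and S :: real assume T: "admT T" and f: "f \<in> sobolev (Suc 0) p" and S: "AE x in \<mu>. \<bar>f x\<bar> \<le> S"
    obtain T1 T2 T3 where A: "adm T T1 T2 T3" using T by (auto simp: admT_def)
    note ns = admT_nonsingular[OF T]
    define f' where "f' = wderiv f"
    have w: "weak_deriv f f'" and f': "f' \<in> Lp_space p" and fp: "f \<in> Lp_space p"
      using sobolev_SucD[OF f] by (auto simp: f'_def)
    have "AE x in \<mu>. 0 \<le> S" using S by eventually_elim linarith
    then have "(\<integral>x. 0 \<partial>\<mu>) \<le> (\<integral>x. S \<partial>\<mu>)" by (intro integral_mono_AE) auto
    then have S0: "0 \<le> S" by simp
    \<comment> \<open>Solves the scalar recurrence y(n+1) = y(n) / \<theta> + b S with equality: a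
      decaying part plus the fixed point b S / (1 - 1/\<theta>).\<close>
    define y where "y n = (1 / \<theta>) ^ n * Lp_norm p f' + b * S / (1 - 1 / \<theta>)" for n
    have yS: "(1 / \<theta>) * y n + b * S = y (Suc n)" for n
      using t by (simp add: y_def field_simps)
    have D: "Lp_norm p (Dn T T1 T2 f f' n) \<le> MM * y n"
    proof (rule transfer_recurrence_Lp[OF ns p1 MM(1) MM(2)[OF T], where R = "\<lambda>n x. G1 T1 T2 x * (transfer T ^^ n) f x" and \<rho> = "1 / \<theta>"])
      note DL = Dn_Lp[OF A w f' S S0]
      show "Dn T T1 T2 f f' n \<in> Lp_space p" "(\<lambda>x. G1 T1 T2 x * (transfer T ^^ n) f x) \<in> Lp_space p" for n by (rule DL)+
      show "0 \<le> 1 / \<theta>" using t by simp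
      show "Lp_norm p (Dn T T1 T2 f f' 0) \<le> y 0" using b0 S0 t by (simp add: y_def)
      show "1 / \<theta> * y n + Lp_norm p (\<lambda>x. G1 T1 T2 x * (transfer T ^^ n) f x) \<le> y (Suc n)" for n
        using DL(2)[of n] yS[of n] by (simp add: b_def mult.assoc)
      fix n
      have i: "integrable \<mu> (\<lambda>x. \<bar>Dn T T1 T2 f f' n x\<bar>)" "integrable \<mu> (\<lambda>x. \<bar>G1 T1 T2 x * (transfer T ^^ n) f x\<bar>)"
        using Lp_integrable(1)[OF _ DL(3)] Lp_integrable(1)[OF _ DL(1)] p1 by auto
      show "AE x in \<mu>. \<bar>Dn T T1 T2 f f' (Suc n) x\<bar> \<le> transfer T (\<lambda>x. 1 / \<theta> * \<bar>Dn T T1 T2 f f' n x\<bar> + \<bar>G1 T1 T2 x * (transfer T ^^ n) f x\<bar>) x"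
        unfolding Dn.simps
      proof (rule transfer_abs[OF ns])
        show "integrable \<mu> (\<lambda>x. G1 T1 T2 x * (transfer T ^^ n) f x + G T1 x * Dn T T1 T2 f f' n x)"
          using weak_deriv_G[OF A Dn_weak[OF A w]] by (rule weak_derivD)
        show "integrable \<mu> (\<lambda>x. 1 / \<theta> * \<bar>Dn T T1 T2 f f' n x\<bar> + \<bar>G1 T1 T2 x * (transfer T ^^ n) f x\<bar>)" using i by auto
        show "AE x in \<mu>. \<bar>G1 T1 T2 x * (transfer T ^^ n) f x + G T1 x * Dn T T1 T2 f f' n x\<bar>
          \<le> 1 / \<theta> * \<bar>Dn T T1 T2 f f' n x\<bar> + \<bar>G1 T1 T2 x * (transfer T ^^ n) f x\<bar>"
          using AE_space[of \<mu>]
        proof eventually_elim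
          case (elim x)
          then have "\<bar>G T1 x * Dn T T1 T2 f f' n x\<bar> \<le> 1 / \<theta> * \<bar>Dn T T1 T2 f f' n x\<bar>"
            using G_bound[OF A, of x] unfolding abs_mult by (intro mult_right_mono) auto
          then show ?case by linarith
        qed
      qed
    qed
    have wn: "weak_deriv ((transfer T ^^ n) f) (Dn T T1 T2 f f' n)" by (rule Dn_weak[OF A w])
    have Pn: "(transfer T ^^ n) f \<in> Lp_space p" "Lp_norm p ((transfer T ^^ n) f) \<le> MM * S"
    proof -
      show "(transfer T ^^ n) f \<in> Lp_space p" by (rule funpow_transfer_Lp'(1)[OF T fp])
      then show "Lp_norm p ((transfer T ^^ n) f) \<le> MM * S"
        using funpow_transfer_sup[OF T Lp_space_measurable[OF fp] S, of n] p1 S0 MM(1)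
        by (intro Lp_bounded(2)) (auto simp: Lp_space_def)
    qed
    show "(transfer T ^^ n) f \<in> sobolev (Suc 0) p"
      using Pn(1) wn Dn_Lp(3)[OF A w f' S S0, of n] by (auto simp only: sobolev_1_iff)
    have nf: "sobolev_norm (Suc 0) p f = Lp_norm p f + Lp_norm p f'" by (simp add: sobolev_norm_weak[OF w])
    have "sobolev_norm (Suc 0) p ((transfer T ^^ n) f) \<le> MM * S + MM * y n"
      unfolding sobolev_norm_weak[OF wn] using Pn(2) D by simp
    also have "\<dots> = MM * ((1 / \<theta>) ^ n * Lp_norm p f') + K * S" by (simp add: y_def K_def algebra_simps)
    also have "\<dots> \<le> K * ((1 / \<theta>) ^ n * sobolev_norm (Suc 0) p f) + K * S"
      unfolding nf using K t by (intro add_right_mono mult_mono) auto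
    finally show "sobolev_norm (Suc 0) p ((transfer T ^^ n) f) \<le> K * ((1 / \<theta>) ^ n * sobolev_norm (Suc 0) p f + S)"
      by (simp add: algebra_simps)
  qed
qed

lemma sobolev_1_sup:
  fixes f :: "real \<Rightarrow> real"
  assumes "f \<in> sobolev (Suc 0) p"
  shows "AE x in \<mu>. \<bar>f x\<bar> \<le> sobolev_norm (Suc 0) p f"
proof -
  note f = sobolev_SucD[OF assms]
  have "(\<integral>x. norm (f x) \<partial>\<mu>) + (\<integral>x. norm (wderiv f x) \<partial>\<mu>) \<le> sobolev_norm (Suc 0) p f"
    using Lp_integrable(2)[of p f] Lp_integrable(2)[of p "wderiv f"] f p1 by (simp add: sobolev_norm_Suc)
  with weak_deriv_sup_bound[OF f(2)] show ?thesis by (auto elim: eventually_mono)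
qed

text \<open>The sequences z and y are a majorant of the W^{1,p} norms of the iterates and a
  supersolution of the scalar recurrence for the second derivatives. Constant sequences give
  boundedness of P, geometric ones give decay.\<close>

lemma W2p_Lasota_Yorke:
  "\<exists>C\<ge>0. \<forall>T n (f :: real \<Rightarrow> real) z y. admT T \<longrightarrow> f \<in> sobolev (Suc (Suc 0)) p \<longrightarrow>
     (\<forall>n. sobolev_norm (Suc 0) p ((transfer T ^^ n) f) \<le> z n) \<longrightarrow> sobolev_norm (Suc (Suc 0)) p f \<le> y 0 \<longrightarrow>
     (\<forall>n. (1 / \<theta>) * y n + C * z n \<le> y (Suc n)) \<longrightarrow>
     (transfer T ^^ n) f \<in> sobolev (Suc (Suc 0)) p \<and>
     sobolev_norm (Suc (Suc 0)) p ((transfer T ^^ n) f) \<le> z n + MM * (y n :: real)"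
proof -
  have pp: "1 \<le> p" "0 < p" using p1 by auto
  \<comment> \<open>The first summand bounds (G G')' P^n f, where the sup of P^n f is at most its
    W^{1,p} norm; the second bounds 3 G G' times the first derivative.\<close>
  define C where "C = K0 * Lp_norm p (\<lambda>x. (wgt x)\<^sup>2) + 3 * K0"
  have C0: "0 \<le> C" using K0_nonneg by (simp add: C_def)
  have t: "0 < 1 / \<theta>" "1 / \<theta> < 1" using \<theta>1 by auto
  show ?thesis
  proof (intro exI[of _ C] conjI allI impI C0)
    fix T n and f :: "real \<Rightarrow> real" and z y :: "nat \<Rightarrow> real"
    assume T: "admT T" and f: "f \<in> sobolev (Suc (Suc 0)) p"
      and z: "\<forall>n. sobolev_norm (Suc 0) p ((transfer T ^^ n) f) \<le> z n"
      and y0: "sobolev_norm (Suc (Suc 0)) p f \<le> y 0" and yS: "\<forall>n. (1 / \<theta>) * y n + C * z n \<le> y (Suc n)"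
    obtain T1 T2 T3 where A: "adm T T1 T2 T3" using T by (auto simp: admT_def)
    note ns = admT_nonsingular[OF T]
    define f' where "f' = wderiv f"
    define f'' where "f'' = wderiv f'"
    have w: "weak_deriv f f'" and f's: "f' \<in> sobolev (Suc 0) p" and fp: "f \<in> Lp_space p"
      using sobolev_SucD[OF f] by (auto simp: f'_def)
    have w2: "weak_deriv f' f''" and f''p: "f'' \<in> Lp_space p" and f'p: "f' \<in> Lp_space p"
      using sobolev_SucD[OF f's] by (auto simp: f''_def)
    have f1: "f \<in> sobolev (Suc 0) p" using fp w f'p by (auto simp only: sobolev_1_iff)
    let ?D = "Dn T T1 T2 f f'" and ?E = "En T T1 T2 T3 f f' f''"
    \<comment> \<open>The part of the second derivative that does not involve \<open>?E n\<close>;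
      it is controlled by the W^{1,p} norm of the iterate.\<close>
    define R where "R n x = H2 T1 T2 T3 x * (transfer T ^^ n) f x + 3 * (GG T1 T2 x * ?D n x)" for n x
    have S: "AE x in \<mu>. \<bar>f x\<bar> \<le> sobolev_norm (Suc 0) p f" by (rule sobolev_1_sup[OF f1])
    note DL = Dn_Lp[OF A w f'p S sobolev_norm_nonneg]
    have wn: "weak_deriv ((transfer T ^^ n) f) (?D n)" for n by (rule Dn_weak[OF A w])
    have w2n: "weak_deriv (?D n) (?E n)" for n by (rule En_weak[OF A w w2])
    have Pn: "(transfer T ^^ n) f \<in> Lp_space p" for n by (rule funpow_transfer_Lp'(1)[OF T fp])
    have Ps: "(transfer T ^^ n) f \<in> sobolev (Suc 0) p" for n using Pn wn DL(3) by (auto simp only: sobolev_1_iff)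
    have z0: "0 \<le> z n" for n using z sobolev_norm_nonneg order_trans by blast
    have R: "R n \<in> Lp_space p" "Lp_norm p (R n) \<le> C * z n" for n
    proof -
      have sup: "AE x in \<mu>. \<bar>(transfer T ^^ n) f x\<bar> \<le> z n"
        using sobolev_1_sup[OF Ps[of n]] by eventually_elim (use z in \<open>auto intro: order_trans\<close>)
      note a = weighted_Lp[OF A H2_measurable[OF A] H2_bound[OF A] wgt_sq_Lp _ Lp_space_measurable[OF Pn[of n]] sup z0, simplified]
      have b: "(\<lambda>x. GG T1 T2 x * ?D n x) \<in> Lp_space p" "Lp_norm p (\<lambda>x. GG T1 T2 x * ?D n x) \<le> K0 * Lp_norm p (?D n)"
        by (rule bounded_mult_Lp[OF GG_measurable[OF A] GG_bound[OF A] K0_nonneg DL(3)[of n]], assumption)+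
      note b' = Lp_scale(1)[OF pp(2) b(1), of 3] Lp_scale(2)[OF pp(2), of 3 "\<lambda>x. GG T1 T2 x * ?D n x"]
      show "R n \<in> Lp_space p" unfolding R_def by (rule Lp_add(1)[OF pp(1) a(1) b'(1)])
      have Dz: "Lp_norm p (?D n) \<le> z n"
      proof -
        have "Lp_norm p ((transfer T ^^ n) f) + Lp_norm p (?D n) \<le> z n"
          using spec[OF z, of n] by (simp add: sobolev_norm_weak[OF wn])
        then show ?thesis using Lp_norm_nonneg[of p "(transfer T ^^ n) f"] by linarith
      qed
      have "Lp_norm p (R n) \<le> K0 * Lp_norm p (\<lambda>x. (wgt x)\<^sup>2) * z n + 3 * (K0 * Lp_norm p (?D n))"
        unfolding R_def using Lp_add(2)[OF pp(1) a(1) b'(1)] a(2) b(2) b'(2) by simp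
      also have "\<dots> \<le> K0 * Lp_norm p (\<lambda>x. (wgt x)\<^sup>2) * z n + 3 * (K0 * z n)"
        using Dz K0_nonneg by (intro add_left_mono mult_left_mono) auto
      also have "\<dots> = C * z n" by (simp add: C_def algebra_simps)
      finally show "Lp_norm p (R n) \<le> C * z n" .
    qed
    \<comment> \<open>One of the two factors 1 / \<theta> is given away, so that the second
      derivatives obey a recurrence with the same rate as the first ones.\<close>
    have Gsq: "\<bar>(G T1 x)\<^sup>2\<bar> \<le> 1 / \<theta>" if "x \<in> {0..1}" for x
    proof -
      have "\<bar>G T1 x\<bar> \<le> 1" using order_trans[OF G_bound[OF A that] less_imp_le[OF t(2)]] .
      then have "\<bar>G T1 x\<bar> * \<bar>G T1 x\<bar> \<le> 1 / \<theta> * 1"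
        using mult_mono[OF G_bound[OF A that], of "\<bar>G T1 x\<bar>" 1] t by simp
      then show ?thesis by (simp add: power2_eq_square abs_mult)
    qed
    have GE: "(\<lambda>x. (G T1 x)\<^sup>2 * h x) \<in> Lp_space p" if "h \<in> Lp_space p" for h
      using that t G_measurable[OF A] by (intro bounded_mult_Lp(1)[where B = "1 / \<theta>"] Gsq) auto
    have Ep: "?E n \<in> Lp_space p" for n
    proof (induction n)
      case (Suc n)
      have "(\<lambda>x. R n x + (G T1 x)\<^sup>2 * ?E n x) \<in> Lp_space p"
        by (intro Lp_add(1)[OF pp(1)] R GE Suc)
      from transfer_Lp[OF T this] show ?case by (simp add: R_def)
    qed (simp add: f''p)
    have E: "Lp_norm p (?E n) \<le> MM * y n"
    proof (rule transfer_recurrence_Lp[OF ns p1 MM(1) MM(2)[OF T] Ep R(1), where \<rho> = "1 / \<theta>"])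
      show "0 \<le> 1 / \<theta>" using t by simp
      have "sobolev_norm (Suc (Suc 0)) p f = Lp_norm p f + (Lp_norm p f' + Lp_norm p f'')"
        by (simp add: sobolev_norm_weak[OF w] sobolev_norm_weak[OF w2])
      then have "Lp_norm p f'' \<le> y 0" using y0 Lp_norm_nonneg[of p f] Lp_norm_nonneg[of p f'] by linarith
      then show "Lp_norm p (?E 0) \<le> y 0" by simp
      show "1 / \<theta> * y n + Lp_norm p (R n) \<le> y (Suc n)" for n
        using yS R(2)[of n] by (meson add_left_mono order_trans)
      fix n
      have i: "integrable \<mu> (\<lambda>x. \<bar>?E n x\<bar>)" "integrable \<mu> (\<lambda>x. \<bar>R n x\<bar>)"
        using Lp_integrable(1)[OF pp(1) Ep] Lp_integrable(1)[OF pp(1) R(1)] by auto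
      have "AE x in \<mu>. \<bar>transfer T (\<lambda>x. R n x + (G T1 x)\<^sup>2 * ?E n x) x\<bar> \<le> transfer T (\<lambda>x. 1 / \<theta> * \<bar>?E n x\<bar> + \<bar>R n x\<bar>) x"
      proof (rule transfer_abs[OF ns])
        show "integrable \<mu> (\<lambda>x. R n x + (G T1 x)\<^sup>2 * ?E n x)"
          by (rule Lp_integrable(1)[OF pp(1) Lp_add(1)[OF pp(1) R(1) GE[OF Ep]]])
        show "integrable \<mu> (\<lambda>x. 1 / \<theta> * \<bar>?E n x\<bar> + \<bar>R n x\<bar>)" using i by auto
        show "AE x in \<mu>. \<bar>R n x + (G T1 x)\<^sup>2 * ?E n x\<bar> \<le> 1 / \<theta> * \<bar>?E n x\<bar> + \<bar>R n x\<bar>"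
          using AE_space[of \<mu>]
        proof eventually_elim
          case (elim x)
          then have "\<bar>(G T1 x)\<^sup>2 * ?E n x\<bar> \<le> 1 / \<theta> * \<bar>?E n x\<bar>"
            using Gsq[of x] unfolding abs_mult by (intro mult_right_mono) auto
          then show ?case by linarith
        qed
      qed
      then show "AE x in \<mu>. \<bar>?E (Suc n) x\<bar> \<le> transfer T (\<lambda>x. 1 / \<theta> * \<bar>?E n x\<bar> + \<bar>R n x\<bar>) x"
        by (simp add: R_def)
    qed
    show "(transfer T ^^ n) f \<in> sobolev (Suc (Suc 0)) p"
      by (rule sobolev_SucI[OF Pn wn sobolev_SucI[OF DL(3) w2n]]) (simp add: Ep)
    have "sobolev_norm (Suc (Suc 0)) p ((transfer T ^^ n) f) = sobolev_norm (Suc 0) p ((transfer T ^^ n) f) + Lp_norm p (?E n)"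
      by (simp add: sobolev_norm_weak[OF wn] sobolev_norm_weak[OF w2n])
    then show "sobolev_norm (Suc (Suc 0)) p ((transfer T ^^ n) f) \<le> z n + MM * y n"
      using E spec[OF z, of n] by simp
  qed
qed

end

section \<open>Covering properties of the unperturbed map\<close>

locale expanding_unimodal =
  fixes c \<theta> a :: real and T T1 :: "real \<Rightarrow> real"
  assumes c01: "0 < c" "c < 1" and \<theta>1: "1 < \<theta>"
    and T_nonsing: "nonsingular T"
    and T_0: "T 0 = 0" and T_1: "T 1 = 0" and T_in: "\<And>x. x \<in> {0..1} \<Longrightarrow> T x \<in> {0..1}"
    and T_lim: "(T \<longlongrightarrow> a) (at c)"
    and T_cont: "continuous_on ({0..1} - {c}) T"
    and T_der: "\<And>x. x \<in> {0<..<1} - {c} \<Longrightarrow> (T has_real_derivative T1 x) (at x)"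
    and T_exp: "\<And>x. x \<in> {0<..<1} - {c} \<Longrightarrow> \<theta> \<le> \<bar>T1 x\<bar>"
begin

lemma expand_abs:
  assumes "0 \<le> x" "x < y" "y \<le> 1" "c \<notin> {x..y}"
  shows "\<theta> * (y - x) \<le> \<bar>T y - T x\<bar>"
proof -
  obtain \<xi> where \<xi>: "x < \<xi>" "\<xi> < y" "T y - T x = (\<lambda>h. h * T1 \<xi>) (y - x)"
  proof (rule mvt[OF assms(2), of T "\<lambda>\<xi> h. h * T1 \<xi>"])
    show "continuous_on {x..y} T" by (rule continuous_on_subset[OF T_cont]) (use assms in auto)
    fix \<xi> assume "x < \<xi>" "\<xi> < y"
    then have "\<xi> \<in> {0<..<1} - {c}" using assms by auto
    from T_der[OF this] show "(T has_derivative (\<lambda>h. h * T1 \<xi>)) (at \<xi>)"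
      by (simp add: has_field_derivative_def mult_commute_abs)
  qed auto
  then have "\<xi> \<in> {0<..<1} - {c}" using assms by auto
  then have "(y - x) * \<theta> \<le> (y - x) * \<bar>T1 \<xi>\<bar>" using T_exp assms by (intro mult_left_mono) auto
  also have "\<dots> = \<bar>T y - T x\<bar>" using \<xi>(3) assms by (simp add: abs_mult)
  finally show ?thesis by (simp add: mult.commute)
qed

text \<open>Expansion gives the size of the increment and this lemma its sign. T starts at the
  minimal value 0; if it decreased from x to y, the intermediate value theorem would produce a point
  z <= x with T z = T y, which expansion forbids.\<close>

lemma expand_left0:
  assumes "0 \<le> x" "x < y" "y < c"
  shows "\<theta> * (y - x) \<le> T y - T x"
proof (rule ccontr)
  assume n: "\<not> ?thesis"
  have e: "\<theta> * (y - x) \<le> \<bar>T y - T x\<bar>" using assms c01 by (intro expand_abs) auto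
  have "0 < \<theta> * (y - x)" using assms \<theta>1 by simp
  with n e have lt: "T y < T x" by linarith
  have "0 \<le> T y" using T_in[of y] assms c01 by auto
  moreover have "continuous_on {0..x} T" by (rule continuous_on_subset[OF T_cont]) (use assms c01 in auto)
  ultimately obtain z where z: "0 \<le> z" "z \<le> x" "T z = T y"
    using IVT'[of T 0 "T y" x] T_0 lt assms by auto
  have "\<theta> * (y - z) \<le> \<bar>T y - T z\<bar>" using assms z c01 by (intro expand_abs) auto
  moreover have "0 < \<theta> * (y - z)" using assms z \<theta>1 by simp
  ultimately show False using z by simp
qed

lemma expand_right0:
  assumes "c < x" "x < y" "y \<le> 1"
  shows "\<theta> * (y - x) \<le> T x - T y"
proof (rule ccontr)
  assume n: "\<not> ?thesis"
  have e: "\<theta> * (y - x) \<le> \<bar>T y - T x\<bar>" using assms c01 by (intro expand_abs) auto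
  have "0 < \<theta> * (y - x)" using assms \<theta>1 by simp
  with n e have lt: "T x < T y" by linarith
  have "0 \<le> T x" using T_in[of x] assms c01 by auto
  moreover have "continuous_on {y..1} T" by (rule continuous_on_subset[OF T_cont]) (use assms c01 in auto)
  ultimately obtain z where z: "y \<le> z" "z \<le> 1" "T z = T x"
    using IVT2'[of T 1 "T x" y] T_1 lt assms by auto
  have "\<theta> * (z - x) \<le> \<bar>T z - T x\<bar>" using assms z c01 by (intro expand_abs) auto
  moreover have "0 < \<theta> * (z - x)" using assms z \<theta>1 by simp
  ultimately show False using z by simp
qed

text \<open>The value of the map at the turning point itself is arbitrary; \<open>S\<close> is its continuous version.\<close>

definition S where "S x = (if x = c then a else T x)"

lemma S_eq: "x \<noteq> c \<Longrightarrow> S x = T x"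
  by (simp add: S_def)

lemma S_cont: "continuous_on {0..1} S"
  unfolding continuous_on_eq_continuous_within
proof
  fix x :: real assume x: "x \<in> {0..1}"
  show "continuous (at x within {0..1}) S"
  proof (cases "x = c")
    case True
    have "(S \<longlongrightarrow> a) (at c)"
      using T_lim by (rule Lim_transform_eventually) (auto simp: S_def eventually_at_filter)
    then show ?thesis using True by (auto simp: continuous_within S_def intro: tendsto_within_subset)
  next
    case False
    have "continuous (at x within {0..1} - {c}) T"
      using T_cont x False by (auto simp: continuous_on_eq_continuous_within)
    moreover have "at x within {0..1} - {c} = at x within {0..1}"
      using False at_within_nhd[of x "- {c}" "{0..1} - {c}" "{0..1}"] by (auto simp: Diff_eq)
    ultimately have "(T \<longlongrightarrow> T x) (at x within {0..1})" by (simp add: continuous_within)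
    moreover have "\<forall>\<^sub>F y in at x within {0..1}. T y = S y"
    proof -
      have "\<forall>\<^sub>F y in nhds x. y \<in> - {c}" using False by (intro eventually_nhds_in_open) auto
      then show ?thesis unfolding eventually_at_filter by eventually_elim (simp add: S_def)
    qed
    ultimately have "(S \<longlongrightarrow> T x) (at x within {0..1})" by (rule Lim_transform_eventually)
    then show ?thesis using S_eq[OF False] by (simp add: continuous_within)
  qed
qed

lemma expand_left:
  assumes "0 \<le> x" "x < y" "y \<le> c"
  shows "\<theta> * (y - x) \<le> S y - S x"
proof (cases "y = c")
  case True
  have "(S \<longlongrightarrow> a) (at c)"
    using T_lim by (rule Lim_transform_eventually) (auto simp: S_def eventually_at_filter)
  then have l: "(S \<longlongrightarrow> a) (at_left c)" by (rule tendsto_within_subset) auto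
  have "((\<lambda>y. \<theta> * (y - x)) \<longlongrightarrow> \<theta> * (c - x)) (at_left c)" by (intro tendsto_intros)
  moreover have "((\<lambda>y. S y - S x) \<longlongrightarrow> a - S x) (at_left c)" by (intro tendsto_intros l)
  moreover have "\<forall>\<^sub>F y in at_left c. \<theta> * (y - x) \<le> S y - S x"
  proof -
    have "\<forall>\<^sub>F y in at_left c. y \<in> {x<..<c}" using assms True by (intro eventually_at_left_real) auto
    then show ?thesis by eventually_elim (use assms True expand_left0[of x] in \<open>auto simp: S_def\<close>)
  qed
  ultimately have "\<theta> * (c - x) \<le> a - S x" by (intro tendsto_le[of "at_left c"]) auto
  then show ?thesis using True by (simp add: S_def)
qed (use assms expand_left0[of x y] in \<open>auto simp: S_def\<close>)

lemma expand_right: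
  assumes "c \<le> x" "x < y" "y \<le> 1"
  shows "\<theta> * (y - x) \<le> S x - S y"
proof (cases "x = c")
  case True
  have "(S \<longlongrightarrow> a) (at c)"
    using T_lim by (rule Lim_transform_eventually) (auto simp: S_def eventually_at_filter)
  then have l: "(S \<longlongrightarrow> a) (at_right c)" by (rule tendsto_within_subset) auto
  have "((\<lambda>x. \<theta> * (y - x)) \<longlongrightarrow> \<theta> * (y - c)) (at_right c)" by (intro tendsto_intros)
  moreover have "((\<lambda>x. S x - S y) \<longlongrightarrow> a - S y) (at_right c)" by (intro tendsto_intros l)
  moreover have "\<forall>\<^sub>F x in at_right c. \<theta> * (y - x) \<le> S x - S y"
  proof -
    have "\<forall>\<^sub>F x in at_right c. x \<in> {c<..<y}" using assms True by (intro eventually_at_right_real) auto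
    then show ?thesis by eventually_elim (use assms True expand_right0[of _ y] in \<open>auto simp: S_def\<close>)
  qed
  ultimately have "\<theta> * (y - c) \<le> a - S y" by (intro tendsto_le[of "at_right c"]) auto
  then show ?thesis using True by (simp add: S_def)
qed (use assms expand_right0[of x y] in \<open>auto simp: S_def\<close>)

lemma S_ends: "S 0 = 0" "S 1 = 0" "S c = a"
  using c01 T_0 T_1 by (auto simp: S_def)

lemma S_less_left: "0 \<le> x \<Longrightarrow> x < y \<Longrightarrow> y \<le> c \<Longrightarrow> S x < S y"
  using expand_left[of x y] \<theta>1 mult_pos_pos[of \<theta> "y - x"] by linarith

lemma S_less_right: "c \<le> x \<Longrightarrow> x < y \<Longrightarrow> y \<le> 1 \<Longrightarrow> S y < S x"
  using expand_right[of x y] \<theta>1 mult_pos_pos[of \<theta> "y - x"] by linarith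

lemma S_le_a: "x \<in> {0..1} \<Longrightarrow> S x \<le> a"
  using S_less_left[of x c] S_less_right[of c x] S_ends by (cases x c rule: linorder_cases) auto

text \<open>If \<open>a < 1\<close>, the interval near \<open>0\<close> cannot be re-entered: \<open>0\<close>, the point \<open>T c\<close> and
  the interval \<open>{r..a}\<close>, for small \<open>r\<close>, together form an invariant set.\<close>

lemma mixing_imp_full:
  assumes mix: "topologically_mixing_on {0..a} T" and a1: "a \<le> 1"
  shows "a = 1"
proof (rule ccontr)
  assume "a \<noteq> 1"
  with a1 have a1: "a < 1" by simp
  have "\<theta> * c \<le> a" using expand_left[of 0 c] c01 S_ends by simp
  moreover have "c < \<theta> * c" using c01 \<theta>1 by simp
  ultimately have ca: "c < a" by linarith
  define b where "b = S a"
  have b0: "0 < b" using S_less_right[of a 1] ca a1 S_ends by (simp add: b_def)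
  define z where "z = T c"
  have z01: "z \<in> {0..1}" unfolding z_def using c01 by (intro T_in) auto
  have Tz: "T z \<in> {0..1}" using z01 by (rule T_in)
  \<comment> \<open>\<open>r\<close> stays below the image of the right end of the interval and
    below those of z and T z that are positive. A point equal to 0 belongs to the invariant set
    anyway, and the default 1 removes it from the minimum.\<close>
  define r where "r = min (min b (a / 2)) (min (if 0 < z then z else 1) (if 0 < T z then T z else 1))"
  have r: "0 < r" "r \<le> b" "r \<le> a / 2" "0 < z \<Longrightarrow> r \<le> z" "0 < T z \<Longrightarrow> r \<le> T z"
    using b0 ca c01 by (auto simp: r_def)
  define I where "I = {0, z} \<union> {r..a}"
  have inv: "T x \<in> I" if x: "x \<in> I" for x
  proof -
    have mid: "T x \<in> I" if x: "x \<in> {r..a}" for x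
    proof -
      have x01: "x \<in> {0..1}" using x r a1 by auto
      consider "x < c" | "x = c" | "c < x" by linarith
      then show ?thesis
      proof cases
        case 1
        have "\<theta> * x \<le> S x" using expand_left[of 0 x] x r 1 S_ends by auto
        moreover have "x \<le> \<theta> * x" using x r \<theta>1 by simp
        ultimately have "x \<le> S x" by linarith
        then show ?thesis using S_le_a[OF x01] 1 x by (simp add: I_def S_eq)
      next
        case 2
        then show ?thesis by (simp add: I_def z_def)
      next
        case 3
        have "b \<le> S x" using S_less_right[of x a] 3 x a1 by (cases "x = a") (auto simp: b_def)
        then show ?thesis using S_le_a[OF x01] 3 r by (simp add: I_def S_eq)
      qed
    qed
    \<comment> \<open>The value z at the turning point is arbitrary and may exceed a. In that case z
      differs from c, so T z is a value of the continuous version and hence at most a.\<close>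
    have "T z \<in> I"
    proof (cases "z \<le> a")
      case True
      then show ?thesis using mid[of z] r z01 T_0 by (cases "z = 0") (auto simp: I_def)
    next
      case False
      then have "z \<noteq> c" using ca by auto
      then have "T z \<le> a" using S_le_a[OF z01] by (simp add: S_eq)
      then show ?thesis using r Tz by (cases "T z = 0") (auto simp: I_def)
    qed
    then show ?thesis using x mid T_0 by (auto simp: I_def)
  qed
  have invn: "x \<in> I \<Longrightarrow> (T ^^ n) x \<in> I" for n x
    by (induction n) (auto intro: inv)
  \<comment> \<open>The orbits of (r, a) remain in the invariant set, which does not meet (0, r);
    this is the pair of open sets that contradicts mixing.\<close>
  have "openin (top_of_set {0..a}) ({0..a} \<inter> {r<..<a})" "openin (top_of_set {0..a}) ({0..a} \<inter> {0<..<r})"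
    by (auto intro: openin_open_Int)
  moreover have "(r + a) / 2 \<in> {0..a} \<inter> {r<..<a}" "r / 2 \<in> {0..a} \<inter> {0<..<r}"
    using r ca c01 by auto
  ultimately obtain N where "\<And>n. n \<ge> N \<Longrightarrow> (T ^^ n) ` ({0..a} \<inter> {r<..<a}) \<inter> ({0..a} \<inter> {0<..<r}) \<noteq> {}"
    using mix unfolding topologically_mixing_on_def by blast
  from this[of N] obtain x where "x \<in> {r<..<a}" "(T ^^ N) x \<in> {0<..<r}" by blast
  moreover from this have "(T ^^ N) x \<in> I" by (intro invn) (auto simp: I_def)
  ultimately show False using r by (auto simp: I_def)
qed

text \<open>\<open>covers J N\<close>: the image of \<open>J\<close> under the \<open>N\<close>-th iterate has full measure, even locally.\<close>

definition covers :: "real set \<Rightarrow> nat \<Rightarrow> bool" where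
  "covers J N \<longleftrightarrow> (\<forall>V \<in> sets \<mu>. negligible (J \<inter> (T ^^ N) -` V \<inter> {0..1}) \<longrightarrow> negligible V)"

lemma covers_mono: "covers J N \<Longrightarrow> J \<subseteq> J' \<Longrightarrow> covers J' N"
  unfolding covers_def by (meson Int_mono negligible_subset order_refl)

lemma covers_unit: "covers {0<..<1} 0"
  unfolding covers_def
proof (intro ballI impI)
  fix V assume V: "V \<in> sets \<mu>" and n: "negligible ({0<..<1} \<inter> (T ^^ 0) -` V \<inter> {0..1})"
  have "V \<subseteq> ({0<..<1} \<inter> (T ^^ 0) -` V \<inter> {0..1}) \<union> {0, 1}"
    using sets.sets_into_space[OF V] by force
  moreover have "negligible ({0<..<1} \<inter> (T ^^ 0) -` V \<inter> {0..1} \<union> {0, 1::real})"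
    by (rule negligible_Un[OF n negligible_finite]) simp
  ultimately show "negligible V" by (rule negligible_subset[rotated])
qed

text \<open>T is differentiable on J and so maps null sets to null sets. If the part of J that
  reaches V is null, its image is null, and this image contains the part of J' that reaches V in N
  steps.\<close>

lemma covers_step:
  assumes J: "J \<subseteq> {0<..<1} - {c}" and im: "J' \<subseteq> T ` J" and g: "covers J' N"
  shows "covers J (Suc N)"
  unfolding covers_def
proof (intro ballI impI)
  fix V assume V: "V \<in> sets \<mu>" and n: "negligible (J \<inter> (T ^^ Suc N) -` V \<inter> {0..1})" (is "negligible ?A")
  have "T differentiable_on ?A"
    unfolding differentiable_on_def
  proof
    fix x assume "x \<in> ?A"
    then have "x \<in> {0<..<1} - {c}" using J by auto
    from T_der[OF this] show "T differentiable (at x within ?A)"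
      by (metis differentiable_at_withinI real_differentiable_def)
  qed
  then have "negligible (T ` ?A)" by (rule negligible_differentiable_image_negligible[OF order_refl n])
  moreover have "J' \<inter> (T ^^ N) -` V \<inter> {0..1} \<subseteq> T ` ?A"
  proof
    fix y assume y: "y \<in> J' \<inter> (T ^^ N) -` V \<inter> {0..1}"
    then obtain x where x: "x \<in> J" "y = T x" using im by blast
    then have "(T ^^ Suc N) x \<in> V" using y by (simp only: funpow_Suc_right comp_apply) auto
    then show "y \<in> T ` ?A" using x J by auto
  qed
  ultimately have "negligible (J' \<inter> (T ^^ N) -` V \<inter> {0..1})" by (rule negligible_subset)
  then show "negligible V" using g V by (auto simp: covers_def)
qed

lemma image_left:
  assumes "0 \<le> u" "u < v" "v \<le> c"
  shows "{S u<..<S v} \<subseteq> T ` {u<..<v}"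
proof
  fix y assume y: "y \<in> {S u<..<S v}"
  have "continuous_on {u..v} S" by (rule continuous_on_subset[OF S_cont]) (use assms c01 in auto)
  then obtain x where x: "u \<le> x" "x \<le> v" "S x = y" using IVT'[of S u y v] y assms by auto
  then have "u < x" "x < v" using y by (auto simp: less_le)
  then show "y \<in> T ` {u<..<v}" using x assms by (auto simp: S_def intro!: image_eqI[of _ _ x])
qed

lemma image_right:
  assumes "c \<le> u" "u < v" "v \<le> 1"
  shows "{S v<..<S u} \<subseteq> T ` {u<..<v}"
proof
  fix y assume y: "y \<in> {S v<..<S u}"
  have "continuous_on {u..v} S" by (rule continuous_on_subset[OF S_cont]) (use assms c01 in auto)
  then obtain x where x: "u \<le> x" "x \<le> v" "S x = y" using IVT2'[of S v y u] y assms by auto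
  then have "u < x" "x < v" using y by (auto simp: less_le)
  then show "y \<in> T ` {u<..<v}" using x assms by (auto simp: S_def intro!: image_eqI[of _ _ x])
qed

lemma covers_left:
  assumes "0 \<le> u" "u < v" "v \<le> c" "covers {S u<..<S v} N"
  shows "covers {u<..<v} (Suc N)"
  using assms c01 by (intro covers_step[OF _ image_left]) auto

lemma covers_right:
  assumes "c \<le> u" "u < v" "v \<le> 1" "covers {S v<..<S u} N"
  shows "covers {u<..<v} (Suc N)"
  using assms c01 by (intro covers_step[OF _ image_right]) auto

section \<open>Every interval covers when both branches are full\<close>

context
  assumes full: "a = 1"
begin

text \<open>Since 0 is fixed, an interval (0, y) with y < c is mapped onto (0, S y) with S y >=
  \<theta> y. The induction counts the steps until the length reaches c, after which the full left
  branch finishes.\<close>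

lemma covers_initial:
  assumes "0 < y" "y \<le> 1"
  shows "\<exists>N. covers {0<..<y} N"
proof -
  have c0: "covers {0<..<c} (Suc 0)"
    using covers_left[of 0 c 0] covers_unit c01 S_ends full by simp
  have *: "0 < y \<Longrightarrow> y \<le> 1 \<Longrightarrow> c \<le> y * \<theta> ^ n \<Longrightarrow> \<exists>N. covers {0<..<y} N" for n y
  proof (induction n arbitrary: y)
    case 0
    then have "{0<..<c} \<subseteq> {0<..<y}" by auto
    then show ?case using covers_mono[OF c0] by blast
  next
    case (Suc n)
    show ?case
    proof (cases "c \<le> y")
      case True
      have "{0<..<c} \<subseteq> {0<..<y}" using True by auto
      then show ?thesis using covers_mono[OF c0] by blast
    next
      case False
      have e: "\<theta> * y \<le> S y" using expand_left[of 0 y] False Suc S_ends by simp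
      have "0 < \<theta> * y" using Suc \<theta>1 by simp
      then have "0 < S y" using e by linarith
      moreover have "S y \<le> 1" using S_le_a[of y] Suc full by simp
      moreover have "c \<le> S y * \<theta> ^ n"
      proof -
        have "c \<le> (\<theta> * y) * \<theta> ^ n" using Suc(4) by (simp add: mult_ac)
        also have "\<dots> \<le> S y * \<theta> ^ n" using e \<theta>1 by (intro mult_right_mono) auto
        finally show ?thesis .
      qed
      ultimately obtain N where "covers {0<..<S y} N" using Suc(1) by blast
      then show ?thesis using covers_left[of 0 y N] Suc False S_ends by auto
    qed
  qed
  obtain n where "c / y < \<theta> ^ n" using real_arch_pow[OF \<theta>1] by blast
  then have "c \<le> y * \<theta> ^ n" using assms by (simp add: field_simps)
  then show ?thesis using * assms by blast
qed

text \<open>A neighbourhood of 1 to the right of c is mapped onto an initial interval; otherwise it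
  contains the whole right branch.\<close>

lemma covers_final:
  assumes "0 \<le> y" "y < 1"
  shows "\<exists>N. covers {y<..<1} N"
proof (cases "y \<le> c")
  case True
  have "covers {c<..<1} (Suc 0)"
    using covers_right[of c 1 0] covers_unit c01 S_ends full by simp
  moreover have "{c<..<1} \<subseteq> {y<..<1}" using True by auto
  ultimately show ?thesis using covers_mono by blast
next
  case False
  have "0 < S y" using S_less_right[of y 1] False assms S_ends by simp
  moreover have "S y \<le> 1" using S_le_a[of y] assms full by simp
  ultimately obtain N where "covers {0<..<S y} N" using covers_initial by blast
  then show ?thesis using covers_right[of y 1 N] False assms S_ends by auto
qed

text \<open>An interval on one side of c grows by the factor \<theta>, which cannot go on forever
  inside [0, 1]. An interval around c has an image reaching up to a = 1 and is handled by
  \<open>covers_final\<close>.\<close>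

lemma covers_interval:
  assumes "0 \<le> u" "u < v" "v \<le> 1"
  shows "\<exists>N. covers {u<..<v} N"
proof -
  have *: "0 \<le> u \<Longrightarrow> u < v \<Longrightarrow> v \<le> 1 \<Longrightarrow> 1 \<le> (v - u) * \<theta> ^ n \<Longrightarrow> \<exists>N. covers {u<..<v} N" for n u v
  proof (induction n arbitrary: u v)
    case 0
    then have "u = 0" "v = 1" by auto
    then show ?case using covers_unit by auto
  next
    case (Suc n)
    have S01: "S x \<le> 1" "0 \<le> S x" if "x \<in> {0..1}" for x
    proof -
      show "S x \<le> 1" using S_le_a[OF that] full by linarith
      have "0 \<le> T x" using T_in[OF that] by simp
      then show "0 \<le> S x"
        using S_eq[of x] S_ends(3) full by (cases "x = c") (metis zero_le_one, linarith)
    qed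
    have grow: "1 \<le> d' * \<theta> ^ n" if "\<theta> * (v - u) \<le> d'" for d'
    proof -
      have "1 \<le> (\<theta> * (v - u)) * \<theta> ^ n" using Suc(5) by (simp add: mult_ac)
      also have "\<dots> \<le> d' * \<theta> ^ n" using that \<theta>1 by (intro mult_right_mono) auto
      finally show ?thesis .
    qed
    consider "v \<le> c" | "c \<le> u" | "u < c" "c < v" by linarith
    then show ?case
    proof cases
      case 1
      have "\<exists>N. covers {S u<..<S v} N"
        using Suc 1 S01[of u] S01[of v] S_less_left[of u v] grow[OF expand_left[of u v]] by (intro Suc(1)) auto
      then show ?thesis using covers_left[of u v] Suc 1 by blast
    next
      case 2
      have "\<exists>N. covers {S v<..<S u} N"
        using Suc 2 S01[of u] S01[of v] S_less_right[of u v] grow[OF expand_right[of u v]] by (intro Suc(1)) auto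
      then show ?thesis using covers_right[of u v] Suc 2 by blast
    next
      case 3
      have "S u < 1" using S_less_left[of u c] Suc 3 S_ends full by simp
      then obtain N where "covers {S u<..<1} N" using covers_final[of "S u"] S01[of u] Suc by auto
      then have "covers {u<..<c} (Suc N)" using covers_left[of u c N] Suc 3 S_ends full by simp
      moreover have "{u<..<c} \<subseteq> {u<..<v}" using 3 by auto
      ultimately show ?thesis using covers_mono by blast
    qed
  qed
  obtain n where "1 / (v - u) < \<theta> ^ n" using real_arch_pow[OF \<theta>1] by blast
  then have "1 \<le> (v - u) * \<theta> ^ n" using assms by (simp add: field_simps)
  then show ?thesis using * assms by blast
qed

text \<open>Monotonicity in the number of steps allows finitely many intervals to share one N. The
  left branch already covers in one step, so a preimage of V is null only if V is.\<close>

lemma covers_Suc: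
  assumes J: "covers J N"
  shows "covers J (Suc N)"
  unfolding covers_def
proof (intro ballI impI)
  fix V assume V: "V \<in> sets \<mu>" and n: "negligible (J \<inter> (T ^^ Suc N) -` V \<inter> {0..1})"
  have Tm: "T \<in> measurable \<mu> \<mu>" using T_nonsing by (simp add: nonsingular_def)
  have TN: "T ^^ N \<in> measurable \<mu> \<mu>" using nonsingular_funpow[OF T_nonsing] by (simp add: nonsingular_def)
  have W: "T -` V \<inter> {0..1} \<in> sets \<mu>" using measurable_sets[OF Tm V] by simp
  have "J \<inter> (T ^^ N) -` (T -` V \<inter> {0..1}) \<inter> {0..1} \<subseteq> J \<inter> (T ^^ Suc N) -` V \<inter> {0..1}" by auto
  then have "negligible (J \<inter> (T ^^ N) -` (T -` V \<inter> {0..1}) \<inter> {0..1})" by (rule negligible_subset[OF n])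
  then have "negligible (T -` V \<inter> {0..1})" using J W by (auto simp: covers_def)
  then have "negligible ({0<..<c} \<inter> (T ^^ Suc 0) -` V \<inter> {0..1})" by (rule negligible_subset) auto
  moreover have "covers {0<..<c} (Suc 0)"
    using covers_left[of 0 c 0] covers_unit c01 S_ends full by simp
  ultimately show "negligible V" using V by (auto simp: covers_def)
qed

lemma covers_ge: "covers J N \<Longrightarrow> N \<le> N' \<Longrightarrow> covers J N'"
  by (rule dec_induct[of N N' "covers J"]) (auto intro: covers_Suc)

end

end

text \<open>The positive part of a mean-zero f has integral equal to half the norm. If f dipped
  below a quarter of the norm in each of the M cells, its positive part would be at most that
  quarter plus the oscillation in the cell. The oscillations sum to at most B times the norm, and
  averaging over cells of length 1 / M leaves less than another quarter.\<close>

lemma weak_deriv_mean_zero_large: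
  fixes f f' :: "real \<Rightarrow> real"
  assumes w: "weak_deriv f f'" and z: "(\<integral>x. f x \<partial>\<mu>) = 0"
    and B: "(\<integral>x. \<bar>f' x\<bar> \<partial>\<mu>) \<le> B * (\<integral>x. \<bar>f x\<bar> \<partial>\<mu>)" and M: "0 < M" "4 * B < real M"
  shows "\<exists>i<M. AE x in \<mu>. x \<in> {real i / M..real (Suc i) / M} \<longrightarrow> (\<integral>x. \<bar>f x\<bar> \<partial>\<mu>) / 4 \<le> f x"
proof -
  define nf where "nf = (\<integral>x. \<bar>f x\<bar> \<partial>\<mu>)"
  have fi: "integrable \<mu> f" and f'i: "integrable \<mu> f'" using w by (auto dest: weak_derivD)
  have nf0: "0 \<le> nf" unfolding nf_def by (rule Bochner_Integration.integral_nonneg) simp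
  show ?thesis
  proof (cases "nf = 0")
    case True
    then have "AE x in \<mu>. \<bar>f x\<bar> = 0"
      using fi integral_nonneg_eq_0_iff_AE[of \<mu> "\<lambda>x. \<bar>f x\<bar>"] by (auto simp: nf_def)
    then have "AE x in \<mu>. x \<in> {real 0 / M..real (Suc 0) / M} \<longrightarrow> (\<integral>x. \<bar>f x\<bar> \<partial>\<mu>) / 4 \<le> f x"
      by eventually_elim (use True in \<open>simp add: nf_def\<close>)
    then show ?thesis using M(1) by blast
  next
    case False
    with nf0 have nf: "0 < nf" by simp
    obtain C where C: "ae_eq f (\<lambda>x. C + prim f' x)" by (rule du_Bois_Reymond[OF w])
    define F where "F x = C + prim f' x" for x
    define V where "V = prim (\<lambda>t. \<bar>f' t\<bar>)"
    have osc: "\<bar>F y - F x\<bar> \<le> V v - V u" if "0 \<le> u" "x \<in> {u..v}" "y \<in> {u..v}" for x y u v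
    proof -
      have "norm (prim f' (max x y) - prim f' (min x y)) \<le> V v - V u"
        using prim_diff_le[OF f'i, of u "min x y" "max x y" v] that by (auto simp: V_def)
      moreover have "\<bar>F y - F x\<bar> = norm (prim f' (max x y) - prim f' (min x y))"
        by (simp add: F_def max_def min_def abs_minus_commute)
      ultimately show ?thesis by simp
    qed
    have Vtot: "V 1 - V 0 \<le> B * nf"
      using B prim_norm_nonneg[of f' 0] by (simp add: V_def prim_1 nf_def)
    define J where "J i = {real i / M..real (Suc i) / M}" for i
    have "\<exists>i<M. \<forall>x\<in>J i. nf / 4 \<le> F x"
    proof (rule ccontr)
      assume "\<not> ?thesis"
      then have ex: "\<exists>x\<in>J i. F x < nf / 4" if "i < M" for i using that by (auto simp: not_le)
      \<comment> \<open>The integral of |f'| over the i-th cell, an upper bound for the oscillation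
        of F there; these numbers telescope to the total variation.\<close>
      define o' where "o' i = V (real (Suc i) / M) - V (real i / M)" for i
      have upper: "F y \<le> nf / 4 + o' i" if i: "i < M" and y: "y \<in> J i" for i y
      proof -
        obtain x where "x \<in> J i" "F x < nf / 4" using ex[OF i] by blast
        moreover have "\<bar>F y - F x\<bar> \<le> o' i"
          unfolding o'_def using calculation y by (intro osc) (auto simp: J_def)
        ultimately show ?thesis by linarith
      qed
      have o'0: "0 \<le> o' i" for i
      proof -
        have "real i / M \<le> real (Suc i) / M" by (simp add: divide_right_mono)
        then show ?thesis using osc[of "real i / M" "real i / M" "real (Suc i) / M" "real i / M"] by (simp add: o'_def)
      qed
      have osum: "(\<Sum>i<M. o' i) = V 1 - V 0"
        unfolding o'_def using sum_lessThan_telescope[of "\<lambda>i. V (real i / M)" M] M(1) by simp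
      let ?g = "\<lambda>x. nf / 4 + (\<Sum>i<M. o' i * indicator (J i) x)"
      have Ji: "integrable \<mu> (indicator (J i) :: real \<Rightarrow> real)" "(\<integral>x. indicator (J i) x \<partial>\<mu>) = 1 / M" if "i < M" for i
      proof -
        have le: "real (Suc i) / M \<le> 1" using that M by (simp add: divide_le_eq)
        have sub: "J i \<subseteq> {0..1}" using le by (auto simp: J_def intro: order_trans)
        then have sets: "J i \<in> sets \<mu>" by (auto simp: sets_restrict_space_iff J_def)
        then show "integrable \<mu> (indicator (J i) :: real \<Rightarrow> real)"
          by (intro integrable_mu_bounded[where B = 1]) (auto simp: indicator_def)
        have "(\<integral>x. indicator (J i) x \<partial>\<mu>) = measure \<mu> (J i)" using sets sub by (simp add: Int_absorb2)
        also have "\<dots> = measure lebesgue (J i)" using sub by (intro measure_restrict_space) (auto simp: J_def)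
        also have "\<dots> = 1 / M" using M by (simp add: J_def divide_right_mono flip: diff_divide_distrib)
        finally show "(\<integral>x. indicator (J i) x \<partial>\<mu>) = 1 / M" .
      qed
      have gi: "integrable \<mu> ?g" using Ji(1) by (intro Bochner_Integration.integrable_add Bochner_Integration.integrable_sum integrable_mult_right) auto
      have "AE x in \<mu>. max (f x) 0 \<le> ?g x"
        using C AE_mu_neq[of 1] AE_space[of \<mu>] unfolding ae_eq_def
      proof eventually_elim
        case (elim x)
        define i where "i = nat \<lfloor>M * x\<rfloor>"
        have x: "0 \<le> x" "x < 1" using elim by auto
        have i1: "real i \<le> M * x" "M * x < real (Suc i)" using x M unfolding i_def by (auto simp: of_nat_nat) linarith+
        moreover have "M * x < M" using x M by simp
        ultimately have iM: "i < M" by simp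
        have xJ: "x \<in> J i" using i1 M by (auto simp: J_def field_simps)
        have "f x \<le> nf / 4 + o' i" using upper[OF iM xJ] elim by (simp add: F_def)
        moreover have "o' i * indicator (J i) x \<le> (\<Sum>i<M. o' i * indicator (J i) x)"
          using iM o'0 by (intro member_le_sum) auto
        moreover have "0 \<le> (\<Sum>i<M. o' i * indicator (J i) x)" using o'0 by (intro sum_nonneg) auto
        ultimately show ?case using xJ nf by simp
      qed
      then have "(\<integral>x. max (f x) 0 \<partial>\<mu>) \<le> (\<integral>x. ?g x \<partial>\<mu>)"
        using fi gi by (intro integral_mono_AE) auto
      also have "\<dots> = nf / 4 + (\<Sum>i<M. o' i * (1 / M))"
      proof -
        have oi: "integrable \<mu> (\<lambda>x. o' i * indicator (J i) x)" if "i \<in> {..<M}" for i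
          using Ji(1)[of i] that by (intro integrable_mult_right) auto
        have "(\<integral>x. (\<Sum>i<M. o' i * indicator (J i) x) \<partial>\<mu>) = (\<Sum>i<M. \<integral>x. o' i * indicator (J i) x \<partial>\<mu>)"
          by (rule Bochner_Integration.integral_sum[OF oi])
        also have "\<dots> = (\<Sum>i<M. o' i * (1 / M))"
          by (intro sum.cong refl) (subst integral_mult_right_zero, subst Ji(2), auto)
        finally show ?thesis
          using Bochner_Integration.integral_add[OF _ Bochner_Integration.integrable_sum[OF oi], of "\<lambda>x. nf / 4" "{..<M}"]
          by simp
      qed
      also have "\<dots> = nf / 4 + (V 1 - V 0) / M" by (simp add: osum flip: sum_divide_distrib)
      also have "\<dots> \<le> nf / 4 + (B * nf) / M" using Vtot by (simp add: divide_right_mono)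
      also have "\<dots> < nf / 4 + nf / 4" using M nf by (simp add: field_simps)
      finally have "(\<integral>x. max (f x) 0 \<partial>\<mu>) < nf / 2" by simp
      moreover have "(\<integral>x. 2 * max (f x) 0 \<partial>\<mu>) = (\<integral>x. f x + \<bar>f x\<bar> \<partial>\<mu>)"
        by (intro Bochner_Integration.integral_cong) auto
      then have "2 * (\<integral>x. max (f x) 0 \<partial>\<mu>) = nf" using fi z by (simp add: nf_def)
      ultimately show False by simp
    qed
    then obtain i where i: "i < M" "\<And>x. x \<in> J i \<Longrightarrow> nf / 4 \<le> F x" by blast
    have "AE x in \<mu>. x \<in> J i \<longrightarrow> nf / 4 \<le> f x"
      using C unfolding ae_eq_def by eventually_elim (use i in \<open>auto simp: F_def\<close>)
    then show ?thesis using i(1) by (auto simp: J_def nf_def)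
  qed
qed

section \<open>Contraction of the L^1 norm on mean-zero functions\<close>

context expanding_unimodal
begin

context
  assumes full: "a = 1"
begin

text \<open>Testing the iterate of the indicator against the set Z where it is not positive shows
  that almost no point of J reaches Z in N steps; covering then makes Z null.\<close>

lemma transfer_indicator_pos:
  assumes J: "covers J N" "J \<in> sets \<mu>"
  shows "AE x in \<mu>. 0 < (transfer T ^^ N) (indicator J :: real \<Rightarrow> real) x"
proof -
  let ?\<psi> = "(transfer T ^^ N) (indicator J :: real \<Rightarrow> real)"
  have Ji: "integrable \<mu> (indicator J :: real \<Rightarrow> real)"
    using J(2) by (intro integrable_mu_bounded[where B = 1]) (auto simp: indicator_def)
  have \<psi>i: "integrable \<mu> ?\<psi>" by (rule funpow_transfer_integrable[OF T_nonsing Ji])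
  have \<psi>m: "?\<psi> \<in> borel_measurable \<mu>" using \<psi>i by auto
  have "AE x in \<mu>. \<bar>(transfer T ^^ N) (\<lambda>x. 0) x\<bar> \<le> ?\<psi> x"
    using Ji by (intro funpow_transfer_abs T_nonsing) auto
  then have nn: "AE x in \<mu>. 0 \<le> ?\<psi> x" by eventually_elim linarith
  define Z where "Z = {x \<in> space \<mu>. ?\<psi> x \<le> 0}"
  have Z: "Z \<in> sets \<mu>" unfolding Z_def using \<psi>m by measurable
  have ZL: "(indicator Z :: real \<Rightarrow> real) \<in> Linf_space" using Z by (intro Linf_bounded[where B = 1]) (auto simp: indicator_def)
  have "(\<integral>x. ?\<psi> x * indicator Z x \<partial>\<mu>) = (\<integral>x. 0 \<partial>\<mu>)"
  proof (rule integral_cong_AE)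
    show "AE x in \<mu>. ?\<psi> x * indicator Z x = 0" using nn by eventually_elim (auto simp: Z_def indicator_def)
  qed (use \<psi>m Z in auto)
  then have "(\<integral>x. indicator J x * indicator Z ((T ^^ N) x) \<partial>\<mu>) = (0::real)"
    using funpow_transfer_duality[OF T_nonsing Ji ZL, of N] by simp
  moreover have TN: "T ^^ N \<in> measurable \<mu> \<mu>" using nonsingular_funpow[OF T_nonsing] by (simp add: nonsingular_def)
  define A where "A = J \<inter> (T ^^ N) -` Z \<inter> {0..1}"
  have "(T ^^ N) -` Z \<inter> {0..1} \<in> sets \<mu>" using measurable_sets[OF TN Z] by simp
  then have A: "A \<in> sets \<mu>" using J(2) by (auto simp: A_def Int_assoc)
  have "(\<integral>x. indicator J x * indicator Z ((T ^^ N) x) \<partial>\<mu>) = (\<integral>x. indicator A x \<partial>\<mu> :: real)"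
    by (intro Bochner_Integration.integral_cong) (auto simp: A_def indicator_def)
  moreover have "(\<integral>x. indicator A x \<partial>\<mu> :: real) = measure \<mu> A"
    using A sets.sets_into_space[OF A] by (simp add: Int_absorb2)
  ultimately have "measure \<mu> A = 0" by simp
  then have "A \<in> null_sets \<mu>" using A by (auto simp: null_sets_def mu.emeasure_eq_measure)
  then have "negligible A" by (auto simp: negligible_iff_null_sets null_sets_restrict_space)
  then have "negligible Z" using J(1) Z unfolding covers_def A_def by blast
  then have "Z \<in> null_sets \<mu>"
    using sets.sets_into_space[OF Z] by (auto simp: negligible_iff_null_sets null_sets_restrict_space)
  then have "AE x in \<mu>. x \<notin> Z" by (rule AE_not_in)
  then show ?thesis using AE_space[of \<mu>] by eventually_elim (auto simp: Z_def)
qed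

text \<open>A cone-type argument: when f' is dominated by B times the norm of f, both f and -f are
  at least a quarter of the norm on some cell of a fixed finite partition. The images of both parts
  then share a common minorant, which cancels in the difference.\<close>

lemma mean_zero_contraction:
  "\<exists>N \<kappa>. 0 < \<kappa> \<and> \<kappa> \<le> (1::real) \<and> (\<forall>(f :: real \<Rightarrow> real) f'. weak_deriv f f' \<longrightarrow> (\<integral>x. f x \<partial>\<mu>) = 0 \<longrightarrow>
     (\<integral>x. \<bar>f' x\<bar> \<partial>\<mu>) \<le> B * (\<integral>x. \<bar>f x\<bar> \<partial>\<mu>) \<longrightarrow>
     (\<integral>x. \<bar>(transfer T ^^ N) f x\<bar> \<partial>\<mu>) \<le> (1 - \<kappa>) * (\<integral>x. \<bar>f x\<bar> \<partial>\<mu>))"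
proof -
  obtain M where M: "max (4 * B) 0 < real M" using reals_Archimedean2 by blast
  then have M0: "0 < M" "4 * B < real M" by auto
  define J where "J i = {real i / M<..<real (Suc i) / M}" for i
  have Jsub: "J i \<subseteq> {0..1}" if "i < M" for i
  proof -
    have "real (Suc i) / M \<le> 1" using that M0 by (simp add: divide_le_eq)
    then show ?thesis by (auto simp: J_def intro: order_trans less_imp_le) (meson divide_nonneg_nonneg le_less_trans less_imp_le of_nat_0_le_iff)
  qed
  have Jsets: "J i \<in> sets \<mu>" if "i < M" for i
    using Jsub[OF that] by (auto simp: sets_restrict_space_iff J_def)
  have "\<exists>N. covers (J i) N" if "i < M" for i
    unfolding J_def using that M0 by (intro covers_interval[OF full]) (auto simp: divide_le_eq divide_strict_right_mono)
  then obtain n where n: "\<And>i. i < M \<Longrightarrow> covers (J i) (n i)" by metis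
  define N where "N = Max (n ` {..<M})"
  have cov: "covers (J i) N" if "i < M" for i
    using that by (intro covers_ge[OF full n[OF that]]) (auto simp: N_def)
  define \<psi> where "\<psi> i = (transfer T ^^ N) (indicator (J i) :: real \<Rightarrow> real)" for i
  have Ji: "integrable \<mu> (indicator (J i) :: real \<Rightarrow> real)" if "i < M" for i
    using Jsets[OF that] by (intro integrable_mu_bounded[where B = 1]) (auto simp: indicator_def)
  have \<psi>i: "integrable \<mu> (\<psi> i)" if "i < M" for i
    unfolding \<psi>_def by (rule funpow_transfer_integrable[OF T_nonsing Ji[OF that]])
  have \<psi>pos: "AE x in \<mu>. \<forall>i\<in>{..<M}. 0 < \<psi> i x"
    unfolding \<psi>_def using cov Jsets by (intro AE_finite_allI transfer_indicator_pos) auto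
  \<comment> \<open>A minorant independent of f: which of the finitely many cells carries the mass
    depends on f, so the minimum over all cells is taken.\<close>
  define \<phi> where "\<phi> x = Min ((\<lambda>i. \<psi> i x) ` {..<M})" for x
  have \<phi>m: "\<phi> \<in> borel_measurable \<mu>"
    unfolding \<phi>_def using \<psi>i M0 by (intro borel_measurable_Min) auto
  have \<phi>le: "\<phi> x \<le> \<psi> i x" if "i < M" for i x using that by (auto simp: \<phi>_def)
  have \<phi>pos: "AE x in \<mu>. 0 < \<phi> x"
    using \<psi>pos by eventually_elim (unfold \<phi>_def, subst Min_gr_iff, use M0 in auto)
  have \<phi>i: "integrable \<mu> \<phi>"
    by (rule Bochner_Integration.integrable_bound[OF \<psi>i[OF M0(1)] \<phi>m])
      (use \<phi>pos in \<open>eventually_elim, use \<phi>le[OF M0(1)] in \<open>auto intro: order_trans[OF _ abs_ge_self]\<close>\<close>)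
  define I where "I = (\<integral>x. \<phi> x \<partial>\<mu>)"
  have I0: "0 < I"
  proof -
    have "0 \<le> I" unfolding I_def using \<phi>pos by (intro integral_nonneg_AE) (auto elim: eventually_mono)
    moreover have "I \<noteq> 0"
    proof
      assume "I = 0"
      then have "AE x in \<mu>. \<phi> x = 0"
      proof -
        have "AE x in \<mu>. 0 \<le> \<phi> x" using \<phi>pos by eventually_elim simp
        then show ?thesis using \<open>I = 0\<close> integral_nonneg_eq_0_iff_AE[OF \<phi>i] by (simp add: I_def)
      qed
      with \<phi>pos have "AE x in \<mu>. False" by eventually_elim simp
      then show False by (simp add: eventually_False ae_filter_eq_bot_iff)
    qed
    ultimately show ?thesis by simp
  qed
  have I1: "I \<le> 1"
  proof -
    have "I \<le> (\<integral>x. \<psi> 0 x \<partial>\<mu>)" unfolding I_def using \<phi>le[OF M0(1)] by (intro integral_mono \<phi>i \<psi>i M0) auto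
    also have "\<dots> = (\<integral>x. indicator (J 0) x \<partial>\<mu>)" unfolding \<psi>_def by (rule funpow_transfer_integral[OF T_nonsing Ji[OF M0(1)]])
    also have "\<dots> \<le> 1" by (rule integral_mu_bounded[OF Ji[OF M0(1)]]) (auto simp: indicator_def)
    finally show ?thesis .
  qed
  have main: "(\<integral>x. \<bar>(transfer T ^^ N) f x\<bar> \<partial>\<mu>) \<le> (1 - I / 2) * (\<integral>x. \<bar>f x\<bar> \<partial>\<mu>)"
    if w: "weak_deriv f f'" and z: "(\<integral>x. f x \<partial>\<mu>) = 0" and b: "(\<integral>x. \<bar>f' x\<bar> \<partial>\<mu>) \<le> B * (\<integral>x. \<bar>f x\<bar> \<partial>\<mu>)"
    for f f' :: "real \<Rightarrow> real"
  proof -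
    define nf where "nf = (\<integral>x. \<bar>f x\<bar> \<partial>\<mu>)"
    have fi: "integrable \<mu> f" using w by (rule weak_derivD)
    have nf0: "0 \<le> nf" unfolding nf_def by (rule Bochner_Integration.integral_nonneg) simp
    have half: "AE x in \<mu>. nf / 4 * \<phi> x \<le> (transfer T ^^ N) (\<lambda>x. max (g x) 0) x"
      if wg: "weak_deriv g g'" "(\<integral>x. g x \<partial>\<mu>) = 0" "(\<integral>x. \<bar>g' x\<bar> \<partial>\<mu>) \<le> B * (\<integral>x. \<bar>g x\<bar> \<partial>\<mu>)"
        "(\<integral>x. \<bar>g x\<bar> \<partial>\<mu>) = nf" for g g'
    proof -
      have gi: "integrable \<mu> g" using wg(1) by (rule weak_derivD)
      obtain i where i: "i < M" "AE x in \<mu>. x \<in> {real i / M..real (Suc i) / M} \<longrightarrow> nf / 4 \<le> g x"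
        using weak_deriv_mean_zero_large[OF wg(1-3) M0] wg(4) by auto
      have "AE x in \<mu>. \<bar>(transfer T ^^ N) (\<lambda>x. nf / 4 * indicator (J i) x) x\<bar> \<le> (transfer T ^^ N) (\<lambda>x. max (g x) 0) x"
      proof (rule funpow_transfer_abs[OF T_nonsing])
        show "AE x in \<mu>. \<bar>nf / 4 * indicator (J i) x\<bar> \<le> max (g x) 0"
          using i(2) by eventually_elim (use nf0 in \<open>auto simp: indicator_def J_def\<close>)
      qed (use Ji[OF i(1)] gi in auto)
      with funpow_transfer_scale[OF T_nonsing Ji[OF i(1)], of N "nf / 4"]
      show ?thesis unfolding ae_eq_def
      proof eventually_elim
        case (elim x)
        have "nf / 4 * \<phi> x \<le> nf / 4 * \<psi> i x" using \<phi>le[OF i(1)] nf0 by (intro mult_left_mono) auto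
        with elim show ?case by (simp add: \<psi>_def)
      qed
    qed
    let ?p = "\<lambda>x. max (f x) 0" and ?m = "\<lambda>x. max ((-1) * f x) 0"
    have pi: "integrable \<mu> ?p" "integrable \<mu> ?m" using fi by auto
    have h1: "AE x in \<mu>. nf / 4 * \<phi> x \<le> (transfer T ^^ N) ?p x"
      by (rule half[OF w z b]) (simp add: nf_def)
    have h2: "AE x in \<mu>. nf / 4 * \<phi> x \<le> (transfer T ^^ N) ?m x"
      by (rule half[OF weak_deriv_scale[OF w]]) (use z b fi in \<open>simp_all add: nf_def\<close>)
    have "ae_eq ((transfer T ^^ N) (\<lambda>x. ?p x - ?m x)) (\<lambda>x. (transfer T ^^ N) ?p x - (transfer T ^^ N) ?m x)"
      by (rule funpow_transfer_diff[OF T_nonsing pi])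
    moreover have "(\<lambda>x. ?p x - ?m x) = f" by (auto simp: max_def)
    ultimately have d: "AE x in \<mu>. (transfer T ^^ N) f x = (transfer T ^^ N) ?p x - (transfer T ^^ N) ?m x"
      by (simp add: ae_eq_def)
    have Pi: "integrable \<mu> ((transfer T ^^ N) ?p)" "integrable \<mu> ((transfer T ^^ N) ?m)" "integrable \<mu> ((transfer T ^^ N) f)"
      by (intro funpow_transfer_integrable T_nonsing pi fi)+
    \<comment> \<open>If two numbers both exceed t, the absolute value of their difference is at
      most their sum minus 2 t. With t a quarter of the norm times \<open>\<phi>\<close>, the gain
      is half the norm times \<open>\<phi>\<close>, so the contraction constant is I / 2.\<close>
    have "(\<integral>x. \<bar>(transfer T ^^ N) f x\<bar> \<partial>\<mu>) \<le> (\<integral>x. ((transfer T ^^ N) ?p x + (transfer T ^^ N) ?m x) - nf / 2 * \<phi> x \<partial>\<mu>)"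
    proof (rule integral_mono_AE)
      show "AE x in \<mu>. \<bar>(transfer T ^^ N) f x\<bar> \<le> ((transfer T ^^ N) ?p x + (transfer T ^^ N) ?m x) - nf / 2 * \<phi> x"
        using d h1 h2 by eventually_elim (auto simp: abs_if)
    qed (use Pi \<phi>i in auto)
    also have "\<dots> = ((\<integral>x. ?p x \<partial>\<mu>) + (\<integral>x. ?m x \<partial>\<mu>)) - nf / 2 * I"
      using Pi \<phi>i funpow_transfer_integral[OF T_nonsing pi(1), of N] funpow_transfer_integral[OF T_nonsing pi(2), of N]
      by (simp add: I_def)
    also have "(\<integral>x. ?p x \<partial>\<mu>) + (\<integral>x. ?m x \<partial>\<mu>) = (\<integral>x. ?p x + ?m x \<partial>\<mu>)"
      using pi by simp
    also have "\<dots> = nf" unfolding nf_def by (intro Bochner_Integration.integral_cong) auto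
    finally show ?thesis by (simp add: nf_def algebra_simps)
  qed
  show ?thesis
    using main I0 I1 by (intro exI[of _ N] exI[of _ "I / 2"]) auto
qed

text \<open>Contraction is available only while the derivative is dominated by the L^1 norm. When
  this fails, the L^1 norm is already at most \<eta> W, and it remains so because P does not
  increase it.\<close>

lemma mean_zero_decay:
  fixes C \<eta> :: real
  assumes C: "0 \<le> C" "\<And>(f :: real \<Rightarrow> real) f' n. weak_deriv f f' \<Longrightarrow>
     (\<exists>g. weak_deriv ((transfer T ^^ n) f) g \<and> (\<integral>x. \<bar>g x\<bar> \<partial>\<mu>) \<le> (\<integral>x. \<bar>f' x\<bar> \<partial>\<mu>) + C * (\<integral>x. \<bar>f x\<bar> \<partial>\<mu>))"
    and \<eta>: "0 < \<eta>"
  shows "\<exists>n. \<forall>(f :: real \<Rightarrow> real) f'. weak_deriv f f' \<longrightarrow> (\<integral>x. f x \<partial>\<mu>) = 0 \<longrightarrow>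
     (\<integral>x. \<bar>(transfer T ^^ n) f x\<bar> \<partial>\<mu>) \<le> \<eta> * ((\<integral>x. \<bar>f x\<bar> \<partial>\<mu>) + (\<integral>x. \<bar>f' x\<bar> \<partial>\<mu>))"
proof -
  \<comment> \<open>The derivatives of all iterates have norm at most (1 + C) W; if the L^1 norm of
    an iterate exceeds \<eta> W, the quotient of the two is at most this B.\<close>
  define B where "B = (1 + C) / \<eta>"
  obtain N and \<kappa> :: real where \<kappa>: "0 < \<kappa>" "\<kappa> \<le> 1" and con: "\<And>(f :: real \<Rightarrow> real) f'. weak_deriv f f' \<Longrightarrow> (\<integral>x. f x \<partial>\<mu>) = 0 \<Longrightarrow>
     (\<integral>x. \<bar>f' x\<bar> \<partial>\<mu>) \<le> B * (\<integral>x. \<bar>f x\<bar> \<partial>\<mu>) \<Longrightarrow>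
     (\<integral>x. \<bar>(transfer T ^^ N) f x\<bar> \<partial>\<mu>) \<le> (1 - \<kappa>) * (\<integral>x. \<bar>f x\<bar> \<partial>\<mu>)"
    using mean_zero_contraction[of B] by blast
  obtain k where k: "(1 - \<kappa>) ^ k < \<eta>" using real_arch_pow_inv[of \<eta> "1 - \<kappa>"] \<eta> \<kappa> by auto
  show ?thesis
  proof (intro exI[of _ "k * N"] allI impI)
    fix f f' :: "real \<Rightarrow> real" assume w: "weak_deriv f f'" and z: "(\<integral>x. f x \<partial>\<mu>) = 0"
    have fi: "integrable \<mu> f" using w by (rule weak_derivD)
    define W where "W = (\<integral>x. \<bar>f x\<bar> \<partial>\<mu>) + (\<integral>x. \<bar>f' x\<bar> \<partial>\<mu>)"
    have n0: "0 \<le> (\<integral>x. \<bar>f x\<bar> \<partial>\<mu>)" "0 \<le> (\<integral>x. \<bar>f' x\<bar> \<partial>\<mu>)"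
      by (rule Bochner_Integration.integral_nonneg, simp)+
    then have W0: "0 \<le> W" by (simp add: W_def)
    have "(\<integral>x. \<bar>(transfer T ^^ (j * N)) f x\<bar> \<partial>\<mu>) \<le> max (\<eta> * W) ((1 - \<kappa>) ^ j * W)" for j
    proof (induction j)
      case 0
      have "(\<integral>x. \<bar>f x\<bar> \<partial>\<mu>) \<le> W" using n0 by (simp add: W_def)
      then show ?case by (simp add: le_max_iff_disj)
    next
      case (Suc j)
      let ?g = "(transfer T ^^ (j * N)) f"
      have gi: "integrable \<mu> ?g" by (rule funpow_transfer_integrable[OF T_nonsing fi])
      have eq: "(transfer T ^^ (Suc j * N)) f = (transfer T ^^ N) ?g" by (simp add: funpow_add)
      show ?case
      proof (cases "(\<integral>x. \<bar>?g x\<bar> \<partial>\<mu>) \<le> \<eta> * W")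
        case True
        have "(\<integral>x. \<bar>(transfer T ^^ N) ?g x\<bar> \<partial>\<mu>) \<le> (\<integral>x. \<bar>?g x\<bar> \<partial>\<mu>)" by (rule funpow_transfer_L1[OF T_nonsing gi])
        with True show ?thesis unfolding eq by linarith
      next
        case False
        obtain g' where g': "weak_deriv ?g g'" "(\<integral>x. \<bar>g' x\<bar> \<partial>\<mu>) \<le> (\<integral>x. \<bar>f' x\<bar> \<partial>\<mu>) + C * (\<integral>x. \<bar>f x\<bar> \<partial>\<mu>)"
          using C(2)[OF w] by blast
        have "(\<integral>x. \<bar>g' x\<bar> \<partial>\<mu>) \<le> (1 + C) * W"
        proof -
          have "(\<integral>x. \<bar>f' x\<bar> \<partial>\<mu>) + C * (\<integral>x. \<bar>f x\<bar> \<partial>\<mu>) \<le> W + C * W"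
            using n0 C(1) by (intro add_mono mult_left_mono) (auto simp: W_def)
          with g'(2) show ?thesis by (simp add: algebra_simps)
        qed
        also have "\<dots> = B * (\<eta> * W)" using \<eta> by (simp add: B_def)
        also have "\<dots> \<le> B * (\<integral>x. \<bar>?g x\<bar> \<partial>\<mu>)" using False C(1) \<eta> by (intro mult_left_mono) (auto simp: B_def)
        finally have "(\<integral>x. \<bar>(transfer T ^^ N) ?g x\<bar> \<partial>\<mu>) \<le> (1 - \<kappa>) * (\<integral>x. \<bar>?g x\<bar> \<partial>\<mu>)"
          using z fi by (intro con[OF g'(1)]) (simp_all add: funpow_transfer_integral[OF T_nonsing])
        also have "\<dots> \<le> (1 - \<kappa>) * ((1 - \<kappa>) ^ j * W)" using Suc False \<kappa> by (intro mult_left_mono) auto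
        finally show ?thesis unfolding eq by (simp add: mult.assoc)
      qed
    qed
    from this[of k] have "(\<integral>x. \<bar>(transfer T ^^ (k * N)) f x\<bar> \<partial>\<mu>) \<le> max (\<eta> * W) ((1 - \<kappa>) ^ k * W)" .
    also have "\<dots> \<le> \<eta> * W" using k W0 by (auto intro: mult_right_mono)
    finally show "(\<integral>x. \<bar>(transfer T ^^ (k * N)) f x\<bar> \<partial>\<mu>) \<le> \<eta> * ((\<integral>x. \<bar>f x\<bar> \<partial>\<mu>) + (\<integral>x. \<bar>f' x\<bar> \<partial>\<mu>))"
      by (simp add: W_def)
  qed
qed

end

end

section \<open>Uniform decay of correlations\<close>

text \<open>Halving over blocks of length N. The incomplete last block costs the factor A, and
  rounding n down to a multiple of N costs at most r^(-N) = 2.\<close>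

lemma geometric_decay:
  fixes x :: "nat \<Rightarrow> real"
  assumes N: "0 < N" and A: "0 \<le> A" and half: "\<And>n. x (n + N) \<le> x n / 2" and bd: "\<And>n s. x (n + s) \<le> A * x n"
    and x0: "0 \<le> x 0"
  shows "x n \<le> (2 * A) * (root N (1/2)) ^ n * x 0"
proof -
  define r where "r = root N (1/2::real)"
  have r: "0 < r" "r < 1" "r ^ N = 1/2" using N by (auto simp: r_def)
  have q: "x (q * N) \<le> (1/2) ^ q * x 0" for q
  proof (induction q)
    case (Suc q)
    then show ?case using half[of "q * N"] by (simp add: add.commute)
  qed simp
  have "x n = x ((n div N) * N + n mod N)" by simp
  also have "\<dots> \<le> A * x ((n div N) * N)" by (rule bd)
  also have "\<dots> \<le> A * ((1/2) ^ (n div N) * x 0)" by (intro mult_left_mono q A)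
  also have "(1/2::real) ^ (n div N) \<le> 2 * r ^ n"
  proof -
    have "(1/2) ^ (n div N) = r ^ (N * (n div N))" by (simp add: power_mult r)
    also have "\<dots> = 2 * (r ^ N * r ^ (N * (n div N)))" by (simp add: r)
    also have "r ^ N * r ^ (N * (n div N)) = r ^ (N + N * (n div N))" by (simp add: power_add)
    also have "\<dots> \<le> r ^ n"
    proof (rule power_decreasing)
      show "n \<le> N + N * (n div N)"
        using mult_div_mod_eq[of N n] mod_less_divisor[OF N, of n] by linarith
    qed (use r in auto)
    finally show ?thesis by simp
  qed
  then have "A * ((1/2) ^ (n div N) * x 0) \<le> A * (2 * r ^ n * x 0)"
    by (intro mult_left_mono mult_right_mono A x0)
  finally show ?thesis by (simp add: r_def mult_ac)
qed

context singular_params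
begin

text \<open>Three times are composed. After N steps the L^1 norm is small by comparison with the
  unperturbed operator; m further steps of the W^{1,1} inequality turn this into a small sup norm; k
  steps of the W^{1,p} inequality, whose weak term is that sup norm, make the full norm small. All
  three depend on common constants only.\<close>

lemma uniform_decay_W1p:
  fixes T :: "real \<Rightarrow> real \<Rightarrow> real"
  assumes \<delta>: "0 < \<delta>" and adm: "\<And>\<epsilon>. \<epsilon> \<in> {0..<\<delta>} \<Longrightarrow> admT (T \<epsilon>)"
    and decay: "\<And>\<eta>. 0 < \<eta> \<Longrightarrow> \<exists>n. \<forall>(f :: real \<Rightarrow> real) f'. weak_deriv f f' \<longrightarrow> (\<integral>x. f x \<partial>\<mu>) = 0 \<longrightarrow>
      (\<integral>x. \<bar>(transfer (T 0) ^^ n) f x\<bar> \<partial>\<mu>) \<le> \<eta> * ((\<integral>x. \<bar>f x\<bar> \<partial>\<mu>) + (\<integral>x. \<bar>f' x\<bar> \<partial>\<mu>))"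
    and close: "\<And>\<tau>. 0 < \<tau> \<Longrightarrow> \<exists>d>0. \<forall>\<epsilon>\<in>{0..<d}. \<forall>f \<in> sobolev (Suc 0) p.
      (\<integral>x. \<bar>transfer (T 0) f x - transfer (T \<epsilon>) f x\<bar> \<partial>\<mu>) \<le> \<tau> * sobolev_norm (Suc 0) p f"
  shows "\<exists>\<delta>'>0. \<delta>' \<le> \<delta> \<and> (\<exists>K>0. \<exists>r. 0 < r \<and> r < 1 \<and> (\<forall>\<epsilon>\<in>{0..<\<delta>'}. \<forall>n. \<forall>f \<in> sobolev (Suc 0) p.
     (\<integral>x. f x \<partial>\<mu>) = (0::real) \<longrightarrow> sobolev_norm (Suc 0) p ((transfer (T \<epsilon>) ^^ n) f) \<le> K * r ^ n * sobolev_norm (Suc 0) p f))"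
proof -
  have pp: "1 \<le> p" using p1 by simp
  let ?N = "sobolev_norm (Suc 0) p :: (real \<Rightarrow> real) \<Rightarrow> real" and ?X = "sobolev (Suc 0) p :: (real \<Rightarrow> real) set"
  obtain K where K: "0 < K" and KLY: "\<And>T n f S. admT T \<Longrightarrow> f \<in> ?X \<Longrightarrow> (AE x in \<mu>. \<bar>f x\<bar> \<le> S) \<Longrightarrow>
     (transfer T ^^ n) f \<in> ?X \<and> ?N ((transfer T ^^ n) f) \<le> K * ((1 / \<theta>) ^ n * ?N f + S)"
    using W1p_Lasota_Yorke by blast
  obtain C where C: "0 \<le> C" and CLY: "\<And>T f f' n. admT T \<Longrightarrow> weak_deriv f f' \<Longrightarrow>
     (\<exists>g. weak_deriv ((transfer T ^^ n) f) g \<and> (\<integral>x. \<bar>g x\<bar> \<partial>\<mu>) \<le> lam ^ n * (\<integral>x. \<bar>f' x\<bar> \<partial>\<mu>) + C * (\<integral>x. \<bar>f x\<bar> \<partial>\<mu>))"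
    using Lasota_Yorke_W11_iterate by blast
  have t: "0 < 1 / \<theta>" "1 / \<theta> < 1" using \<theta>1 by auto
  have X: "(transfer S ^^ n) f \<in> ?X" and bd: "?N ((transfer S ^^ n) f) \<le> 2 * K * ?N f"
    if S: "admT S" and f: "f \<in> ?X" for S n f
  proof -
    note a = KLY[OF S f sobolev_1_sup[OF f], of n]
    then show "(transfer S ^^ n) f \<in> ?X" by blast
    have "(1 / \<theta>) ^ n * ?N f \<le> 1 * ?N f" using t by (intro mult_right_mono power_le_one) auto
    then have "K * ((1 / \<theta>) ^ n * ?N f + ?N f) \<le> K * (2 * ?N f)" using K by (intro mult_left_mono) auto
    with a show "?N ((transfer S ^^ n) f) \<le> 2 * K * ?N f" by (auto simp: mult_ac)
  qed
  have L1: "(\<integral>x. \<bar>f x\<bar> \<partial>\<mu>) + (\<integral>x. \<bar>f' x\<bar> \<partial>\<mu>) \<le> ?N f" if f: "f \<in> ?X" and w: "weak_deriv f f'" for f f'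
  proof -
    have "(\<integral>x. \<bar>f' x\<bar> \<partial>\<mu>) = (\<integral>x. norm (wderiv f x) \<partial>\<mu>)"
      using weak_deriv_wderiv[OF w] weak_derivD(2)[OF w] weak_derivD(2)[OF weak_deriv_wderiv(1)[OF w]]
      by (intro integral_cong_AE) (auto simp: ae_eq_def elim: eventually_mono)
    then show ?thesis
      using Lp_integrable(2)[OF pp, of f] Lp_integrable(2)[OF pp, of "wderiv f"] sobolev_SucD[OF f]
      by (simp add: sobolev_norm_Suc)
  qed
  \<comment> \<open>The factor is tuned so that each of the three contributions to the final norm is
    at most F / 8, for a total of 3/8 F, below the required half.\<close>
  define \<eta> where "\<eta> = 1 / (8 * K * (2 + 2 * C))"
  have \<eta>: "0 < \<eta>" "K * ((2 + 2 * C) * \<eta>) = 1/8" using K C by (auto simp: \<eta>_def)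
  obtain N where N: "\<And>(f :: real \<Rightarrow> real) f'. weak_deriv f f' \<Longrightarrow> (\<integral>x. f x \<partial>\<mu>) = 0 \<Longrightarrow>
      (\<integral>x. \<bar>(transfer (T 0) ^^ N) f x\<bar> \<partial>\<mu>) \<le> \<eta> * ((\<integral>x. \<bar>f x\<bar> \<partial>\<mu>) + (\<integral>x. \<bar>f' x\<bar> \<partial>\<mu>))"
    using decay[OF \<eta>(1)] by blast
  obtain k where k: "(1 / \<theta>) ^ k < 1 / (16 * K * K)"
    using real_arch_pow_inv[of "1 / (16 * K * K)" "1 / \<theta>"] K t by auto
  obtain m where m: "lam ^ m < 1 / (16 * K * K)"
    using real_arch_pow_inv[of "1 / (16 * K * K)" lam] K lam by auto
  \<comment> \<open>The comparison over N steps collects N errors of size \<tau> times 2 K F; N + 1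
    in the denominator also covers N = 0.\<close>
  define \<tau> where "\<tau> = \<eta> / (2 * K * (real N + 1))"
  have \<tau>: "0 < \<tau>" "real N * (\<tau> * (2 * K)) \<le> \<eta>"
  proof -
    show "0 < \<tau>" unfolding \<tau>_def using \<eta>(1) K by (intro divide_pos_pos mult_pos_pos) auto
    have "real N * (\<tau> * (2 * K)) = \<eta> * (real N / (real N + 1))" using K by (simp add: \<tau>_def)
    also have "\<dots> \<le> \<eta> * 1" using \<eta>(1) by (intro mult_left_mono) auto
    finally show "real N * (\<tau> * (2 * K)) \<le> \<eta>" by simp
  qed
  obtain d where d: "0 < d" "\<And>\<epsilon> f. \<epsilon> \<in> {0..<d} \<Longrightarrow> f \<in> ?X \<Longrightarrow>
      (\<integral>x. \<bar>transfer (T 0) f x - transfer (T \<epsilon>) f x\<bar> \<partial>\<mu>) \<le> \<tau> * ?N f"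
    using close[OF \<tau>(1)] by blast
  define \<delta>' where "\<delta>' = min d \<delta>"
  define N0 where "N0 = k + (m + (N + 1))"
  have P0: "admT (T 0)" using adm \<delta> by auto
  have half: "?N ((transfer (T \<epsilon>) ^^ N0) f) \<le> ?N f / 2"
    if \<epsilon>: "\<epsilon> \<in> {0..<\<delta>'}" and f: "f \<in> ?X" and z: "(\<integral>x. f x \<partial>\<mu>) = 0" for \<epsilon> f
  proof -
    let ?P = "transfer (T \<epsilon>)"
    have P: "admT (T \<epsilon>)" using \<epsilon> by (intro adm) (auto simp: \<delta>'_def)
    note ns0 = admT_nonsingular[OF P0] and ns = admT_nonsingular[OF P]
    define F where "F = ?N f"
    have F0: "0 \<le> F" by (simp add: F_def)
    have fi: "integrable \<mu> f" by (rule sobolev_integrable(1)[OF pp f])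
    \<comment> \<open>One more step splits the difference as P0 (u - v) + (P0 - P) v. The first part
      does not grow in L^1; the second is small because v, an iterate of the perturbed operator, has
      a uniformly bounded W^{1,p} norm.\<close>
    have tele: "(\<integral>x. \<bar>(transfer (T 0) ^^ n) f x - (?P ^^ n) f x\<bar> \<partial>\<mu>) \<le> real n * (\<tau> * (2 * K * F))" for n
    proof (induction n)
      case (Suc n)
      let ?u = "(transfer (T 0) ^^ n) f" and ?v = "(?P ^^ n) f"
      have ui: "integrable \<mu> ?u" by (rule funpow_transfer_integrable[OF ns0 fi])
      have vi: "integrable \<mu> ?v" by (rule funpow_transfer_integrable[OF ns fi])
      have i: "integrable \<mu> (transfer (T 0) ?u)" "integrable \<mu> (transfer (T 0) ?v)" "integrable \<mu> (?P ?v)"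
        "integrable \<mu> (transfer (T 0) (\<lambda>x. ?u x - ?v x))"
        using ui vi by (auto intro!: transfer_integrable ns0 ns)
      have "(\<integral>x. \<bar>transfer (T 0) ?u x - ?P ?v x\<bar> \<partial>\<mu>)
        \<le> (\<integral>x. \<bar>transfer (T 0) (\<lambda>x. ?u x - ?v x) x\<bar> + \<bar>transfer (T 0) ?v x - ?P ?v x\<bar> \<partial>\<mu>)"
      proof (rule integral_mono_AE)
        show "AE x in \<mu>. \<bar>transfer (T 0) ?u x - ?P ?v x\<bar> \<le> \<bar>transfer (T 0) (\<lambda>x. ?u x - ?v x) x\<bar> + \<bar>transfer (T 0) ?v x - ?P ?v x\<bar>"
          using transfer_diff[OF ns0 ui vi] unfolding ae_eq_def by eventually_elim linarith
      qed (use i in auto)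
      also have "\<dots> = (\<integral>x. \<bar>transfer (T 0) (\<lambda>x. ?u x - ?v x) x\<bar> \<partial>\<mu>) + (\<integral>x. \<bar>transfer (T 0) ?v x - ?P ?v x\<bar> \<partial>\<mu>)"
        using i by (intro Bochner_Integration.integral_add) auto
      also have "\<dots> \<le> (\<integral>x. \<bar>?u x - ?v x\<bar> \<partial>\<mu>) + \<tau> * ?N ?v"
        using ui vi \<epsilon> by (intro add_mono transfer_L1 ns0 d(2) X P f) (auto simp: \<delta>'_def)
      also have "\<dots> \<le> real n * (\<tau> * (2 * K * F)) + \<tau> * (2 * K * F)"
        using \<tau>(1) bd[OF P f, of n] by (intro add_mono Suc mult_left_mono) (auto simp: F_def)
      finally show ?case by (simp add: algebra_simps)
    qed simp
    \<comment> \<open>The additional iterate costs nothing in L^1 and makes the total time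
      \<open>N0\<close> positive, as needed for the root in the rate.\<close>
    define g where "g = (?P ^^ (N + 1)) f"
    have gX: "g \<in> ?X" and gN: "?N g \<le> 2 * K * F" unfolding g_def F_def by (intro X bd P f)+
    have f': "weak_deriv f (wderiv f)" using sobolev_SucD[OF f] by simp
    have gL: "(\<integral>x. \<bar>g x\<bar> \<partial>\<mu>) \<le> 2 * \<eta> * F"
    proof -
      have i: "integrable \<mu> ((transfer (T 0) ^^ N) f)" "integrable \<mu> ((?P ^^ N) f)"
        by (intro funpow_transfer_integrable ns0 ns fi)+
      have "(\<integral>x. \<bar>g x\<bar> \<partial>\<mu>) \<le> (\<integral>x. \<bar>(?P ^^ N) f x\<bar> \<partial>\<mu>)"
        unfolding g_def using transfer_L1[OF ns i(2)] by simp
      also have "\<dots> \<le> (\<integral>x. \<bar>(transfer (T 0) ^^ N) f x\<bar> + \<bar>(transfer (T 0) ^^ N) f x - (?P ^^ N) f x\<bar> \<partial>\<mu>)"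
        using i by (intro integral_mono) auto
      also have "\<dots> = (\<integral>x. \<bar>(transfer (T 0) ^^ N) f x\<bar> \<partial>\<mu>) + (\<integral>x. \<bar>(transfer (T 0) ^^ N) f x - (?P ^^ N) f x\<bar> \<partial>\<mu>)"
        using i by (intro Bochner_Integration.integral_add) auto
      also have "\<dots> \<le> \<eta> * F + (real N * (\<tau> * (2 * K))) * F"
      proof (intro add_mono)
        have "(\<integral>x. \<bar>(transfer (T 0) ^^ N) f x\<bar> \<partial>\<mu>) \<le> \<eta> * ((\<integral>x. \<bar>f x\<bar> \<partial>\<mu>) + (\<integral>x. \<bar>wderiv f x\<bar> \<partial>\<mu>))" by (rule N[OF f' z])
        also have "\<dots> \<le> \<eta> * F" using L1[OF f f'] \<eta> by (simp add: F_def)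
        finally show "(\<integral>x. \<bar>(transfer (T 0) ^^ N) f x\<bar> \<partial>\<mu>) \<le> \<eta> * F" .
        show "(\<integral>x. \<bar>(transfer (T 0) ^^ N) f x - (?P ^^ N) f x\<bar> \<partial>\<mu>) \<le> (real N * (\<tau> * (2 * K))) * F"
          using tele[of N] by (simp add: mult_ac)
      qed
      also have "\<dots> \<le> \<eta> * F + \<eta> * F" using \<tau>(2) F0 by (intro add_left_mono mult_right_mono)
      finally show ?thesis by (simp add: mult_ac)
    qed
    define u where "u = (?P ^^ m) g"
    have uX: "u \<in> ?X" unfolding u_def by (intro X P gX)
    have uN: "?N u \<le> 2 * K * F"
    proof -
      have "u = (?P ^^ (m + (N + 1))) f" by (simp only: u_def g_def funpow_add comp_apply)
      then show ?thesis unfolding F_def using bd[OF P f, of "m + (N + 1)"] by simp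
    qed
    have g': "weak_deriv g (wderiv g)" using sobolev_SucD[OF gX] by simp
    \<comment> \<open>The L^1 norms of u and of its derivative added: 2 \<eta> F for u, and 2 C
      \<eta> F plus lam^m times 2 K F for the derivative.\<close>
    define S where "S = (2 + 2 * C) * \<eta> * F + lam ^ m * (2 * K * F)"
    have uS: "AE x in \<mu>. \<bar>u x\<bar> \<le> S"
    proof -
      obtain v where v: "weak_deriv u v" "(\<integral>x. \<bar>v x\<bar> \<partial>\<mu>) \<le> lam ^ m * (\<integral>x. \<bar>wderiv g x\<bar> \<partial>\<mu>) + C * (\<integral>x. \<bar>g x\<bar> \<partial>\<mu>)"
        using CLY[OF P g', of m] by (auto simp: u_def)
      have "0 \<le> (\<integral>x. \<bar>g x\<bar> \<partial>\<mu>)" by (rule Bochner_Integration.integral_nonneg) simp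
      then have "(\<integral>x. \<bar>wderiv g x\<bar> \<partial>\<mu>) \<le> 2 * K * F" using L1[OF gX g'] gN by linarith
      then have "lam ^ m * (\<integral>x. \<bar>wderiv g x\<bar> \<partial>\<mu>) + C * (\<integral>x. \<bar>g x\<bar> \<partial>\<mu>) \<le> lam ^ m * (2 * K * F) + C * (2 * \<eta> * F)"
        using lam C gL by (intro add_mono mult_left_mono) auto
      moreover have "(\<integral>x. \<bar>u x\<bar> \<partial>\<mu>) \<le> 2 * \<eta> * F"
        using funpow_transfer_L1[OF ns sobolev_integrable(1)[OF pp gX], of m] gL by (simp add: u_def)
      ultimately have "(\<integral>x. \<bar>u x\<bar> \<partial>\<mu>) + (\<integral>x. \<bar>v x\<bar> \<partial>\<mu>) \<le> S" using v(2) by (simp add: S_def algebra_simps)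
      with weak_deriv_sup_bound[OF v(1)] show ?thesis by (auto elim: eventually_mono)
    qed
    have "(?P ^^ N0) f = (?P ^^ k) u" by (simp only: N0_def u_def g_def funpow_add comp_apply)
    then have "?N ((?P ^^ N0) f) \<le> K * ((1 / \<theta>) ^ k * ?N u + S)" using KLY[OF P uX uS, of k] by simp
    also have "\<dots> \<le> K * (1 / (16 * K * K) * (2 * K * F) + ((2 + 2 * C) * \<eta> * F + 1 / (16 * K * K) * (2 * K * F)))"
      unfolding S_def using K k m uN F0
      by (intro mult_left_mono add_mono mult_mono order_refl) (auto intro: less_imp_le)
    also have "\<dots> = 2 * (K * (1 / (16 * K * K) * (2 * K * F))) + (K * ((2 + 2 * C) * \<eta>)) * F" by (simp add: algebra_simps)
    also have "\<dots> = 3/8 * F" unfolding \<eta>(2) using K by (simp add: field_simps)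
    finally show ?thesis unfolding F_def[symmetric] using F0 by linarith
  qed
  have N0: "0 < N0" by (simp add: N0_def)
  show ?thesis
  proof (rule exI[of _ \<delta>'], intro conjI, goal_cases)
    case 1 show ?case using d \<delta> by (auto simp: \<delta>'_def)
  next
    case 2 show ?case by (auto simp: \<delta>'_def)
  next
    case 3
    show ?case
  proof (rule exI[of _ "2 * (2 * K)"], intro conjI, use K in simp,
      rule exI[of _ "root N0 (1/2)"], intro conjI ballI allI impI)
    show "0 < root N0 (1/2)" "root N0 (1/2) < 1" using N0 by auto
    fix \<epsilon> n f assume \<epsilon>: "\<epsilon> \<in> {0..<\<delta>'}" and f: "f \<in> ?X" and z: "(\<integral>x. f x \<partial>\<mu>) = 0"
    have P: "admT (T \<epsilon>)" using \<epsilon> by (intro adm) (auto simp: \<delta>'_def)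
    note ns = admT_nonsingular[OF P]
    have z': "(\<integral>x. (transfer (T \<epsilon>) ^^ n) f x \<partial>\<mu>) = 0" for n
      using funpow_transfer_integral[OF ns sobolev_integrable(1)[OF pp f]] z by simp
    show "?N ((transfer (T \<epsilon>) ^^ n) f) \<le> 2 * (2 * K) * root N0 (1/2) ^ n * ?N f"
    proof -
      have "?N ((transfer (T \<epsilon>) ^^ n) f) \<le> 2 * (2 * K) * root N0 (1/2) ^ n * ?N ((transfer (T \<epsilon>) ^^ 0) f)"
      proof (rule geometric_decay[OF N0, where x = "\<lambda>n. ?N ((transfer (T \<epsilon>) ^^ n) f)"])
        show "?N ((transfer (T \<epsilon>) ^^ (n + N0)) f) \<le> ?N ((transfer (T \<epsilon>) ^^ n) f) / 2" for n
          using half[OF \<epsilon> X[OF P f] z', of n] by (simp only: add.commute[of n] funpow_add comp_apply)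
        show "?N ((transfer (T \<epsilon>) ^^ (n + s)) f) \<le> 2 * K * ?N ((transfer (T \<epsilon>) ^^ n) f)" for n s
          using bd[OF P X[OF P f, of n], of s] by (simp only: add.commute[of n] funpow_add comp_apply)
      qed (use K in auto)
      then show ?thesis by simp
    qed
  qed
  qed
qed

text \<open>Decay in W^{1,p} makes the forcing term of the recurrence for second derivatives
  geometric, so the solution decays at the slower of the two rates. The hypothesis is imposed on the
  individual function f, and K' and r' depend on K and r only.\<close>

lemma uniform_decay_W2p:
  assumes K: "0 < K" and r: "0 < r" "r < 1"
  shows "\<exists>K'>0. \<exists>r'. 0 < r' \<and> r' < 1 \<and> (\<forall>T (f :: real \<Rightarrow> real) n. admT T \<longrightarrow> f \<in> sobolev (Suc (Suc 0)) p \<longrightarrow>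
     (\<forall>n. sobolev_norm (Suc 0) p ((transfer T ^^ n) f) \<le> K * r ^ n * sobolev_norm (Suc 0) p f) \<longrightarrow>
     sobolev_norm (Suc (Suc 0)) p ((transfer T ^^ n) f) \<le> K' * r' ^ n * (sobolev_norm (Suc (Suc 0)) p f :: real))"
proof -
  obtain C where C: "0 \<le> C" and LY: "\<And>T n (f :: real \<Rightarrow> real) z y. admT T \<Longrightarrow> f \<in> sobolev (Suc (Suc 0)) p \<Longrightarrow>
     (\<And>n. sobolev_norm (Suc 0) p ((transfer T ^^ n) f) \<le> z n) \<Longrightarrow> sobolev_norm (Suc (Suc 0)) p f \<le> y 0 \<Longrightarrow>
     (\<And>n. (1 / \<theta>) * y n + C * z n \<le> y (Suc n)) \<Longrightarrow>
     sobolev_norm (Suc (Suc 0)) p ((transfer T ^^ n) f) \<le> z n + MM * (y n :: real)"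
    using W2p_Lasota_Yorke by metis
  \<comment> \<open>\<open>lam\<close> enters because it lies strictly above 1 / \<theta>. The
    positive gap r' - 1 / \<theta> is what makes Q r'^n F a supersolution for a finite Q.\<close>
  define r' where "r' = max r lam"
  have r': "r \<le> r'" "1 / \<theta> < r'" "0 < r'" "r' < 1" using r lam by (auto simp: r'_def)
  define Q where "Q = 1 + C * K / (r' - 1 / \<theta>)"
  define K' where "K' = K + MM * Q"
  have q0: "0 \<le> C * K / (r' - 1 / \<theta>)" using C K r' by simp
  have K'0: "0 < K'" unfolding K'_def Q_def using K MM(1) q0 by (intro add_pos_nonneg) auto
  show ?thesis
  proof (rule exI[of _ K'], intro conjI K'0, rule exI[of _ r'], intro conjI r' allI impI)
    fix T n and f :: "real \<Rightarrow> real"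
    assume T: "admT T" and f: "f \<in> sobolev (Suc (Suc 0)) p"
      and b: "\<forall>n. sobolev_norm (Suc 0) p ((transfer T ^^ n) f) \<le> K * r ^ n * sobolev_norm (Suc 0) p f"
    define F where "F = sobolev_norm (Suc (Suc 0)) p f"
    have F0: "0 \<le> F" by (simp add: F_def)
    have F1: "sobolev_norm (Suc 0) p f \<le> F" by (simp add: F_def sobolev_norm_Suc)
    define z where "z n = K * r' ^ n * F" for n
    define y where "y n = Q * F * r' ^ n" for n
    have "sobolev_norm (Suc (Suc 0)) p ((transfer T ^^ n) f) \<le> z n + MM * y n"
    proof (rule LY[OF T f])
      fix n
      have "K * r ^ n * sobolev_norm (Suc 0) p f \<le> K * r' ^ n * F"
        using K r r' F1 F0 by (intro mult_mono power_mono) auto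
      then show "sobolev_norm (Suc 0) p ((transfer T ^^ n) f) \<le> z n" using b unfolding z_def by (meson order_trans)
      have "y (Suc n) - (1 / \<theta>) * y n = (r' - 1 / \<theta>) * Q * F * r' ^ n"
        by (simp add: y_def algebra_simps)
      also have "(r' - 1 / \<theta>) * Q = (r' - 1 / \<theta>) + C * K"
        using r' by (simp add: Q_def distrib_left)
      also have "((r' - 1 / \<theta>) + C * K) * F * r' ^ n \<ge> C * K * F * r' ^ n"
        using r' F0 by (intro mult_right_mono) auto
      finally show "(1 / \<theta>) * y n + C * z n \<le> y (Suc n)" by (simp add: z_def mult_ac)
    next
      have "1 * F \<le> Q * F" unfolding Q_def using q0 F0 by (intro mult_right_mono) auto
      then show "sobolev_norm (Suc (Suc 0)) p f \<le> y 0" by (simp add: y_def F_def)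
    qed
    then show "sobolev_norm (Suc (Suc 0)) p ((transfer T ^^ n) f) \<le> K' * r' ^ n * sobolev_norm (Suc (Suc 0)) p f"
      by (simp add: z_def y_def K'_def F_def algebra_simps)
  qed
qed

lemma transfer_bounded_W1p:
  "\<exists>B. \<forall>T (f :: real \<Rightarrow> real). admT T \<longrightarrow> f \<in> sobolev (Suc 0) p \<longrightarrow> transfer T f \<in> sobolev (Suc 0) p \<and>
     sobolev_norm (Suc 0) p (transfer T f) \<le> B * (sobolev_norm (Suc 0) p f :: real)"
proof -
  obtain K where K: "0 < K" and KLY: "\<And>T n (f :: real \<Rightarrow> real) S. admT T \<Longrightarrow> f \<in> sobolev (Suc 0) p \<Longrightarrow> (AE x in \<mu>. \<bar>f x\<bar> \<le> S) \<Longrightarrow>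
     (transfer T ^^ n) f \<in> sobolev (Suc 0) p \<and> sobolev_norm (Suc 0) p ((transfer T ^^ n) f) \<le> K * ((1 / \<theta>) ^ n * sobolev_norm (Suc 0) p f + S)"
    using W1p_Lasota_Yorke by blast
  have "transfer T f \<in> sobolev (Suc 0) p \<and> sobolev_norm (Suc 0) p (transfer T f) \<le> (K * (1 / \<theta> + 1)) * sobolev_norm (Suc 0) p f"
    if "admT T" "f \<in> sobolev (Suc 0) p" for T and f :: "real \<Rightarrow> real"
    using KLY[OF that sobolev_1_sup[OF that(2)], of 1] by (simp add: algebra_simps)
  then show ?thesis by blast
qed

lemma transfer_bounded_W2p:
  "\<exists>B. \<forall>T (f :: real \<Rightarrow> real). admT T \<longrightarrow> f \<in> sobolev (Suc (Suc 0)) p \<longrightarrow> transfer T f \<in> sobolev (Suc (Suc 0)) p \<and>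
     sobolev_norm (Suc (Suc 0)) p (transfer T f) \<le> B * (sobolev_norm (Suc (Suc 0)) p f :: real)"
proof -
  obtain K where K: "0 < K" and KLY: "\<And>T n (f :: real \<Rightarrow> real) S. admT T \<Longrightarrow> f \<in> sobolev (Suc 0) p \<Longrightarrow> (AE x in \<mu>. \<bar>f x\<bar> \<le> S) \<Longrightarrow>
     (transfer T ^^ n) f \<in> sobolev (Suc 0) p \<and> sobolev_norm (Suc 0) p ((transfer T ^^ n) f) \<le> K * ((1 / \<theta>) ^ n * sobolev_norm (Suc 0) p f + S)"
    using W1p_Lasota_Yorke by blast
  obtain C where C: "0 \<le> C" and LY: "\<And>T n (f :: real \<Rightarrow> real) z y. admT T \<Longrightarrow> f \<in> sobolev (Suc (Suc 0)) p \<Longrightarrow>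
     (\<And>n. sobolev_norm (Suc 0) p ((transfer T ^^ n) f) \<le> z n) \<Longrightarrow> sobolev_norm (Suc (Suc 0)) p f \<le> y 0 \<Longrightarrow>
     (\<And>n. (1 / \<theta>) * y n + C * z n \<le> y (Suc n)) \<Longrightarrow>
     (transfer T ^^ n) f \<in> sobolev (Suc (Suc 0)) p \<and>
     sobolev_norm (Suc (Suc 0)) p ((transfer T ^^ n) f) \<le> z n + MM * (y n :: real)"
    using W2p_Lasota_Yorke by metis
  \<comment> \<open>With z constantly 2 K F, the constant sequence Y F is a supersolution as soon as
    (1 - 1/\<theta>) Y is at least 2 K C; the summand 1 takes care of the initial value.\<close>
  define Y where "Y = 1 + C * (2 * K) / (1 - 1 / \<theta>)"
  have t: "0 < 1 / \<theta>" "1 / \<theta> < 1" using \<theta>1 by auto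
  have "transfer T f \<in> sobolev (Suc (Suc 0)) p \<and> sobolev_norm (Suc (Suc 0)) p (transfer T f) \<le> (2 * K + MM * Y) * sobolev_norm (Suc (Suc 0)) p f"
    if T: "admT T" and f: "f \<in> sobolev (Suc (Suc 0)) p" for T and f :: "real \<Rightarrow> real"
  proof -
    define F where "F = sobolev_norm (Suc (Suc 0)) p f"
    have F0: "0 \<le> F" by (simp add: F_def)
    have F1: "sobolev_norm (Suc 0) p f \<le> F" by (simp add: F_def sobolev_norm_Suc)
    have f1: "f \<in> sobolev (Suc 0) p"
      using sobolev_SucD[OF f] sobolev_Lp by (auto simp only: sobolev_1_iff)
    have zb: "sobolev_norm (Suc 0) p ((transfer T ^^ n) f) \<le> 2 * K * F" for n
    proof -
      have "(1 / \<theta>) ^ n * sobolev_norm (Suc 0) p f \<le> 1 * F" using t F1 by (intro mult_mono power_le_one) auto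
      then have "K * ((1 / \<theta>) ^ n * sobolev_norm (Suc 0) p f + sobolev_norm (Suc 0) p f) \<le> K * (1 * F + F)"
        using K F1 by (intro mult_left_mono add_mono) auto
      then show ?thesis using KLY[OF T f1 sobolev_1_sup[OF f1], of n] by simp
    qed
    have "(transfer T ^^ 1) f \<in> sobolev (Suc (Suc 0)) p \<and> sobolev_norm (Suc (Suc 0)) p ((transfer T ^^ 1) f) \<le> 2 * K * F + MM * (Y * F)"
    proof (rule LY[OF T f zb, where y = "\<lambda>n. Y * F"])
      have "1 * F \<le> Y * F" using C K t F0 by (intro mult_right_mono) (auto simp: Y_def)
      then show "sobolev_norm (Suc (Suc 0)) p f \<le> Y * F" by (simp add: F_def)
      have "(1 - 1 / \<theta>) * Y \<ge> C * (2 * K)" using t by (simp add: Y_def distrib_left)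
      then have "(1 - 1 / \<theta>) * Y * F \<ge> C * (2 * K) * F" using F0 by (intro mult_right_mono)
      then show "1 / \<theta> * (Y * F) + C * (2 * K * F) \<le> Y * F" by (simp add: algebra_simps)
    qed
    then show ?thesis by (simp add: F_def algebra_simps)
  qed
  then show ?thesis by blast
qed

end

section \<open>Spectral consequences of decay on the mean-zero subspace\<close>

text \<open>Linearity is required only up to null sets, because \<open>transfer\<close> is a choice
  among representatives. The scalar field stays polymorphic: the real instance yields the density
  and the inverse on mean-zero functions, the complex one the spectrum.\<close>

locale sobolev_decay =
  fixes A :: "(real \<Rightarrow> 'a::{real_normed_field, banach, second_countable_topology}) \<Rightarrow> real \<Rightarrow> 'a"
    and k :: nat and p K r L :: real
  assumes p: "1 \<le> p" and K: "0 < K" and r: "0 < r" "r < 1"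
    and A_in: "f \<in> sobolev k p \<Longrightarrow> A f \<in> sobolev k p"
    and A_bd: "f \<in> sobolev k p \<Longrightarrow> sobolev_norm k p (A f) \<le> L * sobolev_norm k p f"
    and A_cong: "f \<in> sobolev k p \<Longrightarrow> ae_eq f g \<Longrightarrow> ae_eq (A f) (A g)"
    and A_add: "f \<in> sobolev k p \<Longrightarrow> g \<in> sobolev k p \<Longrightarrow> ae_eq (A (\<lambda>x. f x + g x)) (\<lambda>x. A f x + A g x)"
    and A_scale: "f \<in> sobolev k p \<Longrightarrow> ae_eq (A (\<lambda>x. a * f x)) (\<lambda>x. a * A f x)"
    and A_int: "f \<in> sobolev k p \<Longrightarrow> (\<integral>x. A f x \<partial>\<mu>) = (\<integral>x. f x \<partial>\<mu>)"
    and decay: "f \<in> sobolev k p \<Longrightarrow> (\<integral>x. f x \<partial>\<mu>) = 0 \<Longrightarrow>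
      sobolev_norm k p ((A ^^ n) f) \<le> K * r ^ n * sobolev_norm k p f"
begin

abbreviation "X \<equiv> sobolev k p :: (real \<Rightarrow> 'a) set"
abbreviation "N \<equiv> sobolev_norm k p :: (real \<Rightarrow> 'a) \<Rightarrow> real"

lemma p0: "0 < p" using p by simp

lemma X_integrable: "f \<in> X \<Longrightarrow> integrable \<mu> f"
  by (rule sobolev_integrable(1)[OF p])

lemma X_zero: "f \<in> X \<Longrightarrow> N f \<le> 0 \<Longrightarrow> ae_eq f (\<lambda>x. 0)"
  using sobolev_zero_AE[OF p0] sobolev_norm_nonneg[of k p f] by fastforce

lemma An_in: "f \<in> X \<Longrightarrow> (A ^^ n) f \<in> X"
  by (induction n) (auto intro: A_in)

lemma An_int: "f \<in> X \<Longrightarrow> (\<integral>x. (A ^^ n) f x \<partial>\<mu>) = (\<integral>x. f x \<partial>\<mu>)"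
  by (induction n) (auto simp: A_int An_in)

lemma A_diff:
  assumes "f \<in> X" "g \<in> X"
  shows "ae_eq (A (\<lambda>x. f x - g x)) (\<lambda>x. A f x - A g x)"
proof -
  have "(\<lambda>x. (-1) * g x) \<in> X" by (rule sobolev_scale(1)[OF p0 assms(2)])
  from A_add[OF assms(1) this] A_scale[OF assms(2), of "-1"]
  have "AE x in \<mu>. A (\<lambda>x. f x + (-1) * g x) x = A f x - A g x"
    unfolding ae_eq_def by eventually_elim simp
  then show ?thesis by (simp add: ae_eq_def)
qed

lemma shifted_in: "f \<in> X \<Longrightarrow> shifted z A f \<in> X"
  unfolding shifted_def by (intro sobolev_diff(1)[OF p] sobolev_scale(1)[OF p0] A_in)

lemma shifted_int: "f \<in> X \<Longrightarrow> (\<integral>x. shifted z A f x \<partial>\<mu>) = (z - 1) * (\<integral>x. f x \<partial>\<mu>)"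
  unfolding shifted_def using X_integrable[of f] X_integrable[OF A_in, of f]
  by (simp add: A_int algebra_simps)

lemma shifted_diff:
  assumes "f \<in> X" "g \<in> X"
  shows "ae_eq (shifted z A (\<lambda>x. f x - g x)) (\<lambda>x. shifted z A f x - shifted z A g x)"
  using A_diff[OF assms] unfolding ae_eq_def shifted_def by eventually_elim (simp add: algebra_simps)

lemma shifted_cong:
  assumes "f \<in> X" "ae_eq f g"
  shows "ae_eq (shifted z A f) (shifted z A g)"
  using A_cong[OF assms] assms(2) unfolding ae_eq_def shifted_def by eventually_elim simp

text \<open>On such an f the iterates act as z^n, whereas they decay like r^n with r < |z|.\<close>

lemma mean_zero_kernel:
  assumes f: "f \<in> X" "(\<integral>x. f x \<partial>\<mu>) = 0" and z: "r < norm z" and e: "ae_eq (shifted z A f) (\<lambda>x. 0)"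
  shows "ae_eq f (\<lambda>x. 0)"
proof -
  have e1: "ae_eq (A f) (\<lambda>x. z * f x)" using e unfolding ae_eq_def shifted_def by eventually_elim simp
  have en: "ae_eq ((A ^^ n) f) (\<lambda>x. z ^ n * f x)" for n
  proof (induction n)
    case (Suc n)
    have "ae_eq (A ((A ^^ n) f)) (A (\<lambda>x. z ^ n * f x))" by (rule A_cong[OF An_in[OF f(1)] Suc])
    also have "ae_eq (A (\<lambda>x. z ^ n * f x)) (\<lambda>x. z ^ n * A f x)" by (rule A_scale[OF f(1)])
    also have "ae_eq (\<lambda>x. z ^ n * A f x) (\<lambda>x. z ^ Suc n * f x)"
      using e1 unfolding ae_eq_def by eventually_elim simp
    finally show ?case by simp
  qed simp
  have le: "N f \<le> K * (r / norm z) ^ n * N f" for n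
  proof -
    have "norm z ^ n * N f = N (\<lambda>x. z ^ n * f x)" by (simp add: sobolev_scale(2)[OF p0 f(1)] norm_power)
    also have "\<dots> = N ((A ^^ n) f)" using sobolev_norm_cong[OF en] by simp
    also have "\<dots> \<le> K * r ^ n * N f" by (rule decay[OF f])
    finally have "norm z ^ n * N f \<le> K * r ^ n * N f" .
    moreover have "0 < norm z ^ n" by (rule zero_less_power) (use z r in linarith)
    ultimately have "N f \<le> (K * r ^ n * N f) / norm z ^ n" by (simp add: pos_le_divide_eq mult.commute)
    then show ?thesis by (simp add: power_divide)
  qed
  have "(\<lambda>n. K * (r / norm z) ^ n * N f) \<longlonglongrightarrow> K * 0 * N f"
  proof -
    have "0 < norm z" using z r by linarith
    then show ?thesis using z r by (intro tendsto_intros LIMSEQ_power_zero) (simp add: divide_less_eq)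
  qed
  then have "N f \<le> 0" using LIMSEQ_le_const[of _ _ "N f"] le by fastforce
  then show ?thesis by (rule X_zero[OF f(1)])
qed

text \<open>The solution is the Neumann series of z^(-i-1) A^i f, dominated by a geometric series
  with ratio r / |z|. The norm bound is the sum of that series; at z = 1 it becomes the resolvent
  constant K / (1 - r).\<close>

lemma mean_zero_solve:
  assumes f: "f \<in> X" "(\<integral>x. f x \<partial>\<mu>) = 0" and z: "r < norm z"
  shows "\<exists>u\<in>X. (\<integral>x. u x \<partial>\<mu>) = 0 \<and> ae_eq (shifted z A u) f \<and> N u \<le> K / (norm z - r) * N f"
proof -
  have z0: "z \<noteq> 0" using z r by auto
  define v where "v i x = (1 / z ^ Suc i) * (A ^^ i) f x" for i x
  have vX: "v i \<in> X" for i unfolding v_def by (intro sobolev_scale(1)[OF p0] An_in f)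
  have vz: "(\<integral>x. v i x \<partial>\<mu>) = 0" for i
    unfolding v_def using An_int[OF f(1)] f(2) X_integrable[OF An_in[OF f(1)]] by simp
  have vN: "N (v i) \<le> (K / norm z * N f) * (r / norm z) ^ i" for i
  proof -
    have "N (v i) = N ((A ^^ i) f) / norm z ^ Suc i"
      unfolding v_def sobolev_scale(2)[OF p0 An_in[OF f(1)]] by (simp add: norm_divide norm_power norm_mult)
    also have "\<dots> \<le> (K * r ^ i * N f) / norm z ^ Suc i" by (intro divide_right_mono decay f) auto
    finally show ?thesis by (simp add: power_divide mult_ac)
  qed
  have q: "norm (r / norm z) < 1"
  proof -
    have "0 < norm z" using z r by linarith
    then show ?thesis using z r by (simp add: divide_less_eq)
  qed
  have gs: "(\<lambda>i. (K / norm z * N f) * (r / norm z) ^ i) sums (K / (norm z - r) * N f)"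
  proof -
    have "(\<lambda>i. (K / norm z * N f) * (r / norm z) ^ i) sums ((K / norm z * N f) * (1 / (1 - r / norm z)))"
      by (intro sums_mult geometric_sums q)
    moreover have "(K / norm z * N f) * (1 / (1 - r / norm z)) = K / (norm z - r) * N f"
      using z r z0 by (simp add: field_simps)
    ultimately show ?thesis by (simp only:)
  qed
  have s: "summable (\<lambda>i. N (v i))"
    by (rule summable_comparison_test'[OF sums_summable[OF gs], of 0]) (use vN in auto)
  obtain u where u: "u \<in> X" "\<And>n. N (\<lambda>x. u x - (\<Sum>i<n. v i x)) \<le> (\<Sum>i. N (v (i + n)))"
    using sobolev_complete[OF p vX s] by blast
  let ?S = "\<lambda>n x. \<Sum>i<n. v i x"
  have SX: "?S n \<in> X" for n by (rule sobolev_sum[OF p vX])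
  have lim: "(\<lambda>n. N (\<lambda>x. u x - ?S n x)) \<longlonglongrightarrow> 0"
    by (rule tendsto_sandwich[OF _ _ tendsto_const suminf_exist_split2[OF s]]) (use u in auto)
  have Nu: "N u \<le> K / (norm z - r) * N f"
  proof -
    have "N u \<le> (\<Sum>i. N (v i))" using u(2)[of 0] by simp
    also have "\<dots> \<le> (\<Sum>i. (K / norm z * N f) * (r / norm z) ^ i)"
      by (rule suminf_le[OF vN s sums_summable[OF gs]])
    finally show ?thesis using sums_unique[OF gs] by simp
  qed
  have uz: "(\<integral>x. u x \<partial>\<mu>) = 0"
  proof -
    have Sz: "(\<integral>x. ?S n x \<partial>\<mu>) = 0" for n using vz X_integrable[OF vX] by (simp add: Bochner_Integration.integral_sum)
    have "norm (\<integral>x. u x \<partial>\<mu>) \<le> N (\<lambda>x. u x - ?S n x)" for n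
    proof -
      have "(\<integral>x. u x \<partial>\<mu>) = (\<integral>x. u x - ?S n x \<partial>\<mu>)" using Sz X_integrable[OF u(1)] X_integrable[OF SX] by simp
      also have "norm \<dots> \<le> (\<integral>x. norm (u x - ?S n x) \<partial>\<mu>)" by (rule integral_norm_bound)
      also have "\<dots> \<le> N (\<lambda>x. u x - ?S n x)" by (rule sobolev_integrable(2)[OF p sobolev_diff(1)[OF p u(1) SX]])
      finally show ?thesis .
    qed
    then have "norm (\<integral>x. u x \<partial>\<mu>) \<le> 0" using LIMSEQ_le_const[OF lim] by blast
    then show ?thesis by simp
  qed
  \<comment> \<open>Applied to a partial sum the operator z - A telescopes to f minus z^(-n) A^n
    f.\<close>
  have shS: "ae_eq (shifted z A (?S n)) (\<lambda>x. f x - (1 / z ^ n) * (A ^^ n) f x)" for n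
  proof (induction n)
    case 0
    have "ae_eq (A (\<lambda>x. 0 * f x)) (\<lambda>x. 0 * A f x)" by (rule A_scale[OF f(1)])
    then show ?case by (simp add: shifted_def ae_eq_def)
  next
    case (Suc n)
    have "ae_eq (A (v n)) (\<lambda>x. (1 / z ^ Suc n) * A ((A ^^ n) f) x)"
      unfolding v_def by (rule A_scale[OF An_in[OF f(1)]])
    with A_add[OF SX[of n] vX[of n]] Suc show ?case
      unfolding ae_eq_def shifted_def
    proof eventually_elim
      case (elim x)
      have "z * (?S (Suc n) x) - A (?S (Suc n)) x = (z * ?S n x - A (?S n) x) + (z * v n x - A (v n) x)"
        using elim(1) by (simp add: algebra_simps)
      also have "\<dots> = f x - (1 / z ^ n) * (A ^^ n) f x + (z * v n x - (1 / z ^ Suc n) * A ((A ^^ n) f) x)"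
        using elim by simp
      also have "z * v n x = (1 / z ^ n) * (A ^^ n) f x" using z0 by (simp add: v_def)
      finally show ?case by simp
    qed
  qed
  \<comment> \<open>The defect of u is independent of n, so it vanishes once bounded by quantities
    tending to 0: boundedness of A on the tail of the series, and decay of z^(-n) A^n f.\<close>
  have "N (\<lambda>x. shifted z A u x - f x) \<le> (norm z + L) * N (\<lambda>x. u x - ?S n x) + (K * N f) * (r / norm z) ^ n" for n
  proof -
    let ?d = "\<lambda>x. u x - ?S n x" and ?e = "\<lambda>x. (- (1 / z ^ n)) * (A ^^ n) f x"
    have dX: "?d \<in> X" by (rule sobolev_diff(1)[OF p u(1) SX])
    have eX: "?e \<in> X" by (intro sobolev_scale(1)[OF p0] An_in f)
    have "ae_eq (\<lambda>x. shifted z A u x - f x) (\<lambda>x. shifted z A ?d x + ?e x)"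
      using shifted_diff[OF u(1) SX[of n], of z] shS[of n] unfolding ae_eq_def by eventually_elim simp
    then have "N (\<lambda>x. shifted z A u x - f x) = N (\<lambda>x. shifted z A ?d x + ?e x)" by (rule sobolev_norm_cong)
    also have "\<dots> \<le> N (shifted z A ?d) + N ?e" by (intro sobolev_add(2)[OF p] shifted_in dX eX)
    also have "N (shifted z A ?d) \<le> N (\<lambda>x. z * ?d x) + N (A ?d)"
      unfolding shifted_def by (intro sobolev_diff(2)[OF p] sobolev_scale(1)[OF p0] dX A_in)
    also have "N (\<lambda>x. z * ?d x) = norm z * N ?d" by (rule sobolev_scale(2)[OF p0 dX])
    also have "N (A ?d) \<le> L * N ?d" by (rule A_bd[OF dX])
    also have "N ?e = N ((A ^^ n) f) / norm z ^ n"
      by (simp only: sobolev_scale(2)[OF p0 An_in[OF f(1)]]) (simp add: norm_divide norm_power)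
    also have "\<dots> \<le> (K * r ^ n * N f) / norm z ^ n" by (intro divide_right_mono decay f) auto
    finally show ?thesis by (simp add: power_divide algebra_simps)
  qed
  moreover have "(\<lambda>n. (norm z + L) * N (\<lambda>x. u x - ?S n x) + (K * N f) * (r / norm z) ^ n)
      \<longlonglongrightarrow> (norm z + L) * 0 + (K * N f) * 0"
    using q by (intro tendsto_intros lim LIMSEQ_power_zero)
  ultimately have "N (\<lambda>x. shifted z A u x - f x) \<le> 0" using LIMSEQ_le_const by fastforce
  then have "ae_eq (\<lambda>x. shifted z A u x - f x) (\<lambda>x. 0)"
    by (intro X_zero sobolev_diff(1)[OF p] shifted_in u f)
  then have "ae_eq (shifted z A u) f" by (simp add: ae_eq_def)
  then show ?thesis using u(1) uz Nu by blast
qed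

text \<open>A 1 - 1 has mean zero, so u - A u = A 1 - 1 is solvable with mean-zero u, and h = 1 + u
  is invariant. The convergence of A^n 1 to h is recorded because it later transports nonnegativity
  to h.\<close>

lemma ex_invariant:
  "\<exists>h\<in>X. (\<integral>x. h x \<partial>\<mu>) = 1 \<and> ae_eq (A h) h \<and> (\<lambda>n. N (\<lambda>x. h x - (A ^^ n) (\<lambda>x. 1) x)) \<longlonglongrightarrow> 0"
proof -
  let ?o = "\<lambda>x. 1 :: 'a"
  have oX: "?o \<in> X" by (rule sobolev_const[OF p0])
  define f where "f x = A ?o x - 1" for x
  have fX: "f \<in> X" unfolding f_def by (intro sobolev_diff(1)[OF p] A_in oX)
  have fz: "(\<integral>x. f x \<partial>\<mu>) = 0"
    unfolding f_def using X_integrable[OF A_in[OF oX]] by (simp add: A_int[OF oX])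
  obtain u where u: "u \<in> X" "(\<integral>x. u x \<partial>\<mu>) = 0" "ae_eq (shifted 1 A u) f"
    using mean_zero_solve[OF fX fz, of 1] r by auto
  define h where "h x = 1 + u x" for x
  have hX: "h \<in> X" unfolding h_def by (rule sobolev_add(1)[OF p oX u(1)])
  have hA: "ae_eq (A h) h"
    using A_add[OF oX u(1)] u(3) unfolding ae_eq_def h_def shifted_def f_def by eventually_elim (simp add: algebra_simps)
  have hn: "ae_eq ((A ^^ n) u) (\<lambda>x. h x - (A ^^ n) ?o x)" for n
  proof (induction n)
    case 0 show ?case by (simp add: h_def)
  next
    case (Suc n)
    have "ae_eq (A ((A ^^ n) u)) (A (\<lambda>x. h x - (A ^^ n) ?o x))" by (rule A_cong[OF An_in[OF u(1)] Suc])
    also have "ae_eq \<dots> (\<lambda>x. A h x - A ((A ^^ n) ?o) x)" by (rule A_diff[OF hX An_in[OF oX]])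
    also have "ae_eq \<dots> (\<lambda>x. h x - A ((A ^^ n) ?o) x)" using hA unfolding ae_eq_def by eventually_elim simp
    finally show ?case by simp
  qed
  have "(\<lambda>n. N (\<lambda>x. h x - (A ^^ n) ?o x)) \<longlonglongrightarrow> 0"
  proof (rule tendsto_sandwich[OF _ _ tendsto_const])
    show "\<forall>\<^sub>F n in sequentially. N (\<lambda>x. h x - (A ^^ n) ?o x) \<le> K * r ^ n * N u"
      using decay[OF u(1,2)] sobolev_norm_cong[OF hn] by simp
    have "(\<lambda>n. K * r ^ n * N u) \<longlonglongrightarrow> K * 0 * N u" using r by (intro tendsto_intros LIMSEQ_power_zero) simp
    then show "(\<lambda>n. K * r ^ n * N u) \<longlonglongrightarrow> 0" by simp
  qed auto
  moreover have "(\<integral>x. h x \<partial>\<mu>) = 1" unfolding h_def using u X_integrable[OF u(1)] by simp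
  ultimately show ?thesis using hX hA by blast
qed

text \<open>Subtracting from a generalized eigenfunction its mean times h changes none of its images
  under positive powers of 1 - A and leaves a mean-zero function. There 1 - A is injective modulo
  null sets, so all powers can be stripped.\<close>

lemma simple_eigenvalue_1: "simple_eigenvalue X A 1"
proof -
  obtain h where h: "h \<in> X" "(\<integral>x. h x \<partial>\<mu>) = 1" "ae_eq (A h) h" using ex_invariant by blast
  show ?thesis
    unfolding simple_eigenvalue_def
  proof (intro bexI[OF _ h(1)] conjI ballI allI impI)
    show "\<not> ae_eq h (\<lambda>x. 0)"
    proof
      assume "ae_eq h (\<lambda>x. 0)"
      then have "(\<integral>x. h x \<partial>\<mu>) = (\<integral>x. 0 \<partial>\<mu>)"
        using X_integrable[OF h(1)] unfolding ae_eq_def by (intro integral_cong_AE) auto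
      then show False using h(2) by simp
    qed
    show "ae_eq (A h) (\<lambda>x. 1 * h x)" using h(3) by simp
    fix g j assume g: "g \<in> X" and e: "ae_eq ((shifted 1 A ^^ j) g) (\<lambda>x. 0)"
    define m where "m = (\<integral>x. g x \<partial>\<mu>)"
    define f where "f x = g x - m * h x" for x
    have mh: "(\<lambda>x. m * h x) \<in> X" by (rule sobolev_scale(1)[OF p0 h(1)])
    have fX: "f \<in> X" unfolding f_def by (rule sobolev_diff(1)[OF p g mh])
    have fz: "(\<integral>x. f x \<partial>\<mu>) = 0"
      unfolding f_def using X_integrable[OF g] X_integrable[OF h(1)] h(2) by (simp add: m_def)
    have sX: "(shifted 1 A ^^ i) f' \<in> X" if "f' \<in> X" for i f' using that by (induction i) (auto intro: shifted_in)
    have sz: "(\<integral>x. (shifted 1 A ^^ i) f x \<partial>\<mu>) = 0" for i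
      by (induction i) (auto simp: fz shifted_int[OF sX[OF fX]])
    have same: "ae_eq ((shifted 1 A ^^ Suc i) f) ((shifted 1 A ^^ Suc i) g)" for i
    proof (induction i)
      case 0
      have "ae_eq (shifted 1 A (\<lambda>x. m * h x)) (\<lambda>x. 0)"
        using A_scale[OF h(1), of m] h(3) unfolding ae_eq_def shifted_def by eventually_elim simp
      with shifted_diff[OF g mh, of 1] show ?case unfolding f_def ae_eq_def funpow.simps id_apply comp_apply
        by eventually_elim simp
    next
      case (Suc i)
      from shifted_cong[OF sX[OF fX, of "Suc i"] this, of 1] show ?case by simp
    qed
    \<comment> \<open>Each intermediate image is again mean-zero, because 1 - A annihilates the
      integral; the kernel lemma therefore removes one factor at a time.\<close>
    have zero: "ae_eq ((shifted 1 A ^^ i) f) (\<lambda>x. 0) \<Longrightarrow> ae_eq f (\<lambda>x. 0)" for i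
    proof (induction i)
      case (Suc i)
      have "ae_eq (shifted 1 A ((shifted 1 A ^^ i) f)) (\<lambda>x. 0)" using Suc(2) by simp
      then have "ae_eq ((shifted 1 A ^^ i) f) (\<lambda>x. 0)"
        using r by (intro mean_zero_kernel[OF sX[OF fX] sz]) auto
      then show ?case by (rule Suc(1))
    qed simp
    show "\<exists>a. ae_eq g (\<lambda>x. a * h x)"
    proof (cases j)
      case 0
      then show ?thesis using e by (intro exI[of _ 0]) simp
    next
      case (Suc i)
      have "ae_eq ((shifted 1 A ^^ Suc i) f) (\<lambda>x. 0)" using same[of i] e unfolding Suc by (rule ae_eq_trans)
      then have "ae_eq f (\<lambda>x. 0)" by (rule zero)
      then have "ae_eq g (\<lambda>x. m * h x)" unfolding ae_eq_def f_def by eventually_elim simp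
      then show ?thesis by blast
    qed
  qed
qed

text \<open>\<open>ae_inv\<close> picks an unspecified solution. By injectivity modulo null sets it
  agrees a.e. with the constructed one, and the norm does not see the difference. The target Z may
  be larger than Y, as in the bound from mean-zero functions into the whole space.\<close>

lemma op_norm_ae_inv:
  assumes Y: "Y \<subseteq> X" and inj: "\<And>f g. f \<in> Y \<Longrightarrow> g \<in> Y \<Longrightarrow> ae_eq (S f) (S g) \<Longrightarrow> ae_eq f g"
    and sol: "\<And>f. f \<in> Y \<Longrightarrow> \<exists>u\<in>Y. ae_eq (S u) f \<and> N u \<le> C * N f" and C: "0 \<le> C" and YZ: "Y \<subseteq> Z"
  shows "op_norm Y N Z N (ae_inv Y S) \<le> ereal C"
  unfolding op_norm_def
proof (rule SUP_least)
  fix f assume "f \<in> {f \<in> Y. N f \<le> 1}"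
  then have f: "f \<in> Y" "N f \<le> 1" by auto
  obtain u where u: "u \<in> Y" "ae_eq (S u) f" "N u \<le> C * N f" using sol[OF f(1)] by blast
  have i: "ae_inv Y S f \<in> Y \<and> ae_eq (S (ae_inv Y S f)) f"
    unfolding ae_inv_def by (rule someI[of "\<lambda>v. v \<in> Y \<and> ae_eq (S v) f" u]) (use u in auto)
  then have "ae_eq (ae_inv Y S f) u" using inj[of "ae_inv Y S f" u] u(1) ae_eq_trans[OF _ ae_eq_sym[OF u(2)]] by blast
  then have "N (ae_inv Y S f) = N u" by (rule sobolev_norm_cong)
  also have "\<dots> \<le> C * 1" using u(3) f(2) C by (meson mult_left_mono order_trans)
  finally show "(if ae_inv Y S f \<in> Z then ereal (N (ae_inv Y S f)) else \<infinity>) \<le> ereal C" using i YZ by auto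
qed

text \<open>The space splits into the line spanned by h, on which z - A is multiplication by z - 1,
  and the mean-zero functions, on which the Neumann series converges.\<close>

lemma resolvent:
  assumes z: "r < norm z" "z \<noteq> 1"
  shows "ae_bij X (shifted z A)" "op_norm X N X N (ae_inv X (shifted z A)) < \<infinity>"
proof -
  obtain h where h: "h \<in> X" "(\<integral>x. h x \<partial>\<mu>) = 1" "ae_eq (A h) h" using ex_invariant by blast
  have inj: "ae_eq f g" if fg: "f \<in> X" "g \<in> X" "ae_eq (shifted z A f) (shifted z A g)" for f g
  proof -
    let ?d = "\<lambda>x. f x - g x"
    have dX: "?d \<in> X" by (rule sobolev_diff(1)[OF p fg(1,2)])
    have e: "ae_eq (shifted z A ?d) (\<lambda>x. 0)"
      using shifted_diff[OF fg(1,2), of z] fg(3) unfolding ae_eq_def by eventually_elim simp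
    have "(z - 1) * (\<integral>x. ?d x \<partial>\<mu>) = (\<integral>x. shifted z A ?d x \<partial>\<mu>)" by (rule shifted_int[OF dX, symmetric])
    also have "\<dots> = (\<integral>x. 0 \<partial>\<mu>)"
      using e X_integrable[OF shifted_in[OF dX]] unfolding ae_eq_def by (intro integral_cong_AE) auto
    finally have "(\<integral>x. ?d x \<partial>\<mu>) = 0" using z(2) by simp
    from mean_zero_kernel[OF dX this z(1) e] show ?thesis by (simp add: ae_eq_def)
  qed
  \<comment> \<open>First summand: the component along h, with coefficient m / (z - 1) where |m| <=
    N f. Second: the Neumann bound applied to f - m h, whose norm is at most (1 + N h) N f.\<close>
  define C where "C = N h / norm (z - 1) + K / (norm z - r) * (1 + N h)"
  have C0: "0 \<le> C" using z(1) K by (simp add: C_def)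
  have sol: "\<exists>u\<in>X. ae_eq (shifted z A u) f \<and> N u \<le> C * N f" if f: "f \<in> X" for f
  proof -
    define m where "m = (\<integral>x. f x \<partial>\<mu>)"
    have mN: "norm m \<le> N f"
      unfolding m_def using integral_norm_bound[of \<mu> f] sobolev_integrable(2)[OF p f] by linarith
    define g where "g x = f x - m * h x" for x
    have mh: "(\<lambda>x. m * h x) \<in> X" by (rule sobolev_scale(1)[OF p0 h(1)])
    have gX: "g \<in> X" unfolding g_def by (rule sobolev_diff(1)[OF p f mh])
    have gz: "(\<integral>x. g x \<partial>\<mu>) = 0"
      unfolding g_def using X_integrable[OF f] X_integrable[OF h(1)] h(2) by (simp add: m_def)
    obtain v where v: "v \<in> X" "ae_eq (shifted z A v) g" "N v \<le> K / (norm z - r) * N g"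
      using mean_zero_solve[OF gX gz z(1)] by blast
    define q where "q = m / (z - 1)"
    let ?u = "\<lambda>x. q * h x + v x"
    have qh: "(\<lambda>x. q * h x) \<in> X" by (rule sobolev_scale(1)[OF p0 h(1)])
    have uX: "?u \<in> X" by (rule sobolev_add(1)[OF p qh v(1)])
    have "ae_eq (shifted z A ?u) f"
      using A_add[OF qh v(1)] A_scale[OF h(1), of q] h(3) v(2) unfolding ae_eq_def shifted_def g_def
    proof eventually_elim
      case (elim x)
      have "z * (q * h x + v x) - A ?u x = (z - 1) * q * h x + (z * v x - A v x)"
        using elim by (simp add: algebra_simps)
      also have "(z - 1) * q = m" using z(2) by (simp add: q_def)
      finally show ?case using elim by simp
    qed
    moreover have "N ?u \<le> C * N f"
    proof -
      have "N g \<le> N f + norm m * N h"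
        unfolding g_def using sobolev_diff(2)[OF p f mh] sobolev_scale(2)[OF p0 h(1), of m] by simp
      also have "\<dots> \<le> (1 + N h) * N f" using mult_right_mono[OF mN, of "N h"] by (simp add: algebra_simps)
      finally have g: "N g \<le> (1 + N h) * N f" .
      have "N ?u \<le> N (\<lambda>x. q * h x) + N v" by (rule sobolev_add(2)[OF p qh v(1)])
      also have "N (\<lambda>x. q * h x) = norm m * (N h / norm (z - 1))"
        unfolding sobolev_scale(2)[OF p0 h(1)] by (simp add: q_def norm_divide)
      also have "norm m * (N h / norm (z - 1)) \<le> N f * (N h / norm (z - 1))" by (intro mult_right_mono mN) auto
      also have "N v \<le> K / (norm z - r) * ((1 + N h) * N f)"
        using v(3) g z(1) K by (meson divide_nonneg_nonneg diff_ge_0_iff_ge less_imp_le mult_left_mono order_trans)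
      finally show ?thesis by (simp add: C_def algebra_simps add_divide_distrib)
    qed
    ultimately show ?thesis using uX by blast
  qed
  show "ae_bij X (shifted z A)" unfolding ae_bij_def using shifted_in inj sol by blast
  have "op_norm X N X N (ae_inv X (shifted z A)) \<le> ereal C"
    using inj sol C0 by (intro op_norm_ae_inv) auto
  then show "op_norm X N X N (ae_inv X (shifted z A)) < \<infinity>" by (auto simp: less_top)
qed

lemma mean_zero_inverse:
  shows "ae_bij (sobolev_mean_zero k p) (shifted 1 A)"
    and "op_norm (sobolev_mean_zero k p) N X N (ae_inv (sobolev_mean_zero k p) (shifted 1 A)) \<le> ereal (K / (1 - r))"
proof -
  let ?Y = "sobolev_mean_zero k p :: (real \<Rightarrow> 'a) set"
  have r1: "r < norm (1::'a)" using r by simp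
  have Y: "?Y \<subseteq> X" by (auto simp: sobolev_mean_zero_def)
  have inj: "ae_eq f g" if fg: "f \<in> ?Y" "g \<in> ?Y" "ae_eq (shifted 1 A f) (shifted 1 A g)" for f g
  proof -
    have X: "f \<in> X" "g \<in> X" and z: "(\<integral>x. f x \<partial>\<mu>) = 0" "(\<integral>x. g x \<partial>\<mu>) = 0" using fg by (auto simp: sobolev_mean_zero_def)
    let ?d = "\<lambda>x. f x - g x"
    have dX: "?d \<in> X" by (rule sobolev_diff(1)[OF p X])
    have e: "ae_eq (shifted 1 A ?d) (\<lambda>x. 0)"
      using shifted_diff[OF X, of 1] fg(3) unfolding ae_eq_def by eventually_elim simp
    have "(\<integral>x. ?d x \<partial>\<mu>) = 0" using X_integrable[OF X(1)] X_integrable[OF X(2)] z by simp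
    from mean_zero_kernel[OF dX this r1 e] show ?thesis by (simp add: ae_eq_def)
  qed
  have sol: "\<exists>u\<in>?Y. ae_eq (shifted 1 A u) f \<and> N u \<le> K / (1 - r) * N f" if f: "f \<in> ?Y" for f
    using mean_zero_solve[of f 1] f r by (auto simp: sobolev_mean_zero_def)
  have "shifted 1 A f \<in> ?Y" if "f \<in> ?Y" for f
    using that shifted_in[of f 1] shifted_int[of f 1] by (auto simp: sobolev_mean_zero_def)
  then show "ae_bij ?Y (shifted 1 A)" unfolding ae_bij_def using inj sol by blast
  show "op_norm ?Y N X N (ae_inv ?Y (shifted 1 A)) \<le> ereal (K / (1 - r))"
    using inj sol K r Y by (intro op_norm_ae_inv) auto
qed

end

section \<open>Complexification\<close>

lemma Linf_of_real: "g \<in> Linf_space \<Longrightarrow> (\<lambda>x. complex_of_real (g x)) \<in> Linf_space"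
  by (auto simp: Linf_space_def)

lemma Linf_Re: "g \<in> Linf_space \<Longrightarrow> (\<lambda>x. Re (g x)) \<in> Linf_space"
  and Linf_Im: "g \<in> Linf_space \<Longrightarrow> (\<lambda>x. Im (g x)) \<in> Linf_space"
proof -
  assume "g \<in> Linf_space"
  then obtain M where g: "g \<in> borel_measurable \<mu>" "AE x in \<mu>. norm (g x) \<le> M" by (auto simp: Linf_space_def)
  have "AE x in \<mu>. norm (Re (g x)) \<le> M" "AE x in \<mu>. norm (Im (g x)) \<le> M"
    using g(2) by (auto elim!: eventually_mono intro: order_trans[OF abs_Re_le_cmod] order_trans[OF abs_Im_le_cmod])
  then show "(\<lambda>x. Re (g x)) \<in> Linf_space" "(\<lambda>x. Im (g x)) \<in> Linf_space"
    using g(1) unfolding Linf_space_def by auto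
qed

lemma is_transfer_Re_Im:
  fixes f h :: "real \<Rightarrow> complex"
  assumes T: "nonsingular T" and f: "integrable \<mu> f" and t: "is_transfer T f h"
  shows "is_transfer T (\<lambda>x. Re (f x)) (\<lambda>x. Re (h x))" "is_transfer T (\<lambda>x. Im (f x)) (\<lambda>x. Im (h x))"
proof -
  have h: "integrable \<mu> h" using t by (simp add: is_transfer_def)
  have e: "(\<integral>x. h x * of_real (g x) \<partial>\<mu>) = (\<integral>x. f x * of_real (g (T x)) \<partial>\<mu>)"
    and ih: "integrable \<mu> (\<lambda>x. h x * of_real (g x))" and jf: "integrable \<mu> (\<lambda>x. f x * of_real (g (T x)))"
    if "g \<in> Linf_space" for g :: "real \<Rightarrow> real"
  proof -
    have L: "(\<lambda>x. complex_of_real (g x)) \<in> Linf_space" by (rule Linf_of_real[OF that])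
    show "(\<integral>x. h x * of_real (g x) \<partial>\<mu>) = (\<integral>x. f x * of_real (g (T x)) \<partial>\<mu>)"
      using bspec[OF conjunct2[OF t[unfolded is_transfer_def]] L] .
    show "integrable \<mu> (\<lambda>x. h x * of_real (g x))" by (rule Linf_mult_integrable[OF h L])
    show "integrable \<mu> (\<lambda>x. f x * of_real (g (T x)))" by (rule Linf_mult_integrable[OF f Linf_comp[OF T L]])
  qed
  show "is_transfer T (\<lambda>x. Re (f x)) (\<lambda>x. Re (h x))"
    unfolding is_transfer_def
  proof (intro conjI ballI)
    show "integrable \<mu> (\<lambda>x. Re (h x))" using h by simp
    fix g :: "real \<Rightarrow> real" assume g: "g \<in> Linf_space"
    show "(\<integral>x. Re (h x) * g x \<partial>\<mu>) = (\<integral>x. Re (f x) * g (T x) \<partial>\<mu>)"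
      using arg_cong[OF e[OF g], of Re] integral_Re[OF ih[OF g]] integral_Re[OF jf[OF g]] by simp
  qed
  show "is_transfer T (\<lambda>x. Im (f x)) (\<lambda>x. Im (h x))"
    unfolding is_transfer_def
  proof (intro conjI ballI)
    show "integrable \<mu> (\<lambda>x. Im (h x))" using h by simp
    fix g :: "real \<Rightarrow> real" assume g: "g \<in> Linf_space"
    show "(\<integral>x. Im (h x) * g x \<partial>\<mu>) = (\<integral>x. Im (f x) * g (T x) \<partial>\<mu>)"
      using arg_cong[OF e[OF g], of Im] integral_Im[OF ih[OF g]] integral_Im[OF jf[OF g]] by simp
  qed
qed

lemma is_transfer_of_real:
  fixes f h :: "real \<Rightarrow> real"
  assumes T: "nonsingular T" and f: "integrable \<mu> f" and t: "is_transfer T f h"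
  shows "is_transfer T (\<lambda>x. complex_of_real (f x)) (\<lambda>x. complex_of_real (h x))"
  unfolding is_transfer_def
proof (intro conjI ballI)
  have h: "integrable \<mu> h" using t by (simp add: is_transfer_def)
  then show "integrable \<mu> (\<lambda>x. complex_of_real (h x))" by simp
  fix g :: "real \<Rightarrow> complex" assume g: "g \<in> Linf_space"
  have i: "integrable \<mu> (\<lambda>x. complex_of_real (h x) * g x)" "integrable \<mu> (\<lambda>x. complex_of_real (f x) * g (T x))"
    using f h by (auto intro!: Linf_mult_integrable g Linf_comp[OF T g])
  show "(\<integral>x. complex_of_real (h x) * g x \<partial>\<mu>) = (\<integral>x. complex_of_real (f x) * g (T x) \<partial>\<mu>)"
  proof (rule complex_eqI)
    show "Re (\<integral>x. complex_of_real (h x) * g x \<partial>\<mu>) = Re (\<integral>x. complex_of_real (f x) * g (T x) \<partial>\<mu>)"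
      using t Linf_Re[OF g] integral_Re[OF i(1)] integral_Re[OF i(2)] by (simp add: is_transfer_def)
    show "Im (\<integral>x. complex_of_real (h x) * g x \<partial>\<mu>) = Im (\<integral>x. complex_of_real (f x) * g (T x) \<partial>\<mu>)"
      using t Linf_Im[OF g] integral_Im[OF i(1)] integral_Im[OF i(2)] by (simp add: is_transfer_def)
  qed
qed

lemma of_real_Re_Im: "(\<lambda>x. complex_of_real (Re (f x)) + \<i> * complex_of_real (Im (f x))) = f"
  by (auto simp: complex_eq_iff)

text \<open>Existence was obtained from Radon-Nikodym densities and hence over the reals; here a
  complex candidate is assembled from the transfers of the real and imaginary parts, after which the
  choice operator is known to satisfy its specification.\<close>

lemma transfer_is_transfer_complex:
  fixes f :: "real \<Rightarrow> complex"
  assumes T: "nonsingular T" and f: "integrable \<mu> f"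
  shows "is_transfer T f (transfer T f)"
proof -
  have i: "integrable \<mu> (\<lambda>x. Re (f x))" "integrable \<mu> (\<lambda>x. Im (f x))" using f by auto
  have "is_transfer T (\<lambda>x. complex_of_real (Re (f x)) + \<i> * complex_of_real (Im (f x)))
     (\<lambda>x. complex_of_real (transfer T (\<lambda>x. Re (f x)) x) + \<i> * complex_of_real (transfer T (\<lambda>x. Im (f x)) x))"
    using i by (intro is_transfer_add is_transfer_scale is_transfer_of_real transfer_is_transfer_real T) auto
  then have "\<exists>h. is_transfer T f h" unfolding of_real_Re_Im by blast
  then show ?thesis unfolding transfer_alt by (rule someI_ex)
qed

lemma transfer_Re_Im:
  fixes f :: "real \<Rightarrow> complex"
  assumes T: "nonsingular T" and f: "integrable \<mu> f"
  shows "ae_eq (\<lambda>x. Re (transfer T f x)) (transfer T (\<lambda>x. Re (f x)))"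
    "ae_eq (\<lambda>x. Im (transfer T f x)) (transfer T (\<lambda>x. Im (f x)))"
  using is_transfer_Re_Im[OF T f transfer_is_transfer_complex[OF T f]] f
  by (auto intro!: is_transfer_unique_real[OF _ transfer_is_transfer_real[OF T]])

lemma weak_deriv_Re_Im:
  fixes f g :: "real \<Rightarrow> complex"
  assumes w: "weak_deriv f g"
  shows "weak_deriv (\<lambda>x. Re (f x)) (\<lambda>x. Re (g x))" "weak_deriv (\<lambda>x. Im (f x)) (\<lambda>x. Im (g x))"
proof -
  note i = weak_derivD(1,2)[OF w]
  have e: "(\<integral>x. deriv \<phi> x *\<^sub>R f x \<partial>\<mu>) = - (\<integral>x. \<phi> x *\<^sub>R g x \<partial>\<mu>)"
    and j: "integrable \<mu> (\<lambda>x. deriv \<phi> x *\<^sub>R f x)" "integrable \<mu> (\<lambda>x. \<phi> x *\<^sub>R g x)" if "test_fun \<phi>" for \<phi>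
    using weak_derivD(3)[OF w that] test_fun_scaleR_integrable[OF test_fun_deriv[OF that] i(1)]
      test_fun_scaleR_integrable[OF that i(2)] by auto
  show "weak_deriv (\<lambda>x. Re (f x)) (\<lambda>x. Re (g x))"
    unfolding weak_deriv_def
  proof (intro conjI allI impI)
    fix \<phi> assume t: "test_fun \<phi>"
    show "(\<integral>x. deriv \<phi> x *\<^sub>R Re (f x) \<partial>\<mu>) = - (\<integral>x. \<phi> x *\<^sub>R Re (g x) \<partial>\<mu>)"
      using arg_cong[OF e[OF t], of Re] integral_Re[OF j(1)[OF t]] integral_Re[OF j(2)[OF t]] by simp
  qed (use i in auto)
  show "weak_deriv (\<lambda>x. Im (f x)) (\<lambda>x. Im (g x))"
    unfolding weak_deriv_def
  proof (intro conjI allI impI)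
    fix \<phi> assume t: "test_fun \<phi>"
    show "(\<integral>x. deriv \<phi> x *\<^sub>R Im (f x) \<partial>\<mu>) = - (\<integral>x. \<phi> x *\<^sub>R Im (g x) \<partial>\<mu>)"
      using arg_cong[OF e[OF t], of Im] integral_Im[OF j(1)[OF t]] integral_Im[OF j(2)[OF t]] by simp
  qed (use i in auto)
qed

lemma weak_deriv_of_real:
  fixes f g :: "real \<Rightarrow> real"
  assumes w: "weak_deriv f g"
  shows "weak_deriv (\<lambda>x. complex_of_real (f x)) (\<lambda>x. complex_of_real (g x))"
  unfolding weak_deriv_def
proof (intro conjI allI impI)
  fix \<phi> assume t: "test_fun \<phi>"
  show "(\<integral>x. deriv \<phi> x *\<^sub>R complex_of_real (f x) \<partial>\<mu>) = - (\<integral>x. \<phi> x *\<^sub>R complex_of_real (g x) \<partial>\<mu>)"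
    using arg_cong[OF weak_derivD(3)[OF w t], of complex_of_real]
    by (simp add: scaleR_conv_of_real flip: of_real_mult)
qed (use weak_derivD(1,2)[OF w] in auto)

lemma sobolev_Re_Im:
  fixes f :: "real \<Rightarrow> complex"
  assumes p: "1 \<le> p" and "f \<in> sobolev k p"
  shows "(\<lambda>x. Re (f x)) \<in> sobolev k p \<and> sobolev_norm k p (\<lambda>x. Re (f x)) \<le> sobolev_norm k p f"
    "(\<lambda>x. Im (f x)) \<in> sobolev k p \<and> sobolev_norm k p (\<lambda>x. Im (f x)) \<le> sobolev_norm k p f"
proof -
  have Lp: "(\<lambda>x. Re (f x)) \<in> Lp_space p \<and> Lp_norm p (\<lambda>x. Re (f x)) \<le> Lp_norm p f"
    "(\<lambda>x. Im (f x)) \<in> Lp_space p \<and> Lp_norm p (\<lambda>x. Im (f x)) \<le> Lp_norm p f"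
    if f: "f \<in> Lp_space p" for f :: "real \<Rightarrow> complex"
  proof -
    have m: "f \<in> borel_measurable \<mu>" by (rule Lp_space_measurable[OF f])
    then have m': "(\<lambda>x. Re (f x)) \<in> borel_measurable \<mu>" "(\<lambda>x. Im (f x)) \<in> borel_measurable \<mu>" by auto
    have p0: "0 < p" using p by simp
    show "(\<lambda>x. Re (f x)) \<in> Lp_space p \<and> Lp_norm p (\<lambda>x. Re (f x)) \<le> Lp_norm p f"
      using Lp_mono[OF p0 m'(1) f] abs_Re_le_cmod by simp
    show "(\<lambda>x. Im (f x)) \<in> Lp_space p \<and> Lp_norm p (\<lambda>x. Im (f x)) \<le> Lp_norm p f"
      using Lp_mono[OF p0 m'(2) f] abs_Im_le_cmod by simp
  qed
  have "((\<lambda>x. Re (f x)) \<in> sobolev k p \<and> sobolev_norm k p (\<lambda>x. Re (f x)) \<le> sobolev_norm k p f) \<and>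
    ((\<lambda>x. Im (f x)) \<in> sobolev k p \<and> sobolev_norm k p (\<lambda>x. Im (f x)) \<le> sobolev_norm k p f)"
    using assms(2)
  proof (induction k arbitrary: f)
    case 0
    then show ?case using Lp by simp
  next
    case (Suc k)
    note fD = sobolev_SucD[OF Suc(2)]
    note w = weak_deriv_Re_Im[OF fD(2)] and IH = Suc(1)[OF fD(3)] and l = Lp[OF fD(1)]
    show ?case
      unfolding sobolev_norm_weak[OF w(1)] sobolev_norm_weak[OF w(2)] sobolev_norm_weak[OF fD(2)]
      using IH l w by (auto intro!: add_mono)
  qed
  then show "(\<lambda>x. Re (f x)) \<in> sobolev k p \<and> sobolev_norm k p (\<lambda>x. Re (f x)) \<le> sobolev_norm k p f"
    "(\<lambda>x. Im (f x)) \<in> sobolev k p \<and> sobolev_norm k p (\<lambda>x. Im (f x)) \<le> sobolev_norm k p f" by auto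
qed

lemma sobolev_of_real:
  fixes f :: "real \<Rightarrow> real"
  assumes "f \<in> sobolev k p"
  shows "(\<lambda>x. complex_of_real (f x)) \<in> sobolev k p \<and> sobolev_norm k p (\<lambda>x. complex_of_real (f x)) = sobolev_norm k p f"
  using assms
proof (induction k arbitrary: f)
  case 0
  then show ?case by (auto simp: Lp_space_def Lp_norm_def)
next
  case (Suc k)
  note fD = sobolev_SucD[OF Suc(2)]
  note w = weak_deriv_of_real[OF fD(2)] and IH = Suc(1)[OF fD(3)]
  have l: "(\<lambda>x. complex_of_real (f x)) \<in> Lp_space p \<and> Lp_norm p (\<lambda>x. complex_of_real (f x)) = Lp_norm p f"
    using fD(1) by (auto simp: Lp_space_def Lp_norm_def)
  show ?case
    unfolding sobolev_norm_weak[OF w] sobolev_norm_weak[OF fD(2)] using IH l w by auto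
qed

lemma sobolev_complex:
  fixes f :: "real \<Rightarrow> complex"
  assumes p: "1 \<le> p" and "(\<lambda>x. Re (f x)) \<in> sobolev k p" "(\<lambda>x. Im (f x)) \<in> sobolev k p"
  shows "f \<in> sobolev k p" "sobolev_norm k p f \<le> sobolev_norm k p (\<lambda>x. Re (f x)) + sobolev_norm k p (\<lambda>x. Im (f x))"
proof -
  have p0: "0 < p" using p by simp
  note R = sobolev_of_real[OF assms(2)] and I = sobolev_of_real[OF assms(3)]
  note I' = sobolev_scale[OF p0 conjunct1[OF I], of \<i>]
  note S = sobolev_add[OF p conjunct1[OF R] I'(1)]
  show "f \<in> sobolev k p" using S(1) unfolding of_real_Re_Im .
  show "sobolev_norm k p f \<le> sobolev_norm k p (\<lambda>x. Re (f x)) + sobolev_norm k p (\<lambda>x. Im (f x))"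
    using S(2) R I I'(2) unfolding of_real_Re_Im by simp
qed

lemma sobolev_decay_transferI:
  assumes p: "1 \<le> p" and T: "nonsingular T" and K: "0 < K" "0 < r" "r < 1"
    and bd: "\<And>f :: real \<Rightarrow> real. f \<in> sobolev k p \<Longrightarrow>
      transfer T f \<in> sobolev k p \<and> sobolev_norm k p (transfer T f) \<le> L * sobolev_norm k p f"
    and dec: "\<And>(f :: real \<Rightarrow> real) n. f \<in> sobolev k p \<Longrightarrow> (\<integral>x. f x \<partial>\<mu>) = 0 \<Longrightarrow>
      sobolev_norm k p ((transfer T ^^ n) f) \<le> K * r ^ n * sobolev_norm k p f"
  shows "sobolev_decay (transfer T :: (real \<Rightarrow> real) \<Rightarrow> real \<Rightarrow> real) k p K r L"
proof
  note int = sobolev_integrable(1)[OF p]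
  fix f :: "real \<Rightarrow> real" assume f: "f \<in> sobolev k p"
  show "ae_eq (transfer T f) (transfer T g)" if "ae_eq f g" for g by (rule transfer_cong[OF T int[OF f] that])
  show "ae_eq (transfer T (\<lambda>x. f x + g x)) (\<lambda>x. transfer T f x + transfer T g x)" if "g \<in> sobolev k p" for g
    by (rule transfer_add[OF T int[OF f] int[OF that]])
  show "ae_eq (transfer T (\<lambda>x. a * f x)) (\<lambda>x. a * transfer T f x)" for a by (rule transfer_scale[OF T int[OF f]])
  show "(\<integral>x. transfer T f x \<partial>\<mu>) = (\<integral>x. f x \<partial>\<mu>)" by (rule transfer_integral[OF T int[OF f]])
qed (use p K bd dec in auto)

text \<open>The complex operator acts separately on real and imaginary parts, so the rate r is kept
  and the constants double. |L| appears because the real bound is enlarged from the norm of a part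
  to the norm of f, which needs a nonnegative factor.\<close>

lemma sobolev_decay_complex:
  assumes T: "nonsingular T" and D: "sobolev_decay (transfer T :: (real \<Rightarrow> real) \<Rightarrow> real \<Rightarrow> real) k p K r L"
  shows "sobolev_decay (transfer T :: (real \<Rightarrow> complex) \<Rightarrow> real \<Rightarrow> complex) k p (2 * K) r (2 * \<bar>L\<bar>)"
proof -
  interpret D: sobolev_decay "transfer T :: (real \<Rightarrow> real) \<Rightarrow> real \<Rightarrow> real" k p K r L by (rule D)
  let ?C = "transfer T :: (real \<Rightarrow> complex) \<Rightarrow> real \<Rightarrow> complex" and ?R = "transfer T :: (real \<Rightarrow> real) \<Rightarrow> real \<Rightarrow> real"
  have p: "1 \<le> p" by (rule D.p)
  have int: "integrable \<mu> f" if "f \<in> sobolev k p" for f :: "real \<Rightarrow> complex"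
    by (rule sobolev_integrable(1)[OF p that])
  have tr: "is_transfer T f (?C f)" if "integrable \<mu> f" for f by (rule transfer_is_transfer_complex[OF T that])
  have uniq: "ae_eq h h'" if "integrable \<mu> f" "is_transfer T f h" "is_transfer T f h'" for f h h' :: "real \<Rightarrow> complex"
  proof -
    note a = is_transfer_Re_Im[OF T that(1,2)] and b = is_transfer_Re_Im[OF T that(1,3)]
    have "ae_eq (\<lambda>x. Re (h x)) (\<lambda>x. Re (h' x))" "ae_eq (\<lambda>x. Im (h x)) (\<lambda>x. Im (h' x))"
      using is_transfer_unique_real[OF a(1) b(1)] is_transfer_unique_real[OF a(2) b(2)] by auto
    then show ?thesis unfolding ae_eq_def by (rule eventually_elim2) (simp add: complex_eq_iff)
  qed
  note ReIm = sobolev_Re_Im[OF p]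
  have bound: "g \<in> sobolev k p \<and> sobolev_norm k p g \<le> 2 * B"
    if "(\<lambda>x. Re (g x)) \<in> sobolev k p \<and> sobolev_norm k p (\<lambda>x. Re (g x)) \<le> B"
      "(\<lambda>x. Im (g x)) \<in> sobolev k p \<and> sobolev_norm k p (\<lambda>x. Im (g x)) \<le> B" for g B
    using sobolev_complex[OF p, of g k] that by auto
  have transport: "g' \<in> sobolev k p \<and> sobolev_norm k p g' \<le> B"
    if "g \<in> sobolev k p" "sobolev_norm k p g \<le> B" "ae_eq g' g" for g g' :: "real \<Rightarrow> real" and B
    using sobolev_cong[OF that(1) ae_eq_sym[OF that(3)]] sobolev_norm_cong[OF that(3)] that(2) by auto
  have one: "?C f \<in> sobolev k p \<and> sobolev_norm k p (?C f) \<le> 2 * (\<bar>L\<bar> * sobolev_norm k p f)" if f: "f \<in> sobolev k p" for f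
  proof (rule bound)
    have b: "sobolev_norm k p (?R g) \<le> \<bar>L\<bar> * sobolev_norm k p f"
      if "g \<in> sobolev k p \<and> sobolev_norm k p g \<le> sobolev_norm k p f" for g
    proof -
      have "sobolev_norm k p (?R g) \<le> L * sobolev_norm k p g" using that by (intro D.A_bd) auto
      also have "\<dots> \<le> \<bar>L\<bar> * sobolev_norm k p g" by (intro mult_right_mono) auto
      also have "\<dots> \<le> \<bar>L\<bar> * sobolev_norm k p f" using that by (intro mult_left_mono) auto
      finally show ?thesis .
    qed
    show "(\<lambda>x. Re (?C f x)) \<in> sobolev k p \<and> sobolev_norm k p (\<lambda>x. Re (?C f x)) \<le> \<bar>L\<bar> * sobolev_norm k p f"
      by (rule transport[OF _ b[OF ReIm(1)[OF f]] transfer_Re_Im(1)[OF T int[OF f]]]) (use ReIm(1)[OF f] in \<open>auto intro: D.A_in\<close>)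
    show "(\<lambda>x. Im (?C f x)) \<in> sobolev k p \<and> sobolev_norm k p (\<lambda>x. Im (?C f x)) \<le> \<bar>L\<bar> * sobolev_norm k p f"
      by (rule transport[OF _ b[OF ReIm(2)[OF f]] transfer_Re_Im(2)[OF T int[OF f]]]) (use ReIm(2)[OF f] in \<open>auto intro: D.A_in\<close>)
  qed
  have inn: "(?C ^^ n) f \<in> sobolev k p" if "f \<in> sobolev k p" for n f
    by (induction n) (use one that in auto)
  have it: "ae_eq (\<lambda>x. Re ((?C ^^ n) f x)) ((?R ^^ n) (\<lambda>x. Re (f x)))"
    "ae_eq (\<lambda>x. Im ((?C ^^ n) f x)) ((?R ^^ n) (\<lambda>x. Im (f x)))" if f: "f \<in> sobolev k p" for n f
  proof (induction n)
    case (Suc n)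
    { case 1
      have "ae_eq (\<lambda>x. Re (?C ((?C ^^ n) f) x)) (?R (\<lambda>x. Re ((?C ^^ n) f x)))" by (rule transfer_Re_Im(1)[OF T int[OF inn[OF f]]])
      also have "ae_eq \<dots> (?R ((?R ^^ n) (\<lambda>x. Re (f x))))"
        using Suc(1) int[OF inn[OF f, of n]] by (intro transfer_cong T) auto
      finally show ?case by simp }
    { case 2
      have "ae_eq (\<lambda>x. Im (?C ((?C ^^ n) f) x)) (?R (\<lambda>x. Im ((?C ^^ n) f x)))" by (rule transfer_Re_Im(2)[OF T int[OF inn[OF f]]])
      also have "ae_eq \<dots> (?R ((?R ^^ n) (\<lambda>x. Im (f x))))"
        using Suc(2) int[OF inn[OF f, of n]] by (intro transfer_cong T) auto
      finally show ?case by simp }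
  qed simp_all
  show ?thesis
  proof
    show "1 \<le> p" "0 < 2 * K" "0 < r" "r < 1" using p D.K D.r by auto
    fix f :: "real \<Rightarrow> complex" assume f: "f \<in> sobolev k p"
    show "?C f \<in> sobolev k p" "sobolev_norm k p (?C f) \<le> 2 * \<bar>L\<bar> * sobolev_norm k p f" using one[OF f] by auto
    show "ae_eq (?C f) (?C g)" if "ae_eq f g" for g
      using uniq[OF integrable_ae_eq[OF int[OF f] that] is_transfer_ae[OF T tr[OF int[OF f]] int[OF f] that ae_eq_refl]
        tr[OF integrable_ae_eq[OF int[OF f] that]]] .
    show "ae_eq (?C (\<lambda>x. f x + g x)) (\<lambda>x. ?C f x + ?C g x)" if g: "g \<in> sobolev k p" for g
      using int[OF f] int[OF g] by (intro uniq[OF _ tr is_transfer_add[OF T _ _ tr tr]]) auto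
    show "ae_eq (?C (\<lambda>x. a * f x)) (\<lambda>x. a * ?C f x)" for a
      using int[OF f] by (intro uniq[OF _ tr is_transfer_scale[OF tr]]) auto
    have "(\<lambda>x. 1 :: complex) \<in> Linf_space" by (auto simp: Linf_space_def)
    then show "(\<integral>x. ?C f x \<partial>\<mu>) = (\<integral>x. f x \<partial>\<mu>)"
      using tr[OF int[OF f]] unfolding is_transfer_def by fastforce
    fix n assume z: "(\<integral>x. f x \<partial>\<mu>) = 0"
    have zz: "(\<integral>x. Re (f x) \<partial>\<mu>) = 0" "(\<integral>x. Im (f x) \<partial>\<mu>) = 0"
      using z integral_Re[OF int[OF f]] integral_Im[OF int[OF f]] by simp_all
    have "(?C ^^ n) f \<in> sobolev k p \<and> sobolev_norm k p ((?C ^^ n) f) \<le> 2 * (K * r ^ n * sobolev_norm k p f)"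
    proof (rule bound)
      have b: "sobolev_norm k p ((?R ^^ n) g) \<le> K * r ^ n * sobolev_norm k p f"
        if "g \<in> sobolev k p \<and> sobolev_norm k p g \<le> sobolev_norm k p f" "(\<integral>x. g x \<partial>\<mu>) = 0" for g
      proof -
        have "sobolev_norm k p ((?R ^^ n) g) \<le> K * r ^ n * sobolev_norm k p g" using that by (intro D.decay) auto
        also have "\<dots> \<le> K * r ^ n * sobolev_norm k p f" using that D.K D.r by (intro mult_left_mono) auto
        finally show ?thesis .
      qed
      show "(\<lambda>x. Re ((?C ^^ n) f x)) \<in> sobolev k p \<and> sobolev_norm k p (\<lambda>x. Re ((?C ^^ n) f x)) \<le> K * r ^ n * sobolev_norm k p f"
        by (rule transport[OF _ b[OF ReIm(1)[OF f] zz(1)] it(1)[OF f]]) (use ReIm(1)[OF f] in \<open>auto intro: D.An_in\<close>)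
      show "(\<lambda>x. Im ((?C ^^ n) f x)) \<in> sobolev k p \<and> sobolev_norm k p (\<lambda>x. Im ((?C ^^ n) f x)) \<le> K * r ^ n * sobolev_norm k p f"
        by (rule transport[OF _ b[OF ReIm(2)[OF f] zz(2)] it(2)[OF f]]) (use ReIm(2)[OF f] in \<open>auto intro: D.An_in\<close>)
    qed
    then show "sobolev_norm k p ((?C ^^ n) f) \<le> 2 * K * r ^ n * sobolev_norm k p f" by simp
  qed
qed

lemma uniform_spectral_gapI:
  assumes ns: "\<And>\<epsilon>. \<epsilon> \<in> E \<Longrightarrow> nonsingular (T \<epsilon>)"
    and D: "\<And>\<epsilon>. \<epsilon> \<in> E \<Longrightarrow> sobolev_decay (transfer (T \<epsilon>) :: (real \<Rightarrow> real) \<Rightarrow> real \<Rightarrow> real) k p K r L"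
    and K: "0 < K" and r: "0 < r" "r < 1"
  shows "uniform_spectral_gap k p E T"
  unfolding uniform_spectral_gap_def
proof (intro conjI ballI)
  fix \<epsilon> assume \<epsilon>: "\<epsilon> \<in> E"
  interpret R: sobolev_decay "transfer (T \<epsilon>) :: (real \<Rightarrow> real) \<Rightarrow> real \<Rightarrow> real" k p K r L by (rule D[OF \<epsilon>])
  interpret C: sobolev_decay "transfer (T \<epsilon>) :: (real \<Rightarrow> complex) \<Rightarrow> real \<Rightarrow> complex" k p "2 * K" r "2 * \<bar>L\<bar>"
    by (rule sobolev_decay_complex[OF ns[OF \<epsilon>] D[OF \<epsilon>]])
  show "simple_eigenvalue (sobolev k p) (transfer (T \<epsilon>)) (1::complex)" by (rule C.simple_eigenvalue_1)
  have "op_norm R.X R.N R.X R.N (transfer (T \<epsilon>)) \<le> ereal \<bar>L\<bar>"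
    unfolding op_norm_def
  proof (rule SUP_least)
    fix f assume "f \<in> {f \<in> R.X. R.N f \<le> 1}"
    then have f: "f \<in> R.X" "R.N f \<le> 1" by auto
    have "R.N (transfer (T \<epsilon>) f) \<le> L * R.N f" by (rule R.A_bd[OF f(1)])
    also have "\<dots> \<le> \<bar>L\<bar> * 1" using f(2) by (intro mult_mono) auto
    finally show "(if transfer (T \<epsilon>) f \<in> R.X then ereal (R.N (transfer (T \<epsilon>) f)) else \<infinity>) \<le> ereal \<bar>L\<bar>"
      using R.A_in[OF f(1)] by simp
  qed
  then show "op_norm R.X R.N R.X R.N (transfer (T \<epsilon>)) < \<infinity>" by (auto simp: less_top)
next
  show "\<exists>K>0. \<exists>r. 0 < r \<and> r < 1 \<and>
        (\<forall>\<epsilon>\<in>E. spectrum_on (sobolev k p) (sobolev_norm k p) (transfer (T \<epsilon>)) - {1} \<subseteq> cball 0 r) \<and>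
        (\<forall>\<epsilon>\<in>E. \<forall>n. \<forall>f \<in> (sobolev_mean_zero k p :: (real \<Rightarrow> real) set).
           (transfer (T \<epsilon>) ^^ n) f \<in> sobolev k p \<and>
           sobolev_norm k p ((transfer (T \<epsilon>) ^^ n) f) \<le> K * r ^ n * sobolev_norm k p f)"
  proof (rule exI[of _ K], intro conjI K, rule exI[of _ r], intro conjI r ballI allI)
    fix \<epsilon> assume \<epsilon>: "\<epsilon> \<in> E"
    interpret R: sobolev_decay "transfer (T \<epsilon>) :: (real \<Rightarrow> real) \<Rightarrow> real \<Rightarrow> real" k p K r L by (rule D[OF \<epsilon>])
    interpret C: sobolev_decay "transfer (T \<epsilon>) :: (real \<Rightarrow> complex) \<Rightarrow> real \<Rightarrow> complex" k p "2 * K" r "2 * \<bar>L\<bar>"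
      by (rule sobolev_decay_complex[OF ns[OF \<epsilon>] D[OF \<epsilon>]])
    show "spectrum_on (sobolev k p) (sobolev_norm k p) (transfer (T \<epsilon>)) - {1} \<subseteq> cball 0 r"
    proof
      fix z assume z: "z \<in> spectrum_on (sobolev k p) (sobolev_norm k p) (transfer (T \<epsilon>)) - {1}"
      show "z \<in> cball 0 r"
      proof (rule ccontr)
        assume "z \<notin> cball 0 r"
        then have "r < norm z" by simp
        with z C.resolvent[of z] show False by (auto simp: spectrum_on_def)
      qed
    qed
    fix n and f :: "real \<Rightarrow> real" assume f: "f \<in> sobolev_mean_zero k p"
    show "(transfer (T \<epsilon>) ^^ n) f \<in> sobolev k p"
      "sobolev_norm k p ((transfer (T \<epsilon>) ^^ n) f) \<le> K * r ^ n * sobolev_norm k p f"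
      using f R.An_in[of f n] R.decay[of f n] by (auto simp: sobolev_mean_zero_def)
  qed
qed

section \<open>The invariant density\<close>

lemma test_fun_sobolev:
  assumes p: "0 < p"
  shows "test_fun \<phi> \<Longrightarrow> \<phi> \<in> sobolev k p"
proof (induction k arbitrary: \<phi>)
  case 0
  obtain B where B: "\<And>x. \<bar>\<phi> x\<bar> \<le> B" using test_fun_bounded[OF 0] by blast
  moreover have "0 \<le> B" using B[of 0] by linarith
  ultimately show ?case using Lp_bounded(1)[OF p, of B \<phi>] test_fun_borel[OF 0] by simp
next
  case (Suc k)
  obtain B where B: "\<And>x. \<bar>\<phi> x\<bar> \<le> B" using test_fun_bounded[OF Suc(2)] by blast
  moreover have "0 \<le> B" using B[of 0] by linarith
  ultimately have "\<phi> \<in> Lp_space p" using Lp_bounded(1)[OF p, of B \<phi>] test_fun_borel[OF Suc(2)] by simp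
  \<comment> \<open>The classical derivative of a test function is obtained as a weak derivative
    from the product rule with the constant function 1.\<close>
  moreover have "weak_deriv (\<lambda>x. \<phi> x * 1) (\<lambda>x. deriv \<phi> x * 1 + \<phi> x * 0)"
    by (intro weak_deriv_mult weak_deriv_const test_fun_continuous test_fun_differentiable
        continuous_imp_integrable_mu test_fun_deriv Suc(2))
  ultimately show ?case using Suc(1)[OF test_fun_deriv[OF Suc(2)]] by (intro sobolev_SucI) auto
qed

text \<open>A competing density is merely integrable, so decay in the Sobolev space does not apply
  to it. Instead P^n f is shown to tend in L^1 to (\<integral>f) h for every integrable f, by
  density of the bumps and L^1 contractivity; an invariant f of mass 1 must then equal h
  a.e.\<close>

lemma invariant_density_unique:
  assumes T: "nonsingular T" and D: "sobolev_decay (transfer T :: (real \<Rightarrow> real) \<Rightarrow> real \<Rightarrow> real) k p K r L"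
  shows "\<exists>h \<in> sobolev k p. invariant_density T h \<and> (\<forall>h'. invariant_density T h' \<longrightarrow> ae_eq h' h)"
proof -
  interpret sobolev_decay "transfer T :: (real \<Rightarrow> real) \<Rightarrow> real \<Rightarrow> real" k p K r L by (rule D)
  let ?P = "transfer T :: (real \<Rightarrow> real) \<Rightarrow> real \<Rightarrow> real"
  obtain h where h: "h \<in> X" "(\<integral>x. h x \<partial>\<mu>) = 1" "ae_eq (?P h) h"
    and lim: "(\<lambda>n. N (\<lambda>x. h x - (?P ^^ n) (\<lambda>x. 1) x)) \<longlonglongrightarrow> 0"
    using ex_invariant by blast
  have hi: "integrable \<mu> h" by (rule X_integrable[OF h(1)])
  have oX: "(\<lambda>x. 1) \<in> X" by (rule sobolev_const[OF p0])
  have hnn: "AE x in \<mu>. 0 \<le> h x"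
  proof -
    have mi: "integrable \<mu> (\<lambda>x. max (- h x) 0)" using hi by auto
    \<comment> \<open>Since P^n 1 is nonnegative, the negative part of h is at most |h - P^n 1|,
      which tends to 0.\<close>
    have "(\<integral>x. max (- h x) 0 \<partial>\<mu>) \<le> N (\<lambda>x. h x - (?P ^^ n) (\<lambda>x. 1) x)" for n
    proof -
      have dX: "(\<lambda>x. h x - (?P ^^ n) (\<lambda>x. 1) x) \<in> X" by (intro sobolev_diff(1)[OF p] h An_in oX)
      have "AE x in \<mu>. \<bar>(?P ^^ n) (\<lambda>x. 0) x\<bar> \<le> (?P ^^ n) (\<lambda>x. 1) x"
        by (rule funpow_transfer_abs[OF T]) auto
      then have "AE x in \<mu>. max (- h x) 0 \<le> norm (h x - (?P ^^ n) (\<lambda>x. 1) x)"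
        by eventually_elim auto
      then have "(\<integral>x. max (- h x) 0 \<partial>\<mu>) \<le> (\<integral>x. norm (h x - (?P ^^ n) (\<lambda>x. 1) x) \<partial>\<mu>)"
        by (intro integral_mono_AE mi integrable_norm X_integrable dX)
      also have "\<dots> \<le> N (\<lambda>x. h x - (?P ^^ n) (\<lambda>x. 1) x)" by (rule sobolev_integrable(2)[OF p dX])
      finally show ?thesis .
    qed
    then have "(\<integral>x. max (- h x) 0 \<partial>\<mu>) \<le> 0" using LIMSEQ_le_const[OF lim] by blast
    moreover have "0 \<le> (\<integral>x. max (- h x) 0 \<partial>\<mu>)" by (rule Bochner_Integration.integral_nonneg) simp
    ultimately have "AE x in \<mu>. max (- h x) 0 = 0"
      using integral_nonneg_eq_0_iff_AE[OF mi] by simp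
    then show ?thesis by eventually_elim (simp add: max_def split: if_splits)
  qed
  have inv: "invariant_density T h" using hi hnn h by (simp add: invariant_density_def)
  have hn: "ae_eq ((?P ^^ n) h) h" for n
  proof (induction n)
    case (Suc n)
    have "ae_eq (?P ((?P ^^ n) h)) (?P h)" by (rule A_cong[OF An_in[OF h(1)] Suc])
    also note h(3)
    finally show ?case by simp
  qed simp
  have conv: "(\<lambda>n. \<integral>x. \<bar>(?P ^^ n) f x - (\<integral>x. f x \<partial>\<mu>) * h x\<bar> \<partial>\<mu>) \<longlonglongrightarrow> 0" if "integrable \<mu> f" for f
    using that
  proof (induction f rule: L1_dense_induct)
    case (bump a b j)
    let ?f = "bump a b j"
    define m where "m = (\<integral>x. ?f x \<partial>\<mu>)"
    have fX: "?f \<in> X" using bump by (intro test_fun_sobolev[OF p0] test_fun_bump)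
    have mh: "(\<lambda>x. m * h x) \<in> X" by (rule sobolev_scale(1)[OF p0 h(1)])
    let ?g = "\<lambda>x. ?f x - m * h x"
    have gX: "?g \<in> X" by (rule sobolev_diff(1)[OF p fX mh])
    have gz: "(\<integral>x. ?g x \<partial>\<mu>) = 0" using X_integrable[OF fX] hi h(2) by (simp add: m_def)
    have e: "ae_eq ((?P ^^ n) ?g) (\<lambda>x. (?P ^^ n) ?f x - m * h x)" for n
      using funpow_transfer_diff[OF T X_integrable[OF fX] X_integrable[OF mh], of n]
        funpow_transfer_scale[OF T hi, of n m] hn[of n] unfolding ae_eq_def by eventually_elim simp
    show ?case
    proof (rule tendsto_sandwich[OF _ _ tendsto_const])
      show "\<forall>\<^sub>F n in sequentially. (\<integral>x. \<bar>(?P ^^ n) ?f x - (\<integral>x. ?f x \<partial>\<mu>) * h x\<bar> \<partial>\<mu>) \<le> K * r ^ n * N ?g"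
      proof (intro always_eventually allI)
        fix n
        have "(\<integral>x. \<bar>(?P ^^ n) ?f x - (\<integral>x. ?f x \<partial>\<mu>) * h x\<bar> \<partial>\<mu>) = (\<integral>x. norm ((?P ^^ n) ?g x) \<partial>\<mu>)"
        proof (rule integral_cong_AE)
          show "AE x in \<mu>. \<bar>(?P ^^ n) ?f x - (\<integral>x. ?f x \<partial>\<mu>) * h x\<bar> = norm ((?P ^^ n) ?g x)"
            using e[of n] unfolding ae_eq_def by eventually_elim (simp add: m_def)
        qed (use X_integrable[OF An_in[OF gX, of n]] X_integrable[OF An_in[OF fX, of n]] hi in auto)
        also have "\<dots> \<le> N ((?P ^^ n) ?g)" by (rule sobolev_integrable(2)[OF p An_in[OF gX]])
        also have "\<dots> \<le> K * r ^ n * N ?g" by (rule decay[OF gX gz])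
        finally show "(\<integral>x. \<bar>(?P ^^ n) ?f x - (\<integral>x. ?f x \<partial>\<mu>) * h x\<bar> \<partial>\<mu>) \<le> K * r ^ n * N ?g" .
      qed
      have "(\<lambda>n. K * r ^ n * N ?g) \<longlonglongrightarrow> K * 0 * N ?g" using r by (intro tendsto_intros LIMSEQ_power_zero) simp
      then show "(\<lambda>n. K * r ^ n * N ?g) \<longlonglongrightarrow> 0" by simp
    qed (auto intro!: always_eventually Bochner_Integration.integral_nonneg)
  next
    case (scale f s)
    have "(\<integral>x. \<bar>(?P ^^ n) (\<lambda>x. s * f x) x - (\<integral>x. s * f x \<partial>\<mu>) * h x\<bar> \<partial>\<mu>)
      = \<bar>s\<bar> * (\<integral>x. \<bar>(?P ^^ n) f x - (\<integral>x. f x \<partial>\<mu>) * h x\<bar> \<partial>\<mu>)" for n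
    proof -
      have i: "integrable \<mu> ((?P ^^ n) (\<lambda>x. s * f x))" "integrable \<mu> ((?P ^^ n) f)"
        using scale(1) by (auto intro!: funpow_transfer_integrable T)
      have "(\<integral>x. \<bar>(?P ^^ n) (\<lambda>x. s * f x) x - (\<integral>x. s * f x \<partial>\<mu>) * h x\<bar> \<partial>\<mu>)
        = (\<integral>x. \<bar>s\<bar> * \<bar>(?P ^^ n) f x - (\<integral>x. f x \<partial>\<mu>) * h x\<bar> \<partial>\<mu>)"
      proof (rule integral_cong_AE)
        show "AE x in \<mu>. \<bar>(?P ^^ n) (\<lambda>x. s * f x) x - (\<integral>x. s * f x \<partial>\<mu>) * h x\<bar> = \<bar>s\<bar> * \<bar>(?P ^^ n) f x - (\<integral>x. f x \<partial>\<mu>) * h x\<bar>"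
          using funpow_transfer_scale[OF T scale(1), of n s] unfolding ae_eq_def
          by eventually_elim (simp add: right_diff_distrib flip: abs_mult)
      qed (use i hi in auto)
      then show ?thesis by simp
    qed
    then show ?case using tendsto_mult_left[OF scale(2), of "\<bar>s\<bar>"] by simp
  next
    case (add f g)
    have le: "(\<integral>x. \<bar>(?P ^^ n) (\<lambda>x. f x + g x) x - (\<integral>x. f x + g x \<partial>\<mu>) * h x\<bar> \<partial>\<mu>)
      \<le> (\<integral>x. \<bar>(?P ^^ n) f x - (\<integral>x. f x \<partial>\<mu>) * h x\<bar> \<partial>\<mu>) + (\<integral>x. \<bar>(?P ^^ n) g x - (\<integral>x. g x \<partial>\<mu>) * h x\<bar> \<partial>\<mu>)" for n
    proof -
      have i: "integrable \<mu> ((?P ^^ n) (\<lambda>x. f x + g x))" "integrable \<mu> ((?P ^^ n) f)" "integrable \<mu> ((?P ^^ n) g)"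
        using add(1,2) by (auto intro!: funpow_transfer_integrable T)
      have "(\<integral>x. \<bar>(?P ^^ n) (\<lambda>x. f x + g x) x - (\<integral>x. f x + g x \<partial>\<mu>) * h x\<bar> \<partial>\<mu>)
        \<le> (\<integral>x. \<bar>(?P ^^ n) f x - (\<integral>x. f x \<partial>\<mu>) * h x\<bar> + \<bar>(?P ^^ n) g x - (\<integral>x. g x \<partial>\<mu>) * h x\<bar> \<partial>\<mu>)"
      proof (rule integral_mono_AE)
        show "AE x in \<mu>. \<bar>(?P ^^ n) (\<lambda>x. f x + g x) x - (\<integral>x. f x + g x \<partial>\<mu>) * h x\<bar>
          \<le> \<bar>(?P ^^ n) f x - (\<integral>x. f x \<partial>\<mu>) * h x\<bar> + \<bar>(?P ^^ n) g x - (\<integral>x. g x \<partial>\<mu>) * h x\<bar>"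
          using funpow_transfer_add[OF T add(1,2), of n] unfolding ae_eq_def
        proof eventually_elim
          case (elim x)
          have "(\<integral>x. f x + g x \<partial>\<mu>) * h x = (\<integral>x. f x \<partial>\<mu>) * h x + (\<integral>x. g x \<partial>\<mu>) * h x"
            using add(1,2) by (simp add: distrib_right)
          then show ?case using elim by linarith
        qed
      qed (use i hi in auto)
      then show ?thesis using i hi by simp
    qed
    show ?case
      by (rule tendsto_sandwich[OF _ always_eventually tendsto_const tendsto_add_zero[OF add(3,4)]])
        (use le in \<open>auto intro!: always_eventually Bochner_Integration.integral_nonneg\<close>)
  next
    case (lim F f)
    define H where "H = (\<integral>x. \<bar>h x\<bar> \<partial>\<mu>)"
    have H0: "0 \<le> H" unfolding H_def by (rule Bochner_Integration.integral_nonneg) simp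
    \<comment> \<open>Replacing F by f j costs its L^1 distance twice: once through contractivity of
      P^n, once through the changed integral in front of h, which brings the factor H. The bound is
      uniform in n.\<close>
    have le: "(\<integral>x. \<bar>(?P ^^ n) F x - (\<integral>x. F x \<partial>\<mu>) * h x\<bar> \<partial>\<mu>)
      \<le> (1 + H) * (\<integral>x. \<bar>F x - f j x\<bar> \<partial>\<mu>) + (\<integral>x. \<bar>(?P ^^ n) (f j) x - (\<integral>x. f j x \<partial>\<mu>) * h x\<bar> \<partial>\<mu>)" for n j
    proof -
      let ?d = "\<lambda>x. F x - f j x"
      have di: "integrable \<mu> ?d" using lim(1,2) by auto
      have i: "integrable \<mu> ((?P ^^ n) F)" "integrable \<mu> ((?P ^^ n) (f j))" "integrable \<mu> ((?P ^^ n) ?d)"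
        using lim(1,2) di by (auto intro!: funpow_transfer_integrable T)
      have "(\<integral>x. \<bar>(?P ^^ n) F x - (\<integral>x. F x \<partial>\<mu>) * h x\<bar> \<partial>\<mu>)
        \<le> (\<integral>x. \<bar>(?P ^^ n) ?d x\<bar> + (\<bar>\<integral>x. ?d x \<partial>\<mu>\<bar> * \<bar>h x\<bar> + \<bar>(?P ^^ n) (f j) x - (\<integral>x. f j x \<partial>\<mu>) * h x\<bar>) \<partial>\<mu>)"
      proof (rule integral_mono_AE)
        show "AE x in \<mu>. \<bar>(?P ^^ n) F x - (\<integral>x. F x \<partial>\<mu>) * h x\<bar>
          \<le> \<bar>(?P ^^ n) ?d x\<bar> + (\<bar>\<integral>x. ?d x \<partial>\<mu>\<bar> * \<bar>h x\<bar> + \<bar>(?P ^^ n) (f j) x - (\<integral>x. f j x \<partial>\<mu>) * h x\<bar>)"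
          using funpow_transfer_diff[OF T lim(1) lim(2)[of j], of n] unfolding ae_eq_def
        proof eventually_elim
          case (elim x)
          have "(\<integral>x. F x \<partial>\<mu>) * h x = (\<integral>x. ?d x \<partial>\<mu>) * h x + (\<integral>x. f j x \<partial>\<mu>) * h x"
            using lim(1,2) by (simp add: left_diff_distrib)
          then show ?case using elim unfolding abs_mult[symmetric] by linarith
        qed
      qed (use i hi in auto)
      also have "\<dots> = (\<integral>x. \<bar>(?P ^^ n) ?d x\<bar> \<partial>\<mu>) + (\<bar>\<integral>x. ?d x \<partial>\<mu>\<bar> * H + (\<integral>x. \<bar>(?P ^^ n) (f j) x - (\<integral>x. f j x \<partial>\<mu>) * h x\<bar> \<partial>\<mu>))"
        using i hi by (simp add: H_def)
      also have "\<dots> \<le> (\<integral>x. \<bar>?d x\<bar> \<partial>\<mu>) + ((\<integral>x. \<bar>?d x\<bar> \<partial>\<mu>) * H + (\<integral>x. \<bar>(?P ^^ n) (f j) x - (\<integral>x. f j x \<partial>\<mu>) * h x\<bar> \<partial>\<mu>))"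
        using integral_norm_bound[of \<mu> ?d] H0
        by (intro add_mono order_refl mult_right_mono funpow_transfer_L1[OF T di]) auto
      finally show ?thesis by (simp add: algebra_simps)
    qed
    show ?case
    proof (rule LIMSEQ_I)
      fix e :: real assume e: "0 < e"
      have "0 < e / (2 * (1 + H))" using e H0 by simp
      from LIMSEQ_D[OF lim(3) this] obtain j where "\<bar>\<integral>x. \<bar>F x - f j x\<bar> \<partial>\<mu>\<bar> < e / (2 * (1 + H))" by auto
      then have j: "(1 + H) * (\<integral>x. \<bar>F x - f j x\<bar> \<partial>\<mu>) < e / 2" using H0 by (simp add: field_simps)
      have "0 < e / 2" using e by simp
      from LIMSEQ_D[OF lim(4)[of j] this] obtain n0 where
        n0: "\<And>n. n \<ge> n0 \<Longrightarrow> \<bar>\<integral>x. \<bar>(?P ^^ n) (f j) x - (\<integral>x. f j x \<partial>\<mu>) * h x\<bar> \<partial>\<mu>\<bar> < e / 2" by auto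
      have "norm ((\<integral>x. \<bar>(?P ^^ n) F x - (\<integral>x. F x \<partial>\<mu>) * h x\<bar> \<partial>\<mu>) - 0) < e" if "n \<ge> n0" for n
      proof -
        have "0 \<le> (\<integral>x. \<bar>(?P ^^ n) F x - (\<integral>x. F x \<partial>\<mu>) * h x\<bar> \<partial>\<mu>)"
          by (rule Bochner_Integration.integral_nonneg) simp
        moreover have "(\<integral>x. \<bar>(?P ^^ n) F x - (\<integral>x. F x \<partial>\<mu>) * h x\<bar> \<partial>\<mu>) < e"
          using le[of n j] abs_ge_self[THEN le_less_trans, OF n0[OF that]] j by linarith
        ultimately show ?thesis by simp
      qed
      then show "\<exists>no. \<forall>n\<ge>no. norm ((\<integral>x. \<bar>(?P ^^ n) F x - (\<integral>x. F x \<partial>\<mu>) * h x\<bar> \<partial>\<mu>) - 0) < e" by blast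
    qed
  qed
  have "ae_eq h' h" if "invariant_density T h'" for h'
  proof -
    have h': "integrable \<mu> h'" "(\<integral>x. h' x \<partial>\<mu>) = 1" "ae_eq (?P h') h'" using that by (auto simp: invariant_density_def)
    have e: "ae_eq ((?P ^^ n) h') h'" for n
    proof (induction n)
      case (Suc n)
      have "ae_eq (?P ((?P ^^ n) h')) (?P h')" by (rule transfer_cong[OF T funpow_transfer_integrable[OF T h'(1)] Suc])
      also note h'(3)
      finally show ?case by simp
    qed simp
    have "(\<integral>x. \<bar>(?P ^^ n) h' x - (\<integral>x. h' x \<partial>\<mu>) * h x\<bar> \<partial>\<mu>) = (\<integral>x. \<bar>h' x - h x\<bar> \<partial>\<mu>)" for n
    proof (rule integral_cong_AE)
      show "AE x in \<mu>. \<bar>(?P ^^ n) h' x - (\<integral>x. h' x \<partial>\<mu>) * h x\<bar> = \<bar>h' x - h x\<bar>"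
        using e[of n] unfolding ae_eq_def by eventually_elim (simp add: h'(2))
    qed (use funpow_transfer_integrable[OF T h'(1), of n] h'(1) hi in auto)
    then have "(\<integral>x. \<bar>h' x - h x\<bar> \<partial>\<mu>) = 0" using conv[OF h'(1)] by (simp add: LIMSEQ_const_iff)
    then have "AE x in \<mu>. \<bar>h' x - h x\<bar> = 0"
      using h'(1) hi by (subst (asm) integral_nonneg_eq_0_iff_AE) auto
    then show ?thesis by (simp add: ae_eq_def)
  qed
  then show ?thesis using h(1) inv by blast
qed

theorem proposition2p3:
  fixes \<delta> p c \<beta> :: real and T :: "real \<Rightarrow> real \<Rightarrow> real" and a :: "real \<Rightarrow> real"
  assumes \<delta>: "0 < \<delta>" and p: "1 < p" and c: "0 < c" "c < 1"
    and \<beta>: "-1 < \<beta>" "\<beta> < (1 - 2 * p) / (2 * p)"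
    and maps: "\<And>\<epsilon> x. \<epsilon> \<in> {0..<\<delta>} \<Longrightarrow> x \<in> {0..1} \<Longrightarrow> T \<epsilon> x \<in> {0..1}"
    and nonsing: "\<And>\<epsilon>. \<epsilon> \<in> {0..<\<delta>} \<Longrightarrow> nonsingular (T \<epsilon>)"
    and A1: "\<And>\<epsilon>. \<epsilon> \<in> {0..<\<delta>} \<Longrightarrow> inj_on (T \<epsilon>) {0..<c} \<and> inj_on (T \<epsilon>) {c<..1}"
    and A2: "\<And>\<epsilon>. \<epsilon> \<in> {0..<\<delta>} \<Longrightarrow>
               T \<epsilon> 0 = 0 \<and> T \<epsilon> 1 = 0 \<and> a \<epsilon> \<in> {0..1} \<and> (T \<epsilon> \<longlongrightarrow> a \<epsilon>) (at c)"
    and A3: "\<And>\<epsilon>. \<epsilon> \<in> {0..<\<delta>} \<Longrightarrow> Ck_on 3 ({0..1} - {c}) (T \<epsilon>)"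
    and A4: "\<exists>\<theta>>1. \<forall>\<epsilon>\<in>{0..<\<delta>}. \<forall>x\<in>{0..1} - {c}. \<theta> \<le> \<bar>deriv_on ({0..1} - {c}) 1 (T \<epsilon>) x\<bar>"
    and A5: "topologically_mixing_on {0..a 0} (T 0)"
    and A6: "\<And>\<epsilon>. \<epsilon> \<in> {0..<\<delta>} \<Longrightarrow>
               filterlim (deriv_on ({0..1} - {c}) 1 (T \<epsilon>)) at_top (at_left c) \<and>
               filterlim (deriv_on ({0..1} - {c}) 1 (T \<epsilon>)) at_bot (at_right c) \<and>
               (\<exists>C1. ((\<lambda>x. \<bar>deriv_on ({0..1} - {c}) 1 (T \<epsilon>) x\<bar> / \<bar>x - c\<bar> powr \<beta>) \<longlongrightarrow> C1) (at c))"
    and A7: "\<And>\<epsilon>. \<epsilon> \<in> {0..<\<delta>} \<Longrightarrow>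
               (\<exists>C2. ((\<lambda>x. \<bar>deriv_on ({0..1} - {c}) 2 (T \<epsilon>) x\<bar> / \<bar>x - c\<bar> powr (\<beta> - 1)) \<longlongrightarrow> C2) (at c)) \<and>
               (\<exists>C3. ((\<lambda>x. \<bar>deriv_on ({0..1} - {c}) 3 (T \<epsilon>) x\<bar> / \<bar>x - c\<bar> powr (\<beta> - 2)) \<longlongrightarrow> C3) (at c))"
    and A8_sup: "bdd_above {\<bar>deriv_on ({0..1} - {c}) (i + 1) (T \<epsilon>) x\<bar> / \<bar>x - c\<bar> powr (\<beta> - real i) | \<epsilon> i x.
               \<epsilon> \<in> {0..<\<delta>} \<and> i \<in> {0, 1, 2} \<and> x \<in> {0..1} - {c}}"
    and A8_inf: "0 < Inf {\<bar>deriv_on ({0..1} - {c}) 1 (T \<epsilon>) x\<bar> / \<bar>x - c\<bar> powr \<beta> | \<epsilon> x.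
               \<epsilon> \<in> {0..<\<delta>} \<and> x \<in> {0..1} - {c}}"
    and A9_cont: "((\<lambda>\<epsilon>. op_norm (sobolev 1 p :: (real \<Rightarrow> real) set) (sobolev_norm 1 p)
                            (Lp_space (2 * p) :: (real \<Rightarrow> real) set) (Lp_norm (2 * p))
                            (\<lambda>f x. transfer (T 0) f x - transfer (T \<epsilon>) f x)) \<longlongrightarrow> 0)
                   (at 0 within {0..<\<delta>})"
    and A9_diff: "\<And>f :: real \<Rightarrow> real. f \<in> sobolev 2 p \<Longrightarrow>
               \<exists>D \<in> sobolev 1 p.
                 (\<forall>\<^sub>F \<epsilon> in at 0 within {0..<\<delta>}.
                    (\<lambda>x. transfer (T \<epsilon>) f x - transfer (T 0) f x - \<epsilon> * D x) \<in> sobolev 1 p) \<and>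
                 (\<lambda>\<epsilon>. sobolev_norm 1 p (\<lambda>x. transfer (T \<epsilon>) f x - transfer (T 0) f x - \<epsilon> * D x))
                   \<in> o[at 0 within {0..<\<delta>}](\<lambda>\<epsilon>. \<epsilon>)"
  shows "\<exists>\<delta>\<^sub>2>0. \<delta>\<^sub>2 \<le> \<delta> \<and>
           (\<forall>\<epsilon>\<in>{0..<\<delta>\<^sub>2}. \<exists>h \<in> sobolev 2 p. invariant_density (T \<epsilon>) h \<and>
               (\<forall>h'. invariant_density (T \<epsilon>) h' \<longrightarrow> ae_eq h' h)) \<and>
           uniform_spectral_gap 1 p {0..<\<delta>\<^sub>2} T \<and>
           uniform_spectral_gap 2 p {0..<\<delta>\<^sub>2} T \<and>
           (\<exists>C>0. \<forall>\<epsilon>\<in>{0..<\<delta>\<^sub>2}.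
               ae_bij (sobolev_mean_zero 1 p :: (real \<Rightarrow> real) set) (shifted 1 (transfer (T \<epsilon>))) \<and>
               op_norm (sobolev_mean_zero 1 p :: (real \<Rightarrow> real) set) (sobolev_norm 1 p)
                       (sobolev 1 p) (sobolev_norm 1 p)
                       (ae_inv (sobolev_mean_zero 1 p) (shifted 1 (transfer (T \<epsilon>)))) \<le> ereal C)"
proof -
  let ?S = "{0..1} - {c}"
  obtain \<theta> where \<theta>: "1 < \<theta>" "\<And>\<epsilon> x. \<epsilon> \<in> {0..<\<delta>} \<Longrightarrow> x \<in> ?S \<Longrightarrow> \<theta> \<le> \<bar>deriv_on ?S 1 (T \<epsilon>) x\<bar>"
    using A4 by blast
  define Kset where "Kset = {\<bar>deriv_on ?S 1 (T \<epsilon>) x\<bar> / \<bar>x - c\<bar> powr \<beta> | \<epsilon> x. \<epsilon> \<in> {0..<\<delta>} \<and> x \<in> ?S}"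
  define \<kappa> where "\<kappa> = Inf Kset"
  have \<kappa>: "0 < \<kappa>" using A8_inf by (simp add: \<kappa>_def Kset_def)
  have lower: "\<kappa> * \<bar>x - c\<bar> powr \<beta> \<le> \<bar>deriv_on ?S 1 (T \<epsilon>) x\<bar>" if "\<epsilon> \<in> {0..<\<delta>}" "x \<in> ?S" for \<epsilon> x
  proof -
    have "bdd_below Kset" by (rule bdd_belowI[of _ 0]) (auto simp: Kset_def)
    moreover have "\<bar>deriv_on ?S 1 (T \<epsilon>) x\<bar> / \<bar>x - c\<bar> powr \<beta> \<in> Kset" using that by (auto simp: Kset_def)
    ultimately have "\<kappa> \<le> \<bar>deriv_on ?S 1 (T \<epsilon>) x\<bar> / \<bar>x - c\<bar> powr \<beta>"
      unfolding \<kappa>_def by (rule cInf_lower[rotated])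
    moreover have "0 < \<bar>x - c\<bar> powr \<beta>" using that by simp
    ultimately show ?thesis by (simp add: pos_le_divide_eq)
  qed
  obtain L0 where L0: "\<And>\<epsilon> i x. \<epsilon> \<in> {0..<\<delta>} \<Longrightarrow> i \<in> {0, 1, 2} \<Longrightarrow> x \<in> ?S \<Longrightarrow>
      \<bar>deriv_on ?S (i + 1) (T \<epsilon>) x\<bar> / \<bar>x - c\<bar> powr (\<beta> - real i) \<le> L0"
    using A8_sup unfolding bdd_above_def by blast
  \<comment> \<open>The supremum of (A8) enters the locale as its constant \<open>L\<close>; the
    maximum with 0 supplies the nonnegativity assumed there.\<close>
  define L where "L = max L0 0"
  have upper: "\<bar>deriv_on ?S (i + 1) (T \<epsilon>) x\<bar> \<le> L * \<bar>x - c\<bar> powr (\<beta> - real i)"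
    if "\<epsilon> \<in> {0..<\<delta>}" "i \<in> {0, 1, 2}" "x \<in> ?S" for \<epsilon> i x
  proof -
    have "0 < \<bar>x - c\<bar> powr (\<beta> - real i)" using that by simp
    moreover have "\<bar>deriv_on ?S (i + 1) (T \<epsilon>) x\<bar> / \<bar>x - c\<bar> powr (\<beta> - real i) \<le> L"
      using L0[OF that] by (simp add: L_def)
    ultimately show ?thesis by (simp only: pos_divide_le_eq)
  qed
  interpret singular_params c \<beta> \<theta> \<kappa> L p
    by unfold_locales (use c p \<beta> \<theta> \<kappa> in \<open>auto simp: L_def\<close>)
  have der: "(deriv_on ?S j (T \<epsilon>) has_real_derivative deriv_on ?S (Suc j) (T \<epsilon>) x) (at x within ?S)"
    if "\<epsilon> \<in> {0..<\<delta>}" "j < 3" "x \<in> ?S" for \<epsilon> j x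
  proof -
    have "deriv_on ?S j (T \<epsilon>) differentiable (at x within ?S)"
      using A3[OF that(1)] that(2,3) unfolding Ck_on_def by blast
    then have "(deriv_on ?S j (T \<epsilon>) has_vector_derivative deriv_on ?S (Suc j) (T \<epsilon>) x) (at x within ?S)"
      unfolding vector_derivative_works by (simp add: deriv_on_def)
    then show ?thesis by (simp add: has_real_derivative_iff_has_vector_derivative)
  qed
  have d0: "deriv_on ?S 0 f = f" for f by (simp add: deriv_on_def)
  have admA: "adm (T \<epsilon>) (deriv_on ?S 1 (T \<epsilon>)) (deriv_on ?S 2 (T \<epsilon>)) (deriv_on ?S 3 (T \<epsilon>))"
    if \<epsilon>: "\<epsilon> \<in> {0..<\<delta>}" for \<epsilon>
    unfolding adm_def
  proof (intro conjI ballI)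
    show "nonsingular (T \<epsilon>)" by (rule nonsing[OF \<epsilon>])
    show "T \<epsilon> 0 = 0" "T \<epsilon> 1 = 0" using A2[OF \<epsilon>] by auto
    show "\<exists>a. a \<in> {0..1} \<and> (T \<epsilon> \<longlongrightarrow> a) (at c)" using A2[OF \<epsilon>] by blast
    show "continuous_on ?S (deriv_on ?S 3 (T \<epsilon>))" using A3[OF \<epsilon>] unfolding Ck_on_def by blast
    fix x assume x: "x \<in> ?S"
    show "T \<epsilon> x \<in> {0..1}" using maps[OF \<epsilon>, of x] x by blast
    show "(T \<epsilon> has_real_derivative deriv_on ?S 1 (T \<epsilon>) x) (at x within ?S)"
      using der[OF \<epsilon> _ x, of 0] by (simp add: d0)
    show "(deriv_on ?S 1 (T \<epsilon>) has_real_derivative deriv_on ?S 2 (T \<epsilon>) x) (at x within ?S)"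
      using der[OF \<epsilon> _ x, of 1] by (simp add: numeral_2_eq_2)
    show "(deriv_on ?S 2 (T \<epsilon>) has_real_derivative deriv_on ?S 3 (T \<epsilon>) x) (at x within ?S)"
      using der[OF \<epsilon> _ x, of 2] by (simp add: numeral_2_eq_2 numeral_3_eq_3)
    show "\<theta> \<le> \<bar>deriv_on ?S 1 (T \<epsilon>) x\<bar>" by (rule \<theta>(2)[OF \<epsilon> x])
    show "\<kappa> * \<bar>x - c\<bar> powr \<beta> \<le> \<bar>deriv_on ?S 1 (T \<epsilon>) x\<bar>" by (rule lower[OF \<epsilon> x])
    show "\<bar>deriv_on ?S 1 (T \<epsilon>) x\<bar> \<le> L * \<bar>x - c\<bar> powr \<beta>" using upper[OF \<epsilon> _ x, of 0] by simp
    show "\<bar>deriv_on ?S 2 (T \<epsilon>) x\<bar> \<le> L * \<bar>x - c\<bar> powr (\<beta> - 1)"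
      using upper[OF \<epsilon> _ x, of 1] by (simp add: numeral_2_eq_2)
    show "\<bar>deriv_on ?S 3 (T \<epsilon>) x\<bar> \<le> L * \<bar>x - c\<bar> powr (\<beta> - 2)"
      using upper[OF \<epsilon> _ x, of 2] by (simp add: numeral_3_eq_3 numeral_2_eq_2)
  qed
  have adm: "admT (T \<epsilon>)" if "\<epsilon> \<in> {0..<\<delta>}" for \<epsilon>
    using admA[OF that] by (auto simp: admT_def)
  have 0: "0 \<in> {0..<\<delta>}" using \<delta> by simp
  interpret E: expanding_unimodal c \<theta> "a 0" "T 0" "deriv_on ?S 1 (T 0)"
  proof
    show "0 < c" "c < 1" "1 < \<theta>" using c \<theta> by auto
    show "nonsingular (T 0)" by (rule nonsing[OF 0])
    show "T 0 0 = 0" "T 0 1 = 0" "(T 0 \<longlongrightarrow> a 0) (at c)" using A2[OF 0] by auto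
    show "\<And>x. x \<in> {0..1} \<Longrightarrow> T 0 x \<in> {0..1}" by (rule maps[OF 0])
    show "continuous_on ?S (T 0)" by (rule adm_cont(1)[OF admA[OF 0]])
    fix x assume x: "x \<in> {0<..<1} - {c}"
    show "(T 0 has_real_derivative deriv_on ?S 1 (T 0) x) (at x)" by (rule adm_derivs_int(1)[OF admA[OF 0] x])
    show "\<theta> \<le> \<bar>deriv_on ?S 1 (T 0) x\<bar>" using x by (intro \<theta>(2)[OF 0]) auto
  qed
  have full: "a 0 = 1" using A5 A2[OF 0] by (intro E.mixing_imp_full) auto
  obtain C where C: "0 \<le> C" and CLY: "\<And>S f f' n. admT S \<Longrightarrow> weak_deriv f f' \<Longrightarrow>
     (\<exists>g. weak_deriv ((transfer S ^^ n) f) g \<and> (\<integral>x. \<bar>g x\<bar> \<partial>\<mu>) \<le> lam ^ n * (\<integral>x. \<bar>f' x\<bar> \<partial>\<mu>) + C * (\<integral>x. \<bar>f x\<bar> \<partial>\<mu>))"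
    using Lasota_Yorke_W11_iterate by blast
  have decay: "\<exists>n. \<forall>(f :: real \<Rightarrow> real) f'. weak_deriv f f' \<longrightarrow> (\<integral>x. f x \<partial>\<mu>) = 0 \<longrightarrow>
      (\<integral>x. \<bar>(transfer (T 0) ^^ n) f x\<bar> \<partial>\<mu>) \<le> \<eta> * ((\<integral>x. \<bar>f x\<bar> \<partial>\<mu>) + (\<integral>x. \<bar>f' x\<bar> \<partial>\<mu>))" if "0 < \<eta>" for \<eta>
  proof (rule E.mean_zero_decay[OF full C _ that])
    fix f f' :: "real \<Rightarrow> real" and n assume w: "weak_deriv f f'"
    obtain g where g: "weak_deriv ((transfer (T 0) ^^ n) f) g"
      "(\<integral>x. \<bar>g x\<bar> \<partial>\<mu>) \<le> lam ^ n * (\<integral>x. \<bar>f' x\<bar> \<partial>\<mu>) + C * (\<integral>x. \<bar>f x\<bar> \<partial>\<mu>)"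
      using CLY[OF adm[OF 0] w] by blast
    have "0 \<le> (\<integral>x. \<bar>f' x\<bar> \<partial>\<mu>)" by (rule Bochner_Integration.integral_nonneg) simp
    then have "lam ^ n * (\<integral>x. \<bar>f' x\<bar> \<partial>\<mu>) \<le> 1 * (\<integral>x. \<bar>f' x\<bar> \<partial>\<mu>)"
      using lam by (intro mult_right_mono power_le_one) auto
    with g show "\<exists>g. weak_deriv ((transfer (T 0) ^^ n) f) g \<and> (\<integral>x. \<bar>g x\<bar> \<partial>\<mu>) \<le> (\<integral>x. \<bar>f' x\<bar> \<partial>\<mu>) + C * (\<integral>x. \<bar>f x\<bar> \<partial>\<mu>)"
      by (intro exI[of _ g]) auto
  qed
  let ?X = "sobolev (Suc 0) p :: (real \<Rightarrow> real) set" and ?N = "sobolev_norm (Suc 0) p :: (real \<Rightarrow> real) \<Rightarrow> real"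
  have close: "\<exists>d>0. \<forall>\<epsilon>\<in>{0..<d}. \<forall>f \<in> ?X.
      (\<integral>x. \<bar>transfer (T 0) f x - transfer (T \<epsilon>) f x\<bar> \<partial>\<mu>) \<le> \<tau> * ?N f" if \<tau>: "0 < \<tau>" for \<tau>
  proof -
    let ?D = "\<lambda>\<epsilon> f x. transfer (T 0) f x - transfer (T \<epsilon>) f x"
    have "\<forall>\<^sub>F \<epsilon> in at 0 within {0..<\<delta>}. op_norm ?X ?N (Lp_space (2 * p)) (Lp_norm (2 * p)) (?D \<epsilon>) < ereal \<tau>"
      using order_tendstoD(2)[OF A9_cont, of "ereal \<tau>"] \<tau> by simp
    then obtain d where d: "0 < d" "\<And>\<epsilon>. \<epsilon> \<in> {0..<\<delta>} \<Longrightarrow> \<epsilon> \<noteq> 0 \<Longrightarrow> dist \<epsilon> 0 < d \<Longrightarrow>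
        op_norm ?X ?N (Lp_space (2 * p)) (Lp_norm (2 * p)) (?D \<epsilon>) < ereal \<tau>"
      unfolding eventually_at by blast
    show ?thesis
    proof (intro exI[of _ "min d \<delta>"] conjI ballI)
      show "0 < min d \<delta>" using d \<delta> by simp
      fix \<epsilon> f assume \<epsilon>: "\<epsilon> \<in> {0..<min d \<delta>}" and f: "f \<in> ?X"
      have \<epsilon>': "\<epsilon> \<in> {0..<\<delta>}" using \<epsilon> by auto
      note n0 = nonsing[OF 0] and n1 = nonsing[OF \<epsilon>']
      have pp: "1 \<le> p" "0 < p" using p by auto
      have fi: "integrable \<mu> f" by (rule sobolev_integrable(1)[OF pp(1) f])
      define F where "F = ?N f"
      have F0: "0 \<le> F" by (simp add: F_def)
      show "(\<integral>x. \<bar>?D \<epsilon> f x\<bar> \<partial>\<mu>) \<le> \<tau> * ?N f"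
      \<comment> \<open>Two degenerate cases: the punctured limit in (A9) says nothing at \<epsilon>
        = 0, where the difference is 0, and f cannot be normalised when its norm vanishes, but then
        f is 0 a.e.\<close>
      proof (cases "\<epsilon> = 0 \<or> F = 0")
        case True
        have "(\<integral>x. \<bar>?D \<epsilon> f x\<bar> \<partial>\<mu>) = 0"
        proof (cases "\<epsilon> = 0")
          case False
          with True have "?N f = 0" by (simp add: F_def)
          then have "ae_eq f (\<lambda>x. 0)" by (rule sobolev_zero_AE[OF pp(2) f])
          then have z: "(\<integral>x. \<bar>f x\<bar> \<partial>\<mu>) = 0"
            unfolding ae_eq_def by (intro integral_eq_zero_AE) (auto elim: eventually_mono)
          have "(\<integral>x. \<bar>?D \<epsilon> f x\<bar> \<partial>\<mu>) \<le> (\<integral>x. \<bar>transfer (T 0) f x\<bar> + \<bar>transfer (T \<epsilon>) f x\<bar> \<partial>\<mu>)"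
            using transfer_integrable[OF n0 fi] transfer_integrable[OF n1 fi] by (intro integral_mono) auto
          also have "\<dots> = (\<integral>x. \<bar>transfer (T 0) f x\<bar> \<partial>\<mu>) + (\<integral>x. \<bar>transfer (T \<epsilon>) f x\<bar> \<partial>\<mu>)"
            using transfer_integrable[OF n0 fi] transfer_integrable[OF n1 fi] by simp
          also have "\<dots> \<le> 0" using transfer_L1[OF n0 fi] transfer_L1[OF n1 fi] z by simp
          finally have "(\<integral>x. \<bar>?D \<epsilon> f x\<bar> \<partial>\<mu>) \<le> 0" .
          moreover have "0 \<le> (\<integral>x. \<bar>?D \<epsilon> f x\<bar> \<partial>\<mu>)" by (rule Bochner_Integration.integral_nonneg) simp
          ultimately show ?thesis by (rule antisym)
        qed simp
        then show ?thesis using \<tau> by simp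
      next
        case False
        then have Fp: "0 < F" and "\<epsilon> \<noteq> 0" using F0 by auto
        define g where "g x = (1 / F) * f x" for x
        have gX: "g \<in> ?X" and gN: "?N g = 1"
          unfolding g_def using sobolev_scale[OF pp(2) f, of "1 / F"] Fp by (auto simp: F_def)
        \<comment> \<open>Finiteness of the operator norm excludes the infinite branch, so the
          difference at the normalised function lies in L^{2p}; as \<open>\<mu>\<close> has mass 1,
          its L^1 norm is bounded by the same number.\<close>
        have "(if ?D \<epsilon> g \<in> Lp_space (2 * p) then ereal (Lp_norm (2 * p) (?D \<epsilon> g)) else \<infinity>)
            \<le> op_norm ?X ?N (Lp_space (2 * p)) (Lp_norm (2 * p)) (?D \<epsilon>)"
          unfolding op_norm_def using gX gN by (intro SUP_upper) auto
        also have "\<dots> < ereal \<tau>" using \<epsilon> \<open>\<epsilon> \<noteq> 0\<close> by (intro d(2)) (auto simp: dist_norm)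
        finally have g: "?D \<epsilon> g \<in> Lp_space (2 * p)" "Lp_norm (2 * p) (?D \<epsilon> g) < \<tau>" by (auto split: if_splits)
        have gL: "(\<integral>x. \<bar>?D \<epsilon> g x\<bar> \<partial>\<mu>) \<le> \<tau>"
          using Lp_integrable(2)[OF _ g(1)] g(2) p by simp
        have "(\<integral>x. \<bar>?D \<epsilon> f x\<bar> \<partial>\<mu>) = (\<integral>x. F * \<bar>?D \<epsilon> g x\<bar> \<partial>\<mu>)"
        proof (rule integral_cong_AE)
          show "AE x in \<mu>. \<bar>?D \<epsilon> f x\<bar> = F * \<bar>?D \<epsilon> g x\<bar>"
            using transfer_scale[OF n0 fi, of "1 / F"] transfer_scale[OF n1 fi, of "1 / F"]
            unfolding ae_eq_def g_def[abs_def]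
          proof eventually_elim
            case (elim x)
            then have "?D \<epsilon> (\<lambda>x. 1 / F * f x) x = (1 / F) * ?D \<epsilon> f x" by (simp add: right_diff_distrib)
            then show ?case using Fp by (simp add: abs_mult)
          qed
          have "integrable \<mu> (?D \<epsilon> g)" using Lp_integrable(1)[OF _ g(1)] p by simp
          then show "(\<lambda>x. F * \<bar>?D \<epsilon> g x\<bar>) \<in> borel_measurable \<mu>" by auto
        qed (use transfer_integrable[OF n0 fi] transfer_integrable[OF n1 fi] in auto)
        also have "\<dots> = F * (\<integral>x. \<bar>?D \<epsilon> g x\<bar> \<partial>\<mu>)" by simp
        also have "\<dots> \<le> F * \<tau>" using gL F0 by (intro mult_left_mono)
        finally show ?thesis by (simp add: F_def mult.commute)
      qed
    qed
  qed
  obtain \<delta>' K r where \<delta>': "0 < \<delta>'" "\<delta>' \<le> \<delta>" and K: "0 < K" and r: "0 < r" "r < 1"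
    and dec: "\<And>\<epsilon> n f. \<epsilon> \<in> {0..<\<delta>'} \<Longrightarrow> f \<in> ?X \<Longrightarrow> (\<integral>x. f x \<partial>\<mu>) = 0 \<Longrightarrow>
       ?N ((transfer (T \<epsilon>) ^^ n) f) \<le> K * r ^ n * ?N f"
    using uniform_decay_W1p[OF \<delta> adm decay close] by blast
  have sub: "\<epsilon> \<in> {0..<\<delta>}" if "\<epsilon> \<in> {0..<\<delta>'}" for \<epsilon> using that \<delta>' by auto
  \<comment> \<open>Decay in W^{2,p} is derived map by map from the decay in W^{1,p}, so the range
    of \<epsilon> found for the latter serves both spaces.\<close>
  obtain K2 r2 where K2: "0 < K2" and r2: "0 < r2" "r2 < 1"
    and dec2: "\<And>S (f :: real \<Rightarrow> real) n. admT S \<Longrightarrow> f \<in> sobolev (Suc (Suc 0)) p \<Longrightarrow>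
       (\<And>n. ?N ((transfer S ^^ n) f) \<le> K * r ^ n * ?N f) \<Longrightarrow>
       sobolev_norm (Suc (Suc 0)) p ((transfer S ^^ n) f) \<le> K2 * r2 ^ n * sobolev_norm (Suc (Suc 0)) p f"
    using uniform_decay_W2p[OF K r] by metis
  obtain B where B: "\<And>S (f :: real \<Rightarrow> real). admT S \<Longrightarrow> f \<in> ?X \<Longrightarrow> transfer S f \<in> ?X \<and> ?N (transfer S f) \<le> B * ?N f"
    using transfer_bounded_W1p by blast
  obtain B2 where B2: "\<And>S (f :: real \<Rightarrow> real). admT S \<Longrightarrow> f \<in> sobolev (Suc (Suc 0)) p \<Longrightarrow>
      transfer S f \<in> sobolev (Suc (Suc 0)) p \<and>
      sobolev_norm (Suc (Suc 0)) p (transfer S f) \<le> B2 * sobolev_norm (Suc (Suc 0)) p f"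
    using transfer_bounded_W2p by blast
  have pp: "1 \<le> p" using p by simp
  have D1: "sobolev_decay (transfer (T \<epsilon>) :: (real \<Rightarrow> real) \<Rightarrow> real \<Rightarrow> real) (Suc 0) p K r B" if \<epsilon>: "\<epsilon> \<in> {0..<\<delta>'}" for \<epsilon>
    by (rule sobolev_decay_transferI[OF pp nonsing[OF sub[OF \<epsilon>]] K r B[OF adm[OF sub[OF \<epsilon>]]] dec[OF \<epsilon>]])
  have X21: "f \<in> ?X" if "f \<in> sobolev (Suc (Suc 0)) p" for f :: "real \<Rightarrow> real"
    using sobolev_SucD[OF that] sobolev_Lp by (auto simp only: sobolev_1_iff)
  have D2: "sobolev_decay (transfer (T \<epsilon>) :: (real \<Rightarrow> real) \<Rightarrow> real \<Rightarrow> real) (Suc (Suc 0)) p K2 r2 B2"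
    if \<epsilon>: "\<epsilon> \<in> {0..<\<delta>'}" for \<epsilon>
    by (rule sobolev_decay_transferI[OF pp nonsing[OF sub[OF \<epsilon>]] K2 r2 B2[OF adm[OF sub[OF \<epsilon>]]]
        dec2[OF adm[OF sub[OF \<epsilon>]] _ dec[OF \<epsilon> X21]]])
  show ?thesis
  proof (rule exI[of _ \<delta>'], intro conjI \<delta>' ballI)
    have two: "(2::nat) = Suc (Suc 0)" and one: "(1::nat) = Suc 0" by simp_all
    show "uniform_spectral_gap 1 p {0..<\<delta>'} T"
      unfolding one by (rule uniform_spectral_gapI[OF nonsing[OF sub] D1 K r])
    show "uniform_spectral_gap 2 p {0..<\<delta>'} T"
      unfolding two by (rule uniform_spectral_gapI[OF nonsing[OF sub] D2 K2 r2])
    show "\<exists>h \<in> sobolev 2 p. invariant_density (T \<epsilon>) h \<and> (\<forall>h'. invariant_density (T \<epsilon>) h' \<longrightarrow> ae_eq h' h)"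
      if \<epsilon>: "\<epsilon> \<in> {0..<\<delta>'}" for \<epsilon>
      unfolding two by (rule invariant_density_unique[OF nonsing[OF sub[OF \<epsilon>]] D2[OF \<epsilon>]])
    show "\<exists>C>0. \<forall>\<epsilon>\<in>{0..<\<delta>'}.
               ae_bij (sobolev_mean_zero 1 p :: (real \<Rightarrow> real) set) (shifted 1 (transfer (T \<epsilon>))) \<and>
               op_norm (sobolev_mean_zero 1 p :: (real \<Rightarrow> real) set) (sobolev_norm 1 p)
                       (sobolev 1 p) (sobolev_norm 1 p)
                       (ae_inv (sobolev_mean_zero 1 p) (shifted 1 (transfer (T \<epsilon>)))) \<le> ereal C"
      unfolding one
      using sobolev_decay.mean_zero_inverse[OF D1] K r by (intro exI[of _ "K / (1 - r)"]) auto
  qed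
qed

end
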